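(* Let $Q=(Q(i,j))_{i,j\in\{0,1\}}$ be the transition matrix of a Markov chain on $\{0,1\}$ with $Q(1,1)>0$, and assume that the stationary probability measure $(p_0,p_1)$ of $Q$ satisfies $p_1\in(0,\frac12)$. Let $\pi_Q$ be the distribution on $\{0,1\}^{\mathbb Z}$ of a doubly infinite stationary trajectory of the chain. Let $\hat\pi_Q:=\mathrm{Palm}(\pi_Q)$ and let $\eta$ be a configuration with law $\hat\pi_Q$. Define $\alpha=(\alpha_k)_{k\ge1}$ by $\alpha_k:=ab^k$, where $$a=Q(0,1)Q(1,0)\,[Q(1,1)Q(0,0)]^{-1},\qquad b=Q(1,1)Q(0,0).$$ Then $\alpha\in\mathcal A^+$; the random excursions $(\varepsilon^{(i)}[\eta])_{i\in\mathbb Z}$ are i.i.d. with distribution $\nu_\alpha$; the soliton components $(D_k\eta)_{k\ge1}$ are mutually independent; and for each $k\ge1$ the $k$-soliton component $(D_k\eta(j))_{j\in\mathbb Z}$ is a sequence of i.i.d. Geometric$(1-q_k(\alpha))$ random variables. As a consequence, $\pi_Q$ is $T$-invariant.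
   Context: Conventions: $0^0=1$. $Y$ is Geometric$(p)$, $p\in(0,1]$, if $P(Y=j)=p(1-p)^j$ for $j\ge0$. Excursions. An excursion is a finite integer sequence $\varepsilon=(\varepsilon(0),\dots,\varepsilon(2n))$, $n=n(\varepsilon)\ge0$, with $\varepsilon(0)=\varepsilon(2n)=0$, $\varepsilon(z)\ge0$ for $0\le z\le 2n$ and $|\varepsilon(z)-\varepsilon(z-1)|=1$ ($n=0$: empty excursion). $\mathcal E$ is the set of all excursions. The ball configuration of $\varepsilon$ has value $(\varepsilon(z)-\varepsilon(z-1)+1)/2$ at $z$ for $1\le z\le 2n$ and $0$ for all other $z\in\mathbb Z$. Solitons (Takahashi-Satsuma algorithm). A run of a configuration is a maximal (possibly infinite) interval of consecutive boxes on which the configuration is constant. Starting from the ball configuration of $\varepsilon$, as long as there are finite runs: let $k$ be the smallest size of a run, take the leftmost run of size $k$, and declare the $k$ boxes of this run together with the first $k$ boxes of the next run to be a $k$-soliton; then delete (ignore) these $2k$ boxes, recompute the runs, and repeat. A $k$-soliton $\gamma$ consists of $k$ occupied boxes $h_0(\gamma)<\dots<h_{k-1}(\gamma)$ and $k$ empty boxes $t_0(\gamma)<\dots<t_{k-1}(\gamma)$; its support is the set of these $2k$ boxes. $n_k(\varepsilon)$ is the number of $k$-solitons of $\varepsilon$. Box $z$ is a $k$-slot of $\varepsilon$ if $z=0$ or $z\in\{h_i(\gamma),t_i(\gamma)\}$ for some $i\ge k$ and some $m$-soliton $\gamma$ of $\varepsilon$ with $m>k$. Measures on excursions and parameters. For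 $\alpha=(\alpha_k)_{k\ge1}$ with $\alpha_k\in[0,1)$ let $Z_\alpha:=\sum_{\varepsilon\in\mathcal E}\prod_{k\ge1}\alpha_k^{n_k(\varepsilon)}$, $\mathcal A:=\{\alpha:Z_\alpha<\infty\}$. For $\alpha\in\mathcal A$ let $\nu_\alpha(\varepsilon):=Z_\alpha^{-1}\prod_{k\ge1}\alpha_k^{n_k(\varepsilon)}$, $\rho_k(\alpha):=\sum_\varepsilon n_k(\varepsilon)\nu_\alpha(\varepsilon)$, and $\mathcal A^+:=\{\alpha\in\mathcal A:\sum_k2k\rho_k(\alpha)<\infty\}$. For $\alpha\in\mathcal A$, $q(\alpha)$ is given by $q_1=\alpha_1$, $q_k=\alpha_k/\prod_{j=1}^{k-1}(1-q_j)^{2(k-j)}$ for $k\ge2$; one has $q_k(\alpha)\in[0,1)$. Configurations and records. For $\eta\in\{0,1\}^{\mathbb Z}$ let $\xi=W\eta$ be the walk with $\xi(0)=0$, $\xi(z)-\xi(z-1)=2\eta(z)-1$. $z$ is a record of $\eta$ if $\xi(z)<\xi(z')$ for all $z'<z$; $R\eta$ is the set of records and $r(\eta,i):=\min\{z:\xi(z)=-i\}$. $\mathcal X_\lambda$ is the set of $\eta$ with $\lim_{y\to\infty}\frac1y\sum_{z=-y}^0\eta(z)=\lim_{y\to\infty}\frac1y\sum_{z=0}^y\eta(z)=\lambda$; $\mathcal X:=\bigcup_{0\le\lambda<1/2}\mathcal X_\lambda$; $\hat{\mathcal X}:=\{\eta\in\mathcal X:0\in R\eta\}$. For $\eta\in\hat{\mathcal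 X}$ all $r(\eta,i)$, $i\in\mathbb Z$, are finite, $r(\eta,0)=0$, and excursion $i$ is $\varepsilon^{(i)}[\eta]$, with $n=(r(\eta,i+1)-r(\eta,i)-1)/2$ and $\varepsilon^{(i)}(z)=\xi(r(\eta,i)+z)-\xi(r(\eta,i))$, $0\le z\le 2n$. Soliton components. For $\eta\in\hat{\mathcal X}$, the $k$-solitons and $k$-slots of $\eta$ are those of the excursions $\varepsilon^{(i)}[\eta]$ translated by $r(\eta,i)$, $i\in\mathbb Z$. Enumerate the $k$-slots increasingly by $j\in\mathbb Z$, $\mathtt s_k(\eta,j)$, with $\mathtt s_k(\eta,0)=0$. A $k$-soliton is appended to $k$-slot $j$ if its support is contained in the open interval $(\mathtt s_k(\eta,j),\mathtt s_k(\eta,j+1))$. $D_k\eta(j)$ is the number of $k$-solitons of $\eta$ appended to $k$-slot $j$; $D_k\eta=(D_k\eta(j))_{j\in\mathbb Z}$ is the $k$-component. Palm measure. For a translation invariant probability $\mu$ on $\mathcal X$ with $\lambda=\int\eta(0)\mu(d\eta)$ (the density of records is $1-2\lambda$), $\mathrm{Palm}(\mu)$ is the measure $\mu$ conditioned to have a record at $0$: $\int f\,d\,\mathrm{Palm}(\mu)=\frac1{1-2\lambda}\int\mathbf 1\{0\in R\eta\}f(\eta)\mu(d\eta)$. Dynamics (Box-Ball System). $T:\mathcal X\to\mathcal X$, $T\eta(z):=(1-\eta(z))\mathbf 1\{z\notin R\eta\}$. $\mu$ is $T$-invariant if $\mu\circ T^{-1}=\mu$. *)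

theory Defs
  imports "HOL-Probability.Probability"
begin

text \<open>
  Configurations in $\{0,1\}^{\mathbb Z}$ are functions \<open>int \<Rightarrow> bool\<close>, where \<^const>\<open>True\<close> stands for
  a ball (the value 1).
\<close>

type_synonym config = "int \<Rightarrow> bool"

definition config_space :: "config measure" where
  "config_space = (\<Pi>\<^sub>M z\<in>UNIV. count_space UNIV)"


section \<open>Excursions\<close>

text \<open>The excursion $(\varepsilon(0),\dots,\varepsilon(2n))$ is a list of length $2n+1$.\<close>

definition excursions :: "int list set" where
  "excursions = {\<epsilon>. \<exists>n. length \<epsilon> = 2 * n + 1 \<and> \<epsilon> ! 0 = 0 \<and> \<epsilon> ! (2 * n) = 0 \<and>
     (\<forall>z\<le>2 * n. 0 \<le> \<epsilon> ! z) \<and> (\<forall>z. 1 \<le> z \<and> z \<le> 2 * n \<longrightarrow> \<bar>\<epsilon> ! z - \<epsilon> ! (z - 1)\<bar> = 1)}"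

definition ball_config :: "int list \<Rightarrow> config" where
  "ball_config \<epsilon> z \<longleftrightarrow> 1 \<le> z \<and> z < int (length \<epsilon>) \<and> (\<epsilon> ! nat z - \<epsilon> ! (nat z - 1) + 1) div 2 = 1"


section \<open>The Takahashi-Satsuma algorithm\<close>

text \<open>
  \<open>B\<close> is the set of boxes that have not been deleted so far; intervals and runs are taken
  relative to \<open>B\<close>.
\<close>

definition constant_interval :: "config \<Rightarrow> int set \<Rightarrow> int set \<Rightarrow> bool" where
  "constant_interval \<eta> B I \<longleftrightarrow> I \<noteq> {} \<and> I \<subseteq> B \<and>
     (\<forall>x\<in>I. \<forall>y\<in>I. \<forall>z\<in>B. x \<le> z \<and> z \<le> y \<longrightarrow> z \<in> I) \<and> (\<forall>x\<in>I. \<forall>y\<in>I. \<eta> x = \<eta> y)"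

definition runs :: "config \<Rightarrow> int set \<Rightarrow> int set set" where
  "runs \<eta> B = {I. constant_interval \<eta> B I \<and> (\<forall>J. constant_interval \<eta> B J \<and> I \<subseteq> J \<longrightarrow> J = I)}"

definition next_run :: "config \<Rightarrow> int set \<Rightarrow> int set \<Rightarrow> int set \<Rightarrow> bool" where
  "next_run \<eta> B I J \<longleftrightarrow> J \<in> runs \<eta> B \<and>
     (\<forall>x\<in>I. \<forall>y\<in>J. x < y \<and> (\<forall>z\<in>B. x < z \<and> z < y \<longrightarrow> z \<in> I \<union> J))"

definition leftmost_smallest_run :: "config \<Rightarrow> int set \<Rightarrow> int set \<Rightarrow> bool" where
  "leftmost_smallest_run \<eta> B I \<longleftrightarrow> I \<in> runs \<eta> B \<and> finite I \<and>
     (\<forall>I'\<in>runs \<eta> B. finite I' \<longrightarrow> card I < card I' \<or> card I = card I' \<and> Min I \<le> Min I')"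

text \<open>
  A soliton is the pair of its set of occupied boxes $\{h_0<\dots<h_{k-1}\}$ and its set of empty
  boxes $\{t_0<\dots<t_{k-1}\}$.
\<close>

type_synonym soliton = "int set \<times> int set"

definition support :: "soliton \<Rightarrow> int set" where
  "support \<gamma> = fst \<gamma> \<union> snd \<gamma>"

definition soliton_size :: "soliton \<Rightarrow> nat" where
  "soliton_size \<gamma> = card (fst \<gamma>)"

definition head_box :: "soliton \<Rightarrow> nat \<Rightarrow> int" where
  "head_box \<gamma> i = sorted_list_of_set (fst \<gamma>) ! i"

definition tail_box :: "soliton \<Rightarrow> nat \<Rightarrow> int" where
  "tail_box \<gamma> i = sorted_list_of_set (snd \<gamma>) ! i"

definition translate :: "int \<Rightarrow> soliton \<Rightarrow> soliton" where
  "translate r \<gamma> = ((+) r ` fst \<gamma>, (+) r ` snd \<gamma>)"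

definition extracted_soliton :: "config \<Rightarrow> int set \<Rightarrow> soliton \<Rightarrow> bool" where
  "extracted_soliton \<eta> B \<gamma> \<longleftrightarrow> (\<exists>I J S. leftmost_smallest_run \<eta> B I \<and> next_run \<eta> B I J \<and>
     S = I \<union> {x\<in>J. card {y\<in>J. y < x} < card I} \<and>
     \<gamma> = ({z\<in>S. \<eta> z}, {z\<in>S. \<not> \<eta> z}))"

inductive remaining_boxes :: "config \<Rightarrow> int set \<Rightarrow> bool" for \<eta> where
  start: "remaining_boxes \<eta> UNIV"
| step: "remaining_boxes \<eta> B \<Longrightarrow> extracted_soliton \<eta> B \<gamma> \<Longrightarrow> remaining_boxes \<eta> (B - support \<gamma>)"

definition exc_solitons :: "nat \<Rightarrow> int list \<Rightarrow> soliton set" where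
  "exc_solitons k \<epsilon> = {\<gamma>. soliton_size \<gamma> = k \<and>
     (\<exists>B. remaining_boxes (ball_config \<epsilon>) B \<and> extracted_soliton (ball_config \<epsilon>) B \<gamma>)}"

definition num_solitons :: "nat \<Rightarrow> int list \<Rightarrow> nat" where
  "num_solitons k \<epsilon> = card (exc_solitons k \<epsilon>)"

definition exc_slots :: "nat \<Rightarrow> int list \<Rightarrow> int set" where
  "exc_slots k \<epsilon> = insert 0 {z. \<exists>m i \<gamma>. k < m \<and> \<gamma> \<in> exc_solitons m \<epsilon> \<and> k \<le> i \<and> i < m \<and>
     z \<in> {head_box \<gamma> i, tail_box \<gamma> i}}"


section \<open>Measures on excursions\<close>

text \<open>
  Parameters $\alpha=(\alpha_k)_{k\ge1}$ are functions on \<^typ>\<open>nat\<close> whose value at 0 is never used.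
  All factors outside the index set of the product below are equal to 1.
\<close>

definition exc_weight :: "(nat \<Rightarrow> real) \<Rightarrow> int list \<Rightarrow> real" where
  "exc_weight \<alpha> \<epsilon> = (\<Prod>k | 1 \<le> k \<and> num_solitons k \<epsilon> \<noteq> 0. \<alpha> k ^ num_solitons k \<epsilon>)"

definition partition_fun :: "(nat \<Rightarrow> real) \<Rightarrow> ennreal" where
  "partition_fun \<alpha> = (\<Sum>\<^sub>\<infinity>\<epsilon>\<in>excursions. ennreal (exc_weight \<alpha> \<epsilon>))"

definition param_A :: "(nat \<Rightarrow> real) set" where
  "param_A = {\<alpha>. (\<forall>k\<ge>1. 0 \<le> \<alpha> k \<and> \<alpha> k < 1) \<and> partition_fun \<alpha> < \<infinity>}"

definition exc_prob :: "(nat \<Rightarrow> real) \<Rightarrow> int list \<Rightarrow> ennreal" where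
  "exc_prob \<alpha> \<epsilon> = ennreal (exc_weight \<alpha> \<epsilon>) / partition_fun \<alpha>"

definition exc_measure :: "(nat \<Rightarrow> real) \<Rightarrow> int list measure" where
  "exc_measure \<alpha> = point_measure excursions (exc_prob \<alpha>)"

definition soliton_density :: "nat \<Rightarrow> (nat \<Rightarrow> real) \<Rightarrow> ennreal" where
  "soliton_density k \<alpha> = (\<Sum>\<^sub>\<infinity>\<epsilon>\<in>excursions. of_nat (num_solitons k \<epsilon>) * exc_prob \<alpha> \<epsilon>)"

definition param_A_plus :: "(nat \<Rightarrow> real) set" where
  "param_A_plus =
     {\<alpha>\<in>param_A. (\<Sum>\<^sub>\<infinity>k\<in>{1..}. 2 * of_nat k * soliton_density k \<alpha>) < \<infinity>}"

function q_param :: "(nat \<Rightarrow> real) \<Rightarrow> nat \<Rightarrow> real" where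
  "q_param \<alpha> k = \<alpha> k / (\<Prod>j\<in>{1..<k}. (1 - q_param \<alpha> j) ^ (2 * (k - j)))"
  by pat_completeness auto
termination by (relation "Wellfounded.measure snd") auto

declare q_param.simps [simp del]


section \<open>Configurations and records\<close>

definition walk :: "config \<Rightarrow> int \<Rightarrow> int" where
  "walk \<eta> z = (\<Sum>x\<in>{1..z}. 2 * of_bool (\<eta> x) - 1) - (\<Sum>x\<in>{z + 1..0}. 2 * of_bool (\<eta> x) - 1)"

lemma walk_0: "walk \<eta> 0 = 0"
  by (simp add: walk_def)

lemma walk_increment: "walk \<eta> z - walk \<eta> (z - 1) = 2 * of_bool (\<eta> z) - 1"
proof (cases "1 \<le> z")
  case True
  then have "{1..z} = insert z {1..z - 1}" by auto
  with True show ?thesis by (simp add: walk_def)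
next
  case False
  then have "{z..0} = insert z {z + 1..0}" by auto
  with False show ?thesis by (simp add: walk_def)
qed

definition records :: "config \<Rightarrow> int set" where
  "records \<eta> = {z. \<forall>z'<z. walk \<eta> z < walk \<eta> z'}"

definition record_pos :: "config \<Rightarrow> int \<Rightarrow> int" where
  "record_pos \<eta> i = (LEAST z. walk \<eta> z = - i)"

definition configs_density :: "real \<Rightarrow> config set" where
  "configs_density l = {\<eta>.
     (\<lambda>y. (\<Sum>z\<in>{- int y..0}. of_bool (\<eta> z)) / real y) \<longlonglongrightarrow> l \<and>
     (\<lambda>y. (\<Sum>z\<in>{0..int y}. of_bool (\<eta> z)) / real y) \<longlonglongrightarrow> l}"

definition configs :: "config set" where
  "configs = (\<Union>l\<in>{0..<1/2}. configs_density l)"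

definition configs_hat :: "config set" where
  "configs_hat = {\<eta>\<in>configs. 0 \<in> records \<eta>}"

text \<open>Here $2n = r(\eta,i+1)-r(\eta,i)-1$.\<close>

definition excursion_at :: "config \<Rightarrow> int \<Rightarrow> int list" where
  "excursion_at \<eta> i =
     map (\<lambda>z. walk \<eta> (record_pos \<eta> i + z) - walk \<eta> (record_pos \<eta> i))
       [0..record_pos \<eta> (i + 1) - record_pos \<eta> i - 1]"


section \<open>Soliton components\<close>

definition solitons :: "nat \<Rightarrow> config \<Rightarrow> soliton set" where
  "solitons k \<eta> = (\<Union>i. translate (record_pos \<eta> i) ` exc_solitons k (excursion_at \<eta> i))"

definition slots :: "nat \<Rightarrow> config \<Rightarrow> int set" where
  "slots k \<eta> = (\<Union>i. (+) (record_pos \<eta> i) ` exc_slots k (excursion_at \<eta> i))"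

definition slot_enum :: "nat \<Rightarrow> config \<Rightarrow> int \<Rightarrow> int" where
  "slot_enum k \<eta> = (THE s. strict_mono s \<and> range s = slots k \<eta> \<and> s 0 = 0)"

definition component :: "nat \<Rightarrow> config \<Rightarrow> int \<Rightarrow> nat" where
  "component k \<eta> j =
     card {\<gamma>\<in>solitons k \<eta>. support \<gamma> \<subseteq> {slot_enum k \<eta> j<..<slot_enum k \<eta> (j + 1)}}"


section \<open>Palm measure and dynamics\<close>

text \<open>
  The Palm measure of a translation invariant probability concentrated on \<^const>\<open>configs\<close> has mass 1
  and is concentrated on \<^const>\<open>configs_hat\<close>; it is taken here as a measure on that space, outside
  of which excursions and components have no meaning.
\<close>

definition palm :: "config measure \<Rightarrow> config measure" where
  "palm \<mu> = restrict_space
     (density \<mu> (\<lambda>\<eta>. ennreal (indicator {\<eta>. 0 \<in> records \<eta>} \<eta> /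
        (1 - 2 * (\<integral>\<zeta>. of_bool (\<zeta> 0) \<partial>\<mu>))))) configs_hat"

definition bbs :: "config \<Rightarrow> config" where
  "bbs \<eta> z \<longleftrightarrow> \<not> \<eta> z \<and> z \<notin> records \<eta>"


section \<open>Stationary Markov chains\<close>

definition transition_matrix :: "(bool \<Rightarrow> bool \<Rightarrow> real) \<Rightarrow> bool" where
  "transition_matrix Q \<longleftrightarrow> (\<forall>i j. 0 \<le> Q i j) \<and> (\<forall>i. (\<Sum>j\<in>UNIV. Q i j) = 1)"

definition stationary_prob :: "(bool \<Rightarrow> bool \<Rightarrow> real) \<Rightarrow> (bool \<Rightarrow> real) \<Rightarrow> bool" where
  "stationary_prob Q p \<longleftrightarrow> (\<forall>i. 0 \<le> p i) \<and> (\<Sum>i\<in>UNIV. p i) = 1 \<and>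
     (\<forall>j. (\<Sum>i\<in>UNIV. p i * Q i j) = p j)"

text \<open>
  \<open>\<pi>\<close> is the (unique) law of a doubly infinite trajectory of the chain whose one-dimensional marginals
  are all equal to \<open>p\<close>, given by its finite-dimensional distributions.
\<close>

definition stationary_chain_law ::
    "(bool \<Rightarrow> bool \<Rightarrow> real) \<Rightarrow> (bool \<Rightarrow> real) \<Rightarrow> config measure \<Rightarrow> bool" where
  "stationary_chain_law Q p \<pi> \<longleftrightarrow> prob_space \<pi> \<and> sets \<pi> = sets config_space \<and>
     (\<forall>(m::int) (n::nat) (x :: nat \<Rightarrow> bool).
        measure \<pi> {\<eta>. \<forall>i\<le>n. \<eta> (m + int i) = x i} = p (x 0) * (\<Prod>i<n. Q (x i) (x (Suc i))))"

end

theory Submission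
  imports Defs "HOL-Library.Discrete_Functions"
begin

text \<open>
  If \<open>k\<close> is the smallest size of a run, then the Takahashi-Satsuma algorithm removes the first run of
  size \<open>k\<close> and \<open>k\<close> further boxes, and it continues with the configuration composed with the order
  embedding that skips these \<open>2k\<close> boxes. Hence, by induction on the removals, an excursion without
  solitons of size less than \<open>k\<close> corresponds bijectively to what remains of it after the removal of
  its \<open>k\<close>-solitons together with the list of the numbers of \<open>k\<close>-solitons appended to its \<open>k\<close>-slots,
  and this list is arbitrary. Every removal takes away one peak, so an excursion has as many solitons
  as peaks, and for \<open>\<alpha> k = a * b ^ k\<close> its weight depends only on its length and on its number of
  peaks. This is, up to the factor \<open>Q(0,0)\<close>, the probability that the chain follows the excursion.

  Since the number of \<open>k\<close>-slots is an affine function of the length and of the number of peaks, weights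
  of this form are preserved by the removal of the \<open>k\<close>-solitons, and given what remains the numbers of
  appended \<open>k\<close>-solitons are independent geometric variables. In a sequence of independent excursions
  these lists are concatenated; a window of fixed length around slot 0 consists of independent
  geometric variables, independent of everything that remains, no matter how many slots there are.

  Invariance is a reversibility argument. The load of the carrier, that is the excess of the walk over
  its past minimum, increases at the balls of \<open>\<eta>\<close> and decreases strictly at the balls of \<open>T \<eta>\<close>. The
  pairs of consecutive loads form a Markov chain whose law is invariant under time reversal, so \<open>T \<eta>\<close>
  has the law of the reversed configuration, which is again the law of the chain because a stationary
  chain with two states is reversible.
\<close>

section \<open>The Takahashi-Satsuma algorithm under order embeddings\<close>

text \<open>Three points shape the proof. (1) Why a b^k: a block of k + k boxes follows a value c,
  starts with the opposite value and ends with c again, so cutting it out of a chain path divides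
  the weight by Q(0,1) Q(1,0) (Q(0,0) Q(1,1))^(k-1) = a b^k, wherever it sits. (2) The k-solitons
  come off from left to right, so the last one put back belongs to the first k-slot with a nonzero
  count; this order makes the lists of counts both injective and arbitrary. (3) A record and the
  load depend on the whole past. Such events are limits of window events, which yields recursions
  for the joint law of load and box content; they are solved by geometric tails of ratio
  Q(1,1)/Q(0,0), and the mass at load 0 times Q(0,0) is the density of records. A record at 0 with
  prescribed excursions around it then is a record further left followed by a prescribed word.
  Neither q_k < 1 nor the total mass 1/Q(0,0) of the excursion weights is computed directly: both
  are read off from the fact that these laws are probabilities.\<close>

definition image_soliton :: "(int \<Rightarrow> int) \<Rightarrow> soliton \<Rightarrow> soliton" where
  "image_soliton f \<gamma> = (f ` fst \<gamma>, f ` snd \<gamma>)"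

lemma support_image_soliton: "support (image_soliton f \<gamma>) = f ` support \<gamma>"
  by (auto simp: support_def image_soliton_def)

context
  fixes f :: "int \<Rightarrow> int" and \<eta> :: config and B :: "int set"
  assumes f: "strict_mono f"
begin

private lemma le: "f x \<le> f y \<longleftrightarrow> x \<le> y" and lt: "f x < f y \<longleftrightarrow> x < y"
  using f by (auto simp: strict_mono_less_eq strict_mono_less)

private lemma inj: "inj f" using f by (rule strict_mono_imp_inj_on)

private lemma image_eq: "f ` I = f ` J \<longleftrightarrow> I = J"
  using inj by (metis inj_image_eq_iff)

private lemma image_sub: "f ` I \<subseteq> f ` J \<longleftrightarrow> I \<subseteq> J"
  using inj by (metis inj_image_subset_iff)

lemma constant_interval_image:
  "constant_interval \<eta> (f ` B) (f ` I) \<longleftrightarrow> constant_interval (\<eta> \<circ> f) B I"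
  unfolding constant_interval_def using inj
  by (auto simp: image_sub le inj_image_mem_iff)

lemma runs_image: "runs \<eta> (f ` B) = (`) f ` runs (\<eta> \<circ> f) B"
proof -
  have sub: "\<exists>J'. J = f ` J'" if "constant_interval \<eta> (f ` B) J" for J
    using that by (auto simp: constant_interval_def subset_image_iff)
  show ?thesis
  proof (intro equalityI subsetI)
    fix I assume I: "I \<in> runs \<eta> (f ` B)"
    then have c: "constant_interval \<eta> (f ` B) I" by (simp add: runs_def)
    then obtain I' where I': "I = f ` I'" using sub by blast
    have "I' \<in> runs (\<eta> \<circ> f) B"
      unfolding runs_def
    proof (intro CollectI conjI allI impI)
      show "constant_interval (\<eta> \<circ> f) B I'" using c I' by (simp add: constant_interval_image)
      fix J assume "constant_interval (\<eta> \<circ> f) B J \<and> I' \<subseteq> J"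
      then have "f ` J = I" using I I' by (simp add: runs_def constant_interval_image image_sub)
      then show "J = I'" by (simp add: I' image_eq)
    qed
    then show "I \<in> (`) f ` runs (\<eta> \<circ> f) B" using I' by auto
  next
    fix I assume "I \<in> (`) f ` runs (\<eta> \<circ> f) B"
    then obtain I' where I': "I = f ` I'" "I' \<in> runs (\<eta> \<circ> f) B" by auto
    show "I \<in> runs \<eta> (f ` B)"
      unfolding runs_def
    proof (intro CollectI conjI allI impI)
      show "constant_interval \<eta> (f ` B) I" using I' by (auto simp: runs_def constant_interval_image)
      fix J assume J: "constant_interval \<eta> (f ` B) J \<and> I \<subseteq> J"
      then obtain J' where J': "J = f ` J'" using sub by blast
      with J I' show "J = I" by (auto simp: runs_def constant_interval_image image_sub)
    qed
  qed
qed

lemma next_run_image: "next_run \<eta> (f ` B) (f ` I) (f ` J) \<longleftrightarrow> next_run (\<eta> \<circ> f) B I J"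
proof -
  have "f ` J \<in> (`) f ` runs (\<eta> \<circ> f) B \<longleftrightarrow> J \<in> runs (\<eta> \<circ> f) B" by (auto simp: image_eq)
  then show ?thesis
    unfolding next_run_def runs_image using inj by (auto simp: lt inj_image_mem_iff image_Un[symmetric])
qed

lemma leftmost_smallest_run_image:
  "leftmost_smallest_run \<eta> (f ` B) (f ` I) \<longleftrightarrow> leftmost_smallest_run (\<eta> \<circ> f) B I"
proof -
  have c: "card (f ` A) = card A" for A by (rule card_image) (use inj in \<open>auto simp: inj_on_def\<close>)
  have fi: "finite (f ` A) \<longleftrightarrow> finite A" for A
    by (rule finite_image_iff) (use inj in \<open>auto simp: inj_on_def\<close>)
  have m: "Min (f ` A) = f (Min A)" if "finite A" "A \<in> runs (\<eta> \<circ> f) B" for A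
    using mono_Min_commute[OF strict_mono_mono[OF f], of A] that
    by (auto simp: runs_def constant_interval_def)
  have *: "f ` I \<in> (`) f ` runs (\<eta> \<circ> f) B \<longleftrightarrow> I \<in> runs (\<eta> \<circ> f) B" by (auto simp: image_eq)
  have ball: "(\<forall>x\<in>(`) f ` A. P x) \<longleftrightarrow> (\<forall>x\<in>A. P (f ` x))" for A P by blast
  show ?thesis
    unfolding leftmost_smallest_run_def runs_image * fi ball fi
  proof (intro conj_cong ball_cong imp_cong refl)
    fix I' assume "I \<in> runs (\<eta> \<circ> f) B" "finite I" "I' \<in> runs (\<eta> \<circ> f) B" "finite I'"
    then show "(card (f ` I) < card (f ` I') \<or> card (f ` I) = card (f ` I') \<and> Min (f ` I) \<le> Min (f ` I'))
        = (card I < card I' \<or> card I = card I' \<and> Min I \<le> Min I')"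
      by (simp only: c m le)
  qed
qed

text \<open>Runs, neighbouring runs, sizes and minima involve only the order of the remaining boxes,
  so an order embedding transports them. With f = \<open>skip k p\<close> this trades the algorithm
  on a set of remaining boxes for the algorithm on all boxes of a shorter configuration.\<close>

lemma extracted_soliton_image:
  "extracted_soliton \<eta> (f ` B) \<gamma> \<longleftrightarrow> (\<exists>\<gamma>'. extracted_soliton (\<eta> \<circ> f) B \<gamma>' \<and> \<gamma> = image_soliton f \<gamma>')"
proof -
  have c: "card (f ` A) = card A" for A by (rule card_image) (use inj in \<open>auto simp: inj_on_def\<close>)
  have S: "f ` I \<union> {x \<in> f ` J. card {y \<in> f ` J. y < x} < card (f ` I)}
      = f ` (I \<union> {x \<in> J. card {y \<in> J. y < x} < card I})" for I J
  proof -
    have "{y \<in> f ` J. y < f x} = f ` {y \<in> J. y < x}" for x by (auto simp: lt)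
    then have "card {y \<in> f ` J. y < f x} = card {y \<in> J. y < x}" for x by (simp add: c)
    then show ?thesis by (auto simp: c)
  qed
  have \<gamma>: "({z \<in> f ` S. \<eta> z}, {z \<in> f ` S. \<not> \<eta> z}) = image_soliton f ({z \<in> S. (\<eta> \<circ> f) z}, {z \<in> S. \<not> (\<eta> \<circ> f) z})" for S
    by (auto simp: image_soliton_def)
  have lm: "leftmost_smallest_run \<eta> (f ` B) I \<Longrightarrow> \<exists>I'. I = f ` I'" for I
    by (auto simp: leftmost_smallest_run_def runs_image)
  have nr: "next_run \<eta> (f ` B) I J \<Longrightarrow> \<exists>J'. J = f ` J'" for I J
    by (auto simp: next_run_def runs_image)
  show ?thesis
  proof
    assume "extracted_soliton \<eta> (f ` B) \<gamma>"
    then obtain I J where IJ: "leftmost_smallest_run \<eta> (f ` B) I" "next_run \<eta> (f ` B) I J"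
      "\<gamma> = (let S = I \<union> {x\<in>J. card {y\<in>J. y < x} < card I} in ({z\<in>S. \<eta> z}, {z\<in>S. \<not> \<eta> z}))"
      unfolding extracted_soliton_def Let_def by blast
    obtain I' where e1: "I = f ` I'" using lm[OF IJ(1)] by blast
    obtain J' where e2: "J = f ` J'" using nr[OF IJ(2)] by blast
    note e = e1 e2
    let ?S = "I' \<union> {x\<in>J'. card {y\<in>J'. y < x} < card I'}"
    have "extracted_soliton (\<eta> \<circ> f) B ({z \<in> ?S. (\<eta> \<circ> f) z}, {z \<in> ?S. \<not> (\<eta> \<circ> f) z})"
      using IJ(1,2) unfolding e extracted_soliton_def leftmost_smallest_run_image next_run_image by blast
    then show "\<exists>\<gamma>'. extracted_soliton (\<eta> \<circ> f) B \<gamma>' \<and> \<gamma> = image_soliton f \<gamma>'"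
      using IJ(3) unfolding e Let_def S \<gamma> by blast
  next
    assume "\<exists>\<gamma>'. extracted_soliton (\<eta> \<circ> f) B \<gamma>' \<and> \<gamma> = image_soliton f \<gamma>'"
    then obtain I J where IJ: "leftmost_smallest_run (\<eta> \<circ> f) B I" "next_run (\<eta> \<circ> f) B I J"
      "\<gamma> = image_soliton f (let S = I \<union> {x\<in>J. card {y\<in>J. y < x} < card I} in ({z\<in>S. (\<eta> \<circ> f) z}, {z\<in>S. \<not> (\<eta> \<circ> f) z}))"
      unfolding extracted_soliton_def Let_def by blast
    then show "extracted_soliton \<eta> (f ` B) \<gamma>"
      unfolding Let_def \<gamma>[symmetric] S[symmetric] extracted_soliton_def
      using leftmost_smallest_run_image next_run_image by blast
  qed
qed

end

section \<open>A single extraction\<close>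

definition run_start :: "config \<Rightarrow> int \<Rightarrow> bool" where
  "run_start \<eta> x \<longleftrightarrow> \<eta> x \<noteq> \<eta> (x - 1)"

text \<open>Runs are addressed by their first boxes. A run that is infinite to the left has no first
  box and is never tested, and a run that is infinite to the right always passes, so only finite
  runs are constrained.\<close>

definition long_runs :: "nat \<Rightarrow> config \<Rightarrow> bool" where
  "long_runs k \<eta> \<longleftrightarrow> (\<forall>x. run_start \<eta> x \<longrightarrow> (\<forall>i. 0 \<le> i \<and> i < int k \<longrightarrow> \<eta> (x + i) = \<eta> x))"

text \<open>The smallest runs have size \<open>k\<close> and the leftmost of them starts at \<open>p\<close>.\<close>

definition extractable :: "config \<Rightarrow> nat \<Rightarrow> int \<Rightarrow> bool" where
  "extractable \<eta> k p \<longleftrightarrow> long_runs k \<eta> \<and> run_start \<eta> p \<and> \<eta> (p + int k) \<noteq> \<eta> p \<and>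
     (\<forall>x<p. run_start \<eta> x \<longrightarrow> \<eta> (x + int k) = \<eta> x)"

definition skip :: "nat \<Rightarrow> int \<Rightarrow> int \<Rightarrow> int" where
  "skip k p z = (if z < p then z else z + 2 * int k)"

definition block_soliton :: "config \<Rightarrow> nat \<Rightarrow> int \<Rightarrow> soliton" where
  "block_soliton \<eta> k p = ({z\<in>{p..<p + 2 * int k}. \<eta> z}, {z\<in>{p..<p + 2 * int k}. \<not> \<eta> z})"

lemma strict_mono_skip: "strict_mono (skip k p)"
  by (auto simp: strict_mono_def skip_def)

lemma range_skip: "range (skip k p) = UNIV - {p..<p + 2 * int k}"
proof (intro equalityI subsetI)
  fix z assume "z \<in> UNIV - {p..<p + 2 * int k}"
  then have "z = skip k p (if z < p then z else z - 2 * int k)" by (auto simp: skip_def)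
  then show "z \<in> range (skip k p)" by blast
qed (auto simp: skip_def split: if_splits)

lemma support_block_soliton: "support (block_soliton \<eta> k p) = {p..<p + 2 * int k}"
  by (auto simp: support_def block_soliton_def)

lemma extract_unique:
  assumes "extractable \<eta> k p" "extractable \<eta> k' p'"
  shows "k = k'" "p = p'"
proof -
  have "\<not> k < k'" if "extractable \<eta> k p" "extractable \<eta> k' p'" for k k' p p'
  proof
    assume "k < k'"
    then have "\<eta> (p + int k) = \<eta> p" using that unfolding extractable_def long_runs_def
      by (metis of_nat_0_le_iff of_nat_less_iff)
    then show False using that by (auto simp: extractable_def)
  qed
  then show k: "k = k'" using assms by (metis linorder_neqE_nat)
  show "p = p'" using assms unfolding extractable_def k by (metis linorder_neqE)
qed

lemma extract_pos: "extractable \<eta> k p \<Longrightarrow> 0 < k"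
  by (cases k) (auto simp: extractable_def)

text \<open>A run starting less than K boxes in front of p would reach p itself, where the value
  changes. Applied with K = k + 1, so the run in front of an extracted block turns out to be longer
  than k.\<close>

lemma constant_before_run_start:
  assumes st: "run_start \<eta> p"
    and long: "\<And>x i. \<lbrakk>x < p; run_start \<eta> x; 0 \<le> i; i < K\<rbrakk> \<Longrightarrow> \<eta> (x + i) = \<eta> x"
    and i: "0 \<le> i" "i < K"
  shows "\<eta> (p - 1 - i) = \<eta> (p - 1)"
  using i
proof (induction i rule: int_ge_induct)
  case base then show ?case by simp
next
  case (step i)
  show ?case
  proof (rule ccontr)
    assume "\<not> ?thesis"
    then have "run_start \<eta> (p - 1 - i)" using step by (auto simp: run_start_def algebra_simps)
    from long[OF _ this, of "i + 1"] step st show False by (auto simp: run_start_def)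
  qed
qed

text \<open>The choice of the leftmost run makes the runs in front strictly longer than k, so
  \<open>extract_before\<close> covers k + 1 boxes. These boxes agree with the second half of the
  block; every later argument about cutting out a block rests on this agreement.\<close>

lemma extractD:
  assumes "extractable \<eta> k p"
  shows extract_first: "\<And>i. 0 \<le> i \<Longrightarrow> i < int k \<Longrightarrow> \<eta> (p + i) = \<eta> p"
    and extract_second: "\<And>i. 0 \<le> i \<Longrightarrow> i < int k \<Longrightarrow> \<eta> (p + int k + i) = (\<not> \<eta> p)"
    and extract_before: "\<And>i. 0 \<le> i \<Longrightarrow> i \<le> int k \<Longrightarrow> \<eta> (p - 1 - i) = (\<not> \<eta> p)"
    and extract_long: "\<And>x i. x < p \<Longrightarrow> run_start \<eta> x \<Longrightarrow> 0 \<le> i \<Longrightarrow> i \<le> int k \<Longrightarrow> \<eta> (x + i) = \<eta> x"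
proof -
  have A: "long_runs k \<eta>" "run_start \<eta> p" "\<eta> (p + int k) \<noteq> \<eta> p"
    "\<And>x. x < p \<Longrightarrow> run_start \<eta> x \<Longrightarrow> \<eta> (x + int k) = \<eta> x" using assms by (auto simp: extractable_def)
  have k: "0 < k" using extract_pos[OF assms] .
  show 1: "\<eta> (p + i) = \<eta> p" if "0 \<le> i" "i < int k" for i using A that by (auto simp: long_runs_def)
  have "run_start \<eta> (p + int k)"
    using 1[of "int k - 1"] A(3) k by (auto simp: run_start_def algebra_simps)
  then show "\<eta> (p + int k + i) = (\<not> \<eta> p)" if "0 \<le> i" "i < int k" for i
    using A that by (auto simp: long_runs_def)
  show 3: "\<eta> (x + i) = \<eta> x" if "x < p" "run_start \<eta> x" "0 \<le> i" "i \<le> int k" for x i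
    using A(4)[OF that(1,2)] A(1) that by (cases "i = int k") (auto simp: long_runs_def)
  show "\<eta> (p - 1 - i) = (\<not> \<eta> p)" if "0 \<le> i" "i \<le> int k" for i
    using constant_before_run_start[OF A(2), of "int k + 1" i] 3 that A(2) by (auto simp: run_start_def)
qed

lemma extract_exists:
  assumes fin: "finite {z. \<eta> z}" and ne: "\<exists>z. \<eta> z"
  shows "\<exists>k p. extractable \<eta> k p"
proof -
  let ?P = "\<lambda>k x. run_start \<eta> x \<and> \<eta> (x + int k) \<noteq> \<eta> x"
  let ?m = "Min {z. \<eta> z}" and ?M = "Max {z. \<eta> z}"
  have "\<eta> ?m" using Min_in[OF fin] ne by auto
  have "\<not> \<eta> (?m - 1)" using Min_le[OF fin, of "?m - 1"] by auto
  have "\<not> \<eta> (?M + 1)" using Max_ge[OF fin, of "?M + 1"] by auto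
  have "?m \<le> ?M" using fin \<open>\<eta> ?m\<close> by auto
  \<comment> \<open>Between the first ball and the box behind the last ball the value changes. This
    only shows that some k fails the test; the least such k is the size of a smallest run.\<close>
  have ex: "\<exists>k x. ?P k x"
    by (rule exI[of _ "nat (?M + 1 - ?m)"], rule exI[of _ ?m])
       (use \<open>\<eta> ?m\<close> \<open>\<not> \<eta> (?m - 1)\<close> \<open>\<not> \<eta> (?M + 1)\<close> \<open>?m \<le> ?M\<close> in \<open>auto simp: run_start_def\<close>)
  define k where "k = (LEAST k. \<exists>x. ?P k x)"
  have k: "\<exists>x. ?P k x" unfolding k_def by (rule LeastI_ex[OF ex])
  have least: "\<not> ?P k' x" if "k' < k" for k' x using not_less_Least that unfolding k_def by blast
  have "{x. ?P k x} \<subseteq> {z. \<eta> z} \<union> (+) 1 ` {z. \<eta> z}"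
  proof
    fix x assume "x \<in> {x. ?P k x}"
    then have "\<eta> x \<or> \<eta> (x - 1)" by (auto simp: run_start_def)
    moreover have "x = 1 + (x - 1)" by simp
    ultimately show "x \<in> {z. \<eta> z} \<union> (+) 1 ` {z. \<eta> z}" by blast
  qed
  then have fin': "finite {x. ?P k x}" using fin finite_subset by blast
  let ?p = "Min {x. ?P k x}"
  have p: "?P k ?p" using Min_in[OF fin'] k by auto
  have "extractable \<eta> k ?p"
    unfolding extractable_def
  proof (intro conjI allI impI)
    show "long_runs k \<eta>"
      unfolding long_runs_def
    proof (intro allI impI)
      fix x i assume "run_start \<eta> x" "0 \<le> i \<and> i < int k"
      then show "\<eta> (x + i) = \<eta> x" using least[of "nat i" x] by auto
    qed
    fix x assume "x < ?p" "run_start \<eta> x"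
    then show "\<eta> (x + int k) = \<eta> x" using Min_le[OF fin', of x] by auto
  qed (use p in auto)
  then show ?thesis by blast
qed

lemma run_interval_gap:
  assumes I: "I \<in> runs \<eta> UNIV" and fin: "finite I"
  shows "I = {Min I..Max I}" "run_start \<eta> (Min I)" "\<eta> (Max I + 1) \<noteq> \<eta> (Min I)"
    "\<And>z. z \<in> I \<Longrightarrow> \<eta> z = \<eta> (Min I)" "I \<noteq> {}"
proof -
  have c: "constant_interval \<eta> UNIV I" and mx: "\<And>J. constant_interval \<eta> UNIV J \<Longrightarrow> I \<subseteq> J \<Longrightarrow> J = I"
    using I by (auto simp: runs_def)
  show ne: "I \<noteq> {}" using c by (auto simp: constant_interval_def)
  have in1: "Min I \<in> I" "Max I \<in> I" using fin ne by auto
  have conv: "\<And>x y z. x \<in> I \<Longrightarrow> y \<in> I \<Longrightarrow> x \<le> z \<Longrightarrow> z \<le> y \<Longrightarrow> z \<in> I"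
    using c unfolding constant_interval_def by blast
  show col: "\<And>z. z \<in> I \<Longrightarrow> \<eta> z = \<eta> (Min I)" using c in1 unfolding constant_interval_def by blast
  show eq: "I = {Min I..Max I}"
  proof (intro equalityI subsetI)
    fix x assume "x \<in> I"
    from Min_le[OF fin this] Max_ge[OF fin this] show "x \<in> {Min I..Max I}" by simp
  next
    fix x assume "x \<in> {Min I..Max I}"
    with conv[OF in1] show "x \<in> I" by simp
  qed
  have le: "Min I \<le> Max I" using in1 fin by auto
  have "False" if "\<eta> (Min I - 1) = \<eta> (Min I)"
  proof -
    have "constant_interval \<eta> UNIV {Min I - 1..Max I}"
      unfolding constant_interval_def
    proof (intro conjI ballI impI)
      fix x y assume "x \<in> {Min I - 1..Max I}" "y \<in> {Min I - 1..Max I}"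
      then have "x = Min I - 1 \<or> x \<in> I" "y = Min I - 1 \<or> y \<in> I"
        using conv[OF in1, of x] conv[OF in1, of y] by force+
      then show "\<eta> x = \<eta> y" using that col by metis
    qed (use le in auto)
    moreover have "I \<subseteq> {Min I - 1..Max I}" by (subst eq) auto
    ultimately have "{Min I - 1..Max I} = I" by (rule mx)
    moreover have "Min I - 1 \<in> {Min I - 1..Max I}" using le by simp
    ultimately have "Min I - 1 \<in> I" by simp
    from Min_le[OF fin this] show False by simp
  qed
  then show "run_start \<eta> (Min I)" by (auto simp: run_start_def)
  show "\<eta> (Max I + 1) \<noteq> \<eta> (Min I)"
  proof
    assume a: "\<eta> (Max I + 1) = \<eta> (Min I)"
    have "constant_interval \<eta> UNIV {Min I..Max I + 1}"
      unfolding constant_interval_def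
    proof (intro conjI ballI impI)
      fix x y assume "x \<in> {Min I..Max I + 1}" "y \<in> {Min I..Max I + 1}"
      then have "x = Max I + 1 \<or> x \<in> I" "y = Max I + 1 \<or> y \<in> I"
        using conv[OF in1, of x] conv[OF in1, of y] by force+
      then show "\<eta> x = \<eta> y" using a col by metis
    qed (use le in auto)
    moreover have "I \<subseteq> {Min I..Max I + 1}" by (subst eq) auto
    ultimately have "{Min I..Max I + 1} = I" by (rule mx)
    moreover have "Max I + 1 \<in> {Min I..Max I + 1}" using le by simp
    ultimately have "Max I + 1 \<in> I" by simp
    from Max_ge[OF fin this] show False by simp
  qed
qed

lemma run_intervalI:
  assumes "x \<le> y" "\<And>z. x \<le> z \<Longrightarrow> z \<le> y \<Longrightarrow> \<eta> z = c" "\<eta> (x - 1) \<noteq> c" "\<eta> (y + 1) \<noteq> c"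
  shows "{x..y} \<in> runs \<eta> UNIV"
  unfolding runs_def
proof (intro CollectI conjI allI impI)
  show "constant_interval \<eta> UNIV {x..y}" using assms by (auto simp: constant_interval_def)
  fix J assume J: "constant_interval \<eta> UNIV J \<and> {x..y} \<subseteq> J"
  have conv: "\<And>x y z. x \<in> J \<Longrightarrow> y \<in> J \<Longrightarrow> x \<le> z \<Longrightarrow> z \<le> y \<Longrightarrow> z \<in> J"
    and col: "\<And>u v. u \<in> J \<Longrightarrow> v \<in> J \<Longrightarrow> \<eta> u = \<eta> v"
    using J unfolding constant_interval_def by blast+
  have xy: "x \<in> J" "y \<in> J" using J assms(1) by auto
  have "x - 1 \<notin> J" "y + 1 \<notin> J" using col xy assms by auto
  then have "z \<in> {x..y}" if "z \<in> J" for z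
    using conv[OF that xy(1), of "x - 1"] conv[OF xy(2) that, of "y + 1"] by force
  then show "J = {x..y}" using J by auto
qed

lemma extracted_soliton_UNIV:
  assumes ex: "extractable \<eta> k p"
  shows "extracted_soliton \<eta> UNIV \<gamma> \<longleftrightarrow> \<gamma> = block_soliton \<eta> k p"
proof -
  have A: "long_runs k \<eta>" "run_start \<eta> p" "\<eta> (p + int k) \<noteq> \<eta> p"
    "\<And>x. x < p \<Longrightarrow> run_start \<eta> x \<Longrightarrow> \<eta> (x + int k) = \<eta> x" using ex by (auto simp: extractable_def)
  note k = extract_pos[OF ex]
  let ?I = "{p..p + int k - 1}"
  have I: "?I \<in> runs \<eta> UNIV"
    by (rule run_intervalI[where c = "\<eta> p"])
       (use k A extract_first[OF ex, of "z - p" for z] in \<open>auto simp: run_start_def\<close>)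
  have cI: "card ?I = k" "Min ?I = p" using k by (auto simp: Min_eq_iff)
  have other: "k < card I' \<or> k = card I' \<and> p \<le> Min I'" if I': "I' \<in> runs \<eta> UNIV" "finite I'" for I'
  proof -
    note r = run_interval_gap[OF I']
    let ?x = "Min I'" and ?y = "Max I'"
    have le: "?x \<le> ?y" using r(5) I'(2) by simp
    have card: "card I' = nat (?y - ?x + 1)" by (subst r(1)) simp
    have "int k \<le> ?y - ?x + 1"
    proof (rule ccontr)
      assume "\<not> ?thesis"
      then have "\<eta> (?x + (?y - ?x + 1)) = \<eta> ?x"
        using A(1)[unfolded long_runs_def, rule_format, OF r(2), of "?y - ?x + 1"] le by linarith
      with r(3) show False by auto
    qed
    moreover have "p \<le> ?x" if "int k = ?y - ?x + 1"
    proof (rule ccontr)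
      assume "\<not> ?thesis"
      with A(4)[of ?x] r(2,3) that show False by auto
    qed
    ultimately show ?thesis unfolding card by linarith
  qed
  have lm: "leftmost_smallest_run \<eta> UNIV I \<longleftrightarrow> I = ?I" for I
  proof
    assume "leftmost_smallest_run \<eta> UNIV I"
    then have l: "I \<in> runs \<eta> UNIV" "finite I" "card I < card ?I \<or> card I = card ?I \<and> Min I \<le> Min ?I"
      using I unfolding leftmost_smallest_run_def by blast+
    with other[OF l(1,2)] have "card I = k" "Min I = p" unfolding cI by auto
    moreover have "card I = nat (Max I - Min I + 1)"
      by (subst run_interval_gap(1)[OF l(1,2)]) simp
    ultimately have "Max I = p + int k - 1" using k by linarith
    then show "I = ?I" using run_interval_gap(1)[OF l(1,2)] \<open>Min I = p\<close> by simp
  qed (use I other in \<open>auto simp: leftmost_smallest_run_def cI\<close>)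
  \<comment> \<open>The next run is infinite when it lies behind the last ball, so it is described
    by a condition instead of two end points.\<close>
  define J where "J = {z. p + int k \<le> z \<and> (\<forall>y. p + int k \<le> y \<and> y \<le> z \<longrightarrow> \<eta> y \<noteq> \<eta> p)}"
  have pkJ: "{p + int k..<p + 2 * int k} \<subseteq> J"
  proof
    fix z assume z: "z \<in> {p + int k..<p + 2 * int k}"
    have "\<eta> y \<noteq> \<eta> p" if "p + int k \<le> y" "y \<le> z" for y
      using extract_second[OF ex, of "y - (p + int k)"] that z by auto
    then show "z \<in> J" using z by (auto simp: J_def)
  qed
  have pJ: "p + int k \<in> J" by (rule subsetD[OF pkJ]) (use k in auto)
  have J: "J \<in> runs \<eta> UNIV"
    unfolding runs_def
  proof (intro CollectI conjI allI impI)
    have "J \<noteq> {}" using pJ by blast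
    then show "constant_interval \<eta> UNIV J"
      unfolding constant_interval_def by (auto simp: J_def)
    fix J' assume J': "constant_interval \<eta> UNIV J' \<and> J \<subseteq> J'"
    have conv: "\<And>x y z. x \<in> J' \<Longrightarrow> y \<in> J' \<Longrightarrow> x \<le> z \<Longrightarrow> z \<le> y \<Longrightarrow> z \<in> J'"
      and col: "\<And>u v. u \<in> J' \<Longrightarrow> v \<in> J' \<Longrightarrow> \<eta> u = \<eta> v"
      using J' unfolding constant_interval_def by blast+
    have pJ': "p + int k \<in> J'" using pJ J' by blast
    have nJ': "p + int k - 1 \<notin> J'"
    proof
      assume "p + int k - 1 \<in> J'"
      from col[OF pJ' this] have "\<eta> (p + int k) = \<eta> (p + int k - 1)" .
      with extract_first[OF ex, of "int k - 1"] A(3) k show False by (simp add: add_diff_eq)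
    qed
    have "z \<in> J" if z: "z \<in> J'" for z
    proof -
      have "p + int k \<le> z" using conv[OF z pJ', of "p + int k - 1"] nJ' by force
      moreover have "\<eta> y \<noteq> \<eta> p" if "p + int k \<le> y" "y \<le> z" for y
        using conv[OF pJ' z that] col[OF pJ'] A(3) by auto
      ultimately show ?thesis by (auto simp: J_def)
    qed
    then show "J' = J" using J' by auto
  qed
  have nr: "next_run \<eta> UNIV ?I J' \<longleftrightarrow> J' = J" for J'
  proof
    assume n: "next_run \<eta> UNIV ?I J'"
    have J': "J' \<in> runs \<eta> UNIV" "\<And>x y. x \<in> ?I \<Longrightarrow> y \<in> J' \<Longrightarrow> x < y"
      "\<And>x y z. x \<in> ?I \<Longrightarrow> y \<in> J' \<Longrightarrow> x < z \<Longrightarrow> z < y \<Longrightarrow> z \<in> ?I \<union> J'"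
    proof -
      note n1 = n[unfolded next_run_def, THEN conjunct1]
        and n2 = n[unfolded next_run_def, THEN conjunct2, rule_format]
      show "J' \<in> runs \<eta> UNIV" by (rule n1)
      show "x < y" if "x \<in> ?I" "y \<in> J'" for x y by (rule n2[OF that, THEN conjunct1])
      show "z \<in> ?I \<union> J'" if "x \<in> ?I" "y \<in> J'" "x < z" "z < y" for x y z
        by (rule n2[OF that(1,2), THEN conjunct2, rule_format]) (use that in auto)
    qed
    have c: "constant_interval \<eta> UNIV J'" using J'(1) by (simp add: runs_def)
    then obtain y where y: "y \<in> J'" unfolding constant_interval_def by blast
    have "p + int k - 1 \<in> ?I" using k by auto
    from J'(2)[OF this y] J'(3)[OF this y, of "p + int k"] y have pJ': "p + int k \<in> J'"
      by (cases "y = p + int k") auto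
    have conv: "\<And>x y z. x \<in> J' \<Longrightarrow> y \<in> J' \<Longrightarrow> x \<le> z \<Longrightarrow> z \<le> y \<Longrightarrow> z \<in> J'"
      and col: "\<And>u v. u \<in> J' \<Longrightarrow> v \<in> J' \<Longrightarrow> \<eta> u = \<eta> v"
      using c unfolding constant_interval_def by blast+
    have "J' \<subseteq> J"
    proof
      fix z assume z: "z \<in> J'"
      have "p + int k \<le> z" using J'(2)[of "p + int k - 1", OF _ z] k by auto
      moreover have "\<eta> y \<noteq> \<eta> p" if "p + int k \<le> y" "y \<le> z" for y
        using conv[OF pJ' z that] col[OF pJ'] A(3) by auto
      ultimately show "z \<in> J" by (auto simp: J_def)
    qed
    then show "J' = J" using J'(1) J unfolding runs_def by blast
  next
    assume "J' = J"
    then show "next_run \<eta> UNIV ?I J'" using J unfolding next_run_def by (auto simp: J_def)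
  qed
  have S: "?I \<union> {x\<in>J. card {y\<in>J. y < x} < card ?I} = {p..<p + 2 * int k}"
  proof -
    have "card {y\<in>J. y < x} < k \<longleftrightarrow> x < p + 2 * int k" if x: "x \<in> J" for x
    proof -
      have "{y\<in>J. y < x} = {p + int k..<x}"
      proof (intro equalityI subsetI)
        fix y assume "y \<in> {p + int k..<x}"
        then show "y \<in> {y\<in>J. y < x}" using x unfolding J_def by simp
      qed (simp add: J_def)
      then show ?thesis using x k by (auto simp: J_def)
    qed
    note small = this
    have "{x\<in>J. card {y\<in>J. y < x} < k} = {p + int k..<p + 2 * int k}"
    proof (intro equalityI subsetI)
      fix x assume x: "x \<in> {x\<in>J. card {y\<in>J. y < x} < k}"
      then have "x < p + 2 * int k" using small by blast
      moreover have "p + int k \<le> x" using x unfolding J_def by simp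
      ultimately show "x \<in> {p + int k..<p + 2 * int k}" by simp
    next
      fix x assume x: "x \<in> {p + int k..<p + 2 * int k}"
      then have "x \<in> J" using pkJ by blast
      with small[OF this] x show "x \<in> {x\<in>J. card {y\<in>J. y < x} < k}" by simp
    qed
    moreover have "?I \<union> {p + int k..<p + 2 * int k} = {p..<p + 2 * int k}" using k by auto
    ultimately show ?thesis unfolding cI(1) by (simp only:)
  qed
  show ?thesis
  proof
    assume "extracted_soliton \<eta> UNIV \<gamma>"
    then show "\<gamma> = block_soliton \<eta> k p"
      unfolding extracted_soliton_def
    proof (elim exE conjE)
      fix I' J' S' assume *: "leftmost_smallest_run \<eta> UNIV I'" "next_run \<eta> UNIV I' J'"
        "S' = I' \<union> {x\<in>J'. card {y\<in>J'. y < x} < card I'}" "\<gamma> = ({z\<in>S'. \<eta> z}, {z\<in>S'. \<not> \<eta> z})"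
      have I': "I' = ?I" using *(1) unfolding lm .
      have J': "J' = J" using *(2) unfolding I' nr .
      have S': "S' = {p..<p + 2 * int k}" using *(3) unfolding I' J' S .
      show "\<gamma> = block_soliton \<eta> k p" using *(4) unfolding S' block_soliton_def .
    qed
  next
    assume "\<gamma> = block_soliton \<eta> k p"
    then show "extracted_soliton \<eta> UNIV \<gamma>"
      unfolding extracted_soliton_def block_soliton_def
      apply -
      apply (rule exI[of _ ?I], rule exI[of _ J], rule exI[of _ "{p..<p + 2 * int k}"])
      apply (intro conjI)
      subgoal unfolding lm ..
      subgoal unfolding nr ..
      subgoal unfolding S ..
      subgoal .
      done
  qed
qed

text \<open>The first removal is forced, and every later stage takes place on the range of
  \<open>skip\<close>, where it is a stage of the algorithm for the shortened configuration. This
  gives the recursion for the set of all solitons.\<close>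

lemma remaining_boxes_cut:
  assumes ex: "extractable \<eta> k p"
  shows "remaining_boxes \<eta> B \<longleftrightarrow> B = UNIV \<or> (\<exists>B'. remaining_boxes (\<eta> \<circ> skip k p) B' \<and> B = skip k p ` B')"
proof
  assume "remaining_boxes \<eta> B"
  then show "B = UNIV \<or> (\<exists>B'. remaining_boxes (\<eta> \<circ> skip k p) B' \<and> B = skip k p ` B')"
  proof induction
    case (step B \<gamma>)
    show ?case
    proof (cases "B = UNIV")
      case True
      then have "B - support \<gamma> = skip k p ` UNIV"
        using step extracted_soliton_UNIV[OF ex] by (simp add: support_block_soliton range_skip)
      then show ?thesis using remaining_boxes.start by blast
    next
      case False
      then obtain B' where B': "remaining_boxes (\<eta> \<circ> skip k p) B'" "B = skip k p ` B'"
        using step.IH by blast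
      then obtain \<gamma>' where \<gamma>': "extracted_soliton (\<eta> \<circ> skip k p) B' \<gamma>'" "\<gamma> = image_soliton (skip k p) \<gamma>'"
        using step.hyps(2) extracted_soliton_image[OF strict_mono_skip, of \<eta> k p B' \<gamma>] by auto
      have "B - support \<gamma> = skip k p ` (B' - support \<gamma>')"
        using strict_mono_imp_inj_on[OF strict_mono_skip, of k p]
        by (simp add: B' \<gamma>' support_image_soliton image_set_diff)
      then show ?thesis using remaining_boxes.step[OF B'(1) \<gamma>'(1)] by blast
    qed
  qed auto
next
  have "remaining_boxes \<eta> (skip k p ` B')" if "remaining_boxes (\<eta> \<circ> skip k p) B'" for B'
    using that
  proof induction
    case start
    have "UNIV - support (block_soliton \<eta> k p) = range (skip k p)"
      by (simp add: support_block_soliton range_skip)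
    then show ?case using remaining_boxes.step[OF remaining_boxes.start] extracted_soliton_UNIV[OF ex] by metis
  next
    case (step B' \<gamma>')
    have "skip k p ` (B' - support \<gamma>') = skip k p ` B' - support (image_soliton (skip k p) \<gamma>')"
      using strict_mono_imp_inj_on[OF strict_mono_skip, of k p]
      by (simp add: support_image_soliton image_set_diff)
    moreover have "extracted_soliton \<eta> (skip k p ` B') (image_soliton (skip k p) \<gamma>')"
      unfolding extracted_soliton_image[OF strict_mono_skip] using step.hyps(2) by blast
    ultimately show ?case using remaining_boxes.step[OF step.IH] by metis
  qed
  note image = this
  assume "B = UNIV \<or> (\<exists>B'. remaining_boxes (\<eta> \<circ> skip k p) B' \<and> B = skip k p ` B')"
  then show "remaining_boxes \<eta> B"
    using remaining_boxes.start[of \<eta>] image by (elim disjE exE conjE) simp_all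
qed

definition all_solitons :: "config \<Rightarrow> soliton set" where
  "all_solitons \<eta> = {\<gamma>. \<exists>B. remaining_boxes \<eta> B \<and> extracted_soliton \<eta> B \<gamma>}"

lemma all_solitons_cut:
  assumes ex: "extractable \<eta> k p"
  shows "all_solitons \<eta> = insert (block_soliton \<eta> k p) (image_soliton (skip k p) ` all_solitons (\<eta> \<circ> skip k p))"
  (is "?L = ?R")
proof (intro equalityI subsetI)
  fix \<gamma> assume "\<gamma> \<in> ?L"
  then obtain B where B: "remaining_boxes \<eta> B" "extracted_soliton \<eta> B \<gamma>" by (auto simp: all_solitons_def)
  from B(1) consider "B = UNIV" | B' where "remaining_boxes (\<eta> \<circ> skip k p) B'" "B = skip k p ` B'"
    unfolding remaining_boxes_cut[OF ex] by auto
  then show "\<gamma> \<in> ?R"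
  proof cases
    case 1
    then show ?thesis using B(2) extracted_soliton_UNIV[OF ex] by simp
  next
    case 2
    then show ?thesis using B(2) extracted_soliton_image[OF strict_mono_skip, of \<eta> k p B' \<gamma>]
      unfolding all_solitons_def by blast
  qed
next
  fix \<gamma> assume "\<gamma> \<in> ?R"
  then show "\<gamma> \<in> ?L"
    unfolding all_solitons_def
    using extracted_soliton_UNIV[OF ex, of "block_soliton \<eta> k p"] extracted_soliton_image[OF strict_mono_skip, of \<eta> k p]
      remaining_boxes_cut[OF ex] by blast
qed

lemma all_solitons_empty: "all_solitons (\<lambda>_. False) = {}"
proof -
  have none: "\<not> extracted_soliton (\<lambda>_. False) UNIV \<gamma>" for \<gamma>
  proof
    assume "extracted_soliton (\<lambda>_. False) UNIV \<gamma>"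
    then obtain I where "leftmost_smallest_run (\<lambda>_. False) UNIV I"
      unfolding extracted_soliton_def by blast
    then have I: "I \<in> runs (\<lambda>_. False) UNIV" "finite I" by (auto simp: leftmost_smallest_run_def)
    from run_interval_gap(3)[OF this] show False by simp
  qed
  have "B = UNIV" if "remaining_boxes (\<lambda>_. False) B" for B
    using that by induction (use none in blast)+
  then show ?thesis using none unfolding all_solitons_def by blast
qed

section \<open>Excursions as configurations\<close>

text \<open>Excursions as configurations on all of Z, the form in which a removal is a composition
  with \<open>skip\<close>. M is the last position 2n of the excursion; it is determined by the
  configuration (\<open>dyck_size\<close>).\<close>

definition dyck :: "int \<Rightarrow> config \<Rightarrow> bool" where
  "dyck M \<eta> \<longleftrightarrow> 0 \<le> M \<and> (\<forall>z. \<eta> z \<longrightarrow> 1 \<le> z \<and> z \<le> M) \<and> (\<forall>z. 0 \<le> z \<and> z \<le> M \<longrightarrow> 0 \<le> walk \<eta> z) \<and> walk \<eta> M = 0"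

lemma walk_step: "walk \<eta> (z + 1) = walk \<eta> z + (if \<eta> (z + 1) then 1 else - 1)"
  using walk_increment[of \<eta> "z + 1"] by (auto split: if_splits)

lemma walk_constant:
  assumes c: "\<And>i. 0 \<le> i \<Longrightarrow> i < k \<Longrightarrow> \<eta> (x + i) = c" and j: "0 \<le> j" "j \<le> k"
  shows "walk \<eta> (x - 1 + j) = walk \<eta> (x - 1) + (if c then j else - j)"
  using j
proof (induction j rule: int_ge_induct)
  case (step j)
  have "\<eta> (x - 1 + j + 1) = c" using c[of j] step by (simp add: algebra_simps)
  then show ?case using step walk_step[of \<eta> "x - 1 + j"] by (auto simp: algebra_simps split: if_splits)
qed simp

lemma walk_dec: "0 \<le> j \<Longrightarrow> walk \<eta> (z + j) \<ge> walk \<eta> z - j"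
proof (induction j rule: int_ge_induct)
  case (step j)
  then show ?case using walk_step[of \<eta> "z + j"] by (auto simp: algebra_simps split: if_splits)
qed simp

text \<open>The walk has the same height on both sides of the block, so jumping over the block is
  invisible to it. The bound on p keeps the origin, where the walk is normalized, in front of the
  block.\<close>

lemma walk_skip:
  assumes "1 \<le> p" and w: "walk \<eta> (p - 1 + 2 * int k) = walk \<eta> (p - 1)"
  shows "walk (\<eta> \<circ> skip k p) z = walk \<eta> (skip k p z)"
proof -
  have up: "walk (\<eta> \<circ> skip k p) (z + 1) - walk (\<eta> \<circ> skip k p) z
      = walk \<eta> (skip k p (z + 1)) - walk \<eta> (skip k p z)" for z
  proof (cases "z + 1 = p")
    case True
    then show ?thesis
      using walk_step[of "\<eta> \<circ> skip k p" z] walk_step[of \<eta> "p - 1 + 2 * int k"] w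
      by (auto simp: skip_def)
  next
    case False
    then have "skip k p (z + 1) = skip k p z + 1" by (simp add: skip_def)
    then show ?thesis
      using walk_step[of "\<eta> \<circ> skip k p" z] walk_step[of \<eta> "skip k p z"] by simp
  qed
  show ?thesis
  proof (induction z rule: int_induct[where k = 0])
    case base
    then show ?case using assms by (simp add: walk_0 skip_def)
  next
    case (step1 i)
    then show ?case using up[of i] by (simp del: o_apply)
  next
    case (step2 i)
    then show ?case using up[of "i - 1"] by (simp del: o_apply)
  qed
qed

lemma walk_block:
  assumes "extractable \<eta> k p"
  shows walk_block_first: "\<And>j. 0 \<le> j \<Longrightarrow> j \<le> int k \<Longrightarrow> walk \<eta> (p - 1 + j) = walk \<eta> (p - 1) + (if \<eta> p then j else - j)"
    and walk_block_second: "\<And>j. 0 \<le> j \<Longrightarrow> j \<le> int k \<Longrightarrow>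
      walk \<eta> (p - 1 + int k + j) = walk \<eta> (p - 1) + (if \<eta> p then int k - j else j - int k)"
    and walk_block_total: "walk \<eta> (p - 1 + 2 * int k) = walk \<eta> (p - 1)"
proof -
  show 1: "walk \<eta> (p - 1 + j) = walk \<eta> (p - 1) + (if \<eta> p then j else - j)" if "0 \<le> j" "j \<le> int k" for j
    using walk_constant[of "int k" \<eta> p "\<eta> p" j] extract_first[OF assms] that by auto
  show 2: "walk \<eta> (p - 1 + int k + j) = walk \<eta> (p - 1) + (if \<eta> p then int k - j else j - int k)"
    if "0 \<le> j" "j \<le> int k" for j
    using walk_constant[of "int k" \<eta> "p + int k" "\<not> \<eta> p" j] extract_second[OF assms] that 1[of "int k"]
    by (simp add: algebra_simps split: if_splits)
  show "walk \<eta> (p - 1 + 2 * int k) = walk \<eta> (p - 1)"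
    using 2[of "int k"] by (simp add: algebra_simps)
qed

text \<open>A block contains balls, which lie in {1..M}. If it ends with balls, this bounds its end.
  If it ends with empty boxes, the balls in its first half lift the walk to height at least k, and
  coming back to 0 at M takes at least k further steps.\<close>

lemma dyck_cut:
  assumes ex: "extractable \<eta> k p" and d: "dyck M \<eta>"
  shows "1 \<le> p" "p + 2 * int k - 1 \<le> M" "dyck (M - 2 * int k) (\<eta> \<circ> skip k p)"
proof -
  note k = extract_pos[OF ex]
  have ball: "\<And>z. \<eta> z \<Longrightarrow> 1 \<le> z \<and> z \<le> M" and pos: "\<And>z. 0 \<le> z \<Longrightarrow> z \<le> M \<Longrightarrow> 0 \<le> walk \<eta> z"
    and M: "0 \<le> M" "walk \<eta> M = 0" using d by (auto simp: dyck_def)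
  have "\<eta> p \<or> \<eta> (p - 1)" using ex by (auto simp: extractable_def run_start_def)
  then show p: "1 \<le> p" using ball by force
  show q: "p + 2 * int k - 1 \<le> M"
  proof (cases "\<eta> p")
    case False
    then have "\<eta> (p + int k + (int k - 1))" using extract_second[OF ex, of "int k - 1"] k by auto
    then show ?thesis using ball by force
  next
    case True
    then have "\<eta> (p + (int k - 1))" using extract_first[OF ex, of "int k - 1"] k by auto
    then have l: "p - 1 + int k \<le> M" using ball by force
    have "walk \<eta> (p - 1 + int k) \<ge> int k"
      using walk_block_first[OF ex, of "int k"] True pos[of "p - 1"] p l k by auto
    with walk_dec[of "M - (p - 1 + int k)" \<eta> "p - 1 + int k"] M l show ?thesis by auto
  qed
  note ws = walk_skip[OF p walk_block_total[OF ex]]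
  show "dyck (M - 2 * int k) (\<eta> \<circ> skip k p)"
    unfolding dyck_def
  proof (intro conjI allI impI)
    show "0 \<le> M - 2 * int k" using p q by auto
    fix z
    show "1 \<le> z" if "(\<eta> \<circ> skip k p) z" using ball[of "skip k p z"] that p by (auto simp: skip_def split: if_splits)
    show "z \<le> M - 2 * int k" if "(\<eta> \<circ> skip k p) z"
      using ball[of "skip k p z"] that p q by (auto simp: skip_def split: if_splits)
    show "0 \<le> walk (\<eta> \<circ> skip k p) z" if "0 \<le> z \<and> z \<le> M - 2 * int k"
      unfolding ws using pos[of "skip k p z"] that by (auto simp: skip_def split: if_splits)
    show "walk (\<eta> \<circ> skip k p) (M - 2 * int k) = 0"
      unfolding ws
    proof (cases "M - 2 * int k < p")
      case True
      then have "M = p - 1 + 2 * int k" using q by auto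
      then show "walk \<eta> (skip k p (M - 2 * int k)) = 0"
        using M(2) walk_block_total[OF ex] True by (simp add: skip_def)
    qed (use M in \<open>simp add: skip_def\<close>)
  qed
qed

lemma walk_no_balls: "0 \<le> z \<Longrightarrow> walk (\<lambda>_. False) z = - z"
  by (simp add: walk_def)

text \<open>Every removal shortens the excursion by 2k > 0 boxes. The base case has M = 0, because
  without balls the walk would be negative at M.\<close>

lemma dyck_induct [consumes 1, case_names empty cut]:
  assumes d: "dyck M \<eta>"
    and "P 0 (\<lambda>_. False)"
    and "\<And>M \<eta> k p. \<lbrakk>dyck M \<eta>; extractable \<eta> k p; dyck (M - 2 * int k) (\<eta> \<circ> skip k p);
      1 \<le> p; p + 2 * int k - 1 \<le> M; P (M - 2 * int k) (\<eta> \<circ> skip k p)\<rbrakk> \<Longrightarrow> P M \<eta>"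
  shows "P M \<eta>"
  using d
proof (induction "nat M" arbitrary: M \<eta> rule: less_induct)
  case less
  show ?case
  proof (cases "\<exists>z. \<eta> z")
    case False
    then have "\<eta> = (\<lambda>_. False)" by auto
    moreover have "M = 0" using less.prems walk_no_balls[of M] calculation by (auto simp: dyck_def)
    ultimately show ?thesis using assms(2) by simp
  next
    case True
    have "{z. \<eta> z} \<subseteq> {1..M}" using less.prems by (auto simp: dyck_def)
    then have "finite {z. \<eta> z}" using finite_subset by blast
    from extract_exists[OF this True] obtain k p where ex: "extractable \<eta> k p" by blast
    note c = dyck_cut[OF ex less.prems]
    have "nat (M - 2 * int k) < nat M" using extract_pos[OF ex] c by auto
    then show ?thesis using assms(3)[OF less.prems ex c(3,1,2) less.hyps] c(3) by blast
  qed
qed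

lemma extractable_dyck_exists:
  assumes "dyck M \<eta>" "\<eta> z"
  shows "\<exists>k p. extractable \<eta> k p"
proof -
  have "{z. \<eta> z} \<subseteq> {1..M}" using assms by (auto simp: dyck_def)
  then have "finite {z. \<eta> z}" using finite_subset by blast
  then show ?thesis using extract_exists assms(2) by blast
qed

lemma long_runs_mono: "long_runs m \<eta> \<Longrightarrow> k \<le> m \<Longrightarrow> long_runs k \<eta>"
proof -
  assume l: "long_runs m \<eta>" and k: "k \<le> m"
  show "long_runs k \<eta>"
    unfolding long_runs_def
  proof (intro allI impI)
    fix x i assume "run_start \<eta> x" "0 \<le> i \<and> i < int k"
    moreover from this(2) k have "0 \<le> i \<and> i < int m" by simp
    ultimately show "\<eta> (x + i) = \<eta> x" using l unfolding long_runs_def by blast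
  qed
qed

lemma long_runs_le: "long_runs k \<eta> \<Longrightarrow> extractable \<eta> m p \<Longrightarrow> k \<le> m"
proof (rule ccontr)
  assume "long_runs k \<eta>" "extractable \<eta> m p" "\<not> k \<le> m"
  then have "run_start \<eta> p" "0 \<le> int m \<and> int m < int k" unfolding extractable_def by auto
  with \<open>long_runs k \<eta>\<close> have "\<eta> (p + int m) = \<eta> p" unfolding long_runs_def by blast
  then show False using \<open>extractable \<eta> m p\<close> unfolding extractable_def by blast
qed

lemma long_runs_iff: "extractable \<eta> m p \<Longrightarrow> long_runs k \<eta> \<longleftrightarrow> k \<le> m"
proof -
  assume ex: "extractable \<eta> m p"
  then have "long_runs m \<eta>" unfolding extractable_def by blast
  then show "long_runs k \<eta> \<longleftrightarrow> k \<le> m" using long_runs_le[OF _ ex] long_runs_mono by blast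
qed

text \<open>The last box of the block has the value of the box in front of it. Hence a run that
  starts right behind the cut already started there before the removal, and no run that ended in
  front of the block is shortened.\<close>

lemma long_runs_cut:
  assumes ex: "extractable \<eta> k p"
  shows "long_runs k (\<eta> \<circ> skip k p)"
  unfolding long_runs_def
proof (intro allI impI)
  fix x i assume st: "run_start (\<eta> \<circ> skip k p) x" and i: "0 \<le> i \<and> i < int k"
  note k = extract_pos[OF ex]
  have "long_runs k \<eta>" using ex by (simp add: extractable_def)
  then have long: "\<And>x. run_start \<eta> x \<Longrightarrow> \<eta> (x + i) = \<eta> x" using i unfolding long_runs_def by blast
  show "(\<eta> \<circ> skip k p) (x + i) = (\<eta> \<circ> skip k p) x"
  proof (cases "x < p")
    case True
    then have sx: "run_start \<eta> x" using st by (simp add: run_start_def skip_def)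
    have "x + i < p"
    proof (rule ccontr)
      assume n: "\<not> x + i < p"
      have "\<eta> p = \<eta> x" using extract_long[OF ex True sx, of "p - x"] True n i by simp
      moreover have "\<eta> (p - 1) = \<eta> x" using extract_long[OF ex True sx, of "p - 1 - x"] True n i by simp
      ultimately show False using ex by (simp add: extractable_def run_start_def)
    qed
    then show ?thesis using long[OF sx] True by (simp add: skip_def)
  next
    case False
    have "run_start \<eta> (x + 2 * int k)"
    proof (cases "x = p")
      case True
      have "\<eta> (p + 2 * int k - 1) = (\<not> \<eta> p)" using extract_second[OF ex, of "int k - 1"] k by (simp add: algebra_simps)
      moreover have "\<eta> (p - 1) = (\<not> \<eta> p)" using extract_before[OF ex, of 0] k by simp
      ultimately show ?thesis using st True by (auto simp: run_start_def skip_def)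
    next
      case f: False
      then have "skip k p (x - 1) = x + 2 * int k - 1" "skip k p x = x + 2 * int k"
        using False by (auto simp: skip_def)
      then show ?thesis using st by (simp add: run_start_def)
    qed
    from long[OF this] show ?thesis using False i by (simp add: skip_def algebra_simps)
  qed
qed

text \<open>No run of length \<open>k\<close> starts before \<open>q\<close> (for configurations with \<^term>\<open>long_runs k\<close>).\<close>

definition clean :: "nat \<Rightarrow> int \<Rightarrow> config \<Rightarrow> bool" where
  "clean k q \<eta> \<longleftrightarrow> (\<forall>x<q. run_start \<eta> x \<longrightarrow> \<eta> (x + int k) = \<eta> x)"

text \<open>A run starting in front of p is longer than k and stops short of p, since otherwise it
  would contain both p - 1 and p. So the removal does not touch it, and the next removal of the same
  size happens at p or further right (\<open>clean_le\<close>): the k-solitons come off from left to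
  right.\<close>

lemma clean_cut:
  assumes ex: "extractable \<eta> k p" and q: "q \<le> p"
  shows "clean k q (\<eta> \<circ> skip k p)"
  unfolding clean_def
proof (intro allI impI)
  fix x assume x: "x < q" and st: "run_start (\<eta> \<circ> skip k p) x"
  have xp: "x < p" using x q by simp
  have sx: "run_start \<eta> x" using st xp by (simp add: run_start_def skip_def)
  have "x + int k < p"
  proof (rule ccontr)
    assume n: "\<not> x + int k < p"
    have "\<eta> p = \<eta> x" using extract_long[OF ex xp sx, of "p - x"] xp n by simp
    moreover have "\<eta> (p - 1) = \<eta> x" using extract_long[OF ex xp sx, of "p - 1 - x"] xp n by simp
    ultimately show False using ex by (simp add: extractable_def run_start_def)
  qed
  then show "(\<eta> \<circ> skip k p) (x + int k) = (\<eta> \<circ> skip k p) x"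
    using extract_long[OF ex xp sx, of "int k"] xp by (simp add: skip_def)
qed

lemma clean_le: "clean k q \<eta> \<Longrightarrow> extractable \<eta> k p \<Longrightarrow> q \<le> p"
proof (rule ccontr)
  assume a: "clean k q \<eta>" "extractable \<eta> k p" "\<not> q \<le> p"
  have "run_start \<eta> p" "\<eta> (p + int k) \<noteq> \<eta> p" using a(2) unfolding extractable_def by blast+
  moreover have "p < q" using a(3) by simp
  ultimately show False using a(1) unfolding clean_def by blast
qed

section \<open>Solitons and slots of an excursion\<close>

lemma block_soliton_eq:
  assumes ex: "extractable \<eta> k p"
  shows "block_soliton \<eta> k p = (if \<eta> p then ({p..<p + int k}, {p + int k..<p + 2 * int k})
    else ({p + int k..<p + 2 * int k}, {p..<p + int k}))"
proof -
  have 1: "\<eta> z = \<eta> p" if "z \<in> {p..<p + int k}" for z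
    using extract_first[OF ex, of "z - p"] that by auto
  have 2: "\<eta> z = (\<not> \<eta> p)" if "z \<in> {p + int k..<p + 2 * int k}" for z
    using extract_second[OF ex, of "z - (p + int k)"] that by auto
  have 3: "{p..<p + 2 * int k} = {p..<p + int k} \<union> {p + int k..<p + 2 * int k}" by auto
  have F: "{z \<in> {p..<p + 2 * int k}. Q z} = (if b then {p..<p + int k} else {p + int k..<p + 2 * int k})"
    if "\<And>z. z \<in> {p..<p + int k} \<Longrightarrow> Q z = b" "\<And>z. z \<in> {p + int k..<p + 2 * int k} \<Longrightarrow> Q z = (\<not> b)" for Q b
    unfolding 3 using that by (cases b) (auto simp: set_eq_iff)
  show ?thesis
    unfolding block_soliton_def using F[of \<eta> "\<eta> p"] F[of "\<lambda>z. \<not> \<eta> z" "\<not> \<eta> p"] 1 2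
    by (cases "\<eta> p") simp_all
qed

definition wf_soliton :: "int \<Rightarrow> soliton \<Rightarrow> bool" where
  "wf_soliton M \<gamma> \<longleftrightarrow> 0 < soliton_size \<gamma> \<and> card (snd \<gamma>) = soliton_size \<gamma> \<and> support \<gamma> \<subseteq> {1..M}"

lemma wf_soliton_finite:
  assumes "wf_soliton M \<gamma>"
  shows "finite (fst \<gamma>)" "finite (snd \<gamma>)" "support \<gamma> \<noteq> {}"
proof -
  have "fst \<gamma> \<subseteq> {1..M}" "snd \<gamma> \<subseteq> {1..M}" "fst \<gamma> \<noteq> {}"
    using assms by (auto simp: wf_soliton_def support_def soliton_size_def)
  then show "finite (fst \<gamma>)" "finite (snd \<gamma>)" "support \<gamma> \<noteq> {}"
    using finite_subset by (auto simp: support_def)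
qed

lemma inj_image_soliton: "inj (image_soliton (skip k p))"
  by (rule injI) (simp add: image_soliton_def prod_eq_iff inj_image_eq_iff strict_mono_imp_inj_on[OF strict_mono_skip])

lemma soliton_size_image [simp]: "soliton_size (image_soliton (skip k p) \<gamma>) = soliton_size \<gamma>"
  unfolding soliton_size_def image_soliton_def fst_conv
  by (rule card_image) (use strict_mono_imp_inj_on[OF strict_mono_skip] inj_on_subset in blast)

lemma soliton_size_block: "extractable \<eta> k p \<Longrightarrow> soliton_size (block_soliton \<eta> k p) = k"
  by (simp add: block_soliton_eq soliton_size_def)

lemma skip_range_le:
  assumes "1 \<le> p" "p + 2 * int k - 1 \<le> M"
  shows "skip k p z \<in> {1..M} \<longleftrightarrow> z \<in> {1..M - 2 * int k}" "skip k p z \<in> {0..M} \<longleftrightarrow> z \<in> {0..M - 2 * int k}"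
    "skip k p 0 = 0" "skip k p (M - 2 * int k + 1) = M + 1"
  using assms by (auto simp: skip_def)

lemma all_solitons_wf:
  assumes "dyck M \<eta>"
  shows "finite (all_solitons \<eta>) \<and> (\<forall>\<gamma>\<in>all_solitons \<eta>. wf_soliton M \<gamma>)"
  using assms
proof (induction rule: dyck_induct)
  case (cut M \<eta> k p)
  have "wf_soliton M (block_soliton \<eta> k p)"
    unfolding wf_soliton_def support_block_soliton soliton_size_block[OF cut(2)]
    using cut extract_pos[OF cut(2)] by (auto simp: block_soliton_eq)
  moreover have "wf_soliton M (image_soliton (skip k p) \<gamma>)" if "wf_soliton (M - 2 * int k) \<gamma>" for \<gamma>
  proof -
    have "card (snd (image_soliton (skip k p) \<gamma>)) = card (snd \<gamma>)"
      unfolding image_soliton_def snd_conv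
      by (rule card_image) (use strict_mono_imp_inj_on[OF strict_mono_skip] inj_on_subset in blast)
    moreover have "support (image_soliton (skip k p) \<gamma>) \<subseteq> {1..M}"
      unfolding support_image_soliton using that skip_range_le(1)[OF cut(4,5)]
      unfolding wf_soliton_def by blast
    ultimately show ?thesis using that by (simp add: wf_soliton_def)
  qed
  ultimately show ?case unfolding all_solitons_cut[OF cut(2)] using cut(6) by (auto simp del: o_apply)
qed (simp add: all_solitons_empty)

lemma block_not_image: "extractable \<eta> k p \<Longrightarrow> block_soliton \<eta> k p \<notin> image_soliton (skip k p) ` A"
proof
  assume ex: "extractable \<eta> k p" and "block_soliton \<eta> k p \<in> image_soliton (skip k p) ` A"
  then obtain \<gamma> where "support (block_soliton \<eta> k p) = skip k p ` support \<gamma>"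
    by (auto simp: support_image_soliton)
  moreover have "p \<in> support (block_soliton \<eta> k p)" "p \<notin> range (skip k p)"
    using extract_pos[OF ex] by (auto simp: support_block_soliton range_skip)
  ultimately show False by auto
qed

lemma soliton_size_ge:
  assumes "dyck M \<eta>"
  shows "long_runs k \<eta> \<longrightarrow> (\<forall>\<gamma>\<in>all_solitons \<eta>. k \<le> soliton_size \<gamma>)"
  using assms
proof (induction rule: dyck_induct)
  case (cut M \<eta> m p)
  show ?case
  proof
    assume "long_runs k \<eta>"
    then have "k \<le> m" using long_runs_iff[OF cut(2)] by simp
    moreover have "long_runs k (\<eta> \<circ> skip m p)" using long_runs_cut[OF cut(2)] long_runs_mono calculation by blast
    ultimately show "\<forall>\<gamma>\<in>all_solitons \<eta>. k \<le> soliton_size \<gamma>"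
      unfolding all_solitons_cut[OF cut(2)] using cut(6) soliton_size_block[OF cut(2)]
      by (auto simp del: o_apply)
  qed
qed (simp add: all_solitons_empty)

section \<open>Peaks under a removal\<close>

definition num_peaks :: "config \<Rightarrow> nat" where
  "num_peaks \<eta> = card {x. run_start \<eta> x \<and> \<eta> x}"

lemma dyck_peaks_finite: "dyck M \<eta> \<Longrightarrow> finite {x. run_start \<eta> x \<and> \<eta> x}"
  by (rule finite_subset[of _ "{1..M}"]) (auto simp: dyck_def)

text \<open>Exactly one run of balls starts inside the block, at p or in the middle of the block.
  All other starts survive, because the last box of the block repeats the box in front of
  it.\<close>

lemma num_peaks_cut:
  assumes ex: "extractable \<eta> k p" and d: "dyck M \<eta>"
  shows "num_peaks \<eta> = Suc (num_peaks (\<eta> \<circ> skip k p))"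
proof -
  note k = extract_pos[OF ex]
  let ?S = "\<lambda>\<eta>. {x. run_start \<eta> x \<and> \<eta> x}" and ?\<zeta> = "\<eta> \<circ> skip k p" and ?b = "if \<eta> p then p else p + int k"
  have before: "\<eta> (p - 1) = (\<not> \<eta> p)" using extract_before[OF ex, of 0] k by simp
  have last: "\<eta> (p + 2 * int k - 1) = (\<not> \<eta> p)" using extract_second[OF ex, of "int k - 1"] k by (simp add: algebra_simps)
  have st: "run_start \<eta> (skip k p x) \<longleftrightarrow> run_start ?\<zeta> x" for x
  proof (cases "x = p")
    case True
    then show ?thesis using before last by (simp add: run_start_def skip_def)
  next
    case False
    then have "skip k p (x - 1) = skip k p x - 1" by (simp add: skip_def)
    then show ?thesis by (simp add: run_start_def)
  qed
  have blk: "run_start \<eta> z \<and> \<eta> z \<longleftrightarrow> z = ?b" if z: "z \<in> {p..<p + 2 * int k}" for z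
  proof -
    have 1: "\<eta> y = \<eta> p" if "y \<in> {p..<p + int k}" for y using extract_first[OF ex, of "y - p"] that by auto
    have 2: "\<eta> y = (\<not> \<eta> p)" if "y \<in> {p + int k..<p + 2 * int k}" for y
      using extract_second[OF ex, of "y - (p + int k)"] that by auto
    consider "z = p" | "z \<in> {p<..<p + int k}" | "z = p + int k" | "z \<in> {p + int k<..<p + 2 * int k}" using z by force
    then show ?thesis
      using 1[of z] 1[of "z - 1"] 2[of z] 2[of "z - 1"] before k by cases (auto simp: run_start_def)
  qed
  have eqS: "?S \<eta> = insert ?b (skip k p ` ?S ?\<zeta>)"
  proof (intro equalityI subsetI)
    fix z assume z: "z \<in> ?S \<eta>"
    show "z \<in> insert ?b (skip k p ` ?S ?\<zeta>)"
    proof (cases "z \<in> {p..<p + 2 * int k}")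
      case True
      then show ?thesis using blk z by blast
    next
      case False
      then obtain x where x: "z = skip k p x" using range_skip[of k p] by blast
      then show ?thesis using z st by auto
    qed
  next
    fix z assume "z \<in> insert ?b (skip k p ` ?S ?\<zeta>)"
    moreover have "?b \<in> {p..<p + 2 * int k}" using k by auto
    ultimately show "z \<in> ?S \<eta>" using blk[of ?b] st by auto
  qed
  have "?b \<notin> range (skip k p)" unfolding range_skip using k by auto
  then have nb: "?b \<notin> skip k p ` ?S ?\<zeta>" by blast
  have fin: "finite (skip k p ` ?S ?\<zeta>)" using dyck_peaks_finite[OF dyck_cut(3)[OF ex d]] by (rule finite_imageI)
  have "card (skip k p ` ?S ?\<zeta>) = card (?S ?\<zeta>)"
    by (rule card_image) (use strict_mono_imp_inj_on[OF strict_mono_skip] inj_on_subset in blast)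
  then show ?thesis unfolding num_peaks_def eqS card_insert_disjoint[OF fin nb] by (rule arg_cong)
qed

lemma num_peaks_empty: "num_peaks (\<lambda>_. False) = 0"
  by (simp add: num_peaks_def)

text \<open>Boxes at distance at least k from the start of their run. This is the local form of the
  k-slots when all solitons are larger than k: the boxes of index i in a head or a tail count from i
  = k on. Box 0 qualifies because everything to its left is empty.\<close>

definition slot_set :: "nat \<Rightarrow> config \<Rightarrow> int set" where
  "slot_set k \<eta> = {z. \<forall>i. 0 \<le> i \<and> i \<le> int k \<longrightarrow> \<eta> (z - i) = \<eta> z}"

text \<open>Looking back k boxes from a place behind the cut meets the second half of the block
  before the removal, and the boxes in front of the block after it. Both have the value opposite to
  box p, so the test has the same outcome.\<close>

lemma slot_set_skip:
  assumes ex: "extractable \<eta> m p" and km: "k \<le> m"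
  shows "z \<in> slot_set k (\<eta> \<circ> skip m p) \<Longrightarrow> skip m p z \<in> slot_set k \<eta>"
    and "k < m \<Longrightarrow> skip m p z \<in> slot_set k \<eta> \<Longrightarrow> z \<in> slot_set k (\<eta> \<circ> skip m p)"
proof -
  let ?\<zeta> = "\<eta> \<circ> skip m p"
  have before: "\<eta> y = (\<not> \<eta> p)" if "p - 1 - int m \<le> y" "y < p" for y
    using extract_before[OF ex, of "p - 1 - y"] that by simp
  have second: "\<eta> y = (\<not> \<eta> p)" if "p + int m \<le> y" "y < p + 2 * int m" for y
    using extract_second[OF ex, of "y - (p + int m)"] that by simp
  {
    assume z: "z \<in> slot_set k ?\<zeta>"
    then have zD: "\<And>i. 0 \<le> i \<Longrightarrow> i \<le> int k \<Longrightarrow> ?\<zeta> (z - i) = ?\<zeta> z" unfolding slot_set_def by blast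
    show "skip m p z \<in> slot_set k \<eta>"
      unfolding slot_set_def
    proof (intro CollectI allI impI)
      fix i assume i: "0 \<le> i \<and> i \<le> int k"
      show "\<eta> (skip m p z - i) = \<eta> (skip m p z)"
      proof (cases "z < p \<or> p \<le> z - i")
        case True
        then show ?thesis using zD[of i] i by (auto simp: skip_def algebra_simps)
      next
        case False
        then have "?\<zeta> (p - 1) = ?\<zeta> z" using zD[of "z - (p - 1)"] i by simp
        then have "\<eta> (skip m p z) = (\<not> \<eta> p)" using before[of "p - 1"] by (simp add: skip_def)
        moreover have "\<eta> (skip m p z - i) = (\<not> \<eta> p)" using False i km by (intro second) (auto simp: skip_def)
        ultimately show ?thesis by simp
      qed
    qed
  }
  assume km: "k < m" and z: "skip m p z \<in> slot_set k \<eta>"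
  then have zD: "\<And>i. 0 \<le> i \<Longrightarrow> i \<le> int k \<Longrightarrow> \<eta> (skip m p z - i) = \<eta> (skip m p z)" unfolding slot_set_def by blast
  show "z \<in> slot_set k ?\<zeta>"
    unfolding slot_set_def
  proof (intro CollectI allI impI)
    fix i assume i: "0 \<le> i \<and> i \<le> int k"
    show "?\<zeta> (z - i) = ?\<zeta> z"
    proof (cases "z < p \<or> p \<le> z - i")
      case True
      then show ?thesis using zD[of i] i by (auto simp: skip_def algebra_simps)
    next
      case False
      then have "\<eta> (p + 2 * int m - 1) = \<eta> (skip m p z)" using zD[of "z - (p - 1)"] i by (simp add: skip_def algebra_simps)
      then have "?\<zeta> z = (\<not> \<eta> p)" using second[of "p + 2 * int m - 1"] km by simp
      moreover have "?\<zeta> (z - i) = (\<not> \<eta> p)" using False i km before[of "z - i"] by (simp add: skip_def)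
      ultimately show ?thesis by simp
    qed
  qed
qed

lemma slot_set_block:
  assumes ex: "extractable \<eta> m p" and km: "k < m" and z: "z \<in> {p..<p + 2 * int m}"
  shows "z \<in> slot_set k \<eta> \<longleftrightarrow> z \<in> {p + int k..<p + int m} \<union> {p + int m + int k..<p + 2 * int m}"
proof -
  have before: "\<eta> (p - 1) = (\<not> \<eta> p)" using extract_before[OF ex, of 0] by simp
  have first: "\<eta> y = \<eta> p" if "p \<le> y" "y < p + int m" for y
    using extract_first[OF ex, of "y - p"] that by simp
  have second: "\<eta> y = (\<not> \<eta> p)" if "p + int m \<le> y" "y < p + 2 * int m" for y
    using extract_second[OF ex, of "y - (p + int m)"] that by simp
  consider "z < p + int k" | "z \<in> {p + int k..<p + int m}" | "z \<in> {p + int m..<p + int m + int k}"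
    | "z \<in> {p + int m + int k..<p + 2 * int m}"
    using z unfolding atLeastLessThan_iff by linarith
  then show ?thesis
  proof cases
    case 1
    then have "z \<notin> slot_set k \<eta>"
      using before first[of z] z km unfolding slot_set_def
      by (auto intro!: exI[of _ "z - (p - 1)"])
    then show ?thesis using 1 by auto
  next
    case 2
    have "z \<in> slot_set k \<eta>" unfolding slot_set_def using 2 first[of z] first[of "z - i" for i] by auto
    then show ?thesis using 2 by simp
  next
    case 3
    then have "z \<notin> slot_set k \<eta>"
      using first[of "p + (int m - 1)"] second[of z] z km unfolding slot_set_def
      by (auto intro!: exI[of _ "z - (p + int m - 1)"])
    then show ?thesis using 3 km by auto
  next
    case 4
    have "z \<in> slot_set k \<eta>" unfolding slot_set_def using 4 second[of z] second[of "z - i" for i] by auto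
    then show ?thesis using 4 by simp
  qed
qed

lemma sorted_list_of_set_image:
  fixes f :: "'a::linorder \<Rightarrow> 'b::linorder"
  assumes f: "strict_mono f" and fin: "finite A"
  shows "sorted_list_of_set (f ` A) = map f (sorted_list_of_set A)"
proof (rule sorted_distinct_set_unique)
  have "inj f" using f by (rule strict_mono_imp_inj_on)
  then show "distinct (map f (sorted_list_of_set A))"
    by (auto simp: distinct_map intro: inj_on_subset)
  show "sorted (map f (sorted_list_of_set A))"
    using f by (simp add: sorted_map sorted_wrt_mono_rel[of _ "(\<le>)"] strict_mono_less_eq)
qed (use fin in auto)

lemma sorted_list_of_set_interval: "i < n \<Longrightarrow> sorted_list_of_set {a..<a + int n} ! i = a + int i"
proof -
  assume i: "i < n"
  have f: "strict_mono (\<lambda>j::nat. a + int j)" by (simp add: strict_mono_def)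
  have "{a..<a + int n} = (\<lambda>j. a + int j) ` {0..<n}"
  proof (intro equalityI subsetI)
    fix x assume "x \<in> {a..<a + int n}"
    then show "x \<in> (\<lambda>j. a + int j) ` {0..<n}" by (intro image_eqI[of _ _ "nat (x - a)"]) auto
  qed auto
  then show ?thesis using i sorted_list_of_set_image[OF f, of "{0..<n}"] by simp
qed

definition config_slots :: "nat \<Rightarrow> config \<Rightarrow> int set" where
  "config_slots k \<eta> = insert 0 {z. \<exists>m i \<gamma>. k < m \<and> \<gamma> \<in> all_solitons \<eta> \<and> soliton_size \<gamma> = m \<and> k \<le> i \<and> i < m \<and>
     z \<in> {head_box \<gamma> i, tail_box \<gamma> i}}"

lemma exc_solitons_ball_config: "exc_solitons k \<epsilon> = {\<gamma> \<in> all_solitons (ball_config \<epsilon>). soliton_size \<gamma> = k}"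
  by (auto simp: exc_solitons_def all_solitons_def)

lemma exc_slots_ball_config: "exc_slots k \<epsilon> = config_slots k (ball_config \<epsilon>)"
  by (auto simp: exc_slots_def config_slots_def exc_solitons_ball_config)

text \<open>\<open>skip\<close> is increasing, so it commutes with sorting and carries the i-th head
  and tail boxes of a soliton to those of its image. The removed block adds slots only if its size
  exceeds k.\<close>

lemma config_slots_cut:
  assumes ex: "extractable \<eta> m p" and d: "dyck M \<eta>"
  shows "config_slots k \<eta> = skip m p ` config_slots k (\<eta> \<circ> skip m p) \<union>
    (if k < m then {p + int k..<p + int m} \<union> {p + int m + int k..<p + 2 * int m} else {})"
proof -
  let ?B = "\<lambda>\<gamma>. {z. \<exists>i. k \<le> i \<and> i < soliton_size \<gamma> \<and> z \<in> {head_box \<gamma> i, tail_box \<gamma> i}}"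
  have eq: "config_slots k \<eta> = insert 0 (\<Union>\<gamma>\<in>all_solitons \<eta>. ?B \<gamma>)" for \<eta>
    unfolding config_slots_def by (rule arg_cong[of _ _ "insert 0"]) (use le_less_trans in blast)
  note c = dyck_cut[OF ex d]
  have img: "?B (image_soliton (skip m p) \<gamma>) = skip m p ` ?B \<gamma>" if \<gamma>: "\<gamma> \<in> all_solitons (\<eta> \<circ> skip m p)" for \<gamma>
  proof -
    have w: "wf_soliton (M - 2 * int m) \<gamma>" using all_solitons_wf[OF c(3)] \<gamma> by blast
    note fin = wf_soliton_finite[OF w]
    have h: "head_box (image_soliton (skip m p) \<gamma>) i = skip m p (head_box \<gamma> i)"
      "tail_box (image_soliton (skip m p) \<gamma>) i = skip m p (tail_box \<gamma> i)" if "i < soliton_size \<gamma>" for i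
      using that w fin
      by (simp_all add: head_box_def tail_box_def image_soliton_def sorted_list_of_set_image[OF strict_mono_skip]
          wf_soliton_def soliton_size_def)
    show ?thesis
    proof (intro equalityI subsetI)
      fix z assume "z \<in> ?B (image_soliton (skip m p) \<gamma>)"
      then obtain i where "k \<le> i" "i < soliton_size \<gamma>" "z = skip m p (head_box \<gamma> i) \<or> z = skip m p (tail_box \<gamma> i)"
        using h by auto
      then show "z \<in> skip m p ` ?B \<gamma>" by blast
    next
      fix z assume "z \<in> skip m p ` ?B \<gamma>"
      then show "z \<in> ?B (image_soliton (skip m p) \<gamma>)" using h by auto
    qed
  qed
  have blk: "?B (block_soliton \<eta> m p) =
    (if k < m then {p + int k..<p + int m} \<union> {p + int m + int k..<p + 2 * int m} else {})"
  proof -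
    have "sorted_list_of_set {p + int m..<p + 2 * int m} ! i = p + int m + int i" if "i < m" for i
      unfolding mult_2 add.assoc[symmetric] using that by (rule sorted_list_of_set_interval)
    then have "{head_box (block_soliton \<eta> m p) i, tail_box (block_soliton \<eta> m p) i} = {p + int i, p + int m + int i}"
      if "i < m" for i
      using that by (auto simp: head_box_def tail_box_def block_soliton_eq[OF ex] sorted_list_of_set_interval)
    then have "?B (block_soliton \<eta> m p) = {z. \<exists>i. k \<le> i \<and> i < m \<and> z \<in> {p + int i, p + int m + int i}}"
      unfolding soliton_size_block[OF ex] by blast
    also have "\<dots> = (if k < m then {p + int k..<p + int m} \<union> {p + int m + int k..<p + 2 * int m} else {})" (is "?L = ?R")
    proof (intro equalityI subsetI)
      fix z assume "z \<in> ?R"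
      then have km: "k < m" and z: "z \<in> {p + int k..<p + int m} \<or> z \<in> {p + int m + int k..<p + 2 * int m}"
        by (auto split: if_splits)
      from z show "z \<in> ?L"
      proof
        assume "z \<in> {p + int k..<p + int m}"
        then show ?thesis by (intro CollectI exI[of _ "nat (z - p)"]) auto
      next
        assume "z \<in> {p + int m + int k..<p + 2 * int m}"
        then show ?thesis by (intro CollectI exI[of _ "nat (z - p - int m)"]) auto
      qed
    qed auto
    finally show ?thesis .
  qed
  have "skip m p 0 = 0" using c by (simp add: skip_def)
  then show ?thesis
    unfolding eq all_solitons_cut[OF ex] UN_insert blk image_insert image_UN UN_simps using img by auto
qed

lemma config_slots_bounds:
  assumes "dyck M \<eta>"
  shows "config_slots k \<eta> \<subseteq> {0..M} \<and> 0 \<in> config_slots k \<eta>"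
  using assms
proof (induction rule: dyck_induct)
  case (cut M \<eta> m p)
  have "skip m p ` config_slots k (\<eta> \<circ> skip m p) \<subseteq> {0..M}"
    using cut(6) skip_range_le(2)[OF cut(4,5)] by blast
  moreover have "{p + int k..<p + int m} \<union> {p + int m + int k..<p + 2 * int m} \<subseteq> {0..M}"
    using cut(4,5) by auto
  ultimately show ?case unfolding config_slots_cut[OF cut(2,1)]
    using cut(6) skip_range_le(3)[OF cut(4,5)] by (auto simp del: o_apply)
qed (simp add: config_slots_def all_solitons_empty)

lemma config_slots_finite: "dyck M \<eta> \<Longrightarrow> finite (config_slots k \<eta>)"
  by (rule finite_subset[OF config_slots_bounds[THEN conjunct1]]) simp_all

lemma config_slots_long_runs:
  assumes "dyck M \<eta>"
  shows "long_runs (Suc k) \<eta> \<longrightarrow> config_slots k \<eta> = slot_set k \<eta> \<inter> {0..M}"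
  using assms
proof (induction rule: dyck_induct)
  case empty
  then show ?case by (auto simp: config_slots_def all_solitons_empty slot_set_def)
next
  case (cut M \<eta> m p)
  show ?case
  proof
    assume "long_runs (Suc k) \<eta>"
    then have km: "k < m" using long_runs_iff[OF cut(2)] by simp
    let ?\<zeta> = "\<eta> \<circ> skip m p"
    have "long_runs (Suc k) ?\<zeta>" using long_runs_cut[OF cut(2)] long_runs_mono km Suc_leI by blast
    then have IH: "config_slots k ?\<zeta> = slot_set k ?\<zeta> \<inter> {0..M - 2 * int m}" using cut(6) by blast
    show "config_slots k \<eta> = slot_set k \<eta> \<inter> {0..M}"
    proof (intro equalityI subsetI)
      fix z assume "z \<in> config_slots k \<eta>"
      then consider z' where "z' \<in> config_slots k ?\<zeta>" "z = skip m p z'"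
        | "z \<in> {p + int k..<p + int m} \<union> {p + int m + int k..<p + 2 * int m}"
        using km unfolding config_slots_cut[OF cut(2,1)] by auto
      then show "z \<in> slot_set k \<eta> \<inter> {0..M}"
      proof cases
        case 1
        then show ?thesis using IH slot_set_skip(1)[OF cut(2), of k z'] km skip_range_le(2)[OF cut(4,5), of z'] by auto
      next
        case 2
        then have "z \<in> {p..<p + 2 * int m}" by auto
        then show ?thesis using 2 slot_set_block[OF cut(2) km] cut(4,5) by auto
      qed
    next
      fix z assume z: "z \<in> slot_set k \<eta> \<inter> {0..M}"
      show "z \<in> config_slots k \<eta>"
      proof (cases "z \<in> {p..<p + 2 * int m}")
        case True
        then show ?thesis using z slot_set_block[OF cut(2) km] km unfolding config_slots_cut[OF cut(2,1)] by auto
      next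
        case False
        then obtain z' where z': "z = skip m p z'" using range_skip[of m p] by blast
        then have "z' \<in> config_slots k ?\<zeta>"
          using IH z slot_set_skip(2)[OF cut(2), of k z'] km skip_range_le(2)[OF cut(4,5), of z'] by auto
        then show ?thesis unfolding config_slots_cut[OF cut(2,1)] z' by blast
      qed
    qed
  qed
qed

lemma card_config_slots_cut:
  assumes ex: "extractable \<eta> m p" and d: "dyck M \<eta>"
  shows "card (config_slots k \<eta>) = card (config_slots k (\<eta> \<circ> skip m p)) + 2 * (m - k)"
proof -
  let ?A = "skip m p ` config_slots k (\<eta> \<circ> skip m p)"
  have cA: "card ?A = card (config_slots k (\<eta> \<circ> skip m p))"
    by (rule card_image) (use strict_mono_imp_inj_on[OF strict_mono_skip] inj_on_subset in blast)
  have fA: "finite ?A" using config_slots_finite[OF dyck_cut(3)[OF ex d]] by simp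
  show ?thesis
  proof (cases "k < m")
    case True
    let ?B = "{p + int k..<p + int m}" and ?C = "{p + int m + int k..<p + 2 * int m}"
    have BC: "?B \<union> ?C \<subseteq> {p..<p + 2 * int m}" "?B \<inter> ?C = {}" using True by auto
    have "?A \<inter> {p..<p + 2 * int m} = {}" using range_skip[of m p] by blast
    then have "?A \<inter> (?B \<union> ?C) = {}" using BC by blast
    then have "card (?A \<union> (?B \<union> ?C)) = card ?A + (card ?B + card ?C)"
      using BC(2) fA by (subst card_Un_disjoint) (auto simp: card_Un_disjoint)
    then show ?thesis unfolding config_slots_cut[OF ex d] cA using True by simp
  next
    case False
    then show ?thesis unfolding config_slots_cut[OF ex d] using cA by simp
  qed
qed

lemma config_slots_empty: "config_slots k (\<lambda>_. False) = {0}"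
  by (simp add: config_slots_def all_solitons_empty)

text \<open>A soliton of size m contributes 2 (m - k) slots. Over all solitons the terms 2m add up
  to M, the number of solitons is the number of peaks, and box 0 gives the summand 1.\<close>

lemma card_config_slots:
  assumes "dyck M \<eta>"
  shows "long_runs (Suc k) \<eta> \<longrightarrow> int (card (config_slots k \<eta>)) = 1 + M - 2 * int k * int (num_peaks \<eta>)"
  using assms
proof (induction rule: dyck_induct)
  case empty
  then show ?case by (simp add: config_slots_empty num_peaks_empty)
next
  case (cut M \<eta> m p)
  show ?case
  proof
    assume "long_runs (Suc k) \<eta>"
    then have km: "k < m" using long_runs_iff[OF cut(2)] by simp
    then have "long_runs (Suc k) (\<eta> \<circ> skip m p)"
      using long_runs_cut[OF cut(2)] long_runs_mono Suc_leI by blast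
    with cut(6) have "int (card (config_slots k (\<eta> \<circ> skip m p))) = 1 + (M - 2 * int m) - 2 * int k * int (num_peaks (\<eta> \<circ> skip m p))"
      by blast
    then show "int (card (config_slots k \<eta>)) = 1 + M - 2 * int k * int (num_peaks \<eta>)"
      unfolding card_config_slots_cut[OF cut(2,1)] num_peaks_cut[OF cut(2,1)] using km
      by (simp add: of_nat_diff algebra_simps del: o_apply)
  qed
qed

section \<open>Components of an excursion\<close>

definition slot_list :: "nat \<Rightarrow> config \<Rightarrow> int list" where
  "slot_list k \<eta> = sorted_list_of_set (config_slots k \<eta>)"

text \<open>The entry M + 1 closes the interval behind the last slot. In a configuration this box is
  the next record, which is slot 0 of the following excursion.\<close>

definition slot_ends :: "nat \<Rightarrow> int \<Rightarrow> config \<Rightarrow> int list" where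
  "slot_ends k M \<eta> = slot_list k \<eta> @ [M + 1]"

definition comp_list :: "nat \<Rightarrow> int \<Rightarrow> config \<Rightarrow> nat list" where
  "comp_list k M \<eta> = map (\<lambda>j. card {\<gamma>\<in>all_solitons \<eta>. soliton_size \<gamma> = k \<and>
     support \<gamma> \<subseteq> {slot_ends k M \<eta> ! j<..<slot_ends k M \<eta> ! Suc j}}) [0..<length (slot_list k \<eta>)]"

lemma length_slot_list: "length (slot_list k \<eta>) = card (config_slots k \<eta>)"
  by (simp add: slot_list_def)

lemma length_comp_list [simp]: "length (comp_list k M \<eta>) = card (config_slots k \<eta>)"
  by (simp add: comp_list_def length_slot_list)

lemma slot_list_nth_in: "dyck M \<eta> \<Longrightarrow> j < card (config_slots k \<eta>) \<Longrightarrow> slot_list k \<eta> ! j \<in> config_slots k \<eta>"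
  using config_slots_finite[of M \<eta> k] nth_mem[of j "slot_list k \<eta>"]
  by (simp add: slot_list_def)

lemma slot_ends_strict:
  assumes "dyck M \<eta>"
  shows "sorted_wrt (<) (slot_ends k M \<eta>)"
proof -
  have "set (slot_list k \<eta>) \<subseteq> {0..M}"
    using config_slots_bounds[OF assms] config_slots_finite[OF assms] by (simp add: slot_list_def)
  then show ?thesis
    by (auto simp: slot_ends_def sorted_wrt_append slot_list_def)
qed

lemma slot_ends_less:
  assumes "dyck M \<eta>" "i < j" "j \<le> card (config_slots k \<eta>)"
  shows "slot_ends k M \<eta> ! i < slot_ends k M \<eta> ! j"
  using sorted_wrt_nth_less[OF slot_ends_strict[OF assms(1)] assms(2)] assms(3)
  by (simp add: slot_ends_def length_slot_list)

lemma slot_ends_nth: "j < card (config_slots k \<eta>) \<Longrightarrow> slot_ends k M \<eta> ! j = slot_list k \<eta> ! j"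
  by (simp add: slot_ends_def nth_append length_slot_list)

lemma slot_ends_cut:
  assumes ex: "extractable \<eta> m p" and d: "dyck M \<eta>" and mk: "m \<le> k"
  shows "slot_list k \<eta> = map (skip m p) (slot_list k (\<eta> \<circ> skip m p))"
    "slot_ends k M \<eta> = map (skip m p) (slot_ends k (M - 2 * int m) (\<eta> \<circ> skip m p))"
proof -
  note c = dyck_cut[OF ex d]
  show 1: "slot_list k \<eta> = map (skip m p) (slot_list k (\<eta> \<circ> skip m p))"
    unfolding slot_list_def config_slots_cut[OF ex d]
    using mk sorted_list_of_set_image[OF strict_mono_skip config_slots_finite[OF c(3)]] by simp
  show "slot_ends k M \<eta> = map (skip m p) (slot_ends k (M - 2 * int m) (\<eta> \<circ> skip m p))"
    unfolding slot_ends_def 1 using skip_range_le(4)[OF c(1,2)] by (simp del: o_apply)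
qed

lemma comp_list_cut:
  assumes ex: "extractable \<eta> m p" and d: "dyck M \<eta>" and mk: "m \<le> k"
    and j: "j < card (config_slots k \<eta>)"
  shows "comp_list k M \<eta> ! j = comp_list k (M - 2 * int m) (\<eta> \<circ> skip m p) ! j +
    (if m = k \<and> slot_ends k (M - 2 * int m) (\<eta> \<circ> skip m p) ! j < p
       \<and> p \<le> slot_ends k (M - 2 * int m) (\<eta> \<circ> skip m p) ! Suc j then 1 else 0)"
proof -
  let ?\<zeta> = "\<eta> \<circ> skip m p" and ?M = "M - 2 * int m"
  note c = dyck_cut[OF ex d]
  have card_eq: "card (config_slots k \<eta>) = card (config_slots k ?\<zeta>)"
    using card_config_slots_cut[OF ex d, of k] mk by simp
  let ?a = "slot_ends k ?M ?\<zeta> ! j" and ?b = "slot_ends k ?M ?\<zeta> ! Suc j"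
  have len: "Suc j < length (slot_ends k ?M ?\<zeta>)" using j card_eq by (simp add: slot_ends_def length_slot_list)
  have ab: "?a < ?b" using slot_ends_less[OF c(3), of j "Suc j" k] j card_eq by simp
  have nth: "slot_ends k M \<eta> ! j = skip m p ?a" "slot_ends k M \<eta> ! Suc j = skip m p ?b"
    unfolding slot_ends_cut(2)[OF ex d mk] using len by simp_all
  let ?C = "\<lambda>\<eta> a b. {\<gamma>\<in>all_solitons \<eta>. soliton_size \<gamma> = k \<and> support \<gamma> \<subseteq> {a<..<b}}"
  have img: "support (image_soliton (skip m p) \<gamma>) \<subseteq> {skip m p ?a<..<skip m p ?b} \<longleftrightarrow> support \<gamma> \<subseteq> {?a<..<?b}" for \<gamma>
    unfolding support_image_soliton
    by (auto simp: strict_mono_less[OF strict_mono_skip] subset_iff)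
  have blk: "support (block_soliton \<eta> m p) \<subseteq> {skip m p ?a<..<skip m p ?b} \<longleftrightarrow> ?a < p \<and> p \<le> ?b"
    unfolding support_block_soliton using ab extract_pos[OF ex]
    by (auto simp: skip_def subset_iff split: if_splits)
  have C: "?C \<eta> (skip m p ?a) (skip m p ?b) =
    (if m = k \<and> ?a < p \<and> p \<le> ?b then {block_soliton \<eta> m p} else {}) \<union> image_soliton (skip m p) ` ?C ?\<zeta> ?a ?b"
    (is "?L = ?R")
  proof (intro equalityI subsetI)
    fix \<gamma> assume g: "\<gamma> \<in> ?L"
    then consider "\<gamma> = block_soliton \<eta> m p" | \<gamma>' where "\<gamma>' \<in> all_solitons ?\<zeta>" "\<gamma> = image_soliton (skip m p) \<gamma>'"
      unfolding all_solitons_cut[OF ex] by blast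
    then show "\<gamma> \<in> ?R"
    proof cases
      case 1
      have "soliton_size (block_soliton \<eta> m p) = k"
        and sup: "support (block_soliton \<eta> m p) \<subseteq> {skip m p ?a<..<skip m p ?b}" using g unfolding 1 by blast+
      then have "m = k" using soliton_size_block[OF ex] by simp
      then have cnd: "m = k \<and> ?a < p \<and> p \<le> ?b" using sup[unfolded blk] by blast
      show ?thesis unfolding if_P[OF cnd] using 1 by blast
    next
      case 2
      then have "\<gamma>' \<in> ?C ?\<zeta> ?a ?b" using g img by (simp del: o_apply)
      then show ?thesis using 2 by blast
    qed
  next
    fix \<gamma> assume g: "\<gamma> \<in> ?R"
    then consider "\<gamma> = block_soliton \<eta> m p" "m = k \<and> ?a < p \<and> p \<le> ?b"
      | \<gamma>' where "\<gamma>' \<in> ?C ?\<zeta> ?a ?b" "\<gamma> = image_soliton (skip m p) \<gamma>'"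
      by (auto split: if_splits simp del: o_apply)
    then show "\<gamma> \<in> ?L"
    proof cases
      case 1
      have "\<gamma> \<in> all_solitons \<eta>" unfolding all_solitons_cut[OF ex] 1(1) by blast
      moreover have "soliton_size \<gamma> = k" using soliton_size_block[OF ex] 1 by simp
      moreover have "support \<gamma> \<subseteq> {skip m p ?a<..<skip m p ?b}" unfolding 1(1) blk using 1(2) by blast
      ultimately show ?thesis by blast
    next
      case 2
      then show ?thesis using img unfolding all_solitons_cut[OF ex] by (simp del: o_apply)
    qed
  qed
  have "finite (?C ?\<zeta> ?a ?b)" by (rule finite_subset[OF _ all_solitons_wf[OF c(3), THEN conjunct1]]) blast
  moreover have "card (image_soliton (skip m p) ` ?C ?\<zeta> ?a ?b) = card (?C ?\<zeta> ?a ?b)"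
    by (rule card_image) (use inj_image_soliton inj_on_subset in blast)
  moreover have "block_soliton \<eta> m p \<notin> image_soliton (skip m p) ` ?C ?\<zeta> ?a ?b" by (rule block_not_image[OF ex])
  ultimately have "card (?C \<eta> (skip m p ?a) (skip m p ?b)) = card (?C ?\<zeta> ?a ?b) + (if m = k \<and> ?a < p \<and> p \<le> ?b then 1 else 0)"
    unfolding C by auto
  then show ?thesis
    using j card_eq by (simp add: comp_list_def length_slot_list nth del: o_apply)
qed

lemma comp_list_cut_less:
  assumes ex: "extractable \<eta> m p" and d: "dyck M \<eta>" and mk: "m < k"
  shows "comp_list k M \<eta> = comp_list k (M - 2 * int m) (\<eta> \<circ> skip m p)"
proof (rule nth_equalityI)
  show "length (comp_list k M \<eta>) = length (comp_list k (M - 2 * int m) (\<eta> \<circ> skip m p))"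
    using card_config_slots_cut[OF ex d, of k] mk by simp
  show "comp_list k M \<eta> ! j = comp_list k (M - 2 * int m) (\<eta> \<circ> skip m p) ! j" if "j < length (comp_list k M \<eta>)" for j
    using comp_list_cut[OF ex d, of k j] mk that by simp
qed

lemma comp_list_long_runs:
  assumes "dyck M \<eta>" "long_runs (Suc k) \<eta>"
  shows "comp_list k M \<eta> = replicate (card (config_slots k \<eta>)) 0"
proof -
  have "{\<gamma>\<in>all_solitons \<eta>. soliton_size \<gamma> = k \<and> S \<gamma>} = {}" for S
    using soliton_size_ge[OF assms(1), of "Suc k"] assms(2) by force
  then show ?thesis unfolding comp_list_def by (simp add: map_replicate_const length_slot_list del: Collect_empty_eq)
qed

text \<open>Extends the local description of slots to configurations that still contain k-solitons,
  but only to the left of q. There it survives because these solitons are removed at or behind q,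
  which leaves the boxes in front unchanged.\<close>

lemma config_slots_clean:
  assumes "dyck M \<eta>"
  shows "long_runs k \<eta> \<longrightarrow> clean k q \<eta> \<longrightarrow> (\<forall>z. 0 \<le> z \<longrightarrow> z < q \<longrightarrow> z \<le> M \<longrightarrow> (z \<in> config_slots k \<eta> \<longleftrightarrow> z \<in> slot_set k \<eta>))"
  using assms
proof (induction rule: dyck_induct)
  case empty
  then show ?case by (auto simp: config_slots_empty slot_set_def)
next
  case (cut M \<eta> m p)
  show ?case
  proof (intro impI allI)
    fix z assume l: "long_runs k \<eta>" and cl: "clean k q \<eta>" and z: "0 \<le> z" "z < q" "z \<le> M"
    have km: "k \<le> m" using l long_runs_iff[OF cut(2)] by simp
    show "z \<in> config_slots k \<eta> \<longleftrightarrow> z \<in> slot_set k \<eta>"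
    proof (cases "k = m")
      case False
      then have "long_runs (Suc k) \<eta>" using km long_runs_iff[OF cut(2)] by simp
      then show ?thesis using config_slots_long_runs[OF cut(1)] z by auto
    next
      case True
      have ex: "extractable \<eta> k p" using cut(2) True by simp
      have qp: "q \<le> p" using clean_le[OF cl ex] .
      have "z \<in> config_slots k \<eta> \<longleftrightarrow> z \<in> config_slots k (\<eta> \<circ> skip k p)"
        using z qp True unfolding config_slots_cut[OF ex cut(1)] by (auto simp: skip_def)
      also have "\<dots> \<longleftrightarrow> z \<in> slot_set k (\<eta> \<circ> skip k p)"
        using cut(6)[folded True] long_runs_cut[OF ex] clean_cut[OF ex qp] z qp cut(5)[folded True]
        by (simp del: o_apply)
      also have "\<dots> \<longleftrightarrow> z \<in> slot_set k \<eta>"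
      proof -
        have "(\<eta> \<circ> skip k p) (z - i) = \<eta> (z - i)" if "0 \<le> i" for i using z qp that by (simp add: skip_def)
        from this this[of 0] show ?thesis by (simp add: slot_set_def del: o_apply)
      qed
      finally show ?thesis .
    qed
  qed
qed

text \<open>The k-solitons are extracted at positions at least q and \<open>skip\<close> never moves
  a box to the left, so their boxes stay behind q when earlier removals are undone.\<close>

lemma support_clean:
  assumes "dyck M \<eta>"
  shows "long_runs k \<eta> \<longrightarrow> clean k q \<eta> \<longrightarrow> (\<forall>\<gamma>\<in>all_solitons \<eta>. soliton_size \<gamma> = k \<longrightarrow> support \<gamma> \<subseteq> {q..})"
  using assms
proof (induction rule: dyck_induct)
  case empty
  then show ?case by (simp add: all_solitons_empty)
next
  case (cut M \<eta> m p)
  show ?case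
  proof (intro impI ballI)
    fix \<gamma> assume l: "long_runs k \<eta>" and cl: "clean k q \<eta>" and g: "\<gamma> \<in> all_solitons \<eta>" "soliton_size \<gamma> = k"
    have "m \<le> k" using soliton_size_ge[OF cut(1), of m] cut(2) g unfolding extractable_def by blast
    moreover have "k \<le> m" using l long_runs_iff[OF cut(2)] by simp
    ultimately have mk: "m = k" by simp
    then have ex: "extractable \<eta> k p" using cut(2) by simp
    have qp: "q \<le> p" using clean_le[OF cl ex] .
    from g(1) consider "\<gamma> = block_soliton \<eta> k p"
      | \<gamma>' where "\<gamma>' \<in> all_solitons (\<eta> \<circ> skip k p)" "\<gamma> = image_soliton (skip k p) \<gamma>'"
      unfolding all_solitons_cut[OF ex] by blast
    then show "support \<gamma> \<subseteq> {q..}"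
    proof cases
      case 1
      then show ?thesis using qp by (auto simp: support_block_soliton)
    next
      case 2
      then have "support \<gamma>' \<subseteq> {q..}"
        using cut(6)[unfolded mk] long_runs_cut[OF ex] clean_cut[OF ex qp] g(2) by (simp del: o_apply)
      then show ?thesis unfolding 2 support_image_soliton by (auto simp: skip_def subset_iff)
    qed
  qed
qed

section \<open>Removing all small solitons\<close>

text \<open>A relation instead of a recursive function, because for an arbitrary configuration the
  removals need not come to an end. By \<open>extract_unique\<close> each removal is determined, so
  the definite description below is meaningful for excursions.\<close>

inductive reduces :: "nat \<Rightarrow> config \<Rightarrow> config \<Rightarrow> bool" for k where
  reduces_refl: "long_runs k \<eta> \<Longrightarrow> reduces k \<eta> \<eta>"
| reduces_cut: "extractable \<eta> m p \<Longrightarrow> m < k \<Longrightarrow> reduces k (\<eta> \<circ> skip m p) \<zeta> \<Longrightarrow> reduces k \<eta> \<zeta>"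

definition reduced :: "nat \<Rightarrow> config \<Rightarrow> config" where
  "reduced k \<eta> = (THE \<zeta>. reduces k \<eta> \<zeta>)"

lemma reduced_long_runs:
  assumes "long_runs k \<eta>"
  shows "reduced k \<eta> = \<eta>"
proof -
  have "reduces k \<eta> \<zeta> \<longleftrightarrow> \<zeta> = \<eta>" for \<zeta>
  proof
    assume "reduces k \<eta> \<zeta>"
    then show "\<zeta> = \<eta>"
    proof cases
      case (reduces_cut m p)
      then show ?thesis using long_runs_le[OF assms] by fastforce
    qed simp
  qed (use reduces_refl assms in simp)
  then have "reduces k \<eta> = (\<lambda>\<zeta>. \<zeta> = \<eta>)" by (intro ext)
  then show ?thesis unfolding reduced_def by simp
qed

lemma reduced_cut:
  assumes ex: "extractable \<eta> m p" and mk: "m < k"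
  shows "reduced k \<eta> = reduced k (\<eta> \<circ> skip m p)"
proof -
  have "reduces k \<eta> \<zeta> \<longleftrightarrow> reduces k (\<eta> \<circ> skip m p) \<zeta>" for \<zeta>
  proof
    assume "reduces k \<eta> \<zeta>"
    then show "reduces k (\<eta> \<circ> skip m p) \<zeta>"
    proof cases
      case reduces_refl
      then show ?thesis using long_runs_le[OF _ ex] mk by fastforce
    next
      case (reduces_cut m' p')
      then show ?thesis using extract_unique[OF ex] by blast
    qed
  qed (rule reduces_cut[OF ex mk])
  then have "reduces k \<eta> = reduces k (\<eta> \<circ> skip m p)" by (intro ext)
  then show ?thesis unfolding reduced_def by (rule arg_cong)
qed

lemma long_runs_empty: "long_runs k (\<lambda>_. False)"
  by (simp add: long_runs_def run_start_def)

text \<open>Behind M there are no balls, so the walk strictly decreases from 0 and cannot be 0 at a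
  larger M'.\<close>

lemma dyck_size: "dyck M \<eta> \<Longrightarrow> dyck M' \<eta> \<Longrightarrow> M = M'"
proof -
  have "\<not> M < M'" if "dyck M \<eta>" "dyck M' \<eta>" for M M'
  proof
    assume l: "M < M'"
    have "\<not> \<eta> (M + 1 + i)" if "0 \<le> i" "i < M' - M" for i
      using \<open>dyck M \<eta>\<close> that unfolding dyck_def by fastforce
    then have "walk \<eta> (M + 1 - 1 + (M' - M)) = walk \<eta> (M + 1 - 1) + (if False then M' - M else - (M' - M))"
      by (intro walk_constant) (use l in auto)
    then show False using that l by (simp add: dyck_def)
  qed
  then show "dyck M \<eta> \<Longrightarrow> dyck M' \<eta> \<Longrightarrow> M = M'" by (metis linorder_neqE)
qed

definition is_dyck :: "config \<Rightarrow> bool" where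
  "is_dyck \<eta> \<longleftrightarrow> (\<exists>M. dyck M \<eta>)"

definition dyck_size_of :: "config \<Rightarrow> int" where
  "dyck_size_of \<eta> = (THE M. dyck M \<eta>)"

lemma dyck_size_of: "dyck M \<eta> \<Longrightarrow> dyck_size_of \<eta> = M"
  unfolding dyck_size_of_def by (rule the_equality) (assumption, rule dyck_size)

lemma is_dyckD: "is_dyck \<eta> \<Longrightarrow> dyck (dyck_size_of \<eta>) \<eta>"
  using dyck_size_of unfolding is_dyck_def by blast

abbreviation comps :: "nat \<Rightarrow> config \<Rightarrow> nat list" where
  "comps k \<eta> \<equiv> comp_list k (dyck_size_of \<eta>) \<eta>"

lemma reduced_props:
  assumes "dyck M \<eta>"
  shows "is_dyck (reduced k \<eta>) \<and> long_runs k (reduced k \<eta>)"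
  using assms
proof (induction rule: dyck_induct)
  case empty
  have "dyck 0 (\<lambda>_. False)" by (simp add: dyck_def walk_0) (simp add: walk_def)
  then show ?case using reduced_long_runs[OF long_runs_empty] long_runs_empty by (auto simp: is_dyck_def)
next
  case (cut M \<eta> m p)
  show ?case
  proof (cases "m < k")
    case True
    then show ?thesis using cut(6) reduced_cut[OF cut(2)] by (simp del: o_apply)
  next
    case False
    then have "long_runs k \<eta>" using long_runs_iff[OF cut(2)] by simp
    then show ?thesis using reduced_long_runs cut(1) by (auto simp: is_dyck_def)
  qed
qed

lemma reduced_reduced:
  assumes "dyck M \<eta>" "j \<le> k"
  shows "reduced k (reduced j \<eta>) = reduced k \<eta>"
  using assms(1)
proof (induction rule: dyck_induct)
  case empty
  then show ?case by (simp add: reduced_long_runs[OF long_runs_empty])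
next
  case (cut M \<eta> m p)
  show ?case
  proof (cases "m < j")
    case True
    then show ?thesis using cut(6) reduced_cut[OF cut(2)] assms(2) by (simp del: o_apply)
  next
    case False
    then have "long_runs j \<eta>" using long_runs_iff[OF cut(2)] by simp
    then show ?thesis by (simp add: reduced_long_runs)
  qed
qed

lemma comp_reduced:
  assumes "dyck M \<eta>" "j \<le> k"
  shows "comps k (reduced j \<eta>) = comps k \<eta>"
  using assms(1)
proof (induction rule: dyck_induct)
  case empty
  then show ?case by (simp add: reduced_long_runs[OF long_runs_empty])
next
  case (cut M \<eta> m p)
  show ?case
  proof (cases "m < j")
    case True
    then have "comps k \<eta> = comps k (\<eta> \<circ> skip m p)"
      unfolding dyck_size_of[OF cut(1)] dyck_size_of[OF cut(3)]
      using comp_list_cut_less[OF cut(2,1)] assms(2) by simp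
    then show ?thesis using cut(6) reduced_cut[OF cut(2) True] by (simp del: o_apply)
  next
    case False
    then have "long_runs j \<eta>" using long_runs_iff[OF cut(2)] by simp
    then show ?thesis by (simp add: reduced_long_runs)
  qed
qed

text \<open>The number of \<open>k\<close>-slots, for a configuration without solitons of size at most \<open>k\<close>.\<close>

definition num_slots :: "nat \<Rightarrow> config \<Rightarrow> nat" where
  "num_slots k u = nat (1 + dyck_size_of u - 2 * int k * int (num_peaks u))"

text \<open>Removing a soliton of size at most k does not change the number of k-slots, so they can
  be counted after all these removals, where the affine formula applies. Hence the length of the
  list is known from the reduced configuration alone.\<close>

lemma length_comp:
  assumes "dyck M \<eta>"
  shows "length (comps k \<eta>) = num_slots k (reduced (Suc k) \<eta>)"
  using assms
proof (induction rule: dyck_induct)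
  case empty
  have "dyck 0 (\<lambda>_. False)" by (simp add: dyck_def walk_0) (simp add: walk_def)
  then show ?case
    by (simp add: reduced_long_runs[OF long_runs_empty] num_slots_def dyck_size_of num_peaks_empty config_slots_empty)
next
  case (cut M \<eta> m p)
  show ?case
  proof (cases "m < Suc k")
    case True
    then show ?thesis
      using cut(6) reduced_cut[OF cut(2) True] card_config_slots_cut[OF cut(2,1), of k] by (simp del: o_apply)
  next
    case False
    then have "long_runs (Suc k) \<eta>" using long_runs_iff[OF cut(2)] by simp
    then show ?thesis using card_config_slots[OF cut(1), of k] by (simp add: reduced_long_runs num_slots_def dyck_size_of[OF cut(1)])
  qed
qed

text \<open>The k + 1 equal boxes in front of p make p - 1 a k-slot of the shortened configuration,
  and the block is appended to it. All other k-solitons lie behind p - 1, so the slot of the removed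
  block is the first one with a nonzero count. This is the key to inverting the removals.\<close>

lemma extract_slot:
  assumes ex: "extractable \<eta> k p" and d: "dyck M \<eta>"
  obtains j where "j < card (config_slots k \<eta>)" "slot_list k (\<eta> \<circ> skip k p) ! j = p - 1"
    "comps k \<eta> = (comps k (\<eta> \<circ> skip k p))[j := Suc (comps k (\<eta> \<circ> skip k p) ! j)]"
    "\<And>i. i < j \<Longrightarrow> comps k (\<eta> \<circ> skip k p) ! i = 0"
proof -
  let ?\<zeta> = "\<eta> \<circ> skip k p" and ?M = "M - 2 * int k"
  note c = dyck_cut[OF ex d]
  have card_eq: "card (config_slots k \<eta>) = card (config_slots k ?\<zeta>)"
    using card_config_slots_cut[OF ex d, of k] by simp
  have "p - 1 \<in> slot_set k ?\<zeta>"
  proof -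
    have "?\<zeta> (p - 1 - i) = ?\<zeta> (p - 1)" if "0 \<le> i" "i \<le> int k" for i
      using extract_before[OF ex, of i] extract_before[OF ex, of 0] that by (simp add: skip_def)
    then show ?thesis unfolding slot_set_def by blast
  qed
  moreover have "p - 1 \<le> ?M" using c by simp
  ultimately have "p - 1 \<in> config_slots k ?\<zeta>"
    using config_slots_clean[OF c(3), of k p] long_runs_cut[OF ex] clean_cut[OF ex order.refl] c(1) by simp
  then have "p - 1 \<in> set (slot_list k ?\<zeta>)"
    using config_slots_finite[OF c(3)] by (simp add: slot_list_def)
  then obtain j where j: "j < card (config_slots k ?\<zeta>)" "slot_list k ?\<zeta> ! j = p - 1"
    unfolding in_set_conv_nth length_slot_list by blast
  have ej: "slot_ends k ?M ?\<zeta> ! j = p - 1" using slot_ends_nth[OF j(1)] j(2) by simp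
  have up: "p \<le> slot_ends k ?M ?\<zeta> ! i" if "j < i" "i \<le> card (config_slots k ?\<zeta>)" for i
    using slot_ends_less[OF c(3) that] ej by simp
  have low: "slot_ends k ?M ?\<zeta> ! i \<le> p - 1" if "i \<le> j" for i
    using slot_ends_less[OF c(3), of i j k] ej j(1) that by (cases "i = j") auto
  show ?thesis
  proof
    show "j < card (config_slots k \<eta>)" "slot_list k ?\<zeta> ! j = p - 1" using j card_eq by simp_all
    show "comps k \<eta> = (comps k ?\<zeta>)[j := Suc (comps k ?\<zeta> ! j)]"
      unfolding dyck_size_of[OF d] dyck_size_of[OF c(3)]
    proof (rule nth_equalityI)
      show "length (comp_list k M \<eta>) = length ((comp_list k ?M ?\<zeta>)[j := Suc (comp_list k ?M ?\<zeta> ! j)])"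
        using card_eq by simp
      fix i assume "i < length (comp_list k M \<eta>)"
      then have i: "i < card (config_slots k \<eta>)" by simp
      have "(slot_ends k ?M ?\<zeta> ! i < p \<and> p \<le> slot_ends k ?M ?\<zeta> ! Suc i) = (i = j)"
        using low[of i] low[of "Suc i"] up[of i] up[of "Suc i"] i card_eq
        by (cases "i < j"; cases "i = j") auto
      then show "comp_list k M \<eta> ! i = (comp_list k ?M ?\<zeta>)[j := Suc (comp_list k ?M ?\<zeta> ! j)] ! i"
        using comp_list_cut[OF ex d order.refl i] i card_eq by (simp add: nth_list_update)
    qed
    fix i assume i: "i < j"
    have "{\<gamma>\<in>all_solitons ?\<zeta>. soliton_size \<gamma> = k \<and>
      support \<gamma> \<subseteq> {slot_ends k ?M ?\<zeta> ! i<..<slot_ends k ?M ?\<zeta> ! Suc i}} = {}" (is "?S = {}")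
    proof (rule equals0I)
      fix \<gamma> assume g: "\<gamma> \<in> ?S"
      have "support \<gamma> \<subseteq> {p..}"
        using support_clean[OF c(3), of k p] long_runs_cut[OF ex] clean_cut[OF ex order.refl] g by blast
      moreover have "support \<gamma> \<noteq> {}"
        using all_solitons_wf[OF c(3)] wf_soliton_finite(3) g by blast
      moreover have "support \<gamma> \<subseteq> {..p - 1}"
        using low[of "Suc i"] i g by (auto simp: subset_iff)
      ultimately show False by fastforce
    qed
    then show "comps k ?\<zeta> ! i = 0"
      unfolding dyck_size_of[OF c(3)] comp_list_def using i j(1)
      by (simp add: length_slot_list del: Collect_empty_eq o_apply)
  qed
qed

lemma comp_zero_iff:
  assumes d: "dyck M \<eta>" and l: "long_runs k \<eta>"
  shows "long_runs (Suc k) \<eta> \<longleftrightarrow> sum_list (comps k \<eta>) = 0"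
proof
  assume "long_runs (Suc k) \<eta>"
  then show "sum_list (comps k \<eta>) = 0"
    unfolding dyck_size_of[OF d] using comp_list_long_runs[OF d] by (simp add: sum_list_replicate)
next
  assume s: "sum_list (comps k \<eta>) = 0"
  show "long_runs (Suc k) \<eta>"
  proof (rule ccontr)
    assume n: "\<not> long_runs (Suc k) \<eta>"
    then have "\<eta> \<noteq> (\<lambda>_. False)" using long_runs_empty by metis
    then obtain z where "\<eta> z" by auto
    then obtain m p where ex: "extractable \<eta> m p" using extractable_dyck_exists[OF d] by blast
    have "m = k" using n l long_runs_iff[OF ex] by simp
    then have ex: "extractable \<eta> k p" using ex by simp
    obtain j where j: "j < card (config_slots k \<eta>)"
      "comps k \<eta> = (comps k (\<eta> \<circ> skip k p))[j := Suc (comps k (\<eta> \<circ> skip k p) ! j)]"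
      using extract_slot[OF ex d] by metis
    have "j < length (comps k \<eta>)" using j(1) by simp
    then have "comps k \<eta> ! j = Suc (comps k (\<eta> \<circ> skip k p) ! j)"
      by (subst j(2), subst (asm) j(2)) simp
    moreover have "comps k \<eta> ! j = 0" using s \<open>j < length (comps k \<eta>)\<close> by (simp add: sum_list_eq_0_iff)
    ultimately show False by simp
  qed
qed

lemma extract_of_comp:
  assumes d: "dyck M \<eta>" and l: "long_runs k \<eta>" and s: "sum_list (comps k \<eta>) \<noteq> 0"
  obtains p where "extractable \<eta> k p"
proof -
  have n: "\<not> long_runs (Suc k) \<eta>" using comp_zero_iff[OF d l] s by simp
  then have "\<eta> \<noteq> (\<lambda>_. False)" using long_runs_empty by metis
  then obtain z where "\<eta> z" by auto
  then obtain m p where ex: "extractable \<eta> m p" using extractable_dyck_exists[OF d] by blast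
  have "m = k" using n l long_runs_iff[OF ex] by simp
  then show ?thesis using that ex by simp
qed

lemma sum_list_Suc_update: "j < length xs \<Longrightarrow> sum_list (xs[j := Suc (xs ! j)]) = Suc (sum_list xs)"
  by (simp add: sum_list_update)

text \<open>Each k-soliton takes away 2k boxes and one peak. This turns a weight in length and peaks
  into the weight of what remains times a power of one parameter.\<close>

lemma reduced_sizes:
  assumes "dyck M \<eta>"
  shows "long_runs k \<eta> \<longrightarrow> M = dyck_size_of (reduced (Suc k) \<eta>) + 2 * int k * int (sum_list (comps k \<eta>))
    \<and> num_peaks \<eta> = num_peaks (reduced (Suc k) \<eta>) + sum_list (comps k \<eta>)"
  using assms
proof (induction rule: dyck_induct)
  case empty
  have d: "dyck 0 (\<lambda>_. False)" by (simp add: dyck_def walk_0) (simp add: walk_def)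
  show ?case
    using comp_zero_iff[OF d long_runs_empty] long_runs_empty
    by (simp add: reduced_long_runs[OF long_runs_empty] dyck_size_of[OF d])
next
  case (cut M \<eta> m p)
  show ?case
  proof
    assume l: "long_runs k \<eta>"
    show "M = dyck_size_of (reduced (Suc k) \<eta>) + 2 * int k * int (sum_list (comps k \<eta>))
      \<and> num_peaks \<eta> = num_peaks (reduced (Suc k) \<eta>) + sum_list (comps k \<eta>)"
    proof (cases "long_runs (Suc k) \<eta>")
      case True
      then show ?thesis using comp_zero_iff[OF cut(1) l] by (simp add: reduced_long_runs dyck_size_of[OF cut(1)])
    next
      case False
      then have mk: "m = k" using l long_runs_iff[OF cut(2)] by simp
      then have ex: "extractable \<eta> k p" using cut(2) by simp
      obtain j where j: "j < card (config_slots k \<eta>)"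
        "comps k \<eta> = (comps k (\<eta> \<circ> skip k p))[j := Suc (comps k (\<eta> \<circ> skip k p) ! j)]"
        using extract_slot[OF ex cut(1)] by metis
      have "j < length (comps k (\<eta> \<circ> skip k p))"
        using j(1) card_config_slots_cut[OF ex cut(1), of k] by simp
      then have s: "sum_list (comps k \<eta>) = Suc (sum_list (comps k (\<eta> \<circ> skip k p)))"
        using j(2) sum_list_Suc_update by metis
      show ?thesis
        using cut(6) long_runs_cut[OF ex] num_peaks_cut[OF ex cut(1)]
        unfolding reduced_cut[OF ex lessI] mk s by (simp add: algebra_simps del: o_apply)
    qed
  qed
qed

text \<open>The position alone determines a block: its first half must differ from box p - 1,
  because a new run has to start at p.\<close>

definition insert_block :: "nat \<Rightarrow> int \<Rightarrow> config \<Rightarrow> config" where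
  "insert_block k p \<zeta> z = (if z < p then \<zeta> z else if z < p + int k then \<not> \<zeta> (p - 1)
     else if z < p + 2 * int k then \<zeta> (p - 1) else \<zeta> (z - 2 * int k))"

lemma insert_block_cut:
  assumes ex: "extractable \<eta> k p"
  shows "insert_block k p (\<eta> \<circ> skip k p) = \<eta>"
proof
  fix z
  have b: "\<eta> (p - 1) = (\<not> \<eta> p)" using extract_before[OF ex, of 0] by simp
  consider "z < p" | "p \<le> z" "z < p + int k" | "p + int k \<le> z" "z < p + 2 * int k" | "p + 2 * int k \<le> z" by linarith
  then show "insert_block k p (\<eta> \<circ> skip k p) z = \<eta> z"
  proof cases
    case 2
    then show ?thesis using extract_first[OF ex, of "z - p"] b by (simp add: insert_block_def skip_def)
  next
    case 3
    then show ?thesis using extract_second[OF ex, of "z - (p + int k)"] b by (simp add: insert_block_def skip_def)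
  qed (simp_all add: insert_block_def skip_def)
qed

text \<open>The first nonzero entry of the common list is the slot of the block removed first from
  either configuration. After lowering this entry the induction hypothesis identifies the shortened
  configurations, hence the position of that slot, and reinserting the block there restores
  both.\<close>

lemma comps_inj:
  assumes "dyck M \<eta>" "dyck M' \<eta>'" "long_runs k \<eta>" "long_runs k \<eta>'"
    "reduced (Suc k) \<eta> = reduced (Suc k) \<eta>'" "comps k \<eta> = comps k \<eta>'"
  shows "\<eta> = \<eta>'"
  using assms
proof (induction "sum_list (comps k \<eta>)" arbitrary: M M' \<eta> \<eta>')
  case 0
  then have "long_runs (Suc k) \<eta>" "long_runs (Suc k) \<eta>'"
    using comp_zero_iff[of M \<eta> k] comp_zero_iff[of M' \<eta>' k] by metis+
  then show ?case using 0 by (simp add: reduced_long_runs)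
next
  case (Suc n)
  obtain p where ex: "extractable \<eta> k p" using extract_of_comp[of M \<eta> k] Suc by (metis nat.distinct(1))
  obtain p' where ex': "extractable \<eta>' k p'" using extract_of_comp[of M' \<eta>' k] Suc by (metis nat.distinct(1))
  let ?\<zeta> = "\<eta> \<circ> skip k p" and ?\<zeta>' = "\<eta>' \<circ> skip k p'"
  note c = dyck_cut[OF ex Suc(3)] and c' = dyck_cut[OF ex' Suc(4)]
  obtain j where j: "j < card (config_slots k \<eta>)" "slot_list k ?\<zeta> ! j = p - 1"
    "comps k \<eta> = (comps k ?\<zeta>)[j := Suc (comps k ?\<zeta> ! j)]" "\<And>i. i < j \<Longrightarrow> comps k ?\<zeta> ! i = 0"
    using extract_slot[OF ex Suc(3)] by metis
  obtain j' where j': "j' < card (config_slots k \<eta>')" "slot_list k ?\<zeta>' ! j' = p' - 1"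
    "comps k \<eta>' = (comps k ?\<zeta>')[j' := Suc (comps k ?\<zeta>' ! j')]" "\<And>i. i < j' \<Longrightarrow> comps k ?\<zeta>' ! i = 0"
    using extract_slot[OF ex' Suc(4)] by metis
  have len: "length (comps k ?\<zeta>) = card (config_slots k \<eta>)" "length (comps k ?\<zeta>') = card (config_slots k \<eta>')"
    using card_config_slots_cut[OF ex Suc(3), of k] card_config_slots_cut[OF ex' Suc(4), of k] by simp_all
  have z: "comps k \<eta> ! i = 0" if "i < j" for i using j(3,4) that by simp
  have z': "comps k \<eta>' ! i = 0" if "i < j'" for i using j'(3,4) that by simp
  have p: "comps k \<eta> ! j = Suc (comps k ?\<zeta> ! j)" using j(1,3) len(1) by simp
  have p': "comps k \<eta>' ! j' = Suc (comps k ?\<zeta>' ! j')" using j'(1,3) len(2) by simp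
  have jj: "j = j'" using z[of j'] z'[of j] p p' Suc(8) by (cases j j' rule: linorder_cases) auto
  have co: "comps k ?\<zeta> = (comps k \<eta>)[j := comps k \<eta> ! j - 1]"
    using j(3) p by (simp add: list_update_overwrite)
  have co': "comps k ?\<zeta>' = (comps k \<eta>')[j := comps k \<eta>' ! j - 1]"
    using j'(3) p' jj by (simp add: list_update_overwrite)
  have eq: "comps k ?\<zeta> = comps k ?\<zeta>'" unfolding co co' Suc(8) ..
  have "sum_list (comps k \<eta>) = Suc (sum_list (comps k ?\<zeta>))"
    unfolding j(3) using sum_list_Suc_update j(1) len(1) by simp
  then have "n = sum_list (comps k ?\<zeta>)" using Suc(2) by simp
  from Suc(1)[OF this c(3) c'(3) long_runs_cut[OF ex] long_runs_cut[OF ex'] _ eq] Suc(7)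
  have \<zeta>: "?\<zeta> = ?\<zeta>'" unfolding reduced_cut[OF ex lessI] reduced_cut[OF ex' lessI] by blast
  have "p = p'" using j(2) j'(2) unfolding jj \<zeta> by simp
  then show ?case using insert_block_cut[OF ex] insert_block_cut[OF ex'] \<zeta> by metis
qed

text \<open>Since p - 1 is a k-slot, the insertion cuts no run down to size k or less, and since the
  runs in front are longer than k, the inserted block is the one that the algorithm removes
  first.\<close>

lemma insert_block:
  assumes d: "dyck M \<zeta>" and l: "long_runs k \<zeta>" and cl: "clean k p \<zeta>" and k: "0 < k"
    and s: "p - 1 \<in> slot_set k \<zeta>" "0 \<le> p - 1" "p - 1 \<le> M"
  defines "\<eta> \<equiv> insert_block k p \<zeta>"
  shows "extractable \<eta> k p" "\<eta> \<circ> skip k p = \<zeta>" "dyck (M + 2 * int k) \<eta>"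
proof -
  define c where "c = \<zeta> (p - 1)"
  have sD: "\<zeta> (p - 1 - i) = c" if "0 \<le> i" "i \<le> int k" for i
    using s(1) that unfolding slot_set_def c_def by blast
  have e1: "\<eta> z = \<zeta> z" if "z < p" for z using that by (simp add: \<eta>_def insert_block_def)
  have e2: "\<eta> z = (\<not> c)" if "p \<le> z" "z < p + int k" for z using that by (simp add: \<eta>_def insert_block_def c_def)
  have e3: "\<eta> z = c" if "p + int k \<le> z" "z < p + 2 * int k" for z using that by (simp add: \<eta>_def insert_block_def c_def)
  have e4: "\<eta> z = \<zeta> (z - 2 * int k)" if "p + 2 * int k \<le> z" for z using that by (simp add: \<eta>_def insert_block_def)
  have lD: "\<zeta> (x + i) = \<zeta> x" if "run_start \<zeta> x" "0 \<le> i" "i < int k" for x i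
    using l that unfolding long_runs_def by blast
  have clD: "\<zeta> (x + int k) = \<zeta> x" if "run_start \<zeta> x" "x < p" for x
    using cl that unfolding clean_def by blast
  have st1: "run_start \<zeta> x" "x + int k < p" if "x < p" "run_start \<eta> x" for x
  proof -
    show r: "run_start \<zeta> x" using that e1[of x] e1[of "x - 1"] unfolding run_start_def by simp
    show "x + int k < p"
    proof (rule ccontr)
      assume "\<not> x + int k < p"
      then have "\<zeta> x = c" "\<zeta> (x - 1) = c" using sD[of "p - 1 - x"] sD[of "p - x"] that(1) by simp_all
      then show False using r unfolding run_start_def by simp
    qed
  qed
  have long: "long_runs k \<eta>"
    unfolding long_runs_def
  proof (intro allI impI)
    fix x i assume st: "run_start \<eta> x" and i: "0 \<le> i \<and> i < int k"
    consider "x < p" | "x = p" | "p < x" "x < p + int k" | "x = p + int k"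
      | "p + int k < x" "x < p + 2 * int k" | "x = p + 2 * int k" | "p + 2 * int k < x" by linarith
    then show "\<eta> (x + i) = \<eta> x"
    proof cases
      case 1
      then show ?thesis using st1[OF 1 st] lD[of x i] i e1[of x] e1[of "x + i"] by simp
    next
      case 2
      then show ?thesis using e2[of p] e2[of "p + i"] i k by simp
    next
      case 3
      then show ?thesis using st e2[of x] e2[of "x - 1"] unfolding run_start_def by simp
    next
      case 4
      then show ?thesis using e3[of x] e3[of "x + i"] i k by simp
    next
      case 5
      then show ?thesis using st e3[of x] e3[of "x - 1"] unfolding run_start_def by simp
    next
      case 6
      have "\<eta> (x - 1) = c" using e3[of "x - 1"] 6 k by simp
      then have "run_start \<zeta> p" using st e4[of x] 6 unfolding run_start_def c_def by simp
      from lD[OF this, of i] show ?thesis using e4[of x] e4[of "x + i"] i 6 by (simp add: algebra_simps)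
    next
      case 7
      have "run_start \<zeta> (x - 2 * int k)"
        using st e4[of x] e4[of "x - 1"] 7 unfolding run_start_def by (simp add: algebra_simps)
      from lD[OF this, of i] show ?thesis using e4[of x] e4[of "x + i"] i 7 by (simp add: algebra_simps)
    qed
  qed
  show ex: "extractable \<eta> k p"
    unfolding extractable_def
  proof (intro conjI allI impI)
    show "long_runs k \<eta>" by (rule long)
    show "run_start \<eta> p" using e1[of "p - 1"] e2[of p] k unfolding run_start_def c_def by simp
    show "\<eta> (p + int k) \<noteq> \<eta> p" using e2[of p] e3[of "p + int k"] k by simp
    fix x assume "x < p" "run_start \<eta> x"
    from st1[OF this] clD[of x] e1[of x] e1[of "x + int k"] \<open>x < p\<close> show "\<eta> (x + int k) = \<eta> x" by simp
  qed
  show cut: "\<eta> \<circ> skip k p = \<zeta>"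
  proof
    fix z show "(\<eta> \<circ> skip k p) z = \<zeta> z" using e1[of z] e4[of "z + 2 * int k"] by (simp add: skip_def)
  qed
  have p: "1 \<le> p" using s by simp
  have ws: "walk \<eta> (skip k p z) = walk \<zeta> z" for z
    using walk_skip[OF p walk_block_total[OF ex], of z] unfolding cut by simp
  have ball: "\<And>z. \<zeta> z \<Longrightarrow> 1 \<le> z \<and> z \<le> M" and pos: "\<And>z. 0 \<le> z \<Longrightarrow> z \<le> M \<Longrightarrow> 0 \<le> walk \<zeta> z"
    and M: "0 \<le> M" "walk \<zeta> M = 0" using d unfolding dyck_def by blast+
  have wp: "walk \<eta> (p - 1) = walk \<zeta> (p - 1)" using ws[of "p - 1"] by (simp add: skip_def)
  \<comment> \<open>If the block first goes down, the k balls at p - k, ..., p - 1 guarantee enough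
    height for its k empty boxes.\<close>
  have wk: "walk \<zeta> (p - 1) \<ge> int k" if c
  proof -
    have "\<zeta> (p - 1 - int k)" using sD[of "int k"] that by simp
    then have "1 \<le> p - 1 - int k" using ball by blast
    then have "0 \<le> walk \<zeta> (p - 1 - int k)" using pos[of "p - 1 - int k"] s by simp
    moreover have "walk \<zeta> (p - int k - 1 + int k) = walk \<zeta> (p - int k - 1) + (if True then int k else - int k)"
    proof (rule walk_constant)
      show "\<zeta> (p - int k + i) = True" if "0 \<le> i" "i < int k" for i
        using sD[of "int k - 1 - i"] that \<open>c\<close> by (simp add: algebra_simps)
    qed simp_all
    ultimately show ?thesis by (simp add: algebra_simps)
  qed
  have wpos: "0 \<le> walk \<zeta> (p - 1)" using pos s by simp
  have ep: "\<eta> p = (\<not> c)" using e2[of p] k by simp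
  show "dyck (M + 2 * int k) \<eta>"
    unfolding dyck_def
  proof (intro conjI allI impI)
    show "0 \<le> M + 2 * int k" using M by simp
    fix z
    show "1 \<le> z" if "\<eta> z"
      using that e1[of z] ball[of z] p by (cases "z < p") auto
    show "z \<le> M + 2 * int k" if "\<eta> z"
    proof (cases "p + 2 * int k \<le> z")
      case True
      then show ?thesis using e4[of z] ball[of "z - 2 * int k"] that by simp
    qed (use s in simp)
    show "0 \<le> walk \<eta> z" if z: "0 \<le> z \<and> z \<le> M + 2 * int k"
    proof -
      consider "z < p" | "p \<le> z" "z \<le> p - 1 + int k" | "p - 1 + int k < z" "z < p + 2 * int k" | "p + 2 * int k \<le> z" by linarith
      then show ?thesis
      proof cases
        case 1
        then show ?thesis using ws[of z] pos[of z] z s by (simp add: skip_def)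
      next
        case 2
        then show ?thesis
          using walk_block_first[OF ex, of "z - (p - 1)"] wk wpos wp ep by (cases c) auto
      next
        case 3
        then show ?thesis
          using walk_block_second[OF ex, of "z - (p - 1 + int k)"] wk wpos wp ep by (cases c) auto
      next
        case 4
        then show ?thesis using ws[of "z - 2 * int k"] pos[of "z - 2 * int k"] z p by (simp add: skip_def)
      qed
    qed
    show "walk \<eta> (M + 2 * int k) = 0"
    proof (cases "M < p")
      case True
      then have "M = p - 1" using s by simp
      then show ?thesis using walk_block_total[OF ex] wp M by simp
    next
      case False
      then show ?thesis using ws[of M] M by (simp add: skip_def)
    qed
  qed
qed

text \<open>The entry that is lowered for the induction must be the first nonzero one, so that the
  block put back at its slot is the one removed first and the count of no other slot
  changes.\<close>

lemma comps_surj: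
  assumes d: "dyck M' u" and l: "long_runs (Suc k) u" and k: "0 < k" and len: "length x = num_slots k u"
  shows "\<exists>M \<eta>. dyck M \<eta> \<and> long_runs k \<eta> \<and> reduced (Suc k) \<eta> = u \<and> comps k \<eta> = x"
  using len
proof (induction "sum_list x" arbitrary: x)
  case 0
  have "length (comps k u) = num_slots k u" using length_comp[OF d] by (simp add: reduced_long_runs[OF l])
  then have "comps k u = replicate (num_slots k u) 0"
    using comp_list_long_runs[OF d l] by (simp add: dyck_size_of[OF d])
  moreover have "x = replicate (num_slots k u) 0"
    using 0 by (intro replicate_eqI) (auto simp: sum_list_eq_0_iff)
  ultimately show ?case using d l long_runs_mono[OF l] by (intro exI[of _ M'] exI[of _ u]) (simp add: reduced_long_runs)
next
  case (Suc n)
  have exj: "\<exists>j. j < length x \<and> x ! j \<noteq> 0"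
    using Suc(2) by (metis in_set_conv_nth nat.distinct(1) sum_list_eq_0_iff)
  define j where "j = (LEAST j. j < length x \<and> x ! j \<noteq> 0)"
  have j: "j < length x" "x ! j \<noteq> 0" using LeastI_ex[OF exj] unfolding j_def by blast+
  have least: "x ! i = 0" if "i < j" for i using not_less_Least[of i "\<lambda>j. j < length x \<and> x ! j \<noteq> 0"] that j(1) unfolding j_def by auto
  define x' where "x' = x[j := x ! j - 1]"
  have xx': "x = x'[j := Suc (x' ! j)]" using j by (simp add: x'_def)
  have "sum_list x = Suc (sum_list x')"
    by (subst xx', rule sum_list_Suc_update) (use j in \<open>simp add: x'_def\<close>)
  then have "n = sum_list x'" using Suc(2) by simp
  moreover have "length x' = num_slots k u" using Suc(3) by (simp add: x'_def)
  ultimately obtain M \<zeta> where \<zeta>: "dyck M \<zeta>" "long_runs k \<zeta>" "reduced (Suc k) \<zeta> = u" "comps k \<zeta> = x'"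
    using Suc(1) by blast
  have jc: "j < card (config_slots k \<zeta>)" using \<zeta>(4) j(1) by (metis length_comp_list length_list_update x'_def)
  define s where "s = slot_list k \<zeta> ! j"
  have s: "s \<in> config_slots k \<zeta>" unfolding s_def by (rule slot_list_nth_in[OF \<zeta>(1) jc])
  then have "s \<in> {0..M}" using config_slots_bounds[OF \<zeta>(1), of k] by blast
  then have sb: "0 \<le> s" "s \<le> M" by simp_all
  have sort: "slot_list k \<zeta> ! i < slot_list k \<zeta> ! i'" if "i < i'" "i' < card (config_slots k \<zeta>)" for i i'
    using slot_ends_less[OF \<zeta>(1) that(1), of k] that by (simp add: slot_ends_nth)
  \<comment> \<open>A run of size k starting at or in front of the slot s would produce an
    extraction whose slot has an index i < j; but the counts with index below j vanish.\<close>
  have cl: "clean k (s + 1) \<zeta>"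
  proof (rule ccontr)
    assume "\<not> clean k (s + 1) \<zeta>"
    then obtain y where y: "y < s + 1" "run_start \<zeta> y" "\<zeta> (y + int k) \<noteq> \<zeta> y" unfolding clean_def by blast
    have "0 \<le> int k \<and> int k < int (Suc k)" by simp
    then have "\<not> long_runs (Suc k) \<zeta>" using y unfolding long_runs_def by blast
    then have "sum_list (comps k \<zeta>) \<noteq> 0" using comp_zero_iff[OF \<zeta>(1,2)] by simp
    then obtain p where ex: "extractable \<zeta> k p" using extract_of_comp[OF \<zeta>(1,2)] by blast
    have py: "p \<le> y" using ex y unfolding extractable_def by (meson linorder_not_le)
    obtain i where i: "i < card (config_slots k \<zeta>)" "slot_list k (\<zeta> \<circ> skip k p) ! i = p - 1"
      "comps k \<zeta> = (comps k (\<zeta> \<circ> skip k p))[i := Suc (comps k (\<zeta> \<circ> skip k p) ! i)]"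
      using extract_slot[OF ex \<zeta>(1)] by metis
    have lens: "card (config_slots k (\<zeta> \<circ> skip k p)) = card (config_slots k \<zeta>)"
      using card_config_slots_cut[OF ex \<zeta>(1), of k] by simp
    have "slot_list k \<zeta> ! i = skip k p (p - 1)"
      unfolding slot_ends_cut(1)[OF ex \<zeta>(1) order.refl] using i(1,2) lens by (simp add: length_slot_list del: o_apply)
    then have si: "slot_list k \<zeta> ! i = p - 1" by (simp add: skip_def)
    have "i < j"
    proof (rule ccontr)
      assume "\<not> i < j"
      then have "slot_list k \<zeta> ! j \<le> slot_list k \<zeta> ! i" using sort[of j i] i(1) by (cases "i = j") auto
      then show False using si py y(1) unfolding s_def by simp
    qed
    then have "comps k \<zeta> ! i = 0" using least[of i] \<zeta>(4) by (simp add: x'_def)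
    moreover have "comps k \<zeta> ! i \<noteq> 0" unfolding i(3) using i(1) lens by simp
    ultimately show False by simp
  qed
  have ss: "s \<in> slot_set k \<zeta>" using config_slots_clean[OF \<zeta>(1), of k "s + 1"] \<zeta>(2) cl s sb by simp
  let ?p = "s + 1"
  let ?\<eta> = "insert_block k ?p \<zeta>"
  have ib: "extractable ?\<eta> k ?p" "?\<eta> \<circ> skip k ?p = \<zeta>" "dyck (M + 2 * int k) ?\<eta>"
    using insert_block[OF \<zeta>(1,2) cl k] ss sb by simp_all
  obtain i where i: "i < card (config_slots k ?\<eta>)" "slot_list k \<zeta> ! i = ?p - 1"
    "comps k ?\<eta> = (comps k \<zeta>)[i := Suc (comps k \<zeta> ! i)]"
    using extract_slot[OF ib(1,3)] unfolding ib(2) by metis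
  have "i < card (config_slots k \<zeta>)" using i(1) card_config_slots_cut[OF ib(1,3), of k] unfolding ib(2) by simp
  then have "i = j" using i(2) sort[of i j] sort[of j i] jc unfolding s_def by (cases i j rule: linorder_cases) auto
  then have "comps k ?\<eta> = x" using i(3) \<zeta>(4) xx' by simp
  moreover have "reduced (Suc k) ?\<eta> = u" using reduced_cut[OF ib(1) lessI] \<zeta>(3) unfolding ib(2) by simp
  moreover have "long_runs k ?\<eta>" using ib(1) unfolding extractable_def by blast
  ultimately show ?case using ib(3) by blast
qed

section \<open>Soliton counts\<close>

lemma solitons_totals:
  assumes "dyck M \<eta>"
  shows "(\<Sum>\<gamma>\<in>all_solitons \<eta>. 2 * int (soliton_size \<gamma>)) = M \<and> card (all_solitons \<eta>) = num_peaks \<eta>"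
  using assms
proof (induction rule: dyck_induct)
  case empty
  then show ?case by (simp add: all_solitons_empty num_peaks_empty)
next
  case (cut M \<eta> k p)
  let ?A = "all_solitons (\<eta> \<circ> skip k p)"
  have fin: "finite ?A" using all_solitons_wf[OF cut(3)] by blast
  have inj: "inj_on (image_soliton (skip k p)) ?A" using inj_image_soliton inj_on_subset by blast
  have "(\<Sum>\<gamma>\<in>image_soliton (skip k p) ` ?A. 2 * int (soliton_size \<gamma>)) = (\<Sum>\<gamma>\<in>?A. 2 * int (soliton_size \<gamma>))"
    by (subst sum.reindex[OF inj]) simp
  moreover have "card (image_soliton (skip k p) ` ?A) = card ?A" by (rule card_image[OF inj])
  ultimately show ?case
    unfolding all_solitons_cut[OF cut(2)] num_peaks_cut[OF cut(2,1)]
    using cut(6) fin block_not_image[OF cut(2)] soliton_size_block[OF cut(2)]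
    by (simp del: o_apply)
qed

lemma exc_weight_eq:
  assumes d: "dyck M (ball_config \<epsilon>)"
  shows "exc_weight \<alpha> \<epsilon> = (\<Prod>\<gamma>\<in>all_solitons (ball_config \<epsilon>). \<alpha> (soliton_size \<gamma>))"
proof -
  let ?A = "all_solitons (ball_config \<epsilon>)"
  have fin: "finite ?A" and pos: "\<And>\<gamma>. \<gamma> \<in> ?A \<Longrightarrow> 0 < soliton_size \<gamma>"
    using all_solitons_wf[OF d] by (auto simp: wf_soliton_def)
  have es: "exc_solitons k \<epsilon> = {\<gamma> \<in> ?A. soliton_size \<gamma> = k}" for k by (rule exc_solitons_ball_config)
  have K: "{k. 1 \<le> k \<and> num_solitons k \<epsilon> \<noteq> 0} = soliton_size ` ?A"
  proof (intro equalityI subsetI)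
    fix k assume "k \<in> {k. 1 \<le> k \<and> num_solitons k \<epsilon> \<noteq> 0}"
    then have "{\<gamma> \<in> ?A. soliton_size \<gamma> = k} \<noteq> {}" by (auto simp: num_solitons_def es simp del: Collect_empty_eq)
    then show "k \<in> soliton_size ` ?A" by blast
  next
    fix k assume "k \<in> soliton_size ` ?A"
    then obtain \<gamma> where "\<gamma> \<in> ?A" "soliton_size \<gamma> = k" by blast
    then have "{\<gamma> \<in> ?A. soliton_size \<gamma> = k} \<noteq> {}" "0 < k" using pos by blast+
    then show "k \<in> {k. 1 \<le> k \<and> num_solitons k \<epsilon> \<noteq> 0}"
      using fin by (simp add: num_solitons_def es card_eq_0_iff del: Collect_empty_eq)
  qed
  have "(\<Prod>\<gamma>\<in>?A. \<alpha> (soliton_size \<gamma>)) = (\<Prod>k\<in>soliton_size ` ?A. \<Prod>\<gamma>\<in>{\<gamma> \<in> ?A. soliton_size \<gamma> = k}. \<alpha> (soliton_size \<gamma>))"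
    by (rule prod.group[symmetric]) (use fin in auto)
  also have "\<dots> = (\<Prod>k\<in>soliton_size ` ?A. \<alpha> k ^ num_solitons k \<epsilon>)"
    by (intro prod.cong refl) (simp add: num_solitons_def es)
  finally show ?thesis unfolding exc_weight_def K by simp
qed

lemma sum_num_solitons:
  assumes d: "dyck M (ball_config \<epsilon>)"
  shows "(\<Sum>k\<in>K. 2 * int k * int (num_solitons k \<epsilon>)) \<le> M"
proof -
  let ?A = "all_solitons (ball_config \<epsilon>)"
  have fin: "finite ?A" using all_solitons_wf[OF d] by blast
  show ?thesis
  proof (cases "finite K")
    case True
    let ?B = "{\<gamma> \<in> ?A. soliton_size \<gamma> \<in> K}"
    have "(\<Sum>k\<in>K. 2 * int k * int (num_solitons k \<epsilon>)) = (\<Sum>k\<in>K. \<Sum>\<gamma>\<in>{\<gamma> \<in> ?B. soliton_size \<gamma> = k}. 2 * int (soliton_size \<gamma>))"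
    proof (rule sum.cong[OF refl])
      fix k assume k: "k \<in> K"
      have "{\<gamma> \<in> ?B. soliton_size \<gamma> = k} = {\<gamma> \<in> ?A. soliton_size \<gamma> = k}" using k by blast
      then show "2 * int k * int (num_solitons k \<epsilon>) = (\<Sum>\<gamma>\<in>{\<gamma> \<in> ?B. soliton_size \<gamma> = k}. 2 * int (soliton_size \<gamma>))"
        by (simp add: num_solitons_def exc_solitons_ball_config)
    qed
    also have "\<dots> = (\<Sum>\<gamma>\<in>?B. 2 * int (soliton_size \<gamma>))"
      by (rule sum.group) (use fin True in auto)
    also have "\<dots> \<le> (\<Sum>\<gamma>\<in>?A. 2 * int (soliton_size \<gamma>))"
      by (rule sum_mono2) (use fin in auto)
    finally show ?thesis using solitons_totals[OF d] by simp
  next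
    \<comment> \<open>A sum over an infinite index set is 0 by convention, and 0 does not exceed
      M.\<close>
    case False
    then show ?thesis using d by (simp add: dyck_def)
  qed
qed

lemma exc_weight_geometric:
  assumes d: "dyck M (ball_config \<epsilon>)" and \<alpha>: "\<And>k. \<alpha> k = a * b ^ k"
  shows "exc_weight \<alpha> \<epsilon> = a ^ num_peaks (ball_config \<epsilon>) * b ^ nat (M div 2)"
proof -
  let ?A = "all_solitons (ball_config \<epsilon>)"
  have "2 * int (\<Sum>\<gamma>\<in>?A. soliton_size \<gamma>) = M" using solitons_totals[OF d] by (simp add: sum_distrib_left)
  then have "(\<Sum>\<gamma>\<in>?A. soliton_size \<gamma>) = nat (M div 2)" by linarith
  then show ?thesis
    using solitons_totals[OF d]
    by (simp add: exc_weight_eq[OF d] \<alpha> prod.distrib power_sum[symmetric])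
qed

section \<open>Excursions and their configurations\<close>

lemma excursions_dyck:
  assumes "\<epsilon> \<in> excursions"
  shows "dyck (int (length \<epsilon>) - 1) (ball_config \<epsilon>)"
    and "z < length \<epsilon> \<Longrightarrow> walk (ball_config \<epsilon>) (int z) = \<epsilon> ! z" and "0 < length \<epsilon>"
proof -
  obtain n where n: "length \<epsilon> = 2 * n + 1" "\<epsilon> ! 0 = 0" "\<epsilon> ! (2 * n) = 0"
    "\<And>z. z \<le> 2 * n \<Longrightarrow> 0 \<le> \<epsilon> ! z" "\<And>z. 1 \<le> z \<Longrightarrow> z \<le> 2 * n \<Longrightarrow> \<bar>\<epsilon> ! z - \<epsilon> ! (z - 1)\<bar> = 1"
    using assms unfolding excursions_def by blast
  show "0 < length \<epsilon>" using n by simp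
  have w: "walk (ball_config \<epsilon>) (int z) = \<epsilon> ! z" if "z < length \<epsilon>" for z
    using that
  proof (induction z)
    case 0
    then show ?case using n by (simp add: walk_0)
  next
    case (Suc z)
    have a: "\<bar>\<epsilon> ! Suc z - \<epsilon> ! z\<bar> = 1" using n(5)[of "Suc z"] Suc(2) n(1) by simp
    have "ball_config \<epsilon> (int z + 1) \<longleftrightarrow> \<epsilon> ! Suc z - \<epsilon> ! z = 1"
    proof -
      have "nat (int z + 1) = Suc z" by simp
      moreover have "\<epsilon> ! Suc z - \<epsilon> ! z = 1 \<or> \<epsilon> ! Suc z - \<epsilon> ! z = - 1" using a by arith
      ultimately show ?thesis using Suc(2) unfolding ball_config_def by auto
    qed
    then show ?case using walk_step[of "ball_config \<epsilon>" "int z"] Suc a by (auto simp: add.commute)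
  qed
  then show "z < length \<epsilon> \<Longrightarrow> walk (ball_config \<epsilon>) (int z) = \<epsilon> ! z" .
  show "dyck (int (length \<epsilon>) - 1) (ball_config \<epsilon>)"
    unfolding dyck_def
  proof (intro conjI allI impI)
    show "0 \<le> int (length \<epsilon>) - 1" using n by simp
    show "1 \<le> z" "z \<le> int (length \<epsilon>) - 1" if "ball_config \<epsilon> z" for z
      using that unfolding ball_config_def by auto
    show "0 \<le> walk (ball_config \<epsilon>) z" if z: "0 \<le> z \<and> z \<le> int (length \<epsilon>) - 1" for z
    proof -
      have "nat z < length \<epsilon>" "nat z \<le> 2 * n" "int (nat z) = z" using z n by auto
      then show ?thesis using w[of "nat z"] n(4)[of "nat z"] by simp
    qed
    show "walk (ball_config \<epsilon>) (int (length \<epsilon>) - 1) = 0" using w[of "2 * n"] n by simp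
  qed
qed

lemma ball_config_inj: "inj_on ball_config excursions"
proof (rule inj_onI)
  fix \<epsilon> \<epsilon>' assume e: "\<epsilon> \<in> excursions" "\<epsilon>' \<in> excursions" "ball_config \<epsilon> = ball_config \<epsilon>'"
  have "int (length \<epsilon>) - 1 = int (length \<epsilon>') - 1"
    using dyck_size excursions_dyck(1)[OF e(1)] excursions_dyck(1)[OF e(2)] unfolding e(3) by blast
  then have l: "length \<epsilon> = length \<epsilon>'" by simp
  show "\<epsilon> = \<epsilon>'"
    by (rule nth_equalityI[OF l]) (use excursions_dyck(2) e l in metis)
qed

lemma walk_parity: "even (walk \<eta> z - z)"
proof (induction z rule: int_induct[where k = 0])
  case base
  then show ?case by (simp add: walk_0)
next
  case (step1 i)
  then show ?case using walk_step[of \<eta> i] by (auto split: if_splits)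
next
  case (step2 i)
  then show ?case using walk_step[of \<eta> "i - 1"] by (auto split: if_splits)
qed

lemma dyck_excursion:
  assumes d: "dyck M \<eta>"
  shows "\<exists>\<epsilon>\<in>excursions. ball_config \<epsilon> = \<eta> \<and> int (length \<epsilon>) = M + 1"
proof -
  have M: "0 \<le> M" "walk \<eta> M = 0" using d by (auto simp: dyck_def)
  then have "even M" using walk_parity[of \<eta> M] by simp
  then obtain n where n: "M = 2 * int n" using M by (metis dvdE nonneg_int_cases zero_le_mult_iff zero_less_numeral not_le)
  define \<epsilon> where "\<epsilon> = map (\<lambda>z. walk \<eta> (int z)) [0..<2 * n + 1]"
  have nth: "\<epsilon> ! z = walk \<eta> (int z)" if "z \<le> 2 * n" for z
    using that by (simp add: \<epsilon>_def del: upt_Suc)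
  have len: "length \<epsilon> = 2 * n + 1" by (simp add: \<epsilon>_def)
  have step: "\<epsilon> ! Suc z - \<epsilon> ! z = (if \<eta> (int z + 1) then 1 else - 1)" if "Suc z \<le> 2 * n" for z
    using nth[of z] nth[of "Suc z"] walk_step[of \<eta> "int z"] that by (simp add: add.commute)
  have "\<epsilon> \<in> excursions"
    unfolding excursions_def
  proof (intro CollectI exI[of _ n] conjI allI impI)
    show "length \<epsilon> = 2 * n + 1" by (rule len)
    show "\<epsilon> ! 0 = 0" "\<epsilon> ! (2 * n) = 0" using nth[of 0] nth[of "2 * n"] M n by (simp_all add: walk_0)
    show "0 \<le> \<epsilon> ! z" if "z \<le> 2 * n" for z using nth[OF that] d n that by (simp add: dyck_def)
    show "\<bar>\<epsilon> ! z - \<epsilon> ! (z - 1)\<bar> = 1" if "1 \<le> z \<and> z \<le> 2 * n" for z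
      using step[of "z - 1"] that by (auto split: if_splits)
  qed
  moreover have "ball_config \<epsilon> = \<eta>"
  proof
    fix z
    show "ball_config \<epsilon> z = \<eta> z"
    proof (cases "1 \<le> z \<and> z \<le> M")
      case True
      then have "Suc (nat z - 1) = nat z" "Suc (nat z - 1) \<le> 2 * n" "int (nat z - 1) + 1 = z" using n by auto
      then show ?thesis using step[of "nat z - 1"] True n len by (auto simp: ball_config_def split: if_splits)
    next
      case False
      moreover have "\<not> \<eta> z" using False d unfolding dyck_def by blast
      ultimately show ?thesis using n len unfolding ball_config_def by auto
    qed
  qed
  ultimately show ?thesis using n len by auto
qed

section \<open>Cylinder events\<close>

definition cyl :: "int \<Rightarrow> bool list \<Rightarrow> config set" where
  "cyl m ys = {\<eta>. \<forall>i<length ys. \<eta> (m + int i) = ys ! i}"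

definition word :: "int \<Rightarrow> nat \<Rightarrow> config \<Rightarrow> bool list" where
  "word m n \<eta> = map (\<lambda>i. \<eta> (m + int i)) [0..<n]"

lemma length_word [simp]: "length (word m n \<eta>) = n"
  by (simp add: word_def)

lemma cyl_word: "\<eta> \<in> cyl m ys \<longleftrightarrow> word m (length ys) \<eta> = ys"
  unfolding cyl_def word_def list_eq_iff_nth_eq by simp

lemma word_nth: "i < n \<Longrightarrow> word m n \<eta> ! i = \<eta> (m + int i)"
  by (simp add: word_def)

lemma word_append: "word m (n + l) \<eta> = word m n \<eta> @ word (m + int n) l \<eta>"
  by (rule nth_equalityI) (simp_all add: word_nth nth_append algebra_simps)

lemma word_Suc: "word m (Suc n) \<eta> = \<eta> m # word (m + 1) n \<eta>"
  by (rule nth_equalityI) (simp_all add: word_nth nth_Cons algebra_simps split: nat.splits)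

lemma cyl_append: "cyl m (xs @ ys) = cyl m xs \<inter> cyl (m + int (length xs)) ys"
  by (simp add: set_eq_iff cyl_word word_append)

lemma cyl_Cons: "cyl m (x # xs) = {\<eta>. \<eta> m = x} \<inter> cyl (m + 1) xs"
  by (simp add: set_eq_iff cyl_word word_Suc)

lemma space_config_space [simp]: "space config_space = UNIV"
  by (auto simp: config_space_def space_PiM)

lemma measurable_coordinate [measurable]: "(\<lambda>\<eta>. \<eta> z) \<in> measurable config_space (count_space UNIV)"
  unfolding config_space_def by (rule measurable_component_singleton) simp

lemma sets_coordinate_eq: "{\<eta>. \<eta> z = x} \<in> sets config_space"
proof -
  have "(\<lambda>\<eta>. \<eta> z) -` {x} \<inter> space config_space \<in> sets config_space"
    by (rule measurable_sets[OF measurable_coordinate]) simp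
  then show ?thesis by (simp add: vimage_def)
qed

lemma sets_cyl: "cyl m ys \<in> sets config_space"
proof -
  have "cyl m ys = (\<Inter>i\<in>{..<length ys}. {\<eta>. \<eta> (m + int i) = ys ! i}) \<inter> space config_space"
    by (auto simp: cyl_def)
  then show ?thesis
    by (cases "length ys = 0") (auto simp: cyl_def intro!: sets.finite_INT sets_coordinate_eq simp flip: space_config_space)
qed

lemma finite_words: "finite {ys::bool list. length ys = n}"
  using finite_lists_length_eq[of "UNIV :: bool set" n] by simp

lemma word_event: "{\<eta>. word m n \<eta> \<in> S} = (\<Union>ys\<in>{ys\<in>S. length ys = n}. cyl m ys)"
  by (auto simp: cyl_word)

lemma sets_word_event: "{\<eta>. word m n \<eta> \<in> S} \<in> sets config_space"
  unfolding word_event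
  by (intro sets.finite_UN sets_cyl) (rule finite_subset[OF _ finite_words[of n]], blast)

lemma measurable_word [measurable]: "word m n \<in> measurable config_space (count_space UNIV)"
proof (rule measurableI)
  fix A show "word m n -` A \<inter> space config_space \<in> sets config_space"
    using sets_word_event[of m n A] by (simp add: vimage_def)
qed simp

text \<open>A finite-dimensional event depends on the coordinates in some window [-B, B] and is a
  finite disjoint union of cylinders over that window, so comparing cylinders suffices.\<close>

lemma config_measure_eqI:
  assumes sets: "sets M = sets config_space" "sets N = sets config_space"
    and fin: "prob_space M" "prob_space N"
    and eq: "\<And>m ys. measure M (cyl m ys) = measure N (cyl m ys)"
  shows "M = N"
proof -
  interpret M: prob_space M by fact
  interpret N: prob_space N by fact
  have fd: "measure L {\<eta>. word m n \<eta> \<in> S} = (\<Sum>ys\<in>{ys\<in>S. length ys = n}. measure L (cyl m ys))"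
    if "prob_space L" "sets L = sets config_space" for L m n S
  proof -
    interpret L: prob_space L by fact
    show ?thesis
      unfolding word_event
    proof (rule L.finite_measure_finite_Union)
      show "finite {ys\<in>S. length ys = n}" by (rule finite_subset[OF _ finite_words[of n]]) blast
      show "cyl m ` {ys\<in>S. length ys = n} \<subseteq> L.events" using sets_cyl that(2) by auto
      show "disjoint_family_on (cyl m) {ys\<in>S. length ys = n}"
        by (auto simp: disjoint_family_on_def cyl_word)
    qed
  qed
  show ?thesis
  proof (rule measure_eqI_PiM_infinite)
    show "sets M = sets (Pi\<^sub>M UNIV (\<lambda>_. count_space UNIV))" "sets N = sets (Pi\<^sub>M UNIV (\<lambda>_. count_space UNIV))"
      using sets by (simp_all add: config_space_def)
    show "finite_measure M" by (rule M.finite_measure)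
    fix A :: "int \<Rightarrow> bool set" and J :: "int set" assume J: "finite J"
    obtain B where B: "\<forall>j\<in>J. \<bar>j\<bar> \<le> int B"
    proof -
      have "\<forall>j\<in>J. \<bar>j\<bar> \<le> int (nat (Max (insert 0 (abs ` J))))"
        using J by (auto intro!: Max_ge)
      then show ?thesis using that by blast
    qed
    let ?S = "{ys. length ys = 2 * B + 1 \<and> (\<forall>j\<in>J. ys ! nat (j + int B) \<in> A j)}"
    have "prod_emb UNIV (\<lambda>_. count_space UNIV) J (Pi\<^sub>E J A) = {\<eta>. word (- int B) (2 * B + 1) \<eta> \<in> ?S}"
    proof -
      have "\<eta> j = word (- int B) (2 * B + 1) \<eta> ! nat (j + int B)" if "j \<in> J" for \<eta> j
      proof -
        have "nat (j + int B) < 2 * B + 1" "- int B + int (nat (j + int B)) = j" using B that by force+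
        then show ?thesis by (simp add: word_nth)
      qed
      then have "(\<forall>j\<in>J. \<eta> j \<in> A j) \<longleftrightarrow> word (- int B) (2 * B + 1) \<eta> \<in> ?S" for \<eta> by simp
      moreover have "prod_emb UNIV (\<lambda>_. count_space UNIV) J (Pi\<^sub>E J A) = {\<eta>. \<forall>j\<in>J. \<eta> j \<in> A j}"
        by (auto simp: prod_emb_def PiE_iff restrict_def)
      ultimately show ?thesis by simp
    qed
    note pe = this
    show "emeasure M (prod_emb UNIV (\<lambda>_. count_space UNIV) J (Pi\<^sub>E J A))
      = emeasure N (prod_emb UNIV (\<lambda>_. count_space UNIV) J (Pi\<^sub>E J A))"
      unfolding pe M.emeasure_eq_measure N.emeasure_eq_measure
        fd[OF fin(1) sets(1)] fd[OF fin(2) sets(2)] eq ..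
  qed
qed

section \<open>The stationary chain\<close>

fun path_weight :: "(bool \<Rightarrow> bool \<Rightarrow> real) \<Rightarrow> bool \<Rightarrow> bool list \<Rightarrow> real" where
  "path_weight Q x [] = 1"
| "path_weight Q x (y # ys) = Q x y * path_weight Q y ys"

lemma path_weight_append:
  "path_weight Q x (ys @ zs) = path_weight Q x ys * path_weight Q (last (x # ys)) zs"
  by (induction ys arbitrary: x) auto

lemma path_weight_prod: "path_weight Q x ys = (\<Prod>i<length ys. Q ((x # ys) ! i) ((x # ys) ! Suc i))"
  by (induction ys arbitrary: x) (simp_all add: prod.lessThan_Suc_shift del: prod.lessThan_Suc)

text \<open>Positivity of \<open>Q True False\<close> replaces uniqueness of the stationary law: if
  the state 1 were absorbing, the point mass at 1 would be stationary as well, with mass 1 at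
  1.\<close>

locale chain =
  fixes Q :: "bool \<Rightarrow> bool \<Rightarrow> real" and p :: "bool \<Rightarrow> real" and \<pi> :: "config measure"
  assumes transition: "transition_matrix Q" and stationary: "stationary_prob Q p"
    and Q11: "Q True True > 0" and Q10: "Q True False > 0" and p1: "0 < p True" "p True < 1/2"
    and law: "stationary_chain_law Q p \<pi>"
begin

sublocale prob_space \<pi> using law by (simp add: stationary_chain_law_def)

lemma sets_law [measurable_cong]: "sets \<pi> = sets config_space"
  using law by (simp add: stationary_chain_law_def)

lemma space_law [simp]: "space \<pi> = UNIV"
  using sets_eq_imp_space_eq[OF sets_law] by simp

lemma Q_nonneg: "0 \<le> Q i j" using transition by (simp add: transition_matrix_def)

lemma Q_row: "Q i True + Q i False = 1"
  using transition by (simp add: transition_matrix_def UNIV_bool add.commute)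

lemma p_row: "p True + p False = 1"
  using stationary by (simp add: stationary_prob_def UNIV_bool add.commute)

lemma p_stationary: "p True * Q True j + p False * Q False j = p j"
  using stationary by (simp add: stationary_prob_def UNIV_bool add.commute)

text \<open>With two states, stationarity says that the flow from 1 to 0 equals the flow from 0 to
  1. This is detailed balance and the source of reversibility.\<close>

lemma balance: "p True * Q True False = p False * Q False True"
proof -
  have "p True * (Q True True + Q True False) = p True * Q True True + p False * Q False True"
    using p_stationary[of True] Q_row[of True] by simp
  then show ?thesis by (simp add: algebra_simps)
qed

lemma reversible: "p x * Q x y = p y * Q y x"
  using balance by (cases x; cases y) auto

lemma p0: "0 < p False" "p True < p False" using p_row p1 by auto

lemma Q01: "0 < Q False True" "Q False True < Q True False"
proof -
  have "0 < p True * Q True False" using p1 Q10 by simp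
  then have "0 < p False * Q False True" unfolding balance .
  then show "0 < Q False True" using p0 by (simp add: zero_less_mult_iff)
  then have "p True * Q False True < p False * Q False True" using p0 by simp
  then have "p True * Q False True < p True * Q True False" using balance by simp
  then show "Q False True < Q True False" using p1 by simp
qed

lemma Q00: "0 < Q False False" "Q True True < Q False False"
  using Q_row[of True] Q_row[of False] Q01 Q11 by auto

lemma prob_cyl: "prob (cyl m (y # ys)) = p y * path_weight Q y ys"
proof -
  have "prob {\<eta>. \<forall>i\<le>length ys. \<eta> (m + int i) = (y # ys) ! i} =
    p ((y # ys) ! 0) * (\<Prod>i<length ys. Q ((y # ys) ! i) ((y # ys) ! Suc i))"
    using law by (simp add: stationary_chain_law_def)
  moreover have "{\<eta>. \<forall>i\<le>length ys. \<eta> (m + int i) = (y # ys) ! i} = cyl m (y # ys)"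
    by (auto simp: cyl_def less_Suc_eq_le)
  ultimately show ?thesis by (simp add: path_weight_prod)
qed

lemma prob_cyl_append:
  assumes "ys \<noteq> []"
  shows "prob (cyl m (ys @ zs)) = prob (cyl m ys) * path_weight Q (last ys) zs"
  using assms by (cases ys) (simp_all add: prob_cyl path_weight_append)

lemma prob_word_event: "prob {\<eta>. word m n \<eta> \<in> S} = (\<Sum>ys\<in>{ys\<in>S. length ys = n}. prob (cyl m ys))"
  unfolding word_event
proof (rule finite_measure_finite_Union)
  show "finite {ys\<in>S. length ys = n}" by (rule finite_subset[OF _ finite_words[of n]]) blast
  show "cyl m ` {ys\<in>S. length ys = n} \<subseteq> events" using sets_cyl sets_law by auto
  show "disjoint_family_on (cyl m) {ys\<in>S. length ys = n}" by (auto simp: disjoint_family_on_def cyl_word)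
qed

lemma markov_window:
  assumes n: "0 < n"
  shows "prob ({\<eta>. word m n \<eta> \<in> S} \<inter> {\<eta>. \<eta> (m + int n - 1) = x} \<inter> cyl (m + int n) zs)
    = prob ({\<eta>. word m n \<eta> \<in> S} \<inter> {\<eta>. \<eta> (m + int n - 1) = x}) * path_weight Q x zs"
proof -
  let ?S = "{ys\<in>S. length ys = n \<and> last ys = x}"
  have lst: "\<eta> (m + int n - 1) = last (word m n \<eta>)" for \<eta>
    using n by (subst last_conv_nth) (auto simp: word_def algebra_simps of_nat_diff)
  have 1: "{\<eta>. word m n \<eta> \<in> S} \<inter> {\<eta>. \<eta> (m + int n - 1) = x} = {\<eta>. word m n \<eta> \<in> ?S}"
    using lst by auto
  have 2: "{\<eta>. word m n \<eta> \<in> ?S} \<inter> cyl (m + int n) zs = {\<eta>. word m (n + length zs) \<eta> \<in> (\<lambda>ys. ys @ zs) ` ?S}"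
    by (auto simp: cyl_word word_append)
  have 3: "{ys \<in> (\<lambda>ys. ys @ zs) ` ?S. length ys = n + length zs} = (\<lambda>ys. ys @ zs) ` ?S" by auto
  have 4: "{ys \<in> ?S. length ys = n} = ?S" by auto
  have "prob (cyl m (ys @ zs)) = prob (cyl m ys) * path_weight Q x zs" if "ys \<in> ?S" for ys
    using prob_cyl_append[of ys m zs] that n by force
  then show ?thesis
    unfolding 1 2 prob_word_event 3 4 by (subst sum.reindex) (auto simp: inj_on_def sum_distrib_right)
qed

end

section \<open>The load of the carrier\<close>

text \<open>Stated as the existence of a past position instead of a bound on an infimum: this has a
  meaning for every configuration, and it is an increasing union of events that depend on finite
  windows.\<close>

definition exceeds :: "int \<Rightarrow> nat \<Rightarrow> config set" where
  "exceeds z w = {\<eta>. \<exists>y\<le>z. int w \<le> walk \<eta> z - walk \<eta> y}"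

definition level :: "int \<Rightarrow> nat \<Rightarrow> config set" where
  "level z w = exceeds z w - exceeds z (Suc w)"

definition load :: "config \<Rightarrow> int \<Rightarrow> nat" where
  "load \<eta> z = (LEAST w. \<eta> \<notin> exceeds z (Suc w))"

text \<open>The walk has a finite past minimum seen from every box; only then does
  \<open>load\<close> have its meaning.\<close>

definition good :: "config set" where
  "good = {\<eta>. \<forall>z. \<exists>w. \<eta> \<notin> exceeds z w}"

lemma exceeds_0: "exceeds z 0 = UNIV"
  by (auto simp: exceeds_def)

lemma exceeds_mono: "w \<le> w' \<Longrightarrow> exceeds z w' \<subseteq> exceeds z w"
  by (fastforce simp: exceeds_def)

lemma load_eq_iff: "\<eta> \<in> good \<Longrightarrow> load \<eta> z = w \<longleftrightarrow> \<eta> \<in> level z w"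
proof -
  assume "\<eta> \<in> good"
  then obtain w0 where "\<eta> \<notin> exceeds z w0" by (auto simp: good_def)
  then have "\<eta> \<notin> exceeds z (Suc w0)" using exceeds_mono[of w0 "Suc w0"] by auto
  then have n: "\<eta> \<notin> exceeds z (Suc (load \<eta> z))" unfolding load_def by (rule LeastI)
  have l: "\<eta> \<in> exceeds z (Suc v)" if "v < load \<eta> z" for v using not_less_Least that unfolding load_def by blast
  have i: "\<eta> \<in> exceeds z (load \<eta> z)"
    using l[of "load \<eta> z - 1"] by (cases "load \<eta> z") (auto simp: exceeds_0)
  show ?thesis
  proof
    assume "\<eta> \<in> level z w"
    then have w: "\<eta> \<in> exceeds z w" "\<eta> \<notin> exceeds z (Suc w)" by (auto simp: level_def)
    show "load \<eta> z = w"
      using w n l[of w] exceeds_mono[of "Suc (load \<eta> z)" w z] by (cases "load \<eta> z" w rule: linorder_cases) auto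
  qed (use n i in \<open>auto simp: level_def\<close>)
qed

lemma exceeds_ball: "\<eta> z \<Longrightarrow> \<eta> \<in> exceeds z (Suc w) \<longleftrightarrow> \<eta> \<in> exceeds (z - 1) w"
proof -
  assume e: "\<eta> z"
  have s: "walk \<eta> z = walk \<eta> (z - 1) + 1" using walk_step[of \<eta> "z - 1"] e by simp
  show ?thesis
  proof
    assume "\<eta> \<in> exceeds z (Suc w)"
    then obtain y where "y \<le> z" "int (Suc w) \<le> walk \<eta> z - walk \<eta> y" by (auto simp: exceeds_def)
    then show "\<eta> \<in> exceeds (z - 1) w" using s by (cases "y = z") (auto simp: exceeds_def intro!: exI[of _ y])
  next
    assume "\<eta> \<in> exceeds (z - 1) w"
    then obtain y where "y \<le> z - 1" "int w \<le> walk \<eta> (z - 1) - walk \<eta> y" by (auto simp: exceeds_def)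
    then show "\<eta> \<in> exceeds z (Suc w)" using s by (auto simp: exceeds_def intro!: exI[of _ y])
  qed
qed

lemma exceeds_no_ball: "\<not> \<eta> z \<Longrightarrow> \<eta> \<in> exceeds z (Suc w) \<longleftrightarrow> \<eta> \<in> exceeds (z - 1) (Suc (Suc w))"
proof -
  assume e: "\<not> \<eta> z"
  have s: "walk \<eta> z = walk \<eta> (z - 1) - 1" using walk_step[of \<eta> "z - 1"] e by simp
  show ?thesis
  proof
    assume "\<eta> \<in> exceeds z (Suc w)"
    then obtain y where "y \<le> z" "int (Suc w) \<le> walk \<eta> z - walk \<eta> y" by (auto simp: exceeds_def)
    then show "\<eta> \<in> exceeds (z - 1) (Suc (Suc w))" using s by (cases "y = z") (auto simp: exceeds_def intro!: exI[of _ y])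
  next
    assume "\<eta> \<in> exceeds (z - 1) (Suc (Suc w))"
    then obtain y where "y \<le> z - 1" "int (Suc (Suc w)) \<le> walk \<eta> (z - 1) - walk \<eta> y" by (auto simp: exceeds_def)
    then show "\<eta> \<in> exceeds z (Suc w)" using s by (auto simp: exceeds_def intro!: exI[of _ y])
  qed
qed

lemma level_ball: "\<eta> z \<Longrightarrow> \<eta> \<in> level z (Suc w) \<longleftrightarrow> \<eta> \<in> level (z - 1) w"
  by (simp add: level_def exceeds_ball)

lemma level_0_ball: "\<eta> z \<Longrightarrow> \<eta> \<notin> level z 0"
  by (simp add: level_def exceeds_ball exceeds_0)

lemma level_no_ball: "\<not> \<eta> z \<Longrightarrow> \<eta> \<in> level z (Suc w) \<longleftrightarrow> \<eta> \<in> level (z - 1) (Suc (Suc w))"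
  by (simp add: level_def exceeds_no_ball)

lemma level_0_no_ball: "\<not> \<eta> z \<Longrightarrow> \<eta> \<in> level z 0 \<longleftrightarrow> \<eta> \<in> level (z - 1) 0 \<or> \<eta> \<in> level (z - 1) 1"
  using exceeds_mono[of 1 2 "z - 1"] exceeds_mono[of 0 1 "z - 1"]
  by (auto simp: level_def exceeds_no_ball exceeds_0 numeral_2_eq_2)

text \<open>The load is the walk reflected at 0: an empty box takes one ball out of the carrier if
  there is one, which is the truncated subtraction.\<close>

lemma load_step:
  assumes "\<eta> \<in> good"
  shows "load \<eta> z = (if \<eta> z then Suc (load \<eta> (z - 1)) else load \<eta> (z - 1) - 1)"
proof -
  define w where "w = load \<eta> (z - 1)"
  have w: "\<eta> \<in> level (z - 1) w" unfolding w_def by (rule load_eq_iff[OF assms, THEN iffD1, OF refl])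
  show ?thesis
  proof (cases "\<eta> z")
    case True
    then have "\<eta> \<in> level z (Suc w)" using level_ball w by simp
    then show ?thesis using load_eq_iff[OF assms] True by (simp add: w_def)
  next
    case False
    have "\<eta> \<in> level z (w - 1)"
    proof (cases w)
      case 0
      then show ?thesis using level_0_no_ball[of \<eta> z] False w by simp
    next
      case (Suc v)
      then show ?thesis
        using level_0_no_ball[of \<eta> z] level_no_ball[of \<eta> z] False w by (cases v) auto
    qed
    then show ?thesis using load_eq_iff[OF assms] False by (simp add: w_def)
  qed
qed

text \<open>A new strict minimum is reached exactly by a downward step from a current minimum, that
  is, when the carrier arrives empty at an empty box.\<close>

lemma records_load:
  assumes "\<eta> \<in> good"
  shows "z \<in> records \<eta> \<longleftrightarrow> load \<eta> (z - 1) = 0 \<and> \<not> \<eta> z"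
proof -
  have l: "load \<eta> (z - 1) = 0 \<longleftrightarrow> (\<forall>y\<le>z - 1. walk \<eta> (z - 1) \<le> walk \<eta> y)"
    unfolding load_eq_iff[OF assms] level_def exceeds_0 by (force simp: exceeds_def)
  have s: "walk \<eta> z = walk \<eta> (z - 1) + (if \<eta> z then 1 else - 1)" using walk_step[of \<eta> "z - 1"] by simp
  show ?thesis
  proof
    assume "z \<in> records \<eta>"
    then have r: "walk \<eta> z < walk \<eta> y" if "y < z" for y using that by (simp add: records_def)
    have "\<not> \<eta> z" using r[of "z - 1"] s by (auto split: if_splits)
    moreover have "walk \<eta> (z - 1) \<le> walk \<eta> y" if "y \<le> z - 1" for y using r[of y] that s calculation by simp
    ultimately show "load \<eta> (z - 1) = 0 \<and> \<not> \<eta> z" unfolding l by blast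
  next
    assume a: "load \<eta> (z - 1) = 0 \<and> \<not> \<eta> z"
    then have "walk \<eta> (z - 1) \<le> walk \<eta> y" if "y < z" for y using l that by simp
    then show "z \<in> records \<eta>" using a s unfolding records_def by force
  qed
qed

lemma bbs_load:
  assumes "\<eta> \<in> good"
  shows "bbs \<eta> z \<longleftrightarrow> load \<eta> z < load \<eta> (z - 1)" "\<eta> z \<longleftrightarrow> load \<eta> (z - 1) < load \<eta> z"
  using load_step[OF assms, of z] records_load[OF assms, of z] unfolding bbs_def by auto

section \<open>Measurability\<close>

lemma measurable_window:
  assumes "\<And>\<eta> \<eta>'. word m n \<eta> = word m n \<eta>' \<Longrightarrow> f \<eta> = f \<eta>'"
  shows "f \<in> measurable config_space (count_space UNIV)"
proof -
  have "f = (\<lambda>ys. f (SOME \<eta>. word m n \<eta> = ys)) \<circ> word m n"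
  proof
    fix \<eta>
    have "word m n (SOME \<eta>'. word m n \<eta>' = word m n \<eta>) = word m n \<eta>"
      by (rule someI[where x = \<eta>]) (rule refl)
    from assms[OF this] show "f \<eta> = ((\<lambda>ys. f (SOME \<eta>. word m n \<eta> = ys)) \<circ> word m n) \<eta>" by simp
  qed
  moreover have "(\<lambda>ys. f (SOME \<eta>. word m n \<eta> = ys)) \<circ> word m n \<in> measurable config_space (count_space UNIV)"
    by (rule measurable_comp[OF measurable_word]) simp
  ultimately show ?thesis by metis
qed

lemma word_eqD: "word m n \<eta> = word m n \<eta>' \<Longrightarrow> m \<le> z \<Longrightarrow> z < m + int n \<Longrightarrow> \<eta> z = \<eta>' z"
  using word_nth[of "nat (z - m)" n m \<eta>] word_nth[of "nat (z - m)" n m \<eta>'] by (simp add: nat_less_iff)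

lemma walk_diff_cong:
  assumes "\<And>t. y < t \<Longrightarrow> t \<le> z \<Longrightarrow> \<eta> t = \<eta>' t" "y \<le> z"
  shows "walk \<eta> z - walk \<eta> y = walk \<eta>' z - walk \<eta>' y"
  using assms(2,1)
proof (induction z rule: int_ge_induct)
  case (step z)
  then show ?case using walk_step[of \<eta> z] walk_step[of \<eta>' z] by force
qed simp

lemma measurable_walk [measurable]: "(\<lambda>\<eta>. walk \<eta> z) \<in> measurable config_space (count_space UNIV)"
proof (rule measurable_window[of "- \<bar>z\<bar>" "nat (2 * \<bar>z\<bar> + 1)"])
  fix \<eta> \<eta>' assume a: "word (- \<bar>z\<bar>) (nat (2 * \<bar>z\<bar> + 1)) \<eta> = word (- \<bar>z\<bar>) (nat (2 * \<bar>z\<bar> + 1)) \<eta>'"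
  have e: "\<eta> t = \<eta>' t" if "\<bar>t\<bar> \<le> \<bar>z\<bar>" for t using word_eqD[OF a, of t] that by auto
  show "walk \<eta> z = walk \<eta>' z"
    using walk_diff_cong[of 0 z \<eta> \<eta>'] walk_diff_cong[of z 0 \<eta> \<eta>'] e by (cases "0 \<le> z") (auto simp: walk_0)
qed

lemma measurable_config_spaceI:
  assumes "\<And>z. (\<lambda>x. f x z) \<in> measurable M (count_space UNIV)"
  shows "f \<in> measurable M config_space"
  unfolding config_space_def using measurable_PiM_single'[of UNIV "\<lambda>z x. f x z" M "\<lambda>_. count_space UNIV"] assms
  by auto

lemma sets_exceeds [measurable]: "exceeds z w \<in> sets config_space"
proof -
  have "exceeds z w = {\<eta>\<in>space config_space. \<exists>y\<in>{..z}. int w \<le> walk \<eta> z - walk \<eta> y}" by (auto simp: exceeds_def)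
  also have "\<dots> \<in> sets config_space" by measurable
  finally show ?thesis .
qed

lemma sets_level [measurable]: "level z w \<in> sets config_space"
  unfolding level_def by auto

lemma measurable_load [measurable]: "(\<lambda>\<eta>. load \<eta> z) \<in> measurable config_space (count_space UNIV)"
  unfolding load_def by measurable

lemma sets_record: "{\<eta>. z \<in> records \<eta>} \<in> sets config_space"
proof -
  have "{\<eta>. z \<in> records \<eta>} = {\<eta>\<in>space config_space. \<forall>y\<in>{..<z}. walk \<eta> z < walk \<eta> y}" by (auto simp: records_def)
  also have "\<dots> \<in> sets config_space" by measurable
  finally show ?thesis .
qed

lemma measurable_record [measurable]: "(\<lambda>\<eta>. z \<in> records \<eta>) \<in> measurable config_space (count_space UNIV)"
  using sets_record[of z] by (simp add: pred_def)

lemma measurable_bbs: "bbs \<in> measurable config_space config_space"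
  by (rule measurable_config_spaceI) (simp add: bbs_def)

lemma measurable_shift: "(\<lambda>\<eta> z. \<eta> (f z)) \<in> measurable config_space config_space"
  by (rule measurable_config_spaceI) simp

section \<open>The Markov property with respect to the infinite past\<close>

context chain
begin

lemma events_config: "A \<in> sets config_space \<Longrightarrow> A \<in> events"
  by (simp add: sets_law)

text \<open>The Markov property of the future after z, tested on one event A. The class of such A is
  closed under increasing unions and proper differences, which is enough to pass from window events
  to the events that fix the load.\<close>

definition markov_at :: "int \<Rightarrow> config set \<Rightarrow> bool" where
  "markov_at z A \<longleftrightarrow> A \<in> events \<and> (\<forall>x zs. prob (A \<inter> {\<eta>. \<eta> z = x} \<inter> cyl (z + 1) zs) = prob (A \<inter> {\<eta>. \<eta> z = x}) * path_weight Q x zs)"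

lemma markov_at_window:
  assumes "\<And>\<eta> \<eta>'. word (z - int n) (Suc n) \<eta> = word (z - int n) (Suc n) \<eta>' \<Longrightarrow> \<eta> \<in> A \<Longrightarrow> \<eta>' \<in> A"
  shows "markov_at z A"
proof -
  have A: "A = {\<eta>. word (z - int n) (Suc n) \<eta> \<in> word (z - int n) (Suc n) ` A}"
  proof (intro equalityI subsetI)
    fix \<eta> assume "\<eta> \<in> {\<eta>. word (z - int n) (Suc n) \<eta> \<in> word (z - int n) (Suc n) ` A}"
    then obtain \<eta>' where "\<eta>' \<in> A" "word (z - int n) (Suc n) \<eta>' = word (z - int n) (Suc n) \<eta>" by force
    then show "\<eta> \<in> A" using assms by blast
  qed blast
  have 1: "z - int n + int (Suc n) - 1 = z" "z - int n + int (Suc n) = z + 1" by auto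
  show ?thesis
    unfolding markov_at_def
  proof (intro conjI allI)
    show "A \<in> events" by (subst A, rule events_config, rule sets_word_event)
    show "prob (A \<inter> {\<eta>. \<eta> z = x} \<inter> cyl (z + 1) zs) = prob (A \<inter> {\<eta>. \<eta> z = x}) * path_weight Q x zs" for x zs
      using markov_window[of "Suc n" "z - int n" "word (z - int n) (Suc n) ` A" x zs]
      unfolding A[symmetric] 1 by simp
  qed
qed

lemma markov_at_incseq:
  assumes m: "\<And>n::nat. markov_at z (A n)" and inc: "incseq A"
  shows "markov_at z (\<Union>n. A n)"
  unfolding markov_at_def
proof (intro conjI allI)
  have ev: "A n \<in> events" for n using m by (simp add: markov_at_def)
  then show "(\<Union>n. A n) \<in> events" by blast
  fix x zs
  have X: "{\<eta>. \<eta> z = x} \<in> events" by (intro events_config sets_coordinate_eq)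
  have Z: "cyl (z + 1) zs \<in> events" by (intro events_config sets_cyl)
  have l1: "(\<lambda>n. prob (A n \<inter> {\<eta>. \<eta> z = x} \<inter> cyl (z + 1) zs)) \<longlonglongrightarrow> prob (\<Union>n. A n \<inter> {\<eta>. \<eta> z = x} \<inter> cyl (z + 1) zs)"
    by (rule finite_Lim_measure_incseq) (use ev X Z inc in \<open>auto simp: incseq_def\<close>)
  have l2: "(\<lambda>n. prob (A n \<inter> {\<eta>. \<eta> z = x})) \<longlonglongrightarrow> prob (\<Union>n. A n \<inter> {\<eta>. \<eta> z = x})"
    by (rule finite_Lim_measure_incseq) (use ev X inc in \<open>auto simp: incseq_def\<close>)
  have "(\<lambda>n. prob (A n \<inter> {\<eta>. \<eta> z = x} \<inter> cyl (z + 1) zs)) \<longlonglongrightarrow> prob (\<Union>n. A n \<inter> {\<eta>. \<eta> z = x}) * path_weight Q x zs"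
    using tendsto_mult_right[OF l2, of "path_weight Q x zs"] m by (simp add: markov_at_def)
  from LIMSEQ_unique[OF l1 this]
  show "prob ((\<Union>n. A n) \<inter> {\<eta>. \<eta> z = x} \<inter> cyl (z + 1) zs) = prob ((\<Union>n. A n) \<inter> {\<eta>. \<eta> z = x}) * path_weight Q x zs"
    by (simp add: Int_UN_distrib2)
qed

lemma markov_at_Diff:
  assumes "markov_at z A" "markov_at z B" "B \<subseteq> A"
  shows "markov_at z (A - B)"
  unfolding markov_at_def
proof (intro conjI allI)
  have ev: "A \<in> events" "B \<in> events" using assms by (auto simp: markov_at_def)
  then show "A - B \<in> events" by blast
  fix x zs
  have X: "{\<eta>. \<eta> z = x} \<in> events" by (intro events_config sets_coordinate_eq)
  have Z: "cyl (z + 1) zs \<in> events" by (intro events_config sets_cyl)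
  have e: "(A - B) \<inter> {\<eta>. \<eta> z = x} \<inter> cyl (z + 1) zs = (A \<inter> {\<eta>. \<eta> z = x} \<inter> cyl (z + 1) zs) - (B \<inter> {\<eta>. \<eta> z = x} \<inter> cyl (z + 1) zs)"
    "(A - B) \<inter> {\<eta>. \<eta> z = x} = (A \<inter> {\<eta>. \<eta> z = x}) - (B \<inter> {\<eta>. \<eta> z = x})" by auto
  have p1: "prob ((A \<inter> {\<eta>. \<eta> z = x} \<inter> cyl (z + 1) zs) - (B \<inter> {\<eta>. \<eta> z = x} \<inter> cyl (z + 1) zs))
    = prob (A \<inter> {\<eta>. \<eta> z = x} \<inter> cyl (z + 1) zs) - prob (B \<inter> {\<eta>. \<eta> z = x} \<inter> cyl (z + 1) zs)"
    by (rule finite_measure_Diff) (use ev X Z assms(3) in auto)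
  have p2: "prob ((A \<inter> {\<eta>. \<eta> z = x}) - (B \<inter> {\<eta>. \<eta> z = x})) = prob (A \<inter> {\<eta>. \<eta> z = x}) - prob (B \<inter> {\<eta>. \<eta> z = x})"
    by (rule finite_measure_Diff) (use ev X assms(3) in auto)
  have "prob (A \<inter> {\<eta>. \<eta> z = x} \<inter> cyl (z + 1) zs) = prob (A \<inter> {\<eta>. \<eta> z = x}) * path_weight Q x zs"
    "prob (B \<inter> {\<eta>. \<eta> z = x} \<inter> cyl (z + 1) zs) = prob (B \<inter> {\<eta>. \<eta> z = x}) * path_weight Q x zs"
    using assms(1,2) unfolding markov_at_def by blast+
  moreover have "prob ((A - B) \<inter> {\<eta>. \<eta> z = x} \<inter> cyl (z + 1) zs)
    = prob (A \<inter> {\<eta>. \<eta> z = x} \<inter> cyl (z + 1) zs) - prob (B \<inter> {\<eta>. \<eta> z = x} \<inter> cyl (z + 1) zs)"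
    by (subst e(1)) (rule p1)
  moreover have "prob ((A - B) \<inter> {\<eta>. \<eta> z = x}) = prob (A \<inter> {\<eta>. \<eta> z = x}) - prob (B \<inter> {\<eta>. \<eta> z = x})"
    by (subst e(2)) (rule p2)
  ultimately show "prob ((A - B) \<inter> {\<eta>. \<eta> z = x} \<inter> cyl (z + 1) zs) = prob ((A - B) \<inter> {\<eta>. \<eta> z = x}) * path_weight Q x zs"
    by (simp only: left_diff_distrib)
qed

lemma markov_at_exceeds: "markov_at z (exceeds z w)"
proof -
  let ?A = "\<lambda>n::nat. {\<eta>. \<exists>y. z - int n \<le> y \<and> y \<le> z \<and> int w \<le> walk \<eta> z - walk \<eta> y}"
  have "exceeds z w = (\<Union>n. ?A n)"
  proof (intro equalityI subsetI)
    fix \<eta> assume "\<eta> \<in> exceeds z w"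
    then obtain y where y: "y \<le> z" "int w \<le> walk \<eta> z - walk \<eta> y" by (auto simp: exceeds_def)
    then have "\<eta> \<in> ?A (nat (z - y))" by (auto intro!: exI[of _ y])
    then show "\<eta> \<in> (\<Union>n. ?A n)" by blast
  qed (auto simp: exceeds_def)
  moreover have "markov_at z (\<Union>n. ?A n)"
  proof (rule markov_at_incseq)
    show "incseq ?A"
      unfolding incseq_def
    proof (intro allI impI subsetI)
      fix n n' \<eta> assume "n \<le> n'" "\<eta> \<in> ?A n"
      then obtain y where "z - int n \<le> y" "y \<le> z" "int w \<le> walk \<eta> z - walk \<eta> y" by blast
      then show "\<eta> \<in> ?A n'" using \<open>n \<le> n'\<close> by (auto intro!: exI[of _ y])
    qed
    fix n show "markov_at z (?A n)"
    proof (rule markov_at_window)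
      fix \<eta> \<eta>' assume e: "word (z - int n) (Suc n) \<eta> = word (z - int n) (Suc n) \<eta>'" and "\<eta> \<in> ?A n"
      then obtain y where y: "z - int n \<le> y" "y \<le> z" "int w \<le> walk \<eta> z - walk \<eta> y" by auto
      have "walk \<eta> z - walk \<eta> y = walk \<eta>' z - walk \<eta>' y"
        by (rule walk_diff_cong) (use y word_eqD[OF e] in auto)
      then show "\<eta>' \<in> ?A n" using y by auto
    qed
  qed
  ultimately show ?thesis by simp
qed

lemma markov_at_level: "markov_at z (level z w)"
  unfolding level_def by (intro markov_at_Diff markov_at_exceeds exceeds_mono) simp

section \<open>Stationary joint law of load and box content\<close>

lemma shift_law: "distr \<pi> config_space (\<lambda>\<eta> z. \<eta> (z + 1)) = \<pi>"
proof (rule config_measure_eqI)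
  have m: "(\<lambda>\<eta> z. \<eta> (z + 1)) \<in> measurable \<pi> config_space"
    using measurable_shift[of "\<lambda>z. z + 1"] by (simp add: measurable_cong_sets[OF sets_law refl])
  show "prob_space (distr \<pi> config_space (\<lambda>\<eta> z. \<eta> (z + 1)))" by (rule prob_space_distr[OF m])
  fix m' ys
  have "measure (distr \<pi> config_space (\<lambda>\<eta> z. \<eta> (z + 1))) (cyl m' ys) = prob (cyl (m' + 1) ys)"
    by (subst measure_distr[OF m sets_cyl]) (auto simp: cyl_def algebra_simps intro!: arg_cong[of _ _ prob])
  then show "measure (distr \<pi> config_space (\<lambda>\<eta> z. \<eta> (z + 1))) (cyl m' ys) = prob (cyl m' ys)"
    by (cases ys) (simp_all add: prob_cyl, simp add: cyl_def)
qed (auto simp: sets_law intro: prob_space_axioms)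

definition \<mu> :: "nat \<Rightarrow> bool \<Rightarrow> real" where
  "\<mu> w x = prob (level 0 w \<inter> {\<eta>. \<eta> 0 = x})"

lemma walk_shift: "walk (\<lambda>z. \<eta> (z + 1)) z = walk \<eta> (z + 1) - walk \<eta> 1"
proof (induction z rule: int_induct[where k = 0])
  case base
  then show ?case by (simp add: walk_0)
next
  case (step1 i)
  then show ?case using walk_step[of "\<lambda>z. \<eta> (z + 1)" i] walk_step[of \<eta> "i + 1"] by simp
next
  case (step2 i)
  then show ?case using walk_step[of "\<lambda>z. \<eta> (z + 1)" "i - 1"] walk_step[of \<eta> i] by simp
qed

lemma exceeds_shift: "(\<lambda>z. \<eta> (z + 1)) \<in> exceeds z w \<longleftrightarrow> \<eta> \<in> exceeds (z + 1) w"
proof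
  assume "(\<lambda>z. \<eta> (z + 1)) \<in> exceeds z w"
  then obtain y where "y \<le> z" "int w \<le> walk \<eta> (z + 1) - walk \<eta> (y + 1)" by (auto simp: exceeds_def walk_shift)
  then show "\<eta> \<in> exceeds (z + 1) w" by (auto simp: exceeds_def intro!: exI[of _ "y + 1"])
next
  assume "\<eta> \<in> exceeds (z + 1) w"
  then obtain y where "y \<le> z + 1" "int w \<le> walk \<eta> (z + 1) - walk \<eta> y" by (auto simp: exceeds_def)
  then show "(\<lambda>z. \<eta> (z + 1)) \<in> exceeds z w" by (auto simp: exceeds_def walk_shift intro!: exI[of _ "y - 1"])
qed

lemma level_prob: "prob (level z w \<inter> {\<eta>. \<eta> z = x}) = \<mu> w x"
proof -
  have m: "(\<lambda>\<eta> z. \<eta> (z + 1)) \<in> measurable \<pi> config_space"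
    using measurable_shift[of "\<lambda>z. z + 1"] by (simp add: measurable_cong_sets[OF sets_law refl])
  have s: "prob (level (z + 1) w \<inter> {\<eta>. \<eta> (z + 1) = x}) = prob (level z w \<inter> {\<eta>. \<eta> z = x})" for z
  proof -
    have A: "level z w \<inter> {\<eta>. \<eta> z = x} \<in> sets config_space" using sets_coordinate_eq by auto
    have "prob (level z w \<inter> {\<eta>. \<eta> z = x}) = measure (distr \<pi> config_space (\<lambda>\<eta> z. \<eta> (z + 1))) (level z w \<inter> {\<eta>. \<eta> z = x})"
      by (simp add: shift_law)
    also have "\<dots> = prob (level (z + 1) w \<inter> {\<eta>. \<eta> (z + 1) = x})"
      by (subst measure_distr[OF m A]) (auto simp: level_def exceeds_shift intro!: arg_cong[of _ _ prob])
    finally show ?thesis by simp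
  qed
  show ?thesis
  proof (induction z rule: int_induct[where k = 0])
    case base
    then show ?case by (simp add: \<mu>_def)
  next
    case (step1 i)
    then show ?case using s[of i] by simp
  next
    case (step2 i)
    then show ?case using s[of "i - 1"] by simp
  qed
qed

lemma level_cyl: "prob (level z w \<inter> {\<eta>. \<eta> z = x} \<inter> cyl (z + 1) zs) = \<mu> w x * path_weight Q x zs"
  using markov_at_level[of z w] level_prob[of z w x] by (simp add: markov_at_def)

lemma level_cyl_total: "prob (level z w \<inter> cyl (z + 1) zs) = \<mu> w True * path_weight Q True zs + \<mu> w False * path_weight Q False zs"
proof -
  have ev: "level z w \<inter> {\<eta>. \<eta> z = x} \<inter> cyl (z + 1) zs \<in> events" for x
    using sets_coordinate_eq sets_cyl by (intro events_config) auto
  have "level z w \<inter> cyl (z + 1) zs = (level z w \<inter> {\<eta>. \<eta> z = True} \<inter> cyl (z + 1) zs) \<union> (level z w \<inter> {\<eta>. \<eta> z = False} \<inter> cyl (z + 1) zs)"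
    by auto
  also have "prob \<dots> = prob (level z w \<inter> {\<eta>. \<eta> z = True} \<inter> cyl (z + 1) zs) + prob (level z w \<inter> {\<eta>. \<eta> z = False} \<inter> cyl (z + 1) zs)"
    by (rule finite_measure_Union[OF ev ev]) auto
  finally show ?thesis by (simp only: level_cyl)
qed

lemma level_step: "prob (level z w \<inter> {\<eta>. \<eta> (z + 1) = y}) = \<mu> w True * Q True y + \<mu> w False * Q False y"
proof -
  have "cyl (z + 1) [y] = {\<eta>. \<eta> (z + 1) = y}" by (auto simp: cyl_def)
  then show ?thesis using level_cyl_total[of z w "[y]"] by simp
qed

lemma \<mu>_0_True: "\<mu> 0 True = 0"
proof -
  have "level 0 0 \<inter> {\<eta>. \<eta> 0 = True} = {}" using level_0_ball by auto
  then show ?thesis by (simp add: \<mu>_def)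
qed

lemma \<mu>_Suc_True: "\<mu> (Suc w) True = \<mu> w True * Q True True + \<mu> w False * Q False True"
proof -
  have "level 0 (Suc w) \<inter> {\<eta>. \<eta> 0 = True} = level (-1) w \<inter> {\<eta>. \<eta> (-1 + 1) = True}"
    using level_ball[of _ 0 w] by auto
  then show ?thesis unfolding \<mu>_def[of "Suc w"] by (simp only: level_step)
qed

lemma \<mu>_Suc_False: "\<mu> (Suc w) False = \<mu> (Suc (Suc w)) True * Q True False + \<mu> (Suc (Suc w)) False * Q False False"
proof -
  have "level 0 (Suc w) \<inter> {\<eta>. \<eta> 0 = False} = level (-1) (Suc (Suc w)) \<inter> {\<eta>. \<eta> (-1 + 1) = False}"
    using level_no_ball[of _ 0 w] by auto
  then show ?thesis unfolding \<mu>_def[of "Suc w"] by (simp only: level_step)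
qed

lemma \<mu>_0_False: "\<mu> 0 False = \<mu> 1 True * Q True False + \<mu> 1 False * Q False False + \<mu> 0 False * Q False False"
proof -
  have "level 0 0 \<inter> {\<eta>. \<eta> 0 = False}
    = (level (-1) 1 \<inter> {\<eta>. \<eta> (-1 + 1) = False}) \<union> (level (-1) 0 \<inter> {\<eta>. \<eta> (-1 + 1) = False})"
    using level_0_no_ball[of _ 0] by auto
  moreover have "prob ((level (-1) 1 \<inter> {\<eta>. \<eta> (-1 + 1) = False}) \<union> (level (-1) 0 \<inter> {\<eta>. \<eta> (-1 + 1) = False}))
    = prob (level (-1) 1 \<inter> {\<eta>. \<eta> (-1 + 1) = False}) + prob (level (-1) 0 \<inter> {\<eta>. \<eta> (-1 + 1) = False})"
    by (rule finite_measure_Union)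
       (use sets_coordinate_eq in \<open>auto simp: level_def exceeds_0 intro!: events_config\<close>)
  moreover have "\<mu> 0 False = prob (level 0 0 \<inter> {\<eta>. \<eta> 0 = False})" by (simp only: \<mu>_def)
  ultimately have "\<mu> 0 False = prob (level (-1) 1 \<inter> {\<eta>. \<eta> (-1 + 1) = False}) + prob (level (-1) 0 \<inter> {\<eta>. \<eta> (-1 + 1) = False})"
    by (simp only:)
  then show ?thesis by (simp only: level_step \<mu>_0_True)
qed

definition \<rho> :: real where "\<rho> = Q True True / Q False False"

lemma \<rho>: "0 < \<rho>" "\<rho> < 1" "Q False False * \<rho> = Q True True"
  using Q00 Q11 by (auto simp: \<rho>_def)

text \<open>The equations can be solved forward in the load: the mass with a ball at load w + 1
  comes from load w, and the balance for an empty box then yields the mass without a ball. The ratio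
  \<rho> is the one that makes this geometric. Only \<mu> at (0, False) stays free; it is fixed in
  \<open>\<mu>_0\<close>.\<close>

lemma \<mu>_Suc: "\<mu> (Suc w) True = \<mu> 0 False * Q False True * \<rho> ^ w \<and> \<mu> (Suc w) False = \<mu> 0 False * Q False True * \<rho> ^ Suc w"
proof (induction w)
  case 0
  have 1: "\<mu> 1 True = \<mu> 0 False * Q False True" using \<mu>_Suc_True[of 0] \<mu>_0_True by simp
  have "\<mu> 1 False * Q False False = \<mu> 0 False * (1 - Q False False) - \<mu> 1 True * Q True False"
    using \<mu>_0_False by (simp add: algebra_simps)
  also have "\<dots> = \<mu> 0 False * Q False True * (1 - Q True False)"
    using Q_row[of False] unfolding 1 by (simp add: algebra_simps flip: eq_diff_eq)
  also have "\<dots> = \<mu> 0 False * Q False True * \<rho> * Q False False"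
    using Q_row[of True] \<rho>(3) by (simp add: algebra_simps flip: eq_diff_eq)
  finally show ?case using 1 Q00 by simp
next
  case (Suc w)
  let ?g = "\<mu> 0 False * Q False True"
  have "\<mu> (Suc (Suc w)) True = ?g * \<rho> ^ w * (Q True True + \<rho> * Q False True)"
    using \<mu>_Suc_True[of "Suc w"] Suc by (simp add: algebra_simps)
  also have "Q True True + \<rho> * Q False True = \<rho> * (Q False False + Q False True)"
    using \<rho>(3) by (simp add: algebra_simps)
  also have "Q False False + Q False True = 1" using Q_row[of False] by simp
  finally have 1: "\<mu> (Suc (Suc w)) True = ?g * \<rho> ^ Suc w" by simp
  have "\<mu> (Suc (Suc w)) False * Q False False = \<mu> (Suc w) False - \<mu> (Suc (Suc w)) True * Q True False"
    using \<mu>_Suc_False[of w] by linarith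
  also have "\<dots> = ?g * \<rho> ^ Suc w - ?g * \<rho> ^ Suc w * Q True False"
    using Suc unfolding 1 by simp
  also have "\<dots> = ?g * \<rho> ^ Suc w * Q True True"
    using Q_row[of True] by (simp add: algebra_simps flip: eq_diff_eq)
  also have "\<dots> = ?g * \<rho> ^ Suc (Suc w) * Q False False"
    using \<rho>(3) by (simp add: algebra_simps)
  finally show ?case using 1 Q00 by simp
qed

end

section \<open>A law of large numbers\<close>

lemma filterlim_floor_sqrt: "filterlim floor_sqrt at_top at_top"
  unfolding filterlim_at_top eventually_at_top_linorder
proof (intro allI exI impI)
  fix Z n :: nat assume "Z\<^sup>2 \<le> n"
  then show "Z \<le> floor_sqrt n" by (simp add: le_floor_sqrt_iff)
qed

text \<open>Along the squares n = j^2 the second moments of X_n / n are at most 1/j^2, hence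
  summable, which gives convergence there. Between consecutive squares the bounded increments add at
  most 2j, which is negligible against j^2.\<close>

lemma (in prob_space) slow_growth_AE:
  fixes X :: "nat \<Rightarrow> 'a \<Rightarrow> real"
  assumes meas [measurable]: "\<And>n. X n \<in> borel_measurable M"
    and second: "\<And>n. (\<integral>\<^sup>+x. ennreal ((X n x)\<^sup>2) \<partial>M) \<le> ennreal (real n)"
    and inc: "\<And>n x. \<bar>X (Suc n) x - X n x\<bar> \<le> 1"
  shows "AE x in M. (\<lambda>n. X n x / real n) \<longlonglongrightarrow> 0"
proof -
  let ?Y = "\<lambda>j x. (X ((Suc j)\<^sup>2) x / real ((Suc j)\<^sup>2))\<^sup>2"
  have le: "(\<integral>\<^sup>+x. ennreal (?Y j x) \<partial>M) \<le> ennreal (1 / real ((Suc j)\<^sup>2))" for j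
  proof -
    let ?N = "real ((Suc j)\<^sup>2)"
    have N: "0 < ?N" by simp
    have "(\<integral>\<^sup>+x. ennreal (?Y j x) \<partial>M) = (\<integral>\<^sup>+x. ennreal (1 / ?N\<^sup>2) * ennreal ((X ((Suc j)\<^sup>2) x)\<^sup>2) \<partial>M)"
      by (intro nn_integral_cong) (simp add: power_divide ennreal_mult'[symmetric])
    also have "\<dots> = ennreal (1 / ?N\<^sup>2) * (\<integral>\<^sup>+x. ennreal ((X ((Suc j)\<^sup>2) x)\<^sup>2) \<partial>M)"
      by (rule nn_integral_cmult) simp
    also have "\<dots> \<le> ennreal (1 / ?N\<^sup>2) * ennreal ?N"
      by (rule mult_left_mono[OF second]) simp
    also have "\<dots> = ennreal (1 / ?N\<^sup>2 * ?N)" by (rule ennreal_mult'[symmetric]) simp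
    also have "1 / ?N\<^sup>2 * ?N = 1 / ?N" using N by (simp add: power2_eq_square)
    finally show ?thesis .
  qed
  have summ: "summable (\<lambda>j. 1 / real ((Suc j)\<^sup>2))"
  proof -
    have "summable (\<lambda>j. inverse (real (Suc j) ^ 2))"
      by (subst summable_Suc_iff) (rule inverse_power_summable[of 2, where 'a = real], simp)
    then show ?thesis by (simp add: inverse_eq_divide)
  qed
  have "(\<integral>\<^sup>+x. (\<Sum>j. ennreal (?Y j x)) \<partial>M) = (\<Sum>j. \<integral>\<^sup>+x. ennreal (?Y j x) \<partial>M)"
    by (rule nn_integral_suminf) measurable
  also have "\<dots> \<le> (\<Sum>j. ennreal (1 / real ((Suc j)\<^sup>2)))"
    by (rule suminf_le) (use le in auto)
  also have "\<dots> = ennreal (\<Sum>j. 1 / real ((Suc j)\<^sup>2))"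
    by (rule suminf_ennreal2) (use summ in auto)
  finally have "(\<integral>\<^sup>+x. (\<Sum>j. ennreal (?Y j x)) \<partial>M) \<noteq> \<infinity>" by (auto simp: top_unique)
  then have "AE x in M. (\<Sum>j. ennreal (?Y j x)) \<noteq> \<infinity>"
    by (intro nn_integral_PInf_AE) measurable
  then show ?thesis
  proof eventually_elim
    case (elim x)
    have "summable (\<lambda>j. ?Y j x)"
      by (rule summable_suminf_not_top) (use elim in auto)
    then have "(\<lambda>j. ?Y j x) \<longlonglongrightarrow> 0" by (rule summable_LIMSEQ_zero)
    then have "(\<lambda>j. sqrt (?Y j x)) \<longlonglongrightarrow> sqrt 0" by (rule tendsto_real_sqrt)
    then have "(\<lambda>j. \<bar>X ((Suc j)\<^sup>2) x / real ((Suc j)\<^sup>2)\<bar>) \<longlonglongrightarrow> 0" by simp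
    then have l1: "(\<lambda>k. \<bar>X (k\<^sup>2) x / real (k\<^sup>2)\<bar>) \<longlonglongrightarrow> 0" by (rule LIMSEQ_imp_Suc)
    have l2: "(\<lambda>k. \<bar>X (k\<^sup>2) x / real (k\<^sup>2)\<bar> + 2 / real k) \<longlonglongrightarrow> 0"
      using tendsto_add[OF l1 lim_const_over_n[of "2::real"]] by simp
    have l3: "(\<lambda>n. \<bar>X ((floor_sqrt n)\<^sup>2) x / real ((floor_sqrt n)\<^sup>2)\<bar> + 2 / real (floor_sqrt n)) \<longlonglongrightarrow> 0"
      by (rule filterlim_compose[OF l2 filterlim_floor_sqrt])
    show ?case
    proof (rule Lim_null_comparison[OF _ l3], rule eventually_sequentiallyI[of 1])
      fix n :: nat assume n: "1 \<le> n"
      let ?k = "floor_sqrt n"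
      have k: "1 \<le> ?k" "?k\<^sup>2 \<le> n" "n < (Suc ?k)\<^sup>2"
        using n by (simp_all add: le_floor_sqrt_iff Suc_floor_sqrt_power2_gt)
      have inc': "\<bar>X (m + i) x - X m x\<bar> \<le> real i" for m i
      proof (induction i)
        case (Suc i)
        then show ?case using inc[of "m + i" x] by simp
      qed simp
      have "n \<le> ?k\<^sup>2 + 2 * ?k" using k(3) by (simp add: power2_eq_square)
      then have "real n \<le> real (?k\<^sup>2 + 2 * ?k)" by (rule of_nat_mono)
      then have d: "\<bar>X n x\<bar> \<le> \<bar>X (?k\<^sup>2) x\<bar> + 2 * real ?k"
        using inc'[of "?k\<^sup>2" "n - ?k\<^sup>2"] k(2) by simp
      have k2: "0 < real (?k\<^sup>2)" "real (?k\<^sup>2) \<le> real n" using k by auto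
      have "norm (X n x / real n) = \<bar>X n x\<bar> / real n" by simp
      also have "\<dots> \<le> (\<bar>X (?k\<^sup>2) x\<bar> + 2 * real ?k) / real n" by (rule divide_right_mono[OF d]) simp
      also have "\<dots> \<le> (\<bar>X (?k\<^sup>2) x\<bar> + 2 * real ?k) / real (?k\<^sup>2)"
        by (rule divide_left_mono) (use k2 in auto)
      also have "\<dots> = \<bar>X (?k\<^sup>2) x / real (?k\<^sup>2)\<bar> + 2 / real ?k"
        using k by (simp add: add_divide_distrib power2_eq_square)
      finally show "norm (X n x / real n) \<le> \<bar>X (?k\<^sup>2) x / real (?k\<^sup>2)\<bar> + 2 / real ?k" .
    qed
  qed
qed

context chain
begin

text \<open>Martingale increments; their orthogonality gives the second moments needed in
  \<open>slow_growth_AE\<close>.\<close>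

definition \<delta> :: "config \<Rightarrow> int \<Rightarrow> real" where
  "\<delta> \<eta> z = of_bool (\<eta> (z + 1)) - Q (\<eta> z) True"

definition mart :: "int \<Rightarrow> nat \<Rightarrow> config \<Rightarrow> real" where
  "mart m n \<eta> = (\<Sum>i<n. \<delta> \<eta> (m + int i))"

lemma \<delta>_bound: "\<bar>\<delta> \<eta> z\<bar> \<le> 1"
  using Q_nonneg[of "\<eta> z" True] Q_nonneg[of "\<eta> z" False] Q_row[of "\<eta> z"] by (auto simp: \<delta>_def)

lemma window_borel:
  fixes f :: "config \<Rightarrow> real"
  assumes "\<And>\<eta> \<eta>'. word m n \<eta> = word m n \<eta>' \<Longrightarrow> f \<eta> = f \<eta>'"
  shows "f \<in> borel_measurable \<pi>"
proof -
  have "f \<in> measurable config_space (count_space UNIV)" by (rule measurable_window[OF assms])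
  moreover have "(\<lambda>x. x) \<in> measurable (count_space UNIV) (borel :: real measure)" by simp
  ultimately have "f \<in> measurable config_space borel" using measurable_compose by blast
  then show ?thesis by (simp add: measurable_cong_sets[OF sets_law refl])
qed

lemma mart_window: "word m (Suc n) \<eta> = word m (Suc n) \<eta>' \<Longrightarrow> mart m n \<eta> = mart m n \<eta>'"
  unfolding mart_def \<delta>_def
  by (intro sum.cong refl) (use word_eqD in force)

lemma mart_measurable [measurable]: "mart m n \<in> borel_measurable \<pi>"
  by (rule window_borel) (rule mart_window)

lemma \<delta>_measurable [measurable]: "(\<lambda>\<eta>. \<delta> \<eta> z) \<in> borel_measurable \<pi>"
  by (rule window_borel[of z 2]) (use word_eqD[of z 2] in \<open>force simp: \<delta>_def\<close>)

lemma mart_bound: "\<bar>mart m n \<eta>\<bar> \<le> real n"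
proof -
  have "\<bar>mart m n \<eta>\<bar> \<le> (\<Sum>i<n. \<bar>\<delta> \<eta> (m + int i)\<bar>)" unfolding mart_def by (rule sum_abs)
  also have "\<dots> \<le> (\<Sum>i<n. 1)" by (rule sum_mono) (rule \<delta>_bound)
  finally show ?thesis by simp
qed

text \<open>Given the word, the increment is the indicator of the next ball minus its conditional
  probability, so its mean vanishes on every cylinder that ends at box m + n.\<close>

lemma indicator_\<delta>:
  assumes "length ys = Suc n"
  shows "(\<integral>\<eta>. indicator (cyl m ys) \<eta> * \<delta> \<eta> (m + int n) \<partial>\<pi>) = 0"
proof -
  let ?l = "last ys"
  have ne: "ys \<noteq> []" using assms by auto
  have ev: "cyl m zs \<in> events" for zs by (intro events_config sets_cyl)
  have "indicator (cyl m ys) \<eta> * \<delta> \<eta> (m + int n) =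
    indicator (cyl m (ys @ [True])) \<eta> - Q ?l True * indicator (cyl m ys) \<eta>" for \<eta>
  proof (cases "\<eta> \<in> cyl m ys")
    case True
    then have "\<eta> (m + int n) = ?l"
      using assms ne by (simp add: cyl_def last_conv_nth)
    moreover have "\<eta> \<in> cyl m (ys @ [True]) \<longleftrightarrow> \<eta> (m + int n + 1)"
      using True assms by (simp add: cyl_append cyl_Cons add.assoc) (simp add: cyl_def add.commute)
    ultimately show ?thesis using True by (simp add: \<delta>_def indicator_def)
  next
    case False
    then show ?thesis by (simp add: cyl_append)
  qed
  then have "(\<integral>\<eta>. indicator (cyl m ys) \<eta> * \<delta> \<eta> (m + int n) \<partial>\<pi>) =
    prob (cyl m (ys @ [True])) - Q ?l True * prob (cyl m ys)"
    using ev by (simp add: Bochner_Integration.integral_diff integrable_indicator_iff emeasure_eq_measure)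
  also have "\<dots> = 0" using prob_cyl_append[OF ne, of m "[True]"] by simp
  finally show ?thesis .
qed

text \<open>The earlier sum takes one value F(ys) on each cylinder of length n + 1, so the product
  splits into finitely many terms of the form treated in \<open>indicator_\<delta>\<close>.\<close>

lemma mart_orthogonal: "(\<integral>\<eta>. mart m n \<eta> * \<delta> \<eta> (m + int n) \<partial>\<pi>) = 0"
proof -
  define F where "F ys = mart m n (SOME \<eta>. word m (Suc n) \<eta> = ys)" for ys
  let ?L = "{ys::bool list. length ys = Suc n}"
  have F: "mart m n \<eta> = F (word m (Suc n) \<eta>)" for \<eta>
  proof -
    have "word m (Suc n) (SOME \<eta>'. word m (Suc n) \<eta>' = word m (Suc n) \<eta>) = word m (Suc n) \<eta>"
      by (rule someI[where x = \<eta>]) (rule refl)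
    from mart_window[OF this] show ?thesis unfolding F_def by simp
  qed
  have "mart m n \<eta> * \<delta> \<eta> (m + int n) = (\<Sum>ys\<in>?L. F ys * (indicator (cyl m ys) \<eta> * \<delta> \<eta> (m + int n)))" for \<eta>
  proof -
    have "(\<Sum>ys\<in>?L. F ys * (indicator (cyl m ys) \<eta> * \<delta> \<eta> (m + int n)))
      = (\<Sum>ys\<in>?L. if ys = word m (Suc n) \<eta> then F ys * \<delta> \<eta> (m + int n) else 0)"
      by (rule sum.cong[OF refl]) (auto simp: cyl_word indicator_def)
    also have "\<dots> = F (word m (Suc n) \<eta>) * \<delta> \<eta> (m + int n)"
      by (subst sum.delta[OF finite_words]) simp
    finally show ?thesis by (simp add: F)
  qed
  then have "(\<integral>\<eta>. mart m n \<eta> * \<delta> \<eta> (m + int n) \<partial>\<pi>) =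
    (\<integral>\<eta>. (\<Sum>ys\<in>?L. F ys * (indicator (cyl m ys) \<eta> * \<delta> \<eta> (m + int n))) \<partial>\<pi>)" by simp
  also have "\<dots> = (\<Sum>ys\<in>?L. \<integral>\<eta>. F ys * (indicator (cyl m ys) \<eta> * \<delta> \<eta> (m + int n)) \<partial>\<pi>)"
  proof (rule Bochner_Integration.integral_sum)
    fix ys
    have "cyl m ys \<in> events" by (intro events_config sets_cyl)
    then have "integrable \<pi> (\<lambda>\<eta>. indicator (cyl m ys) \<eta> * \<delta> \<eta> (m + int n))"
      using \<delta>_bound by (intro integrable_const_bound[of _ 1]) (auto simp: indicator_def)
    then show "integrable \<pi> (\<lambda>\<eta>. F ys * (indicator (cyl m ys) \<eta> * \<delta> \<eta> (m + int n)))" by simp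
  qed
  also have "\<dots> = 0" by (simp add: indicator_\<delta>)
  finally show ?thesis .
qed

lemma mart_integrable:
  "integrable \<pi> (\<lambda>\<eta>. (mart m n \<eta>)\<^sup>2)" "integrable \<pi> (\<lambda>\<eta>. mart m n \<eta> * \<delta> \<eta> z)" "integrable \<pi> (\<lambda>\<eta>. (\<delta> \<eta> z)\<^sup>2)"
proof -
  show "integrable \<pi> (\<lambda>\<eta>. (mart m n \<eta>)\<^sup>2)"
    by (rule integrable_const_bound[of _ "(real n)\<^sup>2"]) (simp_all add: power2_le_iff_abs_le mart_bound)
  show "integrable \<pi> (\<lambda>\<eta>. mart m n \<eta> * \<delta> \<eta> z)"
  proof (rule integrable_const_bound[of _ "real n * 1"])
    show "AE \<eta> in \<pi>. norm (mart m n \<eta> * \<delta> \<eta> z) \<le> real n * 1"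
      unfolding real_norm_def abs_mult by (intro AE_I2 mult_mono mart_bound \<delta>_bound) simp_all
  qed simp
  show "integrable \<pi> (\<lambda>\<eta>. (\<delta> \<eta> z)\<^sup>2)"
    by (rule integrable_const_bound[of _ 1]) (use \<delta>_bound in \<open>auto simp: abs_square_le_1\<close>)
qed

lemma mart_second_moment: "(\<integral>\<eta>. (mart m n \<eta>)\<^sup>2 \<partial>\<pi>) \<le> real n"
proof (induction n)
  case 0
  then show ?case by (simp add: mart_def)
next
  case (Suc n)
  let ?d = "\<lambda>\<eta>. \<delta> \<eta> (m + int n)"
  have "(mart m (Suc n) \<eta>)\<^sup>2 = (mart m n \<eta>)\<^sup>2 + 2 * (mart m n \<eta> * ?d \<eta>) + (?d \<eta>)\<^sup>2" for \<eta>
    by (simp add: mart_def power2_eq_square algebra_simps)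
  then have "(\<integral>\<eta>. (mart m (Suc n) \<eta>)\<^sup>2 \<partial>\<pi>) = (\<integral>\<eta>. (mart m n \<eta>)\<^sup>2 \<partial>\<pi>) + 2 * (\<integral>\<eta>. mart m n \<eta> * ?d \<eta> \<partial>\<pi>) + (\<integral>\<eta>. (?d \<eta>)\<^sup>2 \<partial>\<pi>)"
    by (simp add: mart_integrable)
  also have "\<dots> \<le> real n + 0 + 1"
  proof (intro add_mono)
    show "(\<integral>\<eta>. (?d \<eta>)\<^sup>2 \<partial>\<pi>) \<le> 1"
      by (rule integral_le_const[OF mart_integrable(3)]) (use \<delta>_bound in \<open>auto simp: abs_square_le_1\<close>)
  qed (simp_all add: mart_orthogonal Suc)
  finally show ?case by simp
qed

lemma mart_second_moment_nn: "(\<integral>\<^sup>+\<eta>. ennreal ((mart m n \<eta>)\<^sup>2) \<partial>\<pi>) \<le> ennreal (real n)"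
  using mart_second_moment[of m n] nn_integral_eq_integral[OF mart_integrable(1), of m n] by (simp add: ennreal_leI)

lemma mart_AE:
  "AE \<eta> in \<pi>. (\<lambda>n. mart 0 n \<eta> / real n) \<longlonglongrightarrow> 0"
  "AE \<eta> in \<pi>. (\<lambda>n. mart (- int n) n \<eta> / real n) \<longlonglongrightarrow> 0"
proof -
  show "AE \<eta> in \<pi>. (\<lambda>n. mart 0 n \<eta> / real n) \<longlonglongrightarrow> 0"
  proof (rule slow_growth_AE)
    fix n \<eta>
    show "\<bar>mart 0 (Suc n) \<eta> - mart 0 n \<eta>\<bar> \<le> 1" using \<delta>_bound by (simp add: mart_def)
  qed (auto intro: mart_second_moment_nn)
  show "AE \<eta> in \<pi>. (\<lambda>n. mart (- int n) n \<eta> / real n) \<longlonglongrightarrow> 0"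
  proof (rule slow_growth_AE)
    fix n \<eta>
    \<comment> \<open>On the left half-line the window grows at its first box. The bounds on
      increments and second moments hold for every starting point, so the same criterion
      applies.\<close>
    have "mart (- int (Suc n)) (Suc n) \<eta> = \<delta> \<eta> (- int (Suc n)) + mart (- int n) n \<eta>"
      unfolding mart_def by (simp add: sum.lessThan_Suc_shift algebra_simps del: sum.lessThan_Suc)
    then show "\<bar>mart (- int (Suc n)) (Suc n) \<eta> - mart (- int n) n \<eta>\<bar> \<le> 1" using \<delta>_bound by simp
  qed (auto intro: mart_second_moment_nn)
qed

text \<open>Q(x, 1) is affine in x, with slope Q(1,1) - Q(0,1). So the martingale is, up to two
  boundary terms, the ball count times 1 - (Q(1,1) - Q(0,1)) = Q(0,1) + Q(1,0), centred by n
  Q(0,1).\<close>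

lemma mart_sum:
  "\<bar>(Q False True + Q True False) * (\<Sum>z\<in>{m..m + int n}. of_bool (\<eta> z)) - real n * Q False True - mart m n \<eta>\<bar> \<le> 2"
proof -
  let ?b = "\<lambda>z. of_bool (\<eta> z) :: real" and ?th = "Q True True - Q False True"
  have Qb: "Q (\<eta> z) True = Q False True + ?th * ?b z" for z by simp
  have S: "(\<Sum>z\<in>{m..m + int n}. ?b z) = (\<Sum>i<n. ?b (m + int i)) + ?b (m + int n)" for n
  proof (induction n)
    case (Suc n)
    have "{m..m + int (Suc n)} = insert (m + int (Suc n)) {m..m + int n}" by auto
    then show ?case using Suc by simp
  qed simp
  have S': "(\<Sum>z\<in>{m..m + int n}. ?b z) = ?b m + (\<Sum>i<n. ?b (m + int i + 1))" for n
  proof (induction n)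
    case (Suc n)
    have "{m..m + int (Suc n)} = insert (m + int (Suc n)) {m..m + int n}" by auto
    then show ?case using Suc by (simp add: algebra_simps)
  qed simp
  let ?S = "\<Sum>z\<in>{m..m + int n}. ?b z"
  have "mart m n \<eta> = (\<Sum>i<n. ?b (m + int i + 1)) - real n * Q False True - ?th * (\<Sum>i<n. ?b (m + int i))"
    unfolding mart_def \<delta>_def Qb by (simp add: sum_subtractf sum.distrib sum_distrib_left algebra_simps)
  also have "\<dots> = ?S - ?b m - real n * Q False True - ?th * (?S - ?b (m + int n))"
    using S[of n] S'[of n] by simp
  finally have M: "mart m n \<eta> = (1 - ?th) * ?S - real n * Q False True - ?b m + ?th * ?b (m + int n)"
    by (simp add: algebra_simps)
  have "1 - ?th = Q False True + Q True False" using Q_row[of True] by simp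
  then have "(Q False True + Q True False) * ?S - real n * Q False True - mart m n \<eta> = ?b m - ?th * ?b (m + int n)"
    using M by simp
  moreover have "\<bar>?th\<bar> \<le> 1"
    using Q_nonneg Q_row[of True] Q_row[of False] by (smt (verit))
  then have "\<bar>?b m - ?th * ?b (m + int n)\<bar> \<le> 2" by (cases "\<eta> m"; cases "\<eta> (m + int n)") auto
  ultimately show ?thesis by simp
qed

lemma p1_eq: "p True = Q False True / (Q False True + Q True False)"
proof -
  have "p True * Q True False = (1 - p True) * Q False True" using balance p_row by (simp add: algebra_simps flip: eq_diff_eq)
  then have "p True * (Q False True + Q True False) = Q False True" by (simp add: algebra_simps)
  then show ?thesis using Q01 Q10 by (simp add: field_simps)
qed

lemma density_limit:
  assumes "(\<lambda>n. mart (m n) n \<eta> / real n) \<longlonglongrightarrow> 0"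
  shows "(\<lambda>n. (\<Sum>z\<in>{m n..m n + int n}. of_bool (\<eta> z)) / real n) \<longlonglongrightarrow> p True"
proof -
  let ?c = "Q False True + Q True False" and ?S = "\<lambda>n. \<Sum>z\<in>{m n..m n + int n}. (of_bool (\<eta> z) :: real)"
  let ?r = "\<lambda>n. ?c * ?S n - real n * Q False True - mart (m n) n \<eta>"
  have c: "0 < ?c" using Q01 Q10 by simp
  have r: "(\<lambda>n. ?r n / real n) \<longlonglongrightarrow> 0"
  proof (rule Lim_null_comparison[OF _ lim_const_over_n[of "2::real"]], rule always_eventually, rule allI)
    fix n
    have "norm (?r n / real n) = \<bar>?r n\<bar> / real n" by simp
    also have "\<dots> \<le> 2 / real n" by (rule divide_right_mono[OF mart_sum]) simp
    finally show "norm (?r n / real n) \<le> 2 / real n" .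
  qed
  have "(\<lambda>n. (?r n / real n + mart (m n) n \<eta> / real n + Q False True) / ?c) \<longlonglongrightarrow> (0 + 0 + Q False True) / ?c"
    by (intro tendsto_intros r assms) (use c in auto)
  moreover have "eventually (\<lambda>n. (?r n / real n + mart (m n) n \<eta> / real n + Q False True) / ?c = ?S n / real n) sequentially"
  proof (rule eventually_sequentiallyI[of 1])
    fix n :: nat assume n: "1 \<le> n"
    have "?r n / real n + mart (m n) n \<eta> / real n + Q False True = ?c * ?S n / real n"
      using n by (simp add: diff_divide_distrib)
    then show "(?r n / real n + mart (m n) n \<eta> / real n + Q False True) / ?c = ?S n / real n" using c by simp
  qed
  ultimately show ?thesis using p1_eq by (simp add: tendsto_cong)
qed

lemma configs_AE: "AE \<eta> in \<pi>. \<eta> \<in> configs"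
  using mart_AE
proof eventually_elim
  case (elim \<eta>)
  have "\<eta> \<in> configs_density (p True)"
    unfolding configs_density_def
    using density_limit[OF elim(1)] density_limit[OF elim(2)] by simp
  then show ?case using p1 unfolding configs_def by auto
qed

end

section \<open>Configurations of density less than one half\<close>

definition drifting :: "config \<Rightarrow> bool" where
  "drifting \<eta> \<longleftrightarrow> (\<forall>K. \<exists>Y. \<forall>y\<le>Y. K \<le> walk \<eta> y) \<and> (\<forall>K. \<exists>Y. \<forall>y\<ge>Y. walk \<eta> y \<le> K)"

lemma walk_right: "walk \<eta> (int y) = 2 * (\<Sum>z\<in>{1..int y}. of_bool (\<eta> z)) - int y"
  by (simp add: walk_def sum_subtractf sum_distrib_left)

lemma walk_left: "walk \<eta> (- int y) = int y - 2 * (\<Sum>z\<in>{- int y + 1..0}. of_bool (\<eta> z))"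
  by (simp add: walk_def sum_subtractf sum_distrib_left)

text \<open>With c strictly between the density and 1/2, the walk eventually lies outside a wedge of
  slope 1 - 2c > 0 on both sides. The later arguments about records need only this consequence of
  having a density.\<close>

lemma configs_drifting:
  assumes "\<eta> \<in> configs"
  shows "drifting \<eta>"
proof -
  obtain l where l: "l < 1/2" "(\<lambda>y. (\<Sum>z\<in>{- int y..0}. of_bool (\<eta> z)) / real y) \<longlonglongrightarrow> l"
    "(\<lambda>y. (\<Sum>z\<in>{0..int y}. of_bool (\<eta> z)) / real y) \<longlonglongrightarrow> l"
    using assms by (auto simp: configs_def configs_density_def)
  define c where "c = (l + 1/2) / 2"
  have c: "l < c" "c < 1/2" using l by (auto simp: c_def)
  obtain N where N: "\<And>y. N \<le> y \<Longrightarrow> (\<Sum>z\<in>{- int y..0}. of_bool (\<eta> z)) / real y < c"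
    using order_tendstoD(2)[OF l(2) c(1)] unfolding eventually_sequentially by blast
  obtain N' where N': "\<And>y. N' \<le> y \<Longrightarrow> (\<Sum>z\<in>{0..int y}. of_bool (\<eta> z)) / real y < c"
    using order_tendstoD(2)[OF l(3) c(1)] unfolding eventually_sequentially by blast
  have left: "real y * (1 - 2 * c) \<le> real_of_int (walk \<eta> (- int y))" if "N \<le> y" "1 \<le> y" for y
  proof -
    have "(\<Sum>z\<in>{- int y + 1..0}. of_bool (\<eta> z) :: real) \<le> (\<Sum>z\<in>{- int y..0}. of_bool (\<eta> z))"
      by (rule sum_mono2) auto
    also have "\<dots> \<le> c * real y" using N[OF that(1)] that(2) by (simp add: field_simps)
    finally show ?thesis unfolding walk_left by (simp add: algebra_simps)
  qed
  have right: "real_of_int (walk \<eta> (int y)) \<le> - (real y * (1 - 2 * c))" if "N' \<le> y" "1 \<le> y" for y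
  proof -
    have "(\<Sum>z\<in>{1..int y}. of_bool (\<eta> z) :: real) \<le> (\<Sum>z\<in>{0..int y}. of_bool (\<eta> z))"
      by (rule sum_mono2) auto
    also have "\<dots> \<le> c * real y" using N'[OF that(1)] that(2) by (simp add: field_simps)
    finally show ?thesis unfolding walk_right by (simp add: algebra_simps)
  qed
  have big: "\<exists>n. \<forall>y\<ge>n. \<bar>real_of_int K\<bar> \<le> real y * (1 - 2 * c)" for K
  proof -
    obtain n :: nat where n: "\<bar>real_of_int K\<bar> / (1 - 2 * c) \<le> real n" using real_arch_simple by blast
    have "\<bar>real_of_int K\<bar> \<le> real y * (1 - 2 * c)" if "n \<le> y" for y
    proof -
      have "\<bar>real_of_int K\<bar> \<le> real n * (1 - 2 * c)" using n c by (simp add: pos_divide_le_eq)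
      also have "\<dots> \<le> real y * (1 - 2 * c)" using that c by (intro mult_right_mono) auto
      finally show ?thesis .
    qed
    then show ?thesis by blast
  qed
  show ?thesis
    unfolding drifting_def
  proof (intro conjI allI)
    fix K :: int
    obtain n where n: "\<And>y. n \<le> y \<Longrightarrow> \<bar>real_of_int K\<bar> \<le> real y * (1 - 2 * c)" using big by blast
    have "K \<le> walk \<eta> y" if y: "y \<le> - int (Suc (max n N))" for y
    proof -
      have "\<bar>real_of_int K\<bar> \<le> real_of_int (walk \<eta> (- int (nat (- y))))"
        using n[of "nat (- y)"] left[of "nat (- y)"] y by linarith
      moreover have "- int (nat (- y)) = y" using y by simp
      ultimately show ?thesis by simp
    qed
    then show "\<exists>Y. \<forall>y\<le>Y. K \<le> walk \<eta> y" by blast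
    have "walk \<eta> y \<le> K" if y: "int (Suc (max n N')) \<le> y" for y
    proof -
      have "real_of_int (walk \<eta> (int (nat y))) \<le> - \<bar>real_of_int K\<bar>"
        using n[of "nat y"] right[of "nat y"] y by linarith
      moreover have "int (nat y) = y" using y by simp
      ultimately show ?thesis by simp
    qed
    then show "\<exists>Y. \<forall>y\<ge>Y. walk \<eta> y \<le> K" by blast
  qed
qed

lemma drifting_good:
  assumes "drifting \<eta>"
  shows "\<eta> \<in> good"
proof -
  have "\<exists>w. \<eta> \<notin> exceeds z w" for z
  proof -
    obtain Y where Y: "\<And>y. y \<le> Y \<Longrightarrow> walk \<eta> z \<le> walk \<eta> y" using assms unfolding drifting_def by blast
    define B where "B = Max (insert 0 ((\<lambda>y. walk \<eta> z - walk \<eta> y) ` {Y..z}))"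
    have B: "walk \<eta> z - walk \<eta> y \<le> B" if "y \<le> z" for y
    proof (cases "y \<le> Y")
      case True
      have "0 \<le> B" unfolding B_def by (rule Max_ge) auto
      then show ?thesis using Y[OF True] by linarith
    next
      case False
      then show ?thesis unfolding B_def using that by (intro Max_ge) auto
    qed
    have "\<eta> \<notin> exceeds z (Suc (nat B))"
    proof
      assume "\<eta> \<in> exceeds z (Suc (nat B))"
      then obtain y where "y \<le> z" "int (Suc (nat B)) \<le> walk \<eta> z - walk \<eta> y" by (auto simp: exceeds_def)
      then show False using B[of y] by linarith
    qed
    then show ?thesis by blast
  qed
  then show ?thesis by (simp add: good_def)
qed

text \<open>The union over the uncountably many densities is rewritten with the Cauchy criterion and
  the limits themselves, which are measurable functions of the configuration.\<close>

lemma sets_configs: "configs \<in> sets config_space"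
proof -
  let ?L = "\<lambda>\<eta> y. (\<Sum>z\<in>{- int y..0}. of_bool (\<eta> z)) / real y"
  let ?R = "\<lambda>\<eta> y. (\<Sum>z\<in>{0..int y}. of_bool (\<eta> z)) / real y"
  have [measurable]: "(\<lambda>\<eta>. of_bool (\<eta> z) :: real) \<in> borel_measurable config_space" for z by simp
  have "configs = {\<eta>\<in>space config_space. Cauchy (?L \<eta>) \<and> Cauchy (?R \<eta>) \<and> lim (?L \<eta>) = lim (?R \<eta>) \<and> lim (?L \<eta>) < 1/2}"
  proof (intro equalityI subsetI)
    fix \<eta> assume "\<eta> \<in> configs"
    then obtain l where "l < 1/2" "?L \<eta> \<longlonglongrightarrow> l" "?R \<eta> \<longlonglongrightarrow> l" by (auto simp: configs_def configs_density_def)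
    then show "\<eta> \<in> {\<eta>\<in>space config_space. Cauchy (?L \<eta>) \<and> Cauchy (?R \<eta>) \<and> lim (?L \<eta>) = lim (?R \<eta>) \<and> lim (?L \<eta>) < 1/2}"
      using LIMSEQ_imp_Cauchy limI by fastforce
  next
    fix \<eta> assume a: "\<eta> \<in> {\<eta>\<in>space config_space. Cauchy (?L \<eta>) \<and> Cauchy (?R \<eta>) \<and> lim (?L \<eta>) = lim (?R \<eta>) \<and> lim (?L \<eta>) < 1/2}"
    then have l: "?L \<eta> \<longlonglongrightarrow> lim (?L \<eta>)" "?R \<eta> \<longlonglongrightarrow> lim (?L \<eta>)"
      using Cauchy_convergent[of "?L \<eta>"] Cauchy_convergent[of "?R \<eta>"] by (auto simp: convergent_LIMSEQ_iff)
    have "0 \<le> lim (?L \<eta>)" by (rule LIMSEQ_le_const[OF l(1)]) (auto intro!: exI[of _ 0] divide_nonneg_nonneg sum_nonneg)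
    then show "\<eta> \<in> configs" using l a by (auto simp: configs_def configs_density_def)
  qed
  also have "\<dots> \<in> sets config_space"
    by (intro sets.sets_Collect sets_Collect_Cauchy) measurable
  finally show ?thesis .
qed

context chain
begin

lemma good_AE: "AE \<eta> in \<pi>. \<eta> \<in> good"
  using configs_AE by eventually_elim (rule drifting_good[OF configs_drifting])

lemma level_disjoint: "w \<noteq> w' \<Longrightarrow> level z w \<inter> level z w' = {}"
  using exceeds_mono[of "Suc w" w' z] exceeds_mono[of "Suc w'" w z]
  by (cases w w' rule: linorder_cases) (auto simp: level_def)

text \<open>Normalization: the masses with a ball form a geometric series in the load whose sum must
  be the probability p_1 of a ball. Detailed balance then turns the constant into 1 - 2 p_1.\<close>

lemma \<mu>_0: "\<mu> 0 False * Q False False = 1 - 2 * p True"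
proof -
  let ?g = "\<mu> 0 False * Q False True" and ?A = "\<lambda>w. level 0 w \<inter> {\<eta>. \<eta> 0 = True}"
  have ev: "?A w \<in> events" for w using sets_coordinate_eq by (intro events_config) auto
  have "(\<lambda>w. prob (?A w)) sums prob (\<Union>w. ?A w)"
    by (rule finite_measure_UNION) (use ev level_disjoint in \<open>auto simp: disjoint_family_on_def\<close>)
  also have "prob (\<Union>w. ?A w) = prob {\<eta>. \<eta> 0 = True}"
  proof (rule finite_measure_eq_AE)
    show "AE \<eta> in \<pi>. (\<eta> \<in> (\<Union>w. ?A w)) = (\<eta> \<in> {\<eta>. \<eta> 0 = True})"
      using good_AE
    proof eventually_elim
      case (elim \<eta>)
      have "\<eta> \<in> level 0 (load \<eta> 0)" using load_eq_iff[OF elim] by blast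
      then show ?case by blast
    qed
    show "(\<Union>w. ?A w) \<in> events" using ev by blast
    show "{\<eta>. \<eta> 0 = True} \<in> events" by (intro events_config sets_coordinate_eq)
  qed
  also have "prob {\<eta>. \<eta> 0 = True} = p True"
  proof -
    have "{\<eta>. \<eta> 0 = True} = cyl 0 [True]" by (auto simp: cyl_def)
    then show ?thesis by (simp only: prob_cyl) simp
  qed
  finally have "(\<lambda>w. \<mu> w True) sums p True" by (simp only: level_prob)
  then have "(\<lambda>w. \<mu> (Suc w) True) sums p True" using sums_Suc_iff[of "\<lambda>w. \<mu> w True" "p True"] \<mu>_0_True by simp
  moreover have "(\<lambda>w. \<mu> (Suc w) True) sums (?g * (1 / (1 - \<rho>)))"
  proof -
    have "(\<lambda>w. ?g * \<rho> ^ w) sums (?g * (1 / (1 - \<rho>)))" by (intro sums_mult geometric_sums) (use \<rho> in simp)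
    then show ?thesis by (simp only: \<mu>_Suc[THEN conjunct1])
  qed
  ultimately have "p True = ?g * (1 / (1 - \<rho>))" by (rule sums_unique2)
  then have g: "?g = p True * (1 - \<rho>)" using \<rho> by simp
  have "\<mu> 0 False * Q False False * Q False True = ?g * Q False False" by simp
  also have "\<dots> = p True * (Q False False - Q False False * \<rho>)" unfolding g by (simp add: algebra_simps)
  also have "Q False False - Q False False * \<rho> = Q True False - Q False True"
    unfolding \<rho>(3) using Q_row[of True] Q_row[of False] by linarith
  also have "p True * (Q True False - Q False True) = (p False - p True) * Q False True"
    using balance by (simp add: algebra_simps)
  also have "p False - p True = 1 - 2 * p True" using p_row by simp
  finally show ?thesis using Q01(1) by simp
qed

text \<open>A record at r means load 0 at r - 1 followed by an empty box. By the Markov property at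
  r - 1 the boxes behind r then follow the chain started from an empty box.\<close>

lemma record_cyl: "prob ({\<eta>. r \<in> records \<eta>} \<inter> cyl (r + 1) zs) = (1 - 2 * p True) * path_weight Q False zs"
proof -
  have "prob ({\<eta>. r \<in> records \<eta>} \<inter> cyl (r + 1) zs) = prob (level (r - 1) 0 \<inter> cyl (r - 1 + 1) (False # zs))"
  proof (rule finite_measure_eq_AE)
    show "AE \<eta> in \<pi>. (\<eta> \<in> {\<eta>. r \<in> records \<eta>} \<inter> cyl (r + 1) zs) = (\<eta> \<in> level (r - 1) 0 \<inter> cyl (r - 1 + 1) (False # zs))"
      using good_AE
    proof eventually_elim
      case (elim \<eta>)
      then show ?case
        using records_load[OF elim, of r] load_eq_iff[OF elim, of "r - 1" 0] by (auto simp: cyl_Cons)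
    qed
    show "{\<eta>. r \<in> records \<eta>} \<inter> cyl (r + 1) zs \<in> events"
      using sets_record sets_cyl by (intro events_config) auto
    show "level (r - 1) 0 \<inter> cyl (r - 1 + 1) (False # zs) \<in> events"
      using sets_cyl by (intro events_config) auto
  qed
  also have "\<dots> = \<mu> 0 False * Q False False * path_weight Q False zs"
    unfolding level_cyl_total by (simp add: \<mu>_0_True)
  finally show ?thesis by (simp add: \<mu>_0)
qed

section \<open>Invariance under the dynamics\<close>

definition load_path :: "int \<Rightarrow> nat \<Rightarrow> config \<Rightarrow> nat list" where
  "load_path m l \<eta> = map (\<lambda>i. load \<eta> (m + int i)) [0..<l + 1]"

lemma load_path_nth: "i \<le> l \<Longrightarrow> load_path m l \<eta> ! i = load \<eta> (m + int i)"
  by (simp add: load_path_def del: upt_Suc)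

lemma length_load_path [simp]: "length (load_path m l \<eta>) = Suc l"
  by (simp add: load_path_def)

fun ups :: "nat list \<Rightarrow> bool list" where
  "ups (u # v # ws) = (u < v) # ups (v # ws)"
| "ups ws = []"

fun valid_path :: "nat list \<Rightarrow> bool" where
  "valid_path (u # v # ws) \<longleftrightarrow> (v = Suc u \<or> v = u - 1) \<and> valid_path (v # ws)"
| "valid_path ws \<longleftrightarrow> True"

lemma length_ups: "length (ups ws) = length ws - 1"
  by (induction ws rule: ups.induct) auto

lemma ups_append: "ups (ws @ [u, v]) = ups (ws @ [u]) @ [u < v]"
  by (induction ws rule: ups.induct) auto

lemma valid_path_append: "valid_path (ws @ [u, v]) \<longleftrightarrow> valid_path (ws @ [u]) \<and> (v = Suc u \<or> v = u - 1)"
  by (induction ws rule: ups.induct) auto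

definition path_prob :: "nat list \<Rightarrow> real" where
  "path_prob ws = (if valid_path ws then \<mu> (hd ws) True * path_weight Q True (ups ws)
     + \<mu> (hd ws) False * path_weight Q False (ups ws) else 0)"

text \<open>Transition probability of the chain of oriented edges of the load. The content of a box
  is read off from the direction of the step into it; the step from 0 to 0 is an empty box.\<close>

definition turn :: "nat \<Rightarrow> nat \<Rightarrow> nat \<Rightarrow> real" where
  "turn u v w = (if w = Suc v \<or> w = v - 1 then Q (u < v) (v < w) else 0)"

lemma path_prob_snoc: "path_prob (ws @ [u, v, w]) = path_prob (ws @ [u, v]) * turn u v w"
proof -
  have 1: "valid_path (ws @ [u, v, w]) \<longleftrightarrow> valid_path (ws @ [u, v]) \<and> (w = Suc v \<or> w = v - 1)"
    using valid_path_append[of "ws @ [u]" v w] by simp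
  have 2: "ups (ws @ [u, v, w]) = ups (ws @ [u, v]) @ [v < w]" using ups_append[of "ws @ [u]" v w] by simp
  have 3: "last (x # ups (ws @ [u, v])) = (u < v)" for x by (simp add: ups_append)
  have 4: "hd (ws @ [u, v, w]) = hd (ws @ [u, v])" by (cases ws) auto
  show ?thesis unfolding path_prob_def 1 2 4 turn_def path_weight_append 3 by (simp add: algebra_simps)
qed

text \<open>Stationary mass of the oriented edge that starts at \<open>u\<close>, upwards or not.\<close>

definition edge :: "nat \<Rightarrow> bool \<Rightarrow> real" where
  "edge u s = \<mu> u True * Q True s + \<mu> u False * Q False s"

lemma edge_simps:
  "edge u True = \<mu> 0 False * Q False True * \<rho> ^ u"
  "edge (Suc u) False = \<mu> 0 False * Q False True * \<rho> ^ u"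
  "edge 0 False = \<mu> 0 False * Q False False"
proof -
  show "edge u True = \<mu> 0 False * Q False True * \<rho> ^ u"
    using \<mu>_Suc_True[of u] \<mu>_Suc[of u] by (simp add: edge_def)
  show "edge 0 False = \<mu> 0 False * Q False False" by (simp add: edge_def \<mu>_0_True)
  have "edge (Suc u) False = \<mu> 0 False * Q False True * \<rho> ^ u * (Q True False + Q False False * \<rho>)"
    using \<mu>_Suc[of u] by (simp add: edge_def algebra_simps)
  also have "Q True False + Q False False * \<rho> = 1" using \<rho>(3) Q_row[of True] by simp
  finally show "edge (Suc u) False = \<mu> 0 False * Q False True * \<rho> ^ u" by simp
qed

lemma path_prob_Cons: "path_prob (u # v # ws) = (if valid_path (u # v # ws) then edge u (u < v) * path_weight Q (u < v) (ups (v # ws)) else 0)"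
  by (simp add: path_prob_def edge_def algebra_simps)

text \<open>The mass of the path u, v, w against that of its reversal w, v, u. By
  \<open>edge_simps\<close> the edges from u to u + 1 and back have equal mass, so only the turns
  have to be compared: a change of direction costs the same both ways, and for two steps in one
  direction \<rho> = Q(1,1)/Q(0,0) compensates.\<close>

lemma edge_turn:
  assumes "v = Suc u \<or> v = u - 1" "w = Suc v \<or> w = v - 1"
  shows "edge u (u < v) * Q (u < v) (v < w) = edge v (v < w) * turn w v u"
proof -
  have r: "Q True True = \<rho> * Q False False"
    using \<rho>(3) by (simp add: mult.commute)
  consider (uu) "v = Suc u" "w = Suc v" | (ud) "v = Suc u" "w = u" | (du) v' where "u = Suc v" "w = Suc v"
    | (dd) v' where "u = Suc v" "v = Suc v'" "w = v'" | (d0) "u = 1" "v = 0" "w = 0"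
    | (z0) "u = 0" "v = 0" "w = 0" | (zu) "u = 0" "v = 0" "w = 1"
    using assms by (cases u; cases v) auto
  then show ?thesis
    by cases (use r in \<open>simp_all add: edge_simps turn_def\<close>)
qed

lemma path_prob_first: "path_prob (u # v # w # ws) = turn w v u * path_prob (v # w # ws)"
proof (cases "valid_path (u # v # w # ws)")
  case True
  then have v: "v = Suc u \<or> v = u - 1" "w = Suc v \<or> w = v - 1" "valid_path (v # w # ws)" by auto
  have "path_prob (u # v # w # ws) = edge u (u < v) * Q (u < v) (v < w) * path_weight Q (v < w) (ups (w # ws))"
    unfolding path_prob_Cons using True by simp
  also have "\<dots> = turn w v u * (edge v (v < w) * path_weight Q (v < w) (ups (w # ws)))"
    unfolding edge_turn[OF v(1,2)] by simp
  finally show ?thesis unfolding path_prob_Cons[of v] using v by simp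
next
  case False
  then have "\<not> (v = Suc u \<or> v = u - 1) \<or> \<not> valid_path (v # w # ws)" by auto
  moreover have "turn w v u = 0" if "\<not> (v = Suc u \<or> v = u - 1)" "valid_path (v # w # ws)"
    using that by (auto simp: turn_def)
  ultimately show ?thesis using False unfolding path_prob_Cons by auto
qed

text \<open>Removing the first step of a path costs the same factor as removing the last step of the
  reversed path, so the two are compared by induction on the path.\<close>

lemma path_prob_rev: "path_prob (rev ws) = path_prob ws"
proof (induction ws rule: induct_list012)
  case (3 u v ws)
  show ?case
  proof (cases ws)
    case Nil
    have "path_prob [v, u] = path_prob [u, v]"
      unfolding path_prob_Cons
      by (cases "v = Suc u"; cases "u = Suc v") (auto simp: edge_simps)
    then show ?thesis using Nil by simp
  next
    case (Cons w ws')
    have "path_prob (rev (u # v # ws)) = path_prob (rev ws' @ [w, v, u])" using Cons by simp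
    also have "\<dots> = path_prob (rev (v # ws)) * turn w v u" unfolding path_prob_snoc using Cons by simp
    also have "\<dots> = path_prob (u # v # ws)" using 3 Cons path_prob_first by simp
    finally show ?thesis .
  qed
qed auto

lemma load_path_Suc: "load_path m (Suc l) \<eta> = load \<eta> m # load_path (m + 1) l \<eta>"
  by (rule nth_equalityI) (auto simp: load_path_nth nth_Cons algebra_simps split: nat.splits)

lemma load_path_valid:
  assumes g: "\<eta> \<in> good"
  shows "valid_path (load_path m l \<eta>)" "ups (load_path m l \<eta>) = word (m + 1) l \<eta>"
proof -
  have hd: "load_path m l \<eta> = load \<eta> m # tl (load_path m l \<eta>)" for m l
    by (cases l) (simp_all add: load_path_Suc, simp add: load_path_def)
  have "valid_path (load_path m l \<eta>) \<and> ups (load_path m l \<eta>) = word (m + 1) l \<eta>"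
  proof (induction l arbitrary: m)
    case 0
    then show ?case by (simp add: load_path_def word_def)
  next
    case (Suc l)
    have s: "load \<eta> (m + 1) = (if \<eta> (m + 1) then Suc (load \<eta> m) else load \<eta> m - 1)"
      using load_step[OF g, of "m + 1"] by simp
    obtain t where t: "load_path (m + 1) l \<eta> = load \<eta> (m + 1) # t" using hd by blast
    have "valid_path (load \<eta> (m + 1) # t)" "ups (load \<eta> (m + 1) # t) = word (m + 1 + 1) l \<eta>"
      using Suc[of "m + 1"] unfolding t by blast+
    then show ?case unfolding load_path_Suc t word_Suc using s by (auto split: if_splits)
  qed
  then show "valid_path (load_path m l \<eta>)" "ups (load_path m l \<eta>) = word (m + 1) l \<eta>" by auto
qed

lemma load_path_downs:
  assumes g: "\<eta> \<in> good"
  shows "word (m + 1) l (bbs \<eta>) = rev (ups (rev (load_path m l \<eta>)))"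
proof (induction l)
  case 0
  then show ?case by (simp add: load_path_def word_def)
next
  case (Suc l)
  have 1: "load_path m (Suc l) \<eta> = load_path m l \<eta> @ [load \<eta> (m + int (Suc l))]" by (simp add: load_path_def)
  have 2: "load_path m l \<eta> = butlast (load_path m l \<eta>) @ [load \<eta> (m + int l)]" by (simp add: load_path_def)
  have 3: "rev (load_path m (Suc l) \<eta>) = load \<eta> (m + int (Suc l)) # load \<eta> (m + int l) # rev (butlast (load_path m l \<eta>))"
    unfolding 1 by (subst 2) simp
  have 4: "rev (load_path m l \<eta>) = load \<eta> (m + int l) # rev (butlast (load_path m l \<eta>))" by (subst 2) simp
  have "word (m + 1) (Suc l) (bbs \<eta>) = word (m + 1) l (bbs \<eta>) @ [bbs \<eta> (m + 1 + int l)]"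
    using word_append[of "m + 1" l 1 "bbs \<eta>"] by (simp add: word_def)
  also have "bbs \<eta> (m + 1 + int l) \<longleftrightarrow> load \<eta> (m + int (Suc l)) < load \<eta> (m + int l)"
    using bbs_load(1)[OF g, of "m + 1 + int l"] by (simp add: algebra_simps)
  finally show ?case unfolding 3 using Suc 4 by simp
qed

lemma measurable_load_path [measurable]: "load_path m l \<in> measurable \<pi> (count_space UNIV)"
proof -
  have "load_path m l \<in> measurable config_space (count_space UNIV)"
  proof (rule measurableI)
    fix A :: "nat list set"
    have "load_path m l -` A \<inter> space config_space = (\<Union>ws\<in>{ws\<in>A. length ws = Suc l}. {\<eta>\<in>space config_space. \<forall>i\<in>{..l}. load \<eta> (m + int i) = ws ! i})"
    proof (intro equalityI subsetI)
      fix \<eta> assume "\<eta> \<in> load_path m l -` A \<inter> space config_space"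
      then show "\<eta> \<in> (\<Union>ws\<in>{ws\<in>A. length ws = Suc l}. {\<eta>\<in>space config_space. \<forall>i\<in>{..l}. load \<eta> (m + int i) = ws ! i})"
        by (intro UN_I[of "load_path m l \<eta>"]) (auto simp: load_path_nth)
    next
      fix \<eta> assume "\<eta> \<in> (\<Union>ws\<in>{ws\<in>A. length ws = Suc l}. {\<eta>\<in>space config_space. \<forall>i\<in>{..l}. load \<eta> (m + int i) = ws ! i})"
      then obtain ws where ws: "ws \<in> A" "length ws = Suc l" "\<And>i. i \<le> l \<Longrightarrow> load \<eta> (m + int i) = ws ! i" by auto
      then have "load_path m l \<eta> = ws" by (intro nth_equalityI) (auto simp: load_path_nth)
      then show "\<eta> \<in> load_path m l -` A \<inter> space config_space" using ws by simp
    qed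
    also have "\<dots> \<in> sets config_space"
    proof -
      have "{\<eta>\<in>space config_space. \<forall>i\<in>{..l}. load \<eta> (m + int i) = ws ! i} \<in> sets config_space" for ws :: "nat list"
        by measurable
      then show ?thesis by (intro sets.countable_UN' countableI_type) blast
    qed
    finally show "load_path m l -` A \<inter> space config_space \<in> sets config_space" .
  qed simp
  then show ?thesis by (simp add: measurable_cong_sets[OF sets_law refl])
qed

lemma prob_load_path:
  assumes "length ws = Suc l"
  shows "prob {\<eta>. load_path m l \<eta> = ws} = path_prob ws"
proof (cases "valid_path ws")
  case True
  have "prob {\<eta>. load_path m l \<eta> = ws} = prob (level m (hd ws) \<inter> cyl (m + 1) (ups ws))"
  proof (rule finite_measure_eq_AE)
    show "AE \<eta> in \<pi>. (\<eta> \<in> {\<eta>. load_path m l \<eta> = ws}) = (\<eta> \<in> level m (hd ws) \<inter> cyl (m + 1) (ups ws))"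
      using good_AE
    proof eventually_elim
      case (elim \<eta>)
      have hd: "hd (load_path m l \<eta>) = load \<eta> m" by (cases l) (simp_all add: load_path_Suc, simp add: load_path_def)
      have inj: "ws = ws'" if "hd ws = hd ws'" "ups ws = ups ws'" "valid_path ws" "valid_path ws'" "length ws = length ws'" for ws ws'
        using that(5,1-4)
      proof (induction ws ws' rule: list_induct2)
        case (Cons x xs y ys)
        then show ?case by (cases xs; cases ys) auto
      qed simp
      have lu: "length (ups ws) = l" using assms by (simp add: length_ups)
      show ?case
      proof
        assume "\<eta> \<in> {\<eta>. load_path m l \<eta> = ws}"
        then have e: "load_path m l \<eta> = ws" by simp
        then have "load \<eta> m = hd ws" "word (m + 1) l \<eta> = ups ws" using hd load_path_valid(2)[OF elim, of m l] by auto
        then show "\<eta> \<in> level m (hd ws) \<inter> cyl (m + 1) (ups ws)"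
          using load_eq_iff[OF elim, of m] lu by (simp add: cyl_word)
      next
        assume "\<eta> \<in> level m (hd ws) \<inter> cyl (m + 1) (ups ws)"
        then have "load \<eta> m = hd ws" "word (m + 1) l \<eta> = ups ws" using load_eq_iff[OF elim, of m] lu by (auto simp: cyl_word)
        then show "\<eta> \<in> {\<eta>. load_path m l \<eta> = ws}"
          using inj[of "load_path m l \<eta>" ws] hd load_path_valid[OF elim, of m l] True assms by simp
      qed
    qed
    show "{\<eta>. load_path m l \<eta> = ws} \<in> events"
      using measurable_sets[OF measurable_load_path, of "{ws}" m l] by (simp add: vimage_def)
    show "level m (hd ws) \<inter> cyl (m + 1) (ups ws) \<in> events"
      using sets_cyl by (intro events_config) auto
  qed
  also have "\<dots> = path_prob ws" unfolding level_cyl_total path_prob_def using True by simp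
  finally show ?thesis .
next
  case False
  have "prob {\<eta>. load_path m l \<eta> = ws} = prob {}"
  proof (rule finite_measure_eq_AE)
    show "AE \<eta> in \<pi>. (\<eta> \<in> {\<eta>. load_path m l \<eta> = ws}) = (\<eta> \<in> {})"
      using good_AE by eventually_elim (use load_path_valid(1) False in blast)
    show "{\<eta>. load_path m l \<eta> = ws} \<in> events"
      using measurable_sets[OF measurable_load_path, of "{ws}" m l] by (simp add: vimage_def)
  qed simp
  then show ?thesis using False by (simp add: path_prob_def)
qed

lemma load_path_reversal:
  "distr \<pi> (count_space UNIV) (\<lambda>\<eta>. rev (load_path m l \<eta>)) = distr \<pi> (count_space UNIV) (load_path m l)"
proof -
  have m: "(\<lambda>\<eta>. rev (load_path m l \<eta>)) \<in> measurable \<pi> (count_space UNIV)"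
    by (rule measurable_compose[OF measurable_load_path]) simp
  show ?thesis
  proof (rule measure_eqI_countable[of _ UNIV])
    fix ws :: "nat list"
    have "prob {\<eta>. rev (load_path m l \<eta>) = ws} = prob {\<eta>. load_path m l \<eta> = ws}"
    proof (cases "length ws = Suc l")
      case True
      have "{\<eta>. rev (load_path m l \<eta>) = ws} = {\<eta>. load_path m l \<eta> = rev ws}" by auto
      then show ?thesis using True by (simp add: prob_load_path path_prob_rev)
    next
      case False
      then have "rev (load_path m l \<eta>) \<noteq> ws" "load_path m l \<eta> \<noteq> ws" for \<eta>
        by (metis length_load_path length_rev)+
      then show ?thesis by simp
    qed
    then show "emeasure (distr \<pi> (count_space UNIV) (\<lambda>\<eta>. rev (load_path m l \<eta>))) {ws}
      = emeasure (distr \<pi> (count_space UNIV) (load_path m l)) {ws}"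
      by (simp add: emeasure_distr[OF m] emeasure_distr vimage_def emeasure_eq_measure)
  qed simp_all
qed

text \<open>The time reversal of the load path turns the balls of \<open>bbs \<eta>\<close> into the balls of the reversed
  configuration.\<close>

lemma prob_cyl_rev: "prob (cyl m (rev ys)) = prob (cyl m' ys)"
proof -
  have "p x * path_weight Q x ys = p (last (x # ys)) * path_weight Q (last (x # ys)) (tl (rev (x # ys)))" for x and ys :: "bool list"
  proof (induction ys arbitrary: x)
    case (Cons y ys)
    let ?l = "last (y # ys)"
    have rne: "rev (y # ys) \<noteq> []" by simp
    have "path_weight Q ?l (tl (rev (x # y # ys))) = path_weight Q ?l (tl (rev (y # ys)) @ [x])"
      using rne by (simp del: rev.simps add: rev.simps(2)[of x])
    also have "\<dots> = path_weight Q ?l (tl (rev (y # ys))) * Q (last (?l # tl (rev (y # ys)))) x"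
      by (simp add: path_weight_append)
    also have "last (?l # tl (rev (y # ys))) = y"
      by (cases ys rule: rev_cases) auto
    finally have "p ?l * path_weight Q ?l (tl (rev (x # y # ys))) = p y * path_weight Q y ys * Q y x"
      using Cons[of y] by simp
    then show ?case using reversible[of x y] by (simp add: algebra_simps)
  qed simp
  note rev_weight = this
  have rev_prob: "prob (cyl m (rev (x # ys))) = p (last (x # ys)) * path_weight Q (last (x # ys)) (tl (rev (x # ys)))" for x ys
  proof -
    have "rev (x # ys) = last (x # ys) # tl (rev (x # ys))"
      by (metis hd_Cons_tl hd_rev list.distinct(1) rev_is_Nil_conv)
    then show ?thesis using prob_cyl by metis
  qed
  show ?thesis
  proof (cases ys)
    case Nil
    then show ?thesis by (simp add: cyl_def)
  next
    case (Cons x xs)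
    show ?thesis unfolding Cons rev_prob prob_cyl by (rule rev_weight[symmetric])
  qed
qed

theorem bbs_invariant: "distr \<pi> \<pi> bbs = \<pi>"
proof (rule config_measure_eqI)
  have m: "bbs \<in> measurable \<pi> \<pi>"
    using measurable_bbs by (simp add: measurable_cong_sets[OF sets_law sets_law])
  show "prob_space (distr \<pi> \<pi> bbs)" by (rule prob_space_distr[OF m])
  fix k :: int and ys :: "bool list"
  let ?l = "length ys" and ?m = "k - 1"
  have ev: "load_path ?m ?l -` A \<inter> space \<pi> \<in> events" for A by (rule measurable_sets[OF measurable_load_path]) simp
  have rm: "(\<lambda>\<eta>. rev (load_path ?m ?l \<eta>)) \<in> measurable \<pi> (count_space UNIV)"
    by (rule measurable_compose[OF measurable_load_path]) simp
  have ev': "(\<lambda>\<eta>. rev (load_path ?m ?l \<eta>)) -` A \<inter> space \<pi> \<in> events" for A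
    by (rule measurable_sets[OF rm]) simp
  have "measure (distr \<pi> \<pi> bbs) (cyl k ys) = prob (bbs -` cyl k ys)"
    by (subst measure_distr[OF m]) (use sets_cyl sets_law in auto)
  also have "\<dots> = prob ((\<lambda>\<eta>. rev (load_path ?m ?l \<eta>)) -` {ws. ups ws = rev ys})"
  proof (rule finite_measure_eq_AE)
    show "AE \<eta> in \<pi>. (\<eta> \<in> bbs -` cyl k ys) = (\<eta> \<in> (\<lambda>\<eta>. rev (load_path ?m ?l \<eta>)) -` {ws. ups ws = rev ys})"
      using good_AE
    proof eventually_elim
      case (elim \<eta>)
      then show ?case using load_path_downs[OF elim, of ?m ?l] by (simp add: cyl_word rev_swap)
    qed
    show "bbs -` cyl k ys \<in> events" using measurable_sets[OF m, of "cyl k ys"] sets_cyl sets_law by simp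
  qed (use ev'[of "{ws. ups ws = rev ys}"] in simp)
  also have "\<dots> = measure (distr \<pi> (count_space UNIV) (\<lambda>\<eta>. rev (load_path ?m ?l \<eta>))) {ws. ups ws = rev ys}"
    by (subst measure_distr[OF rm]) auto
  also have "\<dots> = prob (load_path ?m ?l -` {ws. ups ws = rev ys})"
    unfolding load_path_reversal by (subst measure_distr) auto
  also have "\<dots> = prob (cyl k (rev ys))"
  proof (rule finite_measure_eq_AE)
    show "AE \<eta> in \<pi>. (\<eta> \<in> load_path ?m ?l -` {ws. ups ws = rev ys}) = (\<eta> \<in> cyl k (rev ys))"
      using good_AE by eventually_elim (use load_path_valid(2) in \<open>simp add: cyl_word\<close>)
    show "cyl k (rev ys) \<in> events" by (intro events_config sets_cyl)
  qed (use ev[of "{ws. ups ws = rev ys}"] in simp)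
  also have "\<dots> = prob (cyl k ys)" by (rule prob_cyl_rev)
  finally show "measure (distr \<pi> \<pi> bbs) (cyl k ys) = prob (cyl k ys)" .
qed (use sets_law prob_space_axioms in auto)

end

section \<open>Records and excursions of a drifting configuration\<close>

lemma Least_int:
  fixes P :: "int \<Rightarrow> bool"
  assumes "P z" "\<And>y. P y \<Longrightarrow> B \<le> y"
  shows "P (LEAST z. P z)" "\<And>y. P y \<Longrightarrow> (LEAST z. P z) \<le> y"
proof -
  let ?Q = "\<lambda>n. P (B + int n)"
  have ex: "\<exists>n. ?Q n" using assms(1) assms(2)[OF assms(1)] by (intro exI[of _ "nat (z - B)"]) simp
  have P: "P (B + int (LEAST n. ?Q n))" using LeastI_ex[OF ex] .
  have le: "B + int (LEAST n. ?Q n) \<le> y" if "P y" for y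
    using Least_le[of ?Q "nat (y - B)"] assms(2)[OF that] that by simp
  have eq: "(LEAST z. P z) = B + int (LEAST n. ?Q n)" by (rule Least_equality[where P = P, OF P le])
  show "P (LEAST z. P z)" unfolding eq by (rule P)
  show "\<And>y. P y \<Longrightarrow> (LEAST z. P z) \<le> y" unfolding eq by (rule le)
qed

lemma walk_crossing:
  assumes "y \<le> z" "walk \<eta> z \<le> k" "k \<le> walk \<eta> y"
  shows "\<exists>x. y \<le> x \<and> x \<le> z \<and> walk \<eta> x = k"
  using assms
proof (induction z rule: int_ge_induct)
  case base
  then show ?case by force
next
  case (step z)
  show ?case
  proof (cases "walk \<eta> z \<le> k")
    case True
    then show ?thesis using step by force
  next
    case False
    then have "walk \<eta> (z + 1) = k" using step walk_step[of \<eta> z] by (auto split: if_splits)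
    then show ?thesis using step by (intro exI[of _ "z + 1"]) simp
  qed
qed

text \<open>The word has 2n + 1 letters. Its last letter belongs to the empty box of the next
  record, so the words of consecutive excursions can be concatenated without gaps.\<close>

definition exc_word :: "int list \<Rightarrow> bool list" where
  "exc_word \<epsilon> = word 1 (length \<epsilon>) (ball_config \<epsilon>)"

lemma length_exc_word [simp]: "length (exc_word \<epsilon>) = length \<epsilon>"
  by (simp add: exc_word_def)

context
  fixes \<eta> :: config
  assumes dr: "drifting \<eta>"
begin

lemma record_pos_props:
  shows walk_record_pos: "walk \<eta> (record_pos \<eta> i) = - i"
    and walk_before_record_pos: "z < record_pos \<eta> i \<Longrightarrow> - i < walk \<eta> z"
proof -
  obtain Y where Y: "\<And>y. y \<le> Y \<Longrightarrow> - i + 1 \<le> walk \<eta> y" using dr unfolding drifting_def by blast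
  obtain Y' where Y': "\<And>y. y \<ge> Y' \<Longrightarrow> walk \<eta> y \<le> - i" using dr unfolding drifting_def by blast
  obtain x where x: "walk \<eta> x = - i"
    using walk_crossing[of "min Y Y'" "max Y Y'" \<eta> "- i"] Y[of "min Y Y'"] Y'[of "max Y Y'"] by force
  have B: "Y \<le> y" if "walk \<eta> y = - i" for y using Y[of y] that by force
  note L = Least_int[of "\<lambda>z. walk \<eta> z = - i", OF x B]
  show "walk \<eta> (record_pos \<eta> i) = - i" unfolding record_pos_def by (rule L(1))
  show "- i < walk \<eta> z" if "z < record_pos \<eta> i"
  proof (rule ccontr)
    assume "\<not> - i < walk \<eta> z"
    then obtain x where "x \<le> z" "walk \<eta> x = - i"
      using walk_crossing[of "min Y z" z \<eta> "- i"] Y[of "min Y z"] by force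
    then show False using L(2)[of x] that unfolding record_pos_def by linarith
  qed
qed

lemma record_pos_record: "record_pos \<eta> i \<in> records \<eta>"
  using record_pos_props unfolding records_def by simp

lemma record_pos_eqI:
  assumes "walk \<eta> z = - i" "\<And>y. y < z \<Longrightarrow> - i < walk \<eta> y"
  shows "record_pos \<eta> i = z"
  using walk_record_pos[of i] walk_before_record_pos[of z i] assms(1) assms(2)[of "record_pos \<eta> i"]
  by (cases "record_pos \<eta> i" z rule: linorder_cases) auto

lemma record_is_record_pos: "z \<in> records \<eta> \<Longrightarrow> record_pos \<eta> (- walk \<eta> z) = z"
  by (rule record_pos_eqI) (auto simp: records_def)

lemma record_pos_less: "i < j \<Longrightarrow> record_pos \<eta> i < record_pos \<eta> j"
  using walk_record_pos[of i] walk_record_pos[of j] walk_before_record_pos[of "record_pos \<eta> j" i]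
  by (cases "record_pos \<eta> i" "record_pos \<eta> j" rule: linorder_cases) auto

lemma record_pos_mono: "strict_mono (record_pos \<eta>)"
  by (simp add: strict_mono_def record_pos_less)

lemma excursion_at_props:
  shows length_excursion_at: "int (length (excursion_at \<eta> i)) = record_pos \<eta> (i + 1) - record_pos \<eta> i"
    and excursion_at_nth: "z < length (excursion_at \<eta> i) \<Longrightarrow> excursion_at \<eta> i ! z = walk \<eta> (record_pos \<eta> i + int z) + i"
    and excursion_at_in: "excursion_at \<eta> i \<in> excursions"
proof -
  let ?r = "record_pos \<eta> i" and ?r' = "record_pos \<eta> (i + 1)"
  have rr: "?r < ?r'" by (rule record_pos_less) simp
  show len: "int (length (excursion_at \<eta> i)) = ?r' - ?r" using rr by (simp add: excursion_at_def)
  show nth: "excursion_at \<eta> i ! z = walk \<eta> (?r + int z) + i" if "z < length (excursion_at \<eta> i)" for z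
    using that len walk_record_pos[of i] by (simp add: excursion_at_def)
  have last: "walk \<eta> (?r' - 1) = - i"
    using walk_step[of \<eta> "?r' - 1"] walk_record_pos[of "i + 1"] walk_before_record_pos[of "?r' - 1" "i + 1"]
    by (auto split: if_splits)
  have "even (?r' - 1 - ?r)"
    using walk_parity[of \<eta> "?r' - 1"] walk_parity[of \<eta> ?r] last walk_record_pos[of i] by simp
  then obtain h where h: "?r' - 1 - ?r = 2 * h" by (elim evenE)
  define n where "n = nat h"
  have n: "?r' - 1 - ?r = 2 * int n" using h rr by (simp add: n_def)
  have l: "length (excursion_at \<eta> i) = 2 * n + 1" using len n by linarith
  show "excursion_at \<eta> i \<in> excursions"
    unfolding excursions_def
  proof (intro CollectI exI[of _ n] conjI allI impI)
    show "length (excursion_at \<eta> i) = 2 * n + 1" by (rule l)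
    show "excursion_at \<eta> i ! 0 = 0" using nth[of 0] l walk_record_pos[of i] by simp
    have "?r + int (2 * n) = ?r' - 1" using n by simp
    then show "excursion_at \<eta> i ! (2 * n) = 0" using nth[of "2 * n"] l last by simp
    show "0 \<le> excursion_at \<eta> i ! z" if "z \<le> 2 * n" for z
      using nth[of z] that l walk_before_record_pos[of "?r + int z" "i + 1"] n by simp
    show "\<bar>excursion_at \<eta> i ! z - excursion_at \<eta> i ! (z - 1)\<bar> = 1" if "1 \<le> z \<and> z \<le> 2 * n" for z
      using nth[of z] nth[of "z - 1"] that l walk_step[of \<eta> "?r + int (z - 1)"] by (auto simp: of_nat_diff split: if_splits)
  qed
qed

text \<open>Once its record is located, an excursion is a cylinder event: the word keeps the walk
  above the next level until its final empty box, which therefore is the next record.\<close>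

lemma excursion_at_iff:
  assumes e: "\<epsilon> \<in> excursions"
  shows "excursion_at \<eta> i = \<epsilon> \<longleftrightarrow> \<eta> \<in> cyl (record_pos \<eta> i + 1) (exc_word \<epsilon>)"
proof
  let ?r = "record_pos \<eta> i"
  note ed = excursions_dyck[OF e]
  have noball: "\<not> ball_config \<epsilon> (int (length \<epsilon>))" by (simp add: ball_config_def)
  {
    assume a: "excursion_at \<eta> i = \<epsilon>"
    have len: "int (length \<epsilon>) = record_pos \<eta> (i + 1) - ?r" using length_excursion_at[of i] a by simp
    have "\<eta> (?r + 1 + int t) = ball_config \<epsilon> (1 + int t)" if t: "t < length \<epsilon>" for t
    proof (cases "Suc t < length \<epsilon>")
      case True
      have "walk \<eta> (?r + int t + 1) - walk \<eta> (?r + int t) = walk (ball_config \<epsilon>) (int t + 1) - walk (ball_config \<epsilon>) (int t)"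
        using excursion_at_nth[of "Suc t" i] excursion_at_nth[of t i] ed(2)[of t] ed(2)[of "Suc t"] True unfolding a
        by (simp add: algebra_simps)
      then show ?thesis
        using walk_step[of \<eta> "?r + int t"] walk_step[of "ball_config \<epsilon>" "int t"]
        by (simp add: algebra_simps split: if_splits)
    next
      case False
      then have l: "length \<epsilon> = Suc t" using t by simp
      have p: "?r + 1 + int t = record_pos \<eta> (i + 1)" using len l by simp
      have "\<not> \<eta> (record_pos \<eta> (i + 1))"
        using walk_step[of \<eta> "record_pos \<eta> (i + 1) - 1"] walk_record_pos[of "i + 1"]
          walk_before_record_pos[of "record_pos \<eta> (i + 1) - 1" "i + 1"] by (auto split: if_splits)
      moreover have "1 + int t = int (length \<epsilon>)" using l by simp
      ultimately show ?thesis unfolding p using noball by simp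
    qed
    then show "\<eta> \<in> cyl (?r + 1) (exc_word \<epsilon>)"
      by (simp add: cyl_def exc_word_def word_nth)
  }
  assume c: "\<eta> \<in> cyl (?r + 1) (exc_word \<epsilon>)"
  have eq: "\<eta> (?r + 1 + int t) = ball_config \<epsilon> (1 + int t)" if "t < length \<epsilon>" for t
    using c that by (simp add: cyl_def exc_word_def word_nth)
  have w: "walk \<eta> (?r + int t) = walk (ball_config \<epsilon>) (int t) - i" if "t \<le> length \<epsilon>" for t
    using that
  proof (induction t)
    case 0
    then show ?case by (simp add: walk_0 walk_record_pos)
  next
    case (Suc t)
    then show ?case
      using eq[of t] walk_step[of \<eta> "?r + int t"] walk_step[of "ball_config \<epsilon>" "int t"]
      by (simp add: algebra_simps)
  qed
  have wl: "walk (ball_config \<epsilon>) (int (length \<epsilon>)) = - 1"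
    using walk_step[of "ball_config \<epsilon>" "int (length \<epsilon>) - 1"] noball ed(1) by (simp add: dyck_def)
  have nxt: "record_pos \<eta> (i + 1) = ?r + int (length \<epsilon>)"
  proof (rule record_pos_eqI)
    show "walk \<eta> (?r + int (length \<epsilon>)) = - (i + 1)" using w[of "length \<epsilon>"] wl by simp
    fix y assume y: "y < ?r + int (length \<epsilon>)"
    show "- (i + 1) < walk \<eta> y"
    proof (cases "y < ?r")
      case True
      then show ?thesis using walk_before_record_pos[of y i] by simp
    next
      case False
      then have t: "nat (y - ?r) < length \<epsilon>" "?r + int (nat (y - ?r)) = y" using y by auto
      then have "0 \<le> walk (ball_config \<epsilon>) (int (nat (y - ?r)))" using ed(1) False unfolding dyck_def by simp
      then show ?thesis using w[of "nat (y - ?r)"] t by simp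
    qed
  qed
  show "excursion_at \<eta> i = \<epsilon>"
  proof (rule nth_equalityI)
    show l: "length (excursion_at \<eta> i) = length \<epsilon>" using length_excursion_at[of i] nxt by simp
    show "excursion_at \<eta> i ! t = \<epsilon> ! t" if "t < length (excursion_at \<eta> i)" for t
      using excursion_at_nth[OF that] w[of t] ed(2)[of t] that l by simp
  qed
qed

lemma record_pos_next: "record_pos \<eta> (i + 1) = record_pos \<eta> i + int (length (excursion_at \<eta> i))"
  using length_excursion_at[of i] by simp

lemma excursions_at_iff:
  assumes "set es \<subseteq> excursions"
  shows "(\<forall>t<length es. excursion_at \<eta> (i + int t) = es ! t)
    \<longleftrightarrow> \<eta> \<in> cyl (record_pos \<eta> i + 1) (concat (map exc_word es))"
  using assms
proof (induction es arbitrary: i)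
  case Nil
  then show ?case by (simp add: cyl_def)
next
  case (Cons \<epsilon> es)
  have "(\<forall>t<length (\<epsilon> # es). excursion_at \<eta> (i + int t) = (\<epsilon> # es) ! t)
    \<longleftrightarrow> excursion_at \<eta> i = \<epsilon> \<and> (\<forall>t<length es. excursion_at \<eta> (i + 1 + int t) = es ! t)"
    by (simp add: All_less_Suc2 algebra_simps)
  also have "\<dots> \<longleftrightarrow> excursion_at \<eta> i = \<epsilon> \<and> \<eta> \<in> cyl (record_pos \<eta> (i + 1) + 1) (concat (map exc_word es))"
    using Cons by simp
  also have "\<dots> \<longleftrightarrow> \<eta> \<in> cyl (record_pos \<eta> i + 1) (concat (map exc_word (\<epsilon> # es)))"
    using Cons.prems excursion_at_iff[of \<epsilon> i] record_pos_next[of i] by (auto simp: cyl_append algebra_simps)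
  finally show ?case .
qed

lemma record_pos_shift:
  "record_pos \<eta> (i + int n) = record_pos \<eta> i + (\<Sum>t<n. int (length (excursion_at \<eta> (i + int t))))"
proof (induction n)
  case (Suc n)
  then show ?case using record_pos_next[of "i + int n"] by (simp add: algebra_simps)
qed simp

lemma record_pos_0: "0 \<in> records \<eta> \<Longrightarrow> record_pos \<eta> 0 = 0"
  using record_is_record_pos[of 0] by (simp add: walk_0)

text \<open>The lengths of the excursions to the left of the origin determine how far back the first
  record r lies. Conversely, a record at r followed by the concatenated words produces a record at 0
  at the right index, so no separate condition at 0 is left and the event has the form handled by
  \<open>record_cyl\<close>.\<close>

lemma records_excursions_iff:
  assumes es: "set es \<subseteq> excursions" and i: "i \<le> 0" "0 \<le> i + int (length es)"
  defines "r \<equiv> - (\<Sum>t<nat (- i). int (length (es ! t)))"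
  shows "0 \<in> records \<eta> \<and> (\<forall>t<length es. excursion_at \<eta> (i + int t) = es ! t)
    \<longleftrightarrow> r \<in> records \<eta> \<and> \<eta> \<in> cyl (r + 1) (concat (map exc_word es))"
proof -
  have n: "nat (- i) \<le> length es" "i + int (nat (- i)) = 0" using i by auto
  have sum: "record_pos \<eta> (j + int (nat (- i))) = record_pos \<eta> j - r"
    if "\<forall>t<length es. excursion_at \<eta> (j + int t) = es ! t" for j
    unfolding record_pos_shift r_def using that n(1) by simp
  show ?thesis
  proof
    assume a: "0 \<in> records \<eta> \<and> (\<forall>t<length es. excursion_at \<eta> (i + int t) = es ! t)"
    then have "record_pos \<eta> i = r" using sum[of i] n(2) record_pos_0 by simp
    then show "r \<in> records \<eta> \<and> \<eta> \<in> cyl (r + 1) (concat (map exc_word es))"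
      using record_pos_record[of i] excursions_at_iff[OF es, of i] a by simp
  next
    assume a: "r \<in> records \<eta> \<and> \<eta> \<in> cyl (r + 1) (concat (map exc_word es))"
    let ?j = "- walk \<eta> r"
    have j: "record_pos \<eta> ?j = r" using record_is_record_pos a by blast
    then have ex: "\<forall>t<length es. excursion_at \<eta> (?j + int t) = es ! t" using excursions_at_iff[OF es, of ?j] a by simp
    then have z: "record_pos \<eta> (?j + int (nat (- i))) = 0" using sum[OF ex] j by simp
    then have rec: "0 \<in> records \<eta>" using record_pos_record[of "?j + int (nat (- i))"] by simp
    then have "record_pos \<eta> (?j + int (nat (- i))) = record_pos \<eta> 0" using z record_pos_0 by simp
    then have "?j + int (nat (- i)) = 0" using strict_mono_eq[OF record_pos_mono] by blast
    then have "?j = i" using n(2) by linarith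
    then show "0 \<in> records \<eta> \<and> (\<forall>t<length es. excursion_at \<eta> (i + int t) = es ! t)" using rec ex by simp
  qed
qed

end

section \<open>Enumerating the slots\<close>

lemma counting_enumeration:
  fixes A :: "int set"
  assumes A0: "0 \<in> A" and up: "\<And>K. \<exists>x\<in>A. K < x" and down: "\<And>K. \<exists>x\<in>A. x < K"
  shows "\<exists>s. strict_mono s \<and> range s = A \<and> s (0::int) = 0"
proof -
  \<comment> \<open>The signed number of elements of A between 0 and z. It increases by one at each
    element of A, so its inverse on A is the enumeration with value 0 at 0.\<close>
  define N where "N z = int (card (A \<inter> {0<..z})) - int (card (A \<inter> {z<..0}))" for z
  have step: "N (z + 1) = N z + (if z + 1 \<in> A then 1 else 0)" for z
  proof (cases "0 \<le> z")
    case True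
    then have "A \<inter> {0<..z + 1} = (if z + 1 \<in> A then insert (z + 1) (A \<inter> {0<..z}) else A \<inter> {0<..z})"
      "A \<inter> {z<..0} = {}" "A \<inter> {z + 1<..0} = {}" by (auto simp: zless_add1_eq order_le_less)
    then show ?thesis by (simp add: N_def)
  next
    case False
    then have "{z<..0} = insert (z + 1) {z + 1<..0}" by auto
    then have "A \<inter> {z<..0} = (if z + 1 \<in> A then insert (z + 1) (A \<inter> {z + 1<..0}) else A \<inter> {z + 1<..0})"
      "A \<inter> {0<..z} = {}" "A \<inter> {0<..z + 1} = {}" using False by auto
    then show ?thesis by (simp add: N_def)
  qed
  have mono: "N y \<le> N z" if "y \<le> z" for y z
    using that by (induction z rule: int_ge_induct) (auto simp: step)
  have less: "N y < N z" if "y < z" "z \<in> A" for y z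
    using mono[of y "z - 1"] step[of "z - 1"] that by simp
  have above: "\<exists>z\<in>A. int n \<le> N z" for n
  proof (induction n)
    case 0
    then show ?case using A0 by (intro bexI[of _ 0]) (simp_all add: N_def)
  next
    case (Suc n)
    then obtain z where "z \<in> A" "int n \<le> N z" by blast
    moreover obtain x where "x \<in> A" "z < x" using up by blast
    ultimately show ?case using less[of z x] by (intro bexI[of _ x]) auto
  qed
  have below: "\<exists>z\<in>A. N z \<le> - int n" for n
  proof (induction n)
    case 0
    then show ?case using A0 by (intro bexI[of _ 0]) (simp_all add: N_def)
  next
    case (Suc n)
    then obtain z where "z \<in> A" "N z \<le> - int n" by blast
    moreover obtain x where "x \<in> A" "x < z" using down by blast
    ultimately show ?case using less[of x z] by (intro bexI[of _ x]) auto
  qed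
  have hit: "\<exists>z\<in>A. N z = j" for j
  proof -
    obtain u where "N u \<le> - int (nat (- (j - 1)))" using below by blast
    then have u: "N u \<le> j - 1" by linarith
    obtain v where "int (nat j) \<le> N v" using above by blast
    then have v: "j \<le> N v" by linarith
    have P: "u \<le> y" if "N y \<ge> j" for y
      using mono[of y u] u that by (cases "u \<le> y") auto
    define z where "z = (LEAST z. N z \<ge> j)"
    have z: "N z \<ge> j" "\<And>y. N y \<ge> j \<Longrightarrow> z \<le> y"
      unfolding z_def using Least_int[of "\<lambda>z. N z \<ge> j", OF v P] by blast+
    have "\<not> N (z - 1) \<ge> j" using z(2)[of "z - 1"] by linarith
    then show ?thesis using step[of "z - 1"] z(1) by (intro bexI[of _ z]) (auto split: if_splits)
  qed
  define s where "s j = (SOME z. z \<in> A \<and> N z = j)" for j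
  have s: "s j \<in> A" "N (s j) = j" for j
  proof -
    have "\<exists>z. z \<in> A \<and> N z = j" using hit by blast
    from someI_ex[OF this] show "s j \<in> A" "N (s j) = j" unfolding s_def by blast+
  qed
  have inj: "y = z" if "y \<in> A" "z \<in> A" "N y = N z" for y z
    using less[of y z] less[of z y] that by (cases y z rule: linorder_cases) auto
  have "strict_mono s"
  proof (rule strict_monoI)
    fix i j :: int assume "i < j"
    then have "\<not> s j \<le> s i" using mono[of "s j" "s i"] s(2) by auto
    then show "s i < s j" by simp
  qed
  moreover have "range s = A"
  proof (intro equalityI subsetI)
    fix z assume "z \<in> A"
    have "z = s (N z)" by (rule inj[OF \<open>z \<in> A\<close> s(1)]) (simp add: s(2))
    then show "z \<in> range s" by blast
  qed (use s in auto)
  moreover have "s 0 = 0" by (rule inj) (use s A0 in \<open>auto simp: N_def\<close>)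
  ultimately show ?thesis by blast
qed

lemma enumeration_next:
  fixes s :: "int \<Rightarrow> int"
  assumes s: "strict_mono s" "range s = A" and x: "x \<in> A" "s j < x" "\<And>y. y \<in> A \<Longrightarrow> s j < y \<Longrightarrow> x \<le> y"
  shows "s (j + 1) = x"
proof -
  obtain j' where j': "x = s j'" using x(1) s(2) by blast
  have "j < j'" using x(2) strict_mono_less[OF s(1)] unfolding j' by blast
  moreover have "x \<le> s (j + 1)" by (rule x(3)) (use s strict_mono_less[OF s(1)] in auto)
  then have "j' \<le> j + 1" using strict_mono_less_eq[OF s(1)] unfolding j' by blast
  ultimately have "j' = j + 1" by simp
  then show ?thesis using j' by simp
qed

lemma enumeration_unique:
  fixes s s' :: "int \<Rightarrow> int"
  assumes "strict_mono s" "strict_mono s'" "range s = range s'" "s 0 = s' 0"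
  shows "s = s'"
proof
  have nxt: "s (j + 1) = s' (j + 1)" if "s j = s' j" for j
  proof (rule enumeration_next[OF assms(1) refl])
    show "s' (j + 1) \<in> range s" using assms(3) by blast
    show "s j < s' (j + 1)" using that strict_mono_less[OF assms(2)] by simp
    fix y assume "y \<in> range s" "s j < y"
    then obtain i where "y = s' i" using assms(3) by blast
    then show "s' (j + 1) \<le> y"
      using \<open>s j < y\<close> that strict_mono_less[OF assms(2)] strict_mono_less_eq[OF assms(2)] by simp
  qed
  have prv: "s (j - 1) = s' (j - 1)" if "s j = s' j" for j
  proof (rule antisym)
    obtain i where i: "s (j - 1) = s' i" using assms(3) by blast
    have "s' i < s' j" using i that strict_mono_less[OF assms(1), of "j - 1" j] by simp
    then show "s (j - 1) \<le> s' (j - 1)"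
      unfolding i using strict_mono_less[OF assms(2)] strict_mono_less_eq[OF assms(2)] by simp
    obtain i' where i': "s' (j - 1) = s i'" using assms(3) by blast
    have "s i' < s j" using i' that strict_mono_less[OF assms(2), of "j - 1" j] by simp
    then show "s' (j - 1) \<le> s (j - 1)"
      unfolding i' using strict_mono_less[OF assms(1)] strict_mono_less_eq[OF assms(1)] by simp
  qed
  fix j show "s j = s' j"
    by (induction j rule: int_induct[where k = 0]) (use assms(4) nxt prv in auto)
qed

lemma slot_enumI:
  assumes "strict_mono s" "range s = slots k \<eta>" "s 0 = 0"
  shows "slot_enum k \<eta> = s"
  unfolding slot_enum_def
  by (rule the_equality) (use assms enumeration_unique in \<open>auto simp: \<close>)

section \<open>Soliton components of a configuration\<close>

definition exc_comp :: "nat \<Rightarrow> int list \<Rightarrow> nat list" where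
  "exc_comp k \<epsilon> = comps k (ball_config \<epsilon>)"

lemma exc_size: "\<epsilon> \<in> excursions \<Longrightarrow> dyck_size_of (ball_config \<epsilon>) = int (length \<epsilon>) - 1"
  by (rule dyck_size_of) (rule excursions_dyck(1))

text \<open>Meant for the 2m excursions around the origin. The lists of the first m of them end
  right before slot 0, so slot -m sits m places before the end of their concatenation.\<close>

definition comp_window :: "(int list \<Rightarrow> nat list) \<Rightarrow> nat \<Rightarrow> int list list \<Rightarrow> nat list" where
  "comp_window f m es = take (2 * m) (drop (length (concat (map f (take m es))) - m) (concat (map f es)))"

context
  fixes \<eta> :: config and k :: nat
  assumes dr: "drifting \<eta>" and rec0: "0 \<in> records \<eta>"
begin

private abbreviation (input) "r i \<equiv> record_pos \<eta> i"
private abbreviation (input) "e i \<equiv> excursion_at \<eta> i"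

lemma dyck_excursion_at: "dyck (r (i + 1) - r i - 1) (ball_config (e i))"
  using excursions_dyck(1)[OF excursion_at_in[OF dr, of i]] length_excursion_at[OF dr, of i] by simp

lemma size_excursion_at: "dyck_size_of (ball_config (e i)) = r (i + 1) - r i - 1"
  by (rule dyck_size_of) (rule dyck_excursion_at)

lemma exc_slots_bounds: "exc_slots k (e i) \<subseteq> {0..r (i + 1) - r i - 1}" "0 \<in> exc_slots k (e i)"
  using config_slots_bounds[OF dyck_excursion_at, of k i] unfolding exc_slots_ball_config by blast+

lemma which_excursion: "\<exists>i. r i \<le> z \<and> z < r (i + 1)"
proof -
  have mono: "r i \<le> r j" if "i \<le> j" for i j using strict_mono_less_eq[OF record_pos_mono[OF dr]] that by blast
  have g: "int n \<le> r (int n)" "r (- int n) \<le> - int n" for n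
  proof (induction n)
    case 0
    then show "int 0 \<le> r (int 0)" "r (- int 0) \<le> - int 0" using record_pos_0[OF dr rec0] by simp_all
  next
    case (Suc n)
    then show "int (Suc n) \<le> r (int (Suc n))" "r (- int (Suc n)) \<le> - int (Suc n)"
      using record_pos_less[OF dr, of "int n" "int (Suc n)"] record_pos_less[OF dr, of "- int (Suc n)" "- int n"] by simp_all
  qed
  have lo: "- \<bar>z\<bar> \<le> i" if "z < r (i + 1)" "r i \<le> z" for i
  proof (rule ccontr)
    assume "\<not> - \<bar>z\<bar> \<le> i"
    then have "r (i + 1) \<le> r (- int (nat \<bar>z\<bar>))" by (intro mono) simp
    then show False using g(2)[of "nat \<bar>z\<bar>"] that by simp
  qed
  let ?P = "\<lambda>j. z < r j"
  have P: "?P (int (nat \<bar>z\<bar>) + 1)" using g(1)[of "Suc (nat \<bar>z\<bar>)"] by (simp add: algebra_simps)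
  have B: "- \<bar>z\<bar> \<le> j" if "?P j" for j
  proof (rule ccontr)
    assume "\<not> - \<bar>z\<bar> \<le> j"
    then have "r j \<le> r (- int (nat \<bar>z\<bar>))" by (intro mono) simp
    then show False using g(2)[of "nat \<bar>z\<bar>"] that by simp
  qed
  note L = Least_int[of ?P, OF P B]
  let ?j = "LEAST j. ?P j"
  have "\<not> ?P (?j - 1)" using L(2)[of "?j - 1"] by linarith
  then show ?thesis using L(1) by (intro exI[of _ "?j - 1"]) simp
qed

lemma excursion_index_unique:
  assumes "r i \<le> z" "z < r (i + 1)" "r j \<le> z" "z < r (j + 1)"
  shows "i = j"
proof -
  have "\<not> i < j" if "r j \<le> z" "z < r (i + 1)" for i j
  proof
    assume "i < j"
    then have "r (i + 1) \<le> r j" using strict_mono_less_eq[OF record_pos_mono[OF dr]] by simp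
    then show False using that by simp
  qed
  from this[OF assms(3,2)] this[OF assms(1,4)] show ?thesis by simp
qed

lemma slots_window: "slots k \<eta> \<inter> {r i..<r (i + 1)} = (+) (r i) ` exc_slots k (e i)"
proof (intro equalityI subsetI)
  fix z assume z: "z \<in> slots k \<eta> \<inter> {r i..<r (i + 1)}"
  then obtain j y where j: "z = r j + y" "y \<in> exc_slots k (e j)" by (auto simp: slots_def)
  then have "r j \<le> z" "z < r (j + 1)" using exc_slots_bounds(1)[of j] by auto
  then have "j = i" using excursion_index_unique z by auto
  then show "z \<in> (+) (r i) ` exc_slots k (e i)" using j by blast
next
  fix z assume "z \<in> (+) (r i) ` exc_slots k (e i)"
  then show "z \<in> slots k \<eta> \<inter> {r i..<r (i + 1)}" using exc_slots_bounds(1)[of i] by (auto simp: slots_def)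
qed

lemma record_pos_slot: "r i \<in> slots k \<eta>"
  using exc_slots_bounds(2)[of i] unfolding slots_def by force

lemma slot_enum_props:
  "strict_mono (slot_enum k \<eta>)" "range (slot_enum k \<eta>) = slots k \<eta>" "slot_enum k \<eta> 0 = 0"
proof -
  have "\<exists>s. strict_mono s \<and> range s = slots k \<eta> \<and> s (0::int) = 0"
  proof (rule counting_enumeration)
    show "0 \<in> slots k \<eta>" using record_pos_slot[of 0] record_pos_0[OF dr rec0] by simp
    fix K
    obtain i where "r i \<le> K" "K < r (i + 1)" using which_excursion by blast
    then show "\<exists>x\<in>slots k \<eta>. K < x" using record_pos_slot by blast
    obtain j where j: "r j \<le> K - 1" using which_excursion[of "K - 1"] by blast
    then show "\<exists>x\<in>slots k \<eta>. x < K" using record_pos_slot[of j] by (intro bexI[of _ "r j"]) auto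
  qed
  then obtain s where s: "strict_mono s" "range s = slots k \<eta>" "s (0::int) = 0" by blast
  have "slot_enum k \<eta> = s" by (rule slot_enumI[OF s])
  then show "strict_mono (slot_enum k \<eta>)" "range (slot_enum k \<eta>) = slots k \<eta>" "slot_enum k \<eta> 0 = 0" using s by auto
qed

text \<open>The value t = number of slots is included: it gives the closing entry, the next record,
  from which the enumeration continues in the following excursion.\<close>

lemma slot_enum_excursion:
  assumes j: "slot_enum k \<eta> j = r i" and t: "t \<le> card (exc_slots k (e i))"
  shows "slot_enum k \<eta> (j + int t) = r i + slot_ends k (r (i + 1) - r i - 1) (ball_config (e i)) ! t"
  using t
proof (induction t)
  case 0
  let ?E = "slot_ends k (r (i + 1) - r i - 1) (ball_config (e i))"
  have c: "0 < card (config_slots k (ball_config (e i)))"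
    using exc_slots_bounds(2)[of i] config_slots_finite[OF dyck_excursion_at, of k i] unfolding exc_slots_ball_config
    by (auto simp: card_gt_0_iff)
  have "?E ! 0 \<in> config_slots k (ball_config (e i))"
    using slot_list_nth_in[OF dyck_excursion_at c] slot_ends_nth[OF c] by simp
  then have "0 \<le> ?E ! 0" using exc_slots_bounds(1)[of i] unfolding exc_slots_ball_config by auto
  moreover have "?E ! 0 \<le> 0"
  proof -
    have "0 \<in> set (slot_list k (ball_config (e i)))"
      using exc_slots_bounds(2)[of i] config_slots_finite[OF dyck_excursion_at, of k i]
      unfolding exc_slots_ball_config slot_list_def by simp
    then obtain n where n: "n < card (config_slots k (ball_config (e i)))" "slot_list k (ball_config (e i)) ! n = 0"
      unfolding in_set_conv_nth length_slot_list by blast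
    then show ?thesis
      using slot_ends_less[OF dyck_excursion_at, of 0 n k i] slot_ends_nth[OF n(1)] by (cases "n = 0") (auto simp: less_imp_le)
  qed
  ultimately show ?case using j by simp
next
  case (Suc t)
  let ?E = "slot_ends k (r (i + 1) - r i - 1) (ball_config (e i))" and ?c = "card (config_slots k (ball_config (e i)))"
  have t: "t < ?c" using Suc(2) by (simp add: exc_slots_ball_config)
  have IH: "slot_enum k \<eta> (j + int t) = r i + ?E ! t" using Suc by simp
  have "?E ! t \<in> config_slots k (ball_config (e i))"
    using slot_list_nth_in[OF dyck_excursion_at t] slot_ends_nth[OF t] by simp
  then have Et0: "0 \<le> ?E ! t" using exc_slots_bounds(1)[of i] unfolding exc_slots_ball_config by auto
  have lt: "?E ! t < ?E ! Suc t" by (rule slot_ends_less[OF dyck_excursion_at]) (use t in auto)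
  have inA: "r i + ?E ! Suc t \<in> slots k \<eta>" and ub: "r i + ?E ! Suc t \<le> r (i + 1)"
  proof -
    have "r i + ?E ! Suc t \<in> slots k \<eta> \<and> r i + ?E ! Suc t \<le> r (i + 1)"
    proof (cases "Suc t < ?c")
      case True
      then have "?E ! Suc t \<in> exc_slots k (e i)"
        using slot_list_nth_in[OF dyck_excursion_at True] slot_ends_nth[OF True] by (simp add: exc_slots_ball_config)
      then show ?thesis using exc_slots_bounds(1)[of i] unfolding slots_def by auto
    next
      case False
      then have "Suc t = length (slot_list k (ball_config (e i)))" using t by (simp add: length_slot_list)
      then have "?E ! Suc t = r (i + 1) - r i - 1 + 1" unfolding slot_ends_def by (simp add: nth_append)
      then show ?thesis using record_pos_slot[of "i + 1"] by simp
    qed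
    then show "r i + ?E ! Suc t \<in> slots k \<eta>" "r i + ?E ! Suc t \<le> r (i + 1)" by auto
  qed
  have "slot_enum k \<eta> (j + int t + 1) = r i + ?E ! Suc t"
  proof (rule enumeration_next[OF slot_enum_props(1,2) inA])
    show "slot_enum k \<eta> (j + int t) < r i + ?E ! Suc t" using IH lt by simp
    fix y assume y: "y \<in> slots k \<eta>" "slot_enum k \<eta> (j + int t) < y"
    show "r i + ?E ! Suc t \<le> y"
    proof (rule ccontr)
      assume n: "\<not> ?thesis"
      then have "y \<in> slots k \<eta> \<inter> {r i..<r (i + 1)}" using y IH Et0 ub by auto
      then obtain u where u: "y = r i + u" "u \<in> config_slots k (ball_config (e i))"
        unfolding slots_window exc_slots_ball_config by blast
      then have "u \<in> set (slot_list k (ball_config (e i)))"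
        using config_slots_finite[OF dyck_excursion_at, of k i] by (simp add: slot_list_def)
      then obtain m where m: "m < ?c" "?E ! m = u"
        unfolding in_set_conv_nth length_slot_list using slot_ends_nth by metis
      have "?E ! t < ?E ! m" "?E ! m < ?E ! Suc t" using y(2) IH n u m by auto
      moreover have "m < t \<Longrightarrow> ?E ! m < ?E ! t" using slot_ends_less[OF dyck_excursion_at, of m t k i] t by simp
      moreover have "Suc t < m \<Longrightarrow> ?E ! Suc t < ?E ! m" using slot_ends_less[OF dyck_excursion_at, of "Suc t" m k i] m by simp
      ultimately show False by (cases m t rule: linorder_cases; cases "m = Suc t") auto
    qed
  qed
  then show ?case by (simp add: algebra_simps)
qed

lemma component_excursion:
  assumes j: "slot_enum k \<eta> j = r i" and t: "t < card (exc_slots k (e i))"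
  shows "component k \<eta> (j + int t) = exc_comp k (e i) ! t"
proof -
  let ?M = "r (i + 1) - r i - 1"
  let ?E = "slot_ends k ?M (ball_config (e i))" and ?c = "card (config_slots k (ball_config (e i)))"
  have tc: "t < ?c" using t by (simp add: exc_slots_ball_config)
  have s: "slot_enum k \<eta> (j + int t) = r i + ?E ! t" "slot_enum k \<eta> (j + int t + 1) = r i + ?E ! Suc t"
    using slot_enum_excursion[OF j, of t] slot_enum_excursion[OF j, of "Suc t"] t by (simp_all add: algebra_simps)
  have E0: "0 \<le> ?E ! t"
    using slot_list_nth_in[OF dyck_excursion_at tc] slot_ends_nth[OF tc] exc_slots_bounds(1)[of i]
    unfolding exc_slots_ball_config by auto
  have Eu: "?E ! Suc t \<le> ?M + 1"
  proof (cases "Suc t = ?c")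
    case True
    then show ?thesis by (simp add: slot_ends_def nth_append length_slot_list)
  next
    case False
    have "?E ! ?c = ?M + 1" by (simp add: slot_ends_def nth_append length_slot_list)
    moreover have "?E ! Suc t < ?E ! ?c" by (rule slot_ends_less[OF dyck_excursion_at]) (use False tc in auto)
    ultimately show ?thesis by simp
  qed
  have supp: "support (translate d \<gamma>) = (+) d ` support \<gamma>" for d \<gamma>
    by (auto simp: support_def translate_def)
  have wf: "support \<gamma> \<subseteq> {1..r (i' + 1) - r i' - 1} \<and> support \<gamma> \<noteq> {}" if "\<gamma> \<in> exc_solitons k (e i')" for \<gamma> i'
  proof -
    have "wf_soliton (r (i' + 1) - r i' - 1) \<gamma>"
      using all_solitons_wf[OF dyck_excursion_at, of i'] that unfolding exc_solitons_ball_config by blast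
    then show ?thesis using wf_soliton_finite(3) unfolding wf_soliton_def by blast
  qed
  let ?X = "{\<gamma>\<in>exc_solitons k (e i). support \<gamma> \<subseteq> {?E ! t<..<?E ! Suc t}}"
  have "{\<gamma>\<in>solitons k \<eta>. support \<gamma> \<subseteq> {r i + ?E ! t<..<r i + ?E ! Suc t}} = translate (r i) ` ?X"
  proof (intro equalityI subsetI)
    fix \<gamma> assume g: "\<gamma> \<in> {\<gamma>\<in>solitons k \<eta>. support \<gamma> \<subseteq> {r i + ?E ! t<..<r i + ?E ! Suc t}}"
    then obtain i' \<gamma>' where g': "\<gamma> = translate (r i') \<gamma>'" "\<gamma>' \<in> exc_solitons k (e i')" by (auto simp: solitons_def)
    obtain x where x: "x \<in> support \<gamma>'" using wf[OF g'(2)] by blast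
    have "r i' \<le> r i' + x" "r i' + x < r (i' + 1)" using wf[OF g'(2)] x by auto
    moreover have sg: "support \<gamma> \<subseteq> {r i + ?E ! t<..<r i + ?E ! Suc t}" using g by simp
    then have "r i' + x \<in> {r i + ?E ! t<..<r i + ?E ! Suc t}" unfolding g'(1) supp using x by blast
    then have "r i \<le> r i' + x" "r i' + x < r (i + 1)" using E0 Eu by auto
    ultimately have ii: "i' = i" by (intro excursion_index_unique[of i' "r i' + x" i])
    have "support \<gamma>' \<subseteq> {?E ! t<..<?E ! Suc t}"
    proof
      fix y assume "y \<in> support \<gamma>'"
      then have "r i + y \<in> {r i + ?E ! t<..<r i + ?E ! Suc t}" using sg unfolding g'(1) supp ii by blast
      then show "y \<in> {?E ! t<..<?E ! Suc t}" by simp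
    qed
    then show "\<gamma> \<in> translate (r i) ` ?X" using g' ii by blast
  next
    fix \<gamma> assume "\<gamma> \<in> translate (r i) ` ?X"
    then obtain \<gamma>' where \<gamma>': "\<gamma> = translate (r i) \<gamma>'" "\<gamma>' \<in> exc_solitons k (e i)"
      "support \<gamma>' \<subseteq> {?E ! t<..<?E ! Suc t}" by blast
    have "support \<gamma> \<subseteq> {r i + ?E ! t<..<r i + ?E ! Suc t}"
    proof
      fix y assume "y \<in> support \<gamma>"
      then obtain x where "x \<in> support \<gamma>'" "y = r i + x" unfolding \<gamma>'(1) supp by blast
      moreover from this(1) have "x \<in> {?E ! t<..<?E ! Suc t}" using \<gamma>'(3) by blast
      ultimately show "y \<in> {r i + ?E ! t<..<r i + ?E ! Suc t}" by simp
    qed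
    then show "\<gamma> \<in> {\<gamma>\<in>solitons k \<eta>. support \<gamma> \<subseteq> {r i + ?E ! t<..<r i + ?E ! Suc t}}"
      using \<gamma>' unfolding solitons_def by blast
  qed
  moreover have "inj_on (translate (r i)) ?X"
    by (rule inj_onI) (auto simp: translate_def prod_eq_iff inj_image_eq_iff)
  ultimately have "component k \<eta> (j + int t) = card ?X"
    unfolding component_def s by (simp add: card_image)
  also have "?X = {\<gamma>\<in>all_solitons (ball_config (e i)). soliton_size \<gamma> = k \<and> support \<gamma> \<subseteq> {?E ! t<..<?E ! Suc t}}"
    unfolding exc_solitons_ball_config by blast
  also have "card \<dots> = exc_comp k (e i) ! t"
    unfolding exc_comp_def comp_list_def size_excursion_at using tc by (simp add: length_slot_list)
  finally show ?thesis .
qed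

lemma length_exc_comp: "length (exc_comp k \<epsilon>) = card (exc_slots k \<epsilon>)"
  by (simp add: exc_comp_def exc_slots_ball_config)

lemma component_excursions:
  assumes "slot_enum k \<eta> j = r i"
  defines "ys \<equiv> \<lambda>n. concat (map (\<lambda>t. exc_comp k (e (i + int t))) [0..<n])"
  shows "slot_enum k \<eta> (j + int (length (ys n))) = r (i + int n) \<and> (\<forall>t<length (ys n). component k \<eta> (j + int t) = ys n ! t)"
proof (induction n)
  case 0
  then show ?case using assms by simp
next
  case (Suc n)
  let ?j = "j + int (length (ys n))" and ?i = "i + int n"
  have ys: "ys (Suc n) = ys n @ exc_comp k (e ?i)" by (simp add: ys_def)
  have sj: "slot_enum k \<eta> ?j = r ?i" using Suc by blast
  have last: "slot_ends k (r (?i + 1) - r ?i - 1) (ball_config (e ?i)) ! card (exc_slots k (e ?i)) = r (?i + 1) - r ?i"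
    by (simp add: slot_ends_def nth_append length_slot_list exc_slots_ball_config)
  have "slot_enum k \<eta> (?j + int (card (exc_slots k (e ?i)))) = r (?i + 1)"
    using slot_enum_excursion[OF sj order.refl] last by simp
  then have "slot_enum k \<eta> (j + int (length (ys (Suc n)))) = r (i + int (Suc n))"
    unfolding ys by (simp add: length_exc_comp algebra_simps)
  moreover have "component k \<eta> (j + int t) = ys (Suc n) ! t" if "t < length (ys (Suc n))" for t
  proof (cases "t < length (ys n)")
    case True
    then show ?thesis using Suc unfolding ys by (simp add: nth_append)
  next
    case False
    then have "t - length (ys n) < card (exc_slots k (e ?i))" using that unfolding ys by (simp add: length_exc_comp)
    from component_excursion[OF sj this] False show ?thesis unfolding ys by (simp add: nth_append of_nat_diff)
  qed
  ultimately show ?case by blast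
qed

text \<open>Every excursion has its own slot 0, so n excursions supply at least n slots. This is why
  m excursions on each side suffice for a window of radius m, uniformly in the
  configuration.\<close>

lemma length_concat_ge: "n \<le> length (concat (map (\<lambda>t. exc_comp k (e (i + int t))) [0..<n]))"
proof (induction n)
  case (Suc n)
  have "exc_slots k (e (i + int n)) \<noteq> {}" using exc_slots_bounds(2) by blast
  moreover have "finite (exc_slots k (e (i + int n)))"
    using config_slots_finite[OF dyck_excursion_at] by (simp add: exc_slots_ball_config)
  ultimately have "0 < card (exc_slots k (e (i + int n)))" by (simp add: card_gt_0_iff)
  then show ?case using Suc by (simp add: length_exc_comp)
qed simp

lemma component_window:
  "map (\<lambda>t. component k \<eta> (- int m + int t)) [0..<2 * m]
    = comp_window (exc_comp k) m (map (\<lambda>t. e (- int m + int t)) [0..<2 * m])"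
proof -
  let ?f = "\<lambda>t. exc_comp k (e (- int m + int t))"
  let ?ys = "\<lambda>n. concat (map ?f [0..<n])"
  obtain j where j: "slot_enum k \<eta> j = r (- int m)" using record_pos_slot slot_enum_props(2) by (metis rangeE)
  have "slot_enum k \<eta> (j + int (length (?ys m))) = slot_enum k \<eta> 0"
    using component_excursions[OF j, of m] record_pos_0[OF dr rec0] slot_enum_props(3) by simp
  then have j0: "j = - int (length (?ys m))"
    using strict_mono_eq[OF slot_enum_props(1)] by force
  \<comment> \<open>The place of slot -m in the concatenated list. The truncated subtraction is a
    true one because the first m excursions have at least m slots.\<close>
  let ?d = "length (?ys m) - m"
  have d: "m \<le> length (?ys m)" by (rule length_concat_ge)
  have split: "?ys (m + m) = ?ys m @ concat (map (\<lambda>t. exc_comp k (e (int t))) [0..<m])"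
    unfolding upt_add_eq_append[OF le0] by (simp add: map_add_upt[symmetric] o_def del: map_add_upt)
  have len: "length (?ys m) + m \<le> length (?ys (m + m))"
    unfolding split using length_concat_ge[where i = 0 and n = m] by simp
  have w: "comp_window (exc_comp k) m (map (\<lambda>t. e (- int m + int t)) [0..<2 * m]) = take (2 * m) (drop ?d (?ys (m + m)))"
    by (simp add: comp_window_def take_map o_def mult_2)
  show ?thesis
    unfolding w
  proof (rule nth_equalityI)
    show "length (map (\<lambda>t. component k \<eta> (- int m + int t)) [0..<2 * m]) = length (take (2 * m) (drop ?d (?ys (m + m))))"
      using len d by simp
    fix t assume "t < length (map (\<lambda>t. component k \<eta> (- int m + int t)) [0..<2 * m])"
    then have t: "t < 2 * m" by simp
    have b: "?d + t < length (?ys (m + m))" using t len d by simp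
    have c: "component k \<eta> (j + int (?d + t)) = ?ys (m + m) ! (?d + t)"
      using component_excursions[OF j, of "m + m"] b by blast
    have "j + int (?d + t) = - int m + int t" using j0 d by (simp add: of_nat_diff)
    from c[unfolded this] show "map (\<lambda>t. component k \<eta> (- int m + int t)) [0..<2 * m] ! t = take (2 * m) (drop ?d (?ys (m + m))) ! t"
      using t b by simp
  qed
qed

end

section \<open>Probability mass functions of solitons\<close>

text \<open>Given the R-parts, each X-part is a list of independent copies of G whose length depends
  only on its R-part. Concatenation forgets where these lists are split, leaving one list of
  independent copies whose length is a function of the R-parts.\<close>

lemma map_pmf_rearrange_replicate:
  fixes N :: "'u \<Rightarrow> nat" and G :: "'c pmf"
  assumes "map_pmf (\<lambda>x. (R x, X x)) \<nu> = bind_pmf (map_pmf R \<nu>) (\<lambda>u. map_pmf (Pair u) (replicate_pmf (N u) G))"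
  shows "map_pmf (\<lambda>xs. (map R xs, concat (map X xs))) (replicate_pmf n \<nu>)
    = bind_pmf (replicate_pmf n (map_pmf R \<nu>)) (\<lambda>us. map_pmf (Pair us) (replicate_pmf (sum_list (map N us)) G))"
proof (induction n)
  case 0
  then show ?case by (simp add: bind_return_pmf map_pmf_def)
next
  case (Suc n)
  let ?F = "\<lambda>xs. (map R xs, concat (map X xs))" and ?f = "\<lambda>(u, x) (us, y). (u # us, x @ y)"
  have "map_pmf ?F (replicate_pmf (Suc n) \<nu>)
    = bind_pmf (map_pmf (\<lambda>x. (R x, X x)) \<nu>) (\<lambda>a. bind_pmf (map_pmf ?F (replicate_pmf n \<nu>)) (\<lambda>b. return_pmf (?f a b)))"
    by (simp add: map_pmf_def bind_assoc_pmf bind_return_pmf)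
  also have "\<dots> = bind_pmf (map_pmf R \<nu>) (\<lambda>u. bind_pmf (replicate_pmf (N u) G) (\<lambda>x.
      bind_pmf (replicate_pmf n (map_pmf R \<nu>)) (\<lambda>us. bind_pmf (replicate_pmf (sum_list (map N us)) G) (\<lambda>y.
        return_pmf (u # us, x @ y)))))"
    unfolding assms Suc by (simp add: map_pmf_def bind_assoc_pmf bind_return_pmf)
  also have "\<dots> = bind_pmf (map_pmf R \<nu>) (\<lambda>u. bind_pmf (replicate_pmf n (map_pmf R \<nu>)) (\<lambda>us.
      bind_pmf (replicate_pmf (N u) G) (\<lambda>x. bind_pmf (replicate_pmf (sum_list (map N us)) G) (\<lambda>y.
        return_pmf (u # us, x @ y)))))"
    by (subst bind_commute_pmf[of "replicate_pmf n (map_pmf R \<nu>)"]) (rule refl)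
  also have "\<dots> = bind_pmf (map_pmf R \<nu>) (\<lambda>u. bind_pmf (replicate_pmf n (map_pmf R \<nu>)) (\<lambda>us.
      map_pmf (Pair (u # us)) (replicate_pmf (N u + sum_list (map N us)) G)))"
    by (simp add: replicate_pmf_distrib map_pmf_def bind_assoc_pmf bind_return_pmf)
  also have "\<dots> = bind_pmf (replicate_pmf (Suc n) (map_pmf R \<nu>)) (\<lambda>us. map_pmf (Pair us) (replicate_pmf (sum_list (map N us)) G))"
    by (simp add: bind_assoc_pmf bind_return_pmf)
  finally show ?case .
qed

lemma replicate_pmf_append:
  "replicate_pmf (m + n) p = map_pmf (\<lambda>(xs, ys). xs @ ys) (pair_pmf (replicate_pmf m p) (replicate_pmf n p))"
  by (simp add: replicate_pmf_distrib map_pmf_def pair_pmf_def bind_assoc_pmf bind_return_pmf)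

lemma replicate_pmf_length: "xs \<in> set_pmf (replicate_pmf n p) \<Longrightarrow> length xs = n"
  by (simp add: set_replicate_pmf)

lemma map_take_replicate_pmf: "map_pmf (take m) (replicate_pmf (m + n) p) = replicate_pmf m p"
proof -
  have "map_pmf (take m) (replicate_pmf (m + n) p) = map_pmf fst (pair_pmf (replicate_pmf m p) (replicate_pmf n p))"
    unfolding replicate_pmf_append map_pmf_comp
    by (rule map_pmf_cong[OF refl]) (auto dest: replicate_pmf_length)
  then show ?thesis by (simp add: map_fst_pair_pmf)
qed

lemma map_drop_replicate_pmf: "map_pmf (drop m) (replicate_pmf (m + n) p) = replicate_pmf n p"
proof -
  have "map_pmf (drop m) (replicate_pmf (m + n) p) = map_pmf snd (pair_pmf (replicate_pmf m p) (replicate_pmf n p))"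
    unfolding replicate_pmf_append map_pmf_comp
    by (rule map_pmf_cong[OF refl]) (auto dest: replicate_pmf_length)
  then show ?thesis by (simp add: map_snd_pair_pmf)
qed

lemma map_window_replicate_pmf:
  assumes "d + m \<le> n"
  shows "map_pmf (\<lambda>ys. take m (drop d ys)) (replicate_pmf n p) = replicate_pmf m p"
proof -
  have n: "n = d + (m + (n - d - m))" using assms by simp
  have "map_pmf (\<lambda>ys. take m (drop d ys)) (replicate_pmf n p) = map_pmf (take m) (map_pmf (drop d) (replicate_pmf n p))"
    by (simp add: map_pmf_comp)
  also have "\<dots> = replicate_pmf m p"
    by (subst n) (simp only: map_drop_replicate_pmf map_take_replicate_pmf)
  finally show ?thesis .
qed

lemma pair_pmf_prob_Times:
  "measure_pmf.prob (pair_pmf A B) (S \<times> T) = measure_pmf.prob A S * measure_pmf.prob B T"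
proof -
  have "ennreal (measure_pmf.prob (pair_pmf A B) (S \<times> T)) = (\<integral>\<^sup>+x. indicator (S \<times> T) x \<partial>measure_pmf (pair_pmf A B))"
    by (simp add: measure_pmf.emeasure_eq_measure)
  also have "\<dots> = (\<integral>\<^sup>+a. \<integral>\<^sup>+b. indicator S a * indicator T b \<partial>measure_pmf B \<partial>measure_pmf A)"
    by (simp add: nn_integral_pair_pmf' indicator_times)
  also have "\<dots> = ennreal (measure_pmf.prob A S * measure_pmf.prob B T)"
    by (simp add: nn_integral_cmult nn_integral_multc measure_pmf.emeasure_eq_measure ennreal_mult')
  finally show ?thesis by (simp add: measure_nonneg)
qed

lemma prob_replicate_pmf:
  "measure_pmf.prob (replicate_pmf n p) {xs. \<forall>j<n. xs ! j \<in> A j} = (\<Prod>j<n. measure_pmf.prob p (A j))"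
proof (induction n arbitrary: A)
  case 0
  then show ?case by simp
next
  case (Suc n)
  have "replicate_pmf (Suc n) p = map_pmf (\<lambda>(x, xs). x # xs) (pair_pmf p (replicate_pmf n p))"
    by (simp add: map_pmf_def pair_pmf_def bind_assoc_pmf bind_return_pmf)
  then have "measure_pmf.prob (replicate_pmf (Suc n) p) {xs. \<forall>j<Suc n. xs ! j \<in> A j}
    = measure_pmf.prob (pair_pmf p (replicate_pmf n p)) (A 0 \<times> {xs. \<forall>j<n. xs ! j \<in> A (Suc j)})"
    by (simp add: vimage_def All_less_Suc2 split_beta) (rule arg_cong[of _ _ "measure_pmf.prob _"], auto)
  also have "\<dots> = measure_pmf.prob p (A 0) * (\<Prod>j<n. measure_pmf.prob p (A (Suc j)))"
    unfolding pair_pmf_prob_Times Suc ..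
  finally show ?case by (simp add: prod.lessThan_Suc_shift del: prod.lessThan_Suc)
qed

lemma pmf_replicate_pmf: "pmf (replicate_pmf n p) xs = (if length xs = n then prod_list (map (pmf p) xs) else 0)"
proof (induction n arbitrary: xs)
  case 0
  then show ?case by simp
next
  case (Suc n)
  have r: "replicate_pmf (Suc n) p = map_pmf (\<lambda>(x, xs). x # xs) (pair_pmf p (replicate_pmf n p))"
    by (simp add: map_pmf_def pair_pmf_def bind_assoc_pmf bind_return_pmf)
  show ?case
  proof (cases xs)
    case Nil
    have "[] \<notin> set_pmf (replicate_pmf (Suc n) p)" using replicate_pmf_length by fastforce
    then show ?thesis using Nil by (simp add: pmf_eq_0_set_pmf del: replicate_pmf.simps)
  next
    case (Cons y ys)
    have "pmf (replicate_pmf (Suc n) p) ((\<lambda>(x, xs). x # xs) (y, ys)) = pmf (pair_pmf p (replicate_pmf n p)) (y, ys)"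
      unfolding r by (rule pmf_map_inj') (auto simp: inj_def)
    then show ?thesis using Suc Cons by (simp add: pmf_pair del: replicate_pmf.simps)
  qed
qed

lemma pmf_bind_Pair: "pmf (bind_pmf M (\<lambda>u. map_pmf (Pair u) (K u))) (u, x) = pmf M u * pmf (K u) x"
proof -
  have "pmf (map_pmf (Pair v) (K v)) (u, x) = indicator {u} v * pmf (K u) x" for v
  proof (cases "v = u")
    case True
    have "pmf (map_pmf (Pair u) (K u)) (Pair u x) = pmf (K u) x" by (rule pmf_map_inj') (auto simp: inj_def)
    then show ?thesis using True by simp
  next
    case False
    then have "(u, x) \<notin> set_pmf (map_pmf (Pair v) (K v))" by auto
    then show ?thesis using False by (simp add: pmf_eq_0_set_pmf)
  qed
  then show ?thesis by (simp add: pmf_bind measure_pmf_single)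
qed

text \<open>Summing the kernel over x gives 1, so a product formula for the joint masses identifies
  the marginal.\<close>

lemma pmf_map_fst:
  assumes "\<And>x. pmf P (u, x) = c * pmf (K u) x" "0 \<le> c"
  shows "pmf (map_pmf fst P) u = c"
proof -
  have "ennreal (pmf (map_pmf fst P) u) = (\<integral>\<^sup>+y. indicator (fst -` {u}) y \<partial>measure_pmf P)"
    by (rule ennreal_pmf_map)
  also have "\<dots> = (\<integral>\<^sup>+y. ennreal (pmf P y) * indicator (fst -` {u}) y \<partial>count_space UNIV)"
    by (simp add: nn_integral_measure_pmf)
  also have "\<dots> = (\<integral>\<^sup>+y. ennreal (pmf P y) \<partial>count_space (fst -` {u}))"
    by (simp add: nn_integral_count_space_indicator)
  also have "\<dots> = (\<integral>\<^sup>+x. ennreal (pmf P (u, x)) \<partial>count_space UNIV)"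
    by (rule nn_integral_bij_count_space[symmetric]) (auto simp: bij_betw_def inj_on_def image_def)
  also have "\<dots> = (\<integral>\<^sup>+x. ennreal c * ennreal (pmf (K u) x) \<partial>count_space UNIV)"
    unfolding assms(1) using assms(2) by (simp add: ennreal_mult')
  also have "\<dots> = ennreal c * (\<integral>\<^sup>+x. ennreal (pmf (K u) x) \<partial>count_space UNIV)"
    by (rule nn_integral_cmult) simp
  also have "\<dots> = ennreal c" by (simp add: nn_integral_pmf_eq_1)
  finally show ?thesis using assms(2) by simp
qed

text \<open>Weights of the excursions that remain after the removal of all solitons of size less than \<open>k\<close>.\<close>

locale soliton_pmf =
  fixes \<nu> :: "config pmf" and a b c :: real and \<alpha> :: "nat \<Rightarrow> real"
  assumes pos: "0 < a" "0 < b" "0 < c"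
    and \<nu>: "\<And>\<eta>. pmf \<nu> \<eta> = (if is_dyck \<eta> then c * a ^ num_peaks \<eta> * b ^ nat (dyck_size_of \<eta> div 2) else 0)"
    and \<alpha>: "\<And>k. \<alpha> k = a * b ^ k"
begin

abbreviation "q \<equiv> q_param \<alpha>"

text \<open>An excursion with \<open>M\<close> boxes and \<open>n\<close> solitons, all of size greater than \<open>k\<close>, has \<open>1 + M - 2 * k * n\<close>
  \<open>k\<close>-slots. Summing over the \<open>k\<close>-solitons appended to them multiplies its weight by
  \<open>1 / (1 - q k)\<close> to the number of these slots, which is absorbed by the three parameters.\<close>

definition A :: "nat \<Rightarrow> real" where "A k = a * (\<Prod>j\<in>{1..<k}. (1 - q j) ^ (2 * j))"
definition B :: "nat \<Rightarrow> real" where "B k = b / (\<Prod>j\<in>{1..<k}. (1 - q j)\<^sup>2)"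
definition C :: "nat \<Rightarrow> real" where "C k = c / (\<Prod>j\<in>{1..<k}. 1 - q j)"

definition W :: "nat \<Rightarrow> config \<Rightarrow> real" where
  "W k \<eta> = (if is_dyck \<eta> \<and> long_runs k \<eta> then C k * A k ^ num_peaks \<eta> * B k ^ nat (dyck_size_of \<eta> div 2) else 0)"

text \<open>In A_k B_k^k each earlier j contributes (1 - q_j) to the power 2j - 2k, which is the
  denominator in the recursion for q_k. So q_k is the factor that one appended k-soliton brings to
  the weight.\<close>

lemma q_eq:
  assumes "\<And>j. 1 \<le> j \<Longrightarrow> j < k \<Longrightarrow> q j < 1"
  shows "q k = A k * B k ^ k"
proof -
  have "(1 - q j) ^ (2 * j) * (1 - q j) ^ (2 * (k - j)) = ((1 - q j)\<^sup>2) ^ k" if "j \<in> {1..<k}" for j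
    using that by (simp add: power_add[symmetric] power_mult[symmetric] distrib_left[symmetric])
  then have "(\<Prod>j\<in>{1..<k}. (1 - q j) ^ (2 * j)) * (\<Prod>j\<in>{1..<k}. (1 - q j) ^ (2 * (k - j))) = (\<Prod>j\<in>{1..<k}. (1 - q j)\<^sup>2) ^ k"
    unfolding prod.distrib[symmetric] prod_power_distrib by (intro prod.cong refl) simp
  moreover have "(\<Prod>j\<in>{1..<k}. (1 - q j) ^ (2 * (k - j))) \<noteq> 0" "(\<Prod>j\<in>{1..<k}. (1 - q j)\<^sup>2) \<noteq> 0"
    using assms by (auto simp: prod_zero_iff) (metis order_less_irrefl)+
  ultimately show ?thesis
    unfolding q_param.simps[of \<alpha> k] \<alpha> A_def B_def power_divide
    by (simp add: field_simps)
qed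

lemma num_slots_eq:
  assumes d: "dyck M u" and l: "long_runs (Suc k) u"
  shows "int (num_slots k u) = 1 + M - 2 * int k * int (num_peaks u)"
  using card_config_slots[OF d, of k] l by (simp add: num_slots_def dyck_size_of[OF d])

lemma even_dyck: "dyck M u \<Longrightarrow> even M"
  using walk_parity[of u M] by (simp add: dyck_def)

text \<open>By \<open>comps_inj\<close> and \<open>comps_surj\<close> the pairs of reduced excursion
  and list are in bijection with the excursions without solitons below k, and
  \<open>reduced_sizes\<close> factors their weight. Normalizing the factor of the list changes the
  three constants as in the definitions of A, B and C.\<close>

lemma removal_step:
  assumes k: "1 \<le> k" and low: "\<And>j. 1 \<le> j \<Longrightarrow> j < k \<Longrightarrow> 0 < q j \<and> q j < 1"
    and W: "\<And>\<eta>. pmf (map_pmf (reduced k) \<nu>) \<eta> = W k \<eta>"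
  shows "0 < q k \<and> q k < 1"
    and "\<And>\<eta>. pmf (map_pmf (reduced (Suc k)) \<nu>) \<eta> = W (Suc k) \<eta>"
    and "map_pmf (\<lambda>\<eta>. (reduced (Suc k) \<eta>, comps k \<eta>)) \<nu>
      = bind_pmf (map_pmf (reduced (Suc k)) \<nu>) (\<lambda>u. map_pmf (Pair u) (replicate_pmf (num_slots k u) (geometric_pmf (1 - q k))))"
proof -
  have pj: "0 < 1 - q j" if "j \<in> {1..<k}" for j using low[of j] that by simp
  have prods: "0 < (\<Prod>j\<in>{1..<k}. (1 - q j) ^ (2 * j))" "0 < (\<Prod>j\<in>{1..<k}. (1 - q j)\<^sup>2)" "0 < (\<Prod>j\<in>{1..<k}. 1 - q j)"
    by (intro prod_pos zero_less_power pj; assumption)+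
  have Apos: "0 < A k" and Bpos: "0 < B k" and Cpos: "0 < C k"
    using prods pos by (simp_all add: A_def B_def C_def)
  have q: "q k = A k * B k ^ k" by (rule q_eq) (use low in blast)
  then have qpos: "0 < q k" using Apos Bpos by simp
  let ?f = "\<lambda>\<eta>. (reduced (Suc k) \<eta>, comps k \<eta>)"
  let ?P = "map_pmf ?f \<nu>"
  have dyck_\<nu>: "is_dyck \<eta>" if "\<eta> \<in> set_pmf \<nu>" for \<eta> using that \<nu> by (metis pmf_eq_0_set_pmf)
  have P: "?P = map_pmf ?f (map_pmf (reduced k) \<nu>)"
    unfolding map_pmf_comp
  proof (rule map_pmf_cong[OF refl])
    fix \<eta> assume "\<eta> \<in> set_pmf \<nu>"
    then have d: "dyck (dyck_size_of \<eta>) \<eta>" using dyck_\<nu> is_dyckD by blast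
    show "?f \<eta> = ?f (reduced k \<eta>)"
      using reduced_reduced[OF d, of k "Suc k"] comp_reduced[OF d, of k k] by simp
  qed
  have supp: "\<eta> \<in> set_pmf (map_pmf (reduced k) \<nu>) \<longleftrightarrow> is_dyck \<eta> \<and> long_runs k \<eta>" for \<eta>
    unfolding set_pmf_iff W W_def using Apos Bpos Cpos by simp
  have inj: "inj_on ?f (set_pmf (map_pmf (reduced k) \<nu>))"
    by (rule inj_onI) (use supp comps_inj is_dyckD in blast)
  let ?ok = "\<lambda>u x. is_dyck u \<and> long_runs (Suc k) u \<and> length x = num_slots k u"
  have P1: "pmf ?P (u, x) = C k * A k ^ num_peaks u * B k ^ nat (dyck_size_of u div 2) * q k ^ sum_list x"
    if ok: "?ok u x" for u x
  proof -
    obtain M' where d': "dyck M' u" using ok unfolding is_dyck_def by blast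
    obtain M \<eta> where \<eta>: "dyck M \<eta>" "long_runs k \<eta>" "reduced (Suc k) \<eta> = u" "comps k \<eta> = x"
      using comps_surj[OF d', of k x] ok k by auto
    then have s: "\<eta> \<in> set_pmf (map_pmf (reduced k) \<nu>)" unfolding supp by (auto simp: is_dyck_def)
    have "pmf ?P (u, x) = W k \<eta>"
      using pmf_map_inj[OF inj s] \<eta> unfolding P W by simp
    also have "\<dots> = C k * A k ^ num_peaks \<eta> * B k ^ nat (M div 2)"
      using \<eta> by (auto simp: W_def is_dyck_def dyck_size_of)
    also have "num_peaks \<eta> = num_peaks u + sum_list x"
      using reduced_sizes[OF \<eta>(1), of k] \<eta> by simp
    also have "nat (M div 2) = nat (dyck_size_of u div 2) + k * sum_list x"
    proof -
      have "M = M' + 2 * (int k * int (sum_list x))"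
        using reduced_sizes[OF \<eta>(1), of k] \<eta> dyck_size_of[OF d'] by simp
      then have e: "M div 2 = M' div 2 + int (k * sum_list x)" by simp
      have "0 \<le> M' div 2" using d' by (simp add: dyck_def)
      then show ?thesis
        unfolding e dyck_size_of[OF d'] by (simp only: nat_add_distrib[OF _ of_nat_0_le_iff] nat_int)
    qed
    finally show ?thesis unfolding q by (simp add: power_add power_mult power_mult_distrib algebra_simps)
  qed
  have P0: "pmf ?P (u, x) = 0" if nok: "\<not> ?ok u x" for u x
  proof -
    have "(u, x) \<notin> set_pmf ?P"
    proof
      assume "(u, x) \<in> set_pmf ?P"
      then obtain \<eta> where \<eta>: "\<eta> \<in> set_pmf \<nu>" "u = reduced (Suc k) \<eta>" "x = comps k \<eta>" by auto
      then have d: "dyck (dyck_size_of \<eta>) \<eta>" using dyck_\<nu> is_dyckD by blast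
      show False using nok reduced_props[OF d, of "Suc k"] length_comp[OF d, of k] \<eta> by simp
    qed
    then show ?thesis by (simp add: pmf_eq_0_set_pmf)
  qed
  have de: "dyck 0 (\<lambda>_. False)" by (simp add: dyck_def walk_0) (simp add: walk_def)
  \<comment> \<open>The empty excursion has exactly one k-slot, and n solitons appended to it have
    probability C_k q_k^n. If q_k were at least 1, infinitely many disjoint events would each have
    probability at least C_k > 0.\<close>
  have "\<not> 1 \<le> q k"
  proof
    assume q1: "1 \<le> q k"
    let ?e = "\<lambda>n. ((\<lambda>_. False) :: config, [n :: nat])"
    have ge: "C k \<le> pmf ?P (?e n)" for n
    proof -
      have "pmf ?P (?e n) = C k * q k ^ n"
        using P1[of "\<lambda>_. False" "[n]"] de long_runs_empty
        by (simp add: is_dyck_def num_slots_def dyck_size_of[OF de] num_peaks_empty, blast)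
      moreover have "1 \<le> q k ^ n" using q1 by (rule one_le_power)
      ultimately show ?thesis using Cpos by simp
    qed
    obtain n :: nat where n: "1 < real n * C k" using Cpos reals_Archimedean3 by blast
    have "real n * C k = (\<Sum>i<n. C k)" by simp
    also have "\<dots> \<le> (\<Sum>i<n. pmf ?P (?e i))" by (rule sum_mono) (rule ge)
    also have "\<dots> = (\<Sum>y\<in>?e ` {..<n}. pmf ?P y)" by (subst sum.reindex) (auto simp: inj_on_def)
    also have "\<dots> = measure_pmf.prob ?P (?e ` {..<n})" by (rule measure_measure_pmf_finite[symmetric]) simp
    also have "\<dots> \<le> 1" by (rule measure_pmf.prob_le_1)
    finally show False using n by simp
  qed
  then have q1: "q k < 1" by simp
  show "0 < q k \<and> q k < 1" using qpos q1 by simp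
  let ?G = "geometric_pmf (1 - q k)"
  have G: "pmf ?G n = q k ^ n * (1 - q k)" for n using geometric_pmf.rep_eq[of "1 - q k"] qpos q1 by simp
  have GL: "prod_list (map (pmf ?G) x) = q k ^ sum_list x * (1 - q k) ^ length x" for x
    by (induction x) (simp_all add: G power_add)
  have suc: "{1..<Suc k} = insert k {1..<k}" using k by auto
  have ABC: "A (Suc k) = A k * (1 - q k) ^ (2 * k)" "B (Suc k) = B k / (1 - q k)\<^sup>2" "C (Suc k) = C k / (1 - q k)"
    unfolding A_def B_def C_def suc by (subst prod.insert; simp)+
  \<comment> \<open>The slot count 1 + 2n - 2kN is affine in half length n and number of peaks N:
    each of 1, 2n and 2kN is matched by the power of 1 - q_k by which C, B and A change.\<close>
  have WS: "W (Suc k) u * (1 - q k) ^ num_slots k u = C k * A k ^ num_peaks u * B k ^ nat (dyck_size_of u div 2)"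
    if u: "is_dyck u" "long_runs (Suc k) u" for u
  proof -
    let ?N = "num_peaks u" and ?n = "nat (dyck_size_of u div 2)"
    obtain M where d: "dyck M u" using u unfolding is_dyck_def by blast
    have M: "M = 2 * int ?n" using even_dyck[OF d] d dyck_size_of[OF d] by (auto simp: dyck_def elim!: evenE)
    have "int (num_slots k u) + 2 * int k * int ?N = 1 + 2 * int ?n"
      using num_slots_eq[OF d u(2)] M by simp
    then have s: "num_slots k u + 2 * k * ?N = 1 + 2 * ?n" by (metis (mono_tags, lifting) of_nat_1 of_nat_add of_nat_eq_iff of_nat_mult of_nat_numeral)
    have x: "1 - q k \<noteq> 0" using q1 by simp
    have "W (Suc k) u = C (Suc k) * A (Suc k) ^ ?N * B (Suc k) ^ ?n" using u by (simp add: W_def)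
    also have "\<dots> = C k / (1 - q k) * (A k ^ ?N * (1 - q k) ^ (2 * k * ?N)) * (B k ^ ?n / (1 - q k) ^ (2 * ?n))"
      unfolding ABC by (simp only: power_mult_distrib power_divide power_mult)
    also have "\<dots> * (1 - q k) ^ num_slots k u
      = C k * A k ^ ?N * B k ^ ?n * ((1 - q k) ^ (num_slots k u + 2 * k * ?N) / ((1 - q k) ^ (1 + 2 * ?n)))"
      using x by (simp add: power_add divide_simps)
    also have "\<dots> = C k * A k ^ ?N * B k ^ ?n" unfolding s using x by simp
    finally show ?thesis .
  qed
  have PW: "pmf ?P (u, x) = W (Suc k) u * pmf (replicate_pmf (num_slots k u) ?G) x" for u x
  proof (cases "?ok u x")
    case True
    have "W (Suc k) u * pmf (replicate_pmf (num_slots k u) ?G) x = W (Suc k) u * (1 - q k) ^ num_slots k u * q k ^ sum_list x"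
      using True by (simp add: pmf_replicate_pmf GL)
    then show ?thesis using P1[OF True] WS True by simp
  next
    case False
    then have "W (Suc k) u = 0 \<or> length x \<noteq> num_slots k u" by (auto simp: W_def)
    then show ?thesis using P0[OF False] by (auto simp: pmf_replicate_pmf)
  qed
  have WP: "pmf (map_pmf (reduced (Suc k)) \<nu>) u = W (Suc k) u" for u
  proof -
    have "0 \<le> W (Suc k) u"
    proof (cases "is_dyck u \<and> long_runs (Suc k) u")
      case True
      then have "0 \<le> W (Suc k) u * (1 - q k) ^ num_slots k u" using WS Apos Bpos Cpos by simp
      moreover have "0 < (1 - q k) ^ num_slots k u" using q1 by simp
      ultimately show ?thesis by (meson mult_neg_pos not_le)
    qed (auto simp: W_def)
    moreover have "map_pmf (reduced (Suc k)) \<nu> = map_pmf fst ?P" by (simp add: map_pmf_comp)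
    ultimately show ?thesis
      using pmf_map_fst[of ?P u "W (Suc k) u" "\<lambda>u. replicate_pmf (num_slots k u) ?G"] PW by simp
  qed
  then show "\<And>\<eta>. pmf (map_pmf (reduced (Suc k)) \<nu>) \<eta> = W (Suc k) \<eta>" .
  show "?P = bind_pmf (map_pmf (reduced (Suc k)) \<nu>) (\<lambda>u. map_pmf (Pair u) (replicate_pmf (num_slots k u) ?G))"
  proof (rule pmf_eqI)
    fix y show "pmf ?P y = pmf (bind_pmf (map_pmf (reduced (Suc k)) \<nu>) (\<lambda>u. map_pmf (Pair u) (replicate_pmf (num_slots k u) ?G))) y"
      by (cases y) (simp only: pmf_bind_Pair WP PW)
  qed
qed

lemma removal_steps:
  assumes "1 \<le> k"
  shows "(\<forall>j. 1 \<le> j \<and> j < k \<longrightarrow> 0 < q j \<and> q j < 1) \<and> (\<forall>\<eta>. pmf (map_pmf (reduced k) \<nu>) \<eta> = W k \<eta>)"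
  using assms
proof (induction k rule: nat_induct_at_least)
  case base
  have l1: "long_runs 1 \<eta>" for \<eta>
  proof -
    have "i = 0" if "0 \<le> i \<and> i < int 1" for i using that by simp
    then show ?thesis unfolding long_runs_def by fastforce
  qed
  then have "map_pmf (reduced 1) \<nu> = \<nu>" by (simp add: reduced_long_runs map_pmf_idI)
  then show ?case using l1 by (simp add: \<nu> W_def A_def B_def C_def)
next
  case (Suc k)
  have low: "0 < q j \<and> q j < 1" if "1 \<le> j" "j < k" for j using Suc.IH that by blast
  have W: "pmf (map_pmf (reduced k) \<nu>) \<eta> = W k \<eta>" for \<eta> using Suc.IH by blast
  have "0 < q j \<and> q j < 1" if "1 \<le> j" "j < Suc k" for j
    using that low[of j] removal_step(1)[OF Suc.hyps low W] by (cases "j = k") auto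
  then show ?case using removal_step(2)[OF Suc.hyps low W] by blast
qed

lemma comps_law:
  assumes "1 \<le> k"
  shows "map_pmf (\<lambda>\<eta>. (reduced (Suc k) \<eta>, comps k \<eta>)) \<nu>
      = bind_pmf (map_pmf (reduced (Suc k)) \<nu>) (\<lambda>u. map_pmf (Pair u) (replicate_pmf (num_slots k u) (geometric_pmf (1 - q k))))"
  using removal_step(3)[OF assms] removal_steps[OF assms] by blast

end

section \<open>Windows of the concatenated lists around slot 0\<close>

context soliton_pmf
begin

lemma supp_dyck: "\<eta> \<in> set_pmf \<nu> \<Longrightarrow> dyck (dyck_size_of \<eta>) \<eta>"
  using \<nu>[of \<eta>] is_dyckD by (auto simp: set_pmf_iff split: if_splits)

abbreviation window :: "nat \<Rightarrow> nat \<Rightarrow> config list \<Rightarrow> nat list" where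
  "window k m us \<equiv> take (2 * m) (drop (length (concat (map (comps k) (take m us))) - m) (concat (map (comps k) us)))"

text \<open>The offset of the window is computed from slot numbers, which are functions of the
  reduced excursions. Conditionally on these the window is a slice at a fixed place of a long enough
  list of independent geometric variables, so its law does not depend on them.\<close>

lemma window_law:
  assumes k: "1 \<le> k"
  shows "map_pmf (\<lambda>us. (map (reduced (Suc k)) us, window k m us)) (replicate_pmf (2 * m) \<nu>)
    = pair_pmf (replicate_pmf (2 * m) (map_pmf (reduced (Suc k)) \<nu>)) (replicate_pmf (2 * m) (geometric_pmf (1 - q k)))"
proof -
  let ?N = "num_slots k" and ?R = "reduced (Suc k)" and ?G = "geometric_pmf (1 - q k)"
  let ?off = "\<lambda>us. sum_list (map ?N (take m us)) - m"
  have len: "length (comps k u) = ?N (?R u)" if "u \<in> set_pmf \<nu>" for u using length_comp[OF supp_dyck[OF that]] .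
  have pos: "1 \<le> ?N (?R u)" if "u \<in> set_pmf \<nu>" for u
  proof -
    have "config_slots k u \<noteq> {}" "finite (config_slots k u)"
      using config_slots_bounds[OF supp_dyck[OF that]] config_slots_finite[OF supp_dyck[OF that]] by auto
    then have "0 < card (config_slots k u)" by (simp add: card_gt_0_iff)
    then show ?thesis using len[OF that] by simp
  qed
  have "map_pmf (\<lambda>us. (map ?R us, window k m us)) (replicate_pmf (2 * m) \<nu>)
    = map_pmf (\<lambda>(us, y). (us, take (2 * m) (drop (?off us) y)))
        (map_pmf (\<lambda>us. (map ?R us, concat (map (comps k) us))) (replicate_pmf (2 * m) \<nu>))"
    unfolding map_pmf_comp
  proof (rule map_pmf_cong[OF refl])
    fix us assume "us \<in> set_pmf (replicate_pmf (2 * m) \<nu>)"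
    then have "set us \<subseteq> set_pmf \<nu>" by (auto simp: set_replicate_pmf)
    with set_take_subset[of m us] have tk: "set (take m us) \<subseteq> set_pmf \<nu>" by (rule order.trans)
    have "map (\<lambda>u. length (comps k u)) (take m us) = map (\<lambda>u. ?N (?R u)) (take m us)"
      by (rule map_cong[OF refl]) (rule len, rule subsetD[OF tk])
    then have "length (concat (map (comps k) (take m us))) = sum_list (map ?N (take m (map ?R us)))"
      unfolding length_concat take_map map_map o_def by (rule arg_cong)
    then show "(map ?R us, window k m us) = (case (map ?R us, concat (map (comps k) us)) of (us, y) \<Rightarrow> (us, take (2 * m) (drop (?off us) y)))"
      by simp
  qed
  also have "\<dots> = bind_pmf (replicate_pmf (2 * m) (map_pmf ?R \<nu>)) (\<lambda>us.
      map_pmf (Pair us) (map_pmf (\<lambda>y. take (2 * m) (drop (?off us) y)) (replicate_pmf (sum_list (map ?N us)) ?G)))"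
    unfolding map_pmf_rearrange_replicate[OF comps_law[OF k]]
    by (simp add: map_bind_pmf map_pmf_comp)
  also have "\<dots> = bind_pmf (replicate_pmf (2 * m) (map_pmf ?R \<nu>)) (\<lambda>us. map_pmf (Pair us) (replicate_pmf (2 * m) ?G))"
  proof (rule bind_pmf_cong[OF refl])
    fix us assume us: "us \<in> set_pmf (replicate_pmf (2 * m) (map_pmf ?R \<nu>))"
    then have l: "length us = 2 * m" and s: "set us \<subseteq> ?R ` set_pmf \<nu>" by (auto simp: set_replicate_pmf)
    have ge: "length vs \<le> sum_list (map ?N vs)" if "set vs \<subseteq> ?R ` set_pmf \<nu>" for vs
      using that
    proof (induction vs)
      case (Cons v vs)
      then obtain u where "u \<in> set_pmf \<nu>" "v = ?R u" by auto
      then have "1 \<le> ?N v" using pos by simp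
      then show ?case using Cons by simp
    qed simp
    have "m \<le> sum_list (map ?N (take m us))" "m \<le> sum_list (map ?N (drop m us))"
      using ge[of "take m us"] ge[of "drop m us"] s l set_take_subset[of m us] set_drop_subset[of m us] by auto
    moreover have "sum_list (map ?N us) = sum_list (map ?N (take m us)) + sum_list (map ?N (drop m us))"
      by (metis append_take_drop_id map_append sum_list_append)
    ultimately have "?off us + 2 * m \<le> sum_list (map ?N us)" by linarith
    then show "map_pmf (Pair us) (map_pmf (\<lambda>y. take (2 * m) (drop (?off us) y)) (replicate_pmf (sum_list (map ?N us)) ?G))
      = map_pmf (Pair us) (replicate_pmf (2 * m) ?G)"
      by (simp add: map_window_replicate_pmf)
  qed
  also have "\<dots> = pair_pmf (replicate_pmf (2 * m) (map_pmf ?R \<nu>)) (replicate_pmf (2 * m) ?G)"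
    by (simp add: pair_pmf_def map_pmf_def)
  finally show ?thesis .
qed

lemma map_replicate_pmf: "map_pmf (map f) (replicate_pmf n p) = replicate_pmf n (map_pmf f p)"
proof (induction n)
  case (Suc n)
  show ?case by (simp add: Suc[symmetric] map_bind_pmf bind_map_pmf)
qed simp

lemma window_reduced:
  assumes "set us \<subseteq> set_pmf \<nu>" "j \<le> k"
  shows "window k m (map (reduced j) us) = window k m us"
proof -
  have "map (comps k) (map (reduced j) us) = map (comps k) us"
    using comp_reduced[OF supp_dyck assms(2)] assms(1) by auto
  then show ?thesis unfolding take_map[symmetric] by (simp only: take_map)
qed

text \<open>Start with the smallest size l: its window is independent of the excursions reduced to
  sizes above l, and by \<open>window_reduced\<close> all larger windows are functions of those.
  Induction then treats the remaining sizes.\<close>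

lemma windows_prob:
  assumes "1 \<le> l"
  shows "measure_pmf.prob (replicate_pmf (2 * m) \<nu>) {us. \<forall>k\<in>{l..<l + n}. window k m us \<in> D k}
    = (\<Prod>k\<in>{l..<l + n}. measure_pmf.prob (replicate_pmf (2 * m) (geometric_pmf (1 - q k))) (D k))"
  using assms
proof (induction n arbitrary: l)
  case 0
  then show ?case by simp
next
  case (Suc n)
  let ?P = "replicate_pmf (2 * m) \<nu>" and ?R = "reduced (Suc l)" and ?I = "{Suc l..<Suc l + n}"
  let ?f = "\<lambda>us. (map ?R us, window l m us)" and ?S = "{us. \<forall>k\<in>?I. window k m us \<in> D k}"
  have I: "{l..<l + Suc n} = insert l ?I" by auto
  have eq: "us \<in> map ?R -` ?S \<longleftrightarrow> us \<in> ?S" if "us \<in> set_pmf ?P" for us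
  proof -
    have "set us \<subseteq> set_pmf \<nu>" using that by (auto simp: set_replicate_pmf)
    then have "window k m (map ?R us) = window k m us" if "k \<in> ?I" for k
      by (rule window_reduced) (use that in simp)
    then show ?thesis by auto
  qed
  have cong: "measure_pmf.prob ?P X = measure_pmf.prob ?P Y" if "\<And>us. us \<in> set_pmf ?P \<Longrightarrow> us \<in> X \<longleftrightarrow> us \<in> Y" for X Y
    by (rule measure_prob_cong_0) (use that in \<open>auto simp: pmf_eq_0_set_pmf\<close>)
  have red: "measure_pmf.prob (map_pmf (map ?R) ?P) ?S = measure_pmf.prob ?P ?S"
    unfolding measure_map_pmf by (rule cong) (rule eq)
  have "measure_pmf.prob ?P {us. \<forall>k\<in>{l..<l + Suc n}. window k m us \<in> D k} = measure_pmf.prob ?P (?f -` (?S \<times> D l))"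
  proof (rule cong)
    fix us assume "us \<in> set_pmf ?P"
    then show "us \<in> {us. \<forall>k\<in>{l..<l + Suc n}. window k m us \<in> D k} \<longleftrightarrow> us \<in> ?f -` (?S \<times> D l)"
      using eq[of us] unfolding I by auto
  qed
  also have "\<dots> = measure_pmf.prob (map_pmf ?f ?P) (?S \<times> D l)" by (simp only: measure_map_pmf)
  also have "\<dots> = measure_pmf.prob (map_pmf (map ?R) ?P) ?S * measure_pmf.prob (replicate_pmf (2 * m) (geometric_pmf (1 - q l))) (D l)"
    unfolding window_law[OF Suc.prems] pair_pmf_prob_Times map_replicate_pmf ..
  also have "measure_pmf.prob (map_pmf (map ?R) ?P) ?S = (\<Prod>k\<in>?I. measure_pmf.prob (replicate_pmf (2 * m) (geometric_pmf (1 - q k))) (D k))"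
    unfolding red using Suc.IH[of "Suc l"] by simp
  finally show ?case unfolding I by simp
qed

end

section \<open>The law of the excursions\<close>

lemma path_weight_replicate: "path_weight Q x (replicate n x) = Q x x ^ n"
  by (induction n) auto

lemma path_weight_block:
  assumes "0 < k"
  shows "path_weight Q c (replicate k (\<not> c) @ replicate k c) = Q c (\<not> c) * Q (\<not> c) c * (Q c c * Q (\<not> c) (\<not> c)) ^ (k - 1)"
    "last (c # replicate k (\<not> c) @ replicate k c) = c"
proof -
  obtain n where k: "k = Suc n" using assms by (cases k) auto
  show "path_weight Q c (replicate k (\<not> c) @ replicate k c) = Q c (\<not> c) * Q (\<not> c) c * (Q c c * Q (\<not> c) (\<not> c)) ^ (k - 1)"
    unfolding k by (simp add: path_weight_append path_weight_replicate power_mult_distrib)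
  show "last (c # replicate k (\<not> c) @ replicate k c) = c" unfolding k by simp
qed

lemma word_constant: "(\<And>i. i < n \<Longrightarrow> \<eta> (m + int i) = c) \<Longrightarrow> word m n \<eta> = replicate n c"
  by (rule nth_equalityI) (simp_all add: word_nth)

lemma word_cong: "(\<And>i. i < n \<Longrightarrow> \<eta> (m + int i) = \<eta>' (m' + int i)) \<Longrightarrow> word m n \<eta> = word m' n \<eta>'"
  by (rule nth_equalityI) (simp_all add: word_nth)

context chain
begin

definition qa :: real where "qa = Q False True * Q True False / (Q True True * Q False False)"
definition qb :: real where "qb = Q True True * Q False False"

lemma qa_qb_pos: "0 < qa" "0 < qb"
  using Q00 Q11 Q01 Q10 by (simp_all add: qa_def qb_def)

text \<open>A block preceded by c has two changes of value and k - 1 repetitions of each value. The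
  product is symmetric in the two states, so both orientations of a block weigh the same.\<close>

lemma block_weight: "0 < k \<Longrightarrow> Q c (\<not> c) * Q (\<not> c) c * (Q c c * Q (\<not> c) (\<not> c)) ^ (k - 1) = qa * qb ^ k"
proof -
  assume "0 < k"
  then obtain n where k: "k = Suc n" by (cases k) auto
  have "qa * qb = Q False True * Q True False" using Q00 Q11 by (simp add: qa_def qb_def)
  then have "qa * qb ^ k = Q False True * Q True False * qb ^ n" unfolding k power_Suc mult.assoc[symmetric] by (rule arg_cong)
  moreover have "Q c (\<not> c) * Q (\<not> c) c = Q False True * Q True False" "Q c c * Q (\<not> c) (\<not> c) = qb"
    by (cases c; simp add: qb_def)+
  ultimately show ?thesis unfolding k by (simp only: diff_Suc_1)
qed

text \<open>A block ends with the value that precedes it, so cutting it out leaves the transition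
  into the next box intact and divides the weight by a b^k. The remaining Q(0,0) is the step from
  the record in front of the empty excursion to the next record.\<close>

lemma dyck_path_weight:
  assumes "dyck M \<eta>"
  shows "path_weight Q False (word 1 (nat (M + 1)) \<eta>) = Q False False * qa ^ num_peaks \<eta> * qb ^ nat (M div 2)"
  using assms
proof (induction rule: dyck_induct)
  case empty
  then show ?case by (simp add: word_def num_peaks_empty)
next
  case (cut M \<eta> k p)
  note ex = cut(2)
  note k = extract_pos[OF ex]
  let ?\<zeta> = "\<eta> \<circ> skip k p"
  define c where "c = (\<not> \<eta> p)"
  define n1 where "n1 = nat (p - 1)"
  define n2 where "n2 = nat (M + 2 - p - 2 * int k)"
  have n1: "int n1 = p - 1" and n2: "int n2 = M + 2 - p - 2 * int k" using cut(4,5) by (auto simp: n1_def n2_def)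
  have cp: "\<eta> (p - 1) = c" using extract_before[OF ex, of 0] k by (simp add: c_def)
  have N: "nat (M + 1) = n1 + (k + k + n2)" using n1 n2 by linarith
  have N': "nat (M - 2 * int k + 1) = n1 + n2" using n1 n2 by linarith
  have blk: "word p (k + k) \<eta> = replicate k (\<not> c) @ replicate k c"
    unfolding word_append
    using extract_first[OF ex] extract_second[OF ex] by (auto simp: c_def intro!: arg_cong2[of _ _ _ _ "(@)"] word_constant)
  have w: "word 1 (nat (M + 1)) \<eta> = word 1 n1 \<eta> @ (replicate k (\<not> c) @ replicate k c) @ word (p + 2 * int k) n2 \<eta>"
    unfolding N word_append[of 1] word_append[of _ "k + k"] using n1 blk by (simp add: word_append algebra_simps)
  have w': "word 1 (nat (M - 2 * int k + 1)) ?\<zeta> = word 1 n1 \<eta> @ word (p + 2 * int k) n2 \<eta>"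
  proof -
    have "word 1 n1 ?\<zeta> = word 1 n1 \<eta>" by (rule word_cong) (use n1 in \<open>simp add: skip_def\<close>)
    moreover have "word (1 + int n1) n2 ?\<zeta> = word (p + 2 * int k) n2 \<eta>"
      by (rule word_cong) (use n1 in \<open>simp add: skip_def algebra_simps\<close>)
    ultimately show ?thesis unfolding N' word_append by simp
  qed
  \<comment> \<open>If the block starts at box 1, the word in front of it is empty and the preceding
    value is the empty box 0.\<close>
  have l1: "last (False # word 1 n1 \<eta>) = c"
  proof (cases "n1 = 0")
    case True
    then have "\<eta> 0 = c" using cp n1 by simp
    moreover have "\<not> \<eta> 0" using cut(1) unfolding dyck_def by force
    ultimately show ?thesis using True by (simp add: word_def)
  next
    case False
    then have "last (False # word 1 n1 \<eta>) = word 1 n1 \<eta> ! (n1 - 1)" by (simp add: last_conv_nth word_def)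
    also have "\<dots> = \<eta> (1 + int (n1 - 1))" using False by (simp add: word_nth)
    also have "1 + int (n1 - 1) = p - 1" using False n1 by simp
    finally show ?thesis using cp by simp
  qed
  have "path_weight Q False (word 1 (nat (M + 1)) \<eta>)
    = path_weight Q False (word 1 n1 \<eta>) * path_weight Q c (replicate k (\<not> c) @ replicate k c) * path_weight Q c (word (p + 2 * int k) n2 \<eta>)"
    unfolding w path_weight_append[of Q False] l1
    unfolding path_weight_append[of Q c "replicate k (\<not> c) @ replicate k c"] path_weight_block(2)[OF k] by simp
  also have "\<dots> = qa * qb ^ k * path_weight Q False (word 1 (nat (M - 2 * int k + 1)) ?\<zeta>)"
    unfolding w' path_weight_append[of Q False] l1 path_weight_block(1)[OF k] block_weight[OF k] by simp
  also have "\<dots> = qa * qb ^ k * (Q False False * qa ^ num_peaks ?\<zeta> * qb ^ nat ((M - 2 * int k) div 2))"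
    using cut(6) by (simp del: o_apply)
  also have "nat (M div 2) = k + nat ((M - 2 * int k) div 2)"
  proof -
    have "0 \<le> M - 2 * int k" using cut(3) by (simp add: dyck_def)
    moreover have "(M - 2 * int k) div 2 = M div 2 - int k" by simp
    ultimately show ?thesis by linarith
  qed
  then have "qa * qb ^ k * (Q False False * qa ^ num_peaks ?\<zeta> * qb ^ nat ((M - 2 * int k) div 2))
    = Q False False * qa ^ num_peaks \<eta> * qb ^ nat (M div 2)"
    unfolding num_peaks_cut[OF ex cut(1)] by (simp add: power_add del: o_apply)
  finally show ?case .
qed

definition exc_wt :: "int list \<Rightarrow> real" where
  "exc_wt \<epsilon> = (if \<epsilon> \<in> excursions then path_weight Q False (exc_word \<epsilon>) else 0)"

lemma exc_wt_eq:
  assumes "\<epsilon> \<in> excursions"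
  shows "exc_wt \<epsilon> = Q False False * qa ^ num_peaks (ball_config \<epsilon>) * qb ^ nat ((int (length \<epsilon>) - 1) div 2)"
  using dyck_path_weight[OF excursions_dyck(1)[OF assms]] assms by (simp add: exc_wt_def exc_word_def)

lemma exc_wt_pos: "\<epsilon> \<in> excursions \<Longrightarrow> 0 < exc_wt \<epsilon>"
  using qa_qb_pos Q00 by (simp add: exc_wt_eq)

lemma exc_wt_nonneg: "0 \<le> exc_wt \<epsilon>"
  using exc_wt_pos[of \<epsilon>] by (cases "\<epsilon> \<in> excursions") (auto simp: exc_wt_def)

lemma exc_wt_weight:
  assumes "\<epsilon> \<in> excursions" "\<And>k. \<alpha> k = qa * qb ^ k"
  shows "exc_wt \<epsilon> = Q False False * exc_weight \<alpha> \<epsilon>"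
  using exc_wt_eq[OF assms(1)] exc_weight_geometric[OF excursions_dyck(1)[OF assms(1)] assms(2)] by simp

lemma last_exc_word: "\<epsilon> \<in> excursions \<Longrightarrow> exc_word \<epsilon> \<noteq> [] \<and> last (exc_word \<epsilon>) = False"
proof -
  assume "\<epsilon> \<in> excursions"
  then have l: "0 < length \<epsilon>" by (rule excursions_dyck(3))
  then have "exc_word \<epsilon> \<noteq> []" by (simp add: exc_word_def word_def)
  moreover have "last (exc_word \<epsilon>) = ball_config \<epsilon> (int (length \<epsilon>))"
  proof -
    have "last (exc_word \<epsilon>) = exc_word \<epsilon> ! (length \<epsilon> - 1)" using calculation by (simp add: last_conv_nth)
    also have "\<dots> = ball_config \<epsilon> (1 + int (length \<epsilon> - 1))" using l by (simp add: exc_word_def word_nth)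
    also have "1 + int (length \<epsilon> - 1) = int (length \<epsilon>)" using l by linarith
    finally show ?thesis .
  qed
  ultimately show ?thesis by (simp add: ball_config_def)
qed

lemma path_weight_excursions:
  "set es \<subseteq> excursions \<Longrightarrow> path_weight Q False (concat (map exc_word es)) = prod_list (map exc_wt es)"
proof (induction es)
  case (Cons \<epsilon> es)
  then show ?case using last_exc_word[of \<epsilon>] by (simp add: path_weight_append exc_wt_def)
qed simp

section \<open>The Palm measure\<close>

lemma v_pos: "0 < 1 - 2 * p True" using p1 by simp

lemma expectation_origin: "(\<integral>\<zeta>. of_bool (\<zeta> 0) \<partial>\<pi>) = p True"
proof -
  have "(\<integral>\<zeta>. of_bool (\<zeta> 0) \<partial>\<pi>) = (\<integral>\<zeta>. indicator (cyl 0 [True]) \<zeta> \<partial>\<pi>)"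
    by (rule Bochner_Integration.integral_cong) (auto simp: cyl_def indicator_def)
  also have "\<dots> = prob (cyl 0 [True])" using sets_cyl sets_law by simp
  finally show ?thesis by (simp add: prob_cyl)
qed

lemma sets_configs_hat: "configs_hat \<in> sets config_space"
proof -
  have "configs_hat = configs \<inter> {\<eta>. 0 \<in> records \<eta>}" by (auto simp: configs_hat_def)
  also have "\<dots> \<in> sets config_space" by (intro sets.Int sets_configs sets_record)
  finally show ?thesis .
qed

lemma space_palm [simp]: "space (palm \<pi>) = configs_hat"
  by (simp add: palm_def space_restrict_space)

lemma palm_sets: "A \<in> sets config_space \<Longrightarrow> A \<inter> configs_hat \<in> sets (palm \<pi>)"
  by (auto simp: palm_def sets_restrict_space sets_law)

lemma sets_palmI: "A \<in> sets config_space \<Longrightarrow> A \<subseteq> configs_hat \<Longrightarrow> A \<in> sets (palm \<pi>)"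
  using palm_sets[of A] by (simp add: Int_absorb2)

lemma emeasure_palm:
  assumes A: "A \<in> sets config_space"
  shows "emeasure (palm \<pi>) (A \<inter> configs_hat) = ennreal (prob (A \<inter> {\<eta>. 0 \<in> records \<eta>}) / (1 - 2 * p True))"
proof -
  let ?R = "{\<eta>. 0 \<in> records \<eta>}" and ?v = "1 - 2 * p True"
  have ev: "A \<inter> configs_hat \<in> events" "A \<inter> ?R \<in> events"
    using A sets_configs_hat sets_record by (auto simp: sets_law)
  have dm: "(\<lambda>\<eta>. ennreal (indicator ?R \<eta> / ?v)) \<in> borel_measurable \<pi>"
    using sets_record[of 0] by (simp add: sets_law)
  have "emeasure (palm \<pi>) (A \<inter> configs_hat) = emeasure (density \<pi> (\<lambda>\<eta>. ennreal (indicator ?R \<eta> / ?v))) (A \<inter> configs_hat)"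
    unfolding palm_def expectation_origin
    by (rule emeasure_restrict_space) (use sets_configs_hat sets_law in auto)
  also have "\<dots> = (\<integral>\<^sup>+\<eta>. ennreal (indicator ?R \<eta> / ?v) * indicator (A \<inter> configs_hat) \<eta> \<partial>\<pi>)"
    by (rule emeasure_density[OF dm ev(1)])
  also have "\<dots> = (\<integral>\<^sup>+\<eta>. ennreal (1 / ?v) * indicator (A \<inter> configs_hat) \<eta> \<partial>\<pi>)"
    by (rule nn_integral_cong) (auto simp: indicator_def configs_hat_def)
  also have "\<dots> = ennreal (1 / ?v) * emeasure \<pi> (A \<inter> configs_hat)"
    by (rule nn_integral_cmult_indicator[OF ev(1)])
  also have "\<dots> = ennreal (prob (A \<inter> configs_hat) / ?v)"
    using v_pos by (simp add: emeasure_eq_measure ennreal_mult'[symmetric])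
  also have "prob (A \<inter> configs_hat) = prob (A \<inter> ?R)"
    by (rule finite_measure_eq_AE) (use configs_AE ev in \<open>auto simp: configs_hat_def elim!: eventually_mono\<close>)
  finally show ?thesis .
qed

lemma palm_prob_space: "prob_space (palm \<pi>)"
proof
  have "emeasure (palm \<pi>) (UNIV \<inter> configs_hat) = ennreal (prob (UNIV \<inter> {\<eta>. 0 \<in> records \<eta>}) / (1 - 2 * p True))"
    by (rule emeasure_palm) (use sets.top[of config_space] in simp)
  also have "prob (UNIV \<inter> {\<eta>. 0 \<in> records \<eta>}) = 1 - 2 * p True"
    using record_cyl[of 0 "[]"] by (simp add: cyl_def)
  finally show "emeasure (palm \<pi>) (space (palm \<pi>)) = 1" using v_pos by simp
qed

sublocale palm: prob_space "palm \<pi>" by (rule palm_prob_space)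

lemma palm_measure:
  assumes "A \<in> sets config_space"
  shows "palm.prob (A \<inter> configs_hat) = prob (A \<inter> {\<eta>. 0 \<in> records \<eta>}) / (1 - 2 * p True)"
  using emeasure_palm[OF assms] v_pos by (simp add: palm.emeasure_eq_measure)

lemma hat_drifting: "\<eta> \<in> configs_hat \<Longrightarrow> drifting \<eta>" "\<eta> \<in> configs_hat \<Longrightarrow> 0 \<in> records \<eta>"
  using configs_drifting by (auto simp: configs_hat_def)

text \<open>The position of record i is random; splitting over its countably many values leaves a
  record and a cylinder at fixed places.\<close>

lemma measurable_excursion_at: "(\<lambda>\<eta>. excursion_at \<eta> i) \<in> measurable (palm \<pi>) (count_space excursions)"
proof -
  have "{\<eta>\<in>configs_hat. excursion_at \<eta> i = \<epsilon>} \<in> sets (palm \<pi>)" if e: "\<epsilon> \<in> excursions" for \<epsilon>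
  proof (rule sets_palmI)
    have "{\<eta>\<in>configs_hat. excursion_at \<eta> i = \<epsilon>} = configs_hat \<inter> (\<Union>z. {\<eta>\<in>space config_space. walk \<eta> z = - i} \<inter> {\<eta>. z \<in> records \<eta>} \<inter> cyl (z + 1) (exc_word \<epsilon>))"
      (is "?L = ?R")
    proof (intro equalityI subsetI)
      fix \<eta> assume a: "\<eta> \<in> ?L"
      then have d: "drifting \<eta>" using hat_drifting by blast
      then have "\<eta> \<in> cyl (record_pos \<eta> i + 1) (exc_word \<epsilon>)" using excursion_at_iff[OF d e, of i] a by blast
      then show "\<eta> \<in> ?R" using a walk_record_pos[OF d, of i] record_pos_record[OF d, of i] by auto
    next
      fix \<eta> assume a: "\<eta> \<in> ?R"
      then have d: "drifting \<eta>" using hat_drifting by blast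
      obtain z where z: "walk \<eta> z = - i" "z \<in> records \<eta>" "\<eta> \<in> cyl (z + 1) (exc_word \<epsilon>)" using a by blast
      then have "record_pos \<eta> i = z" using record_is_record_pos[OF d z(2)] by simp
      then show "\<eta> \<in> ?L" using a z(3) excursion_at_iff[OF d e, of i] by simp
    qed
    also have "\<dots> \<in> sets config_space"
    proof -
      have W: "{\<eta>\<in>space config_space. walk \<eta> z = - i} \<in> sets config_space" for z by measurable
      show ?thesis
        by (intro sets.Int sets_configs_hat sets.countable_UN image_subsetI W sets_record sets_cyl)
    qed
    finally show "{\<eta>\<in>configs_hat. excursion_at \<eta> i = \<epsilon>} \<in> sets config_space" .
  qed auto
  then have "(\<lambda>\<eta>. excursion_at \<eta> i) -` {\<epsilon>} \<inter> space (palm \<pi>) \<in> sets (palm \<pi>)" if "\<epsilon> \<in> excursions" for \<epsilon>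
    using that by (simp add: vimage_def Int_def conj_commute)
  moreover have "(\<lambda>\<eta>. excursion_at \<eta> i) \<in> space (palm \<pi>) \<rightarrow> excursions"
    using excursion_at_in hat_drifting by auto
  ultimately show ?thesis
    by (subst measurable_count_space_eq2_countable) (auto intro: countableI_type)
qed

definition exc_vec :: "int \<Rightarrow> nat \<Rightarrow> config \<Rightarrow> int list list" where
  "exc_vec i n \<eta> = map (\<lambda>t. excursion_at \<eta> (i + int t)) [0..<n]"

lemma exc_vec_eq: "exc_vec i n \<eta> = es \<longleftrightarrow> length es = n \<and> (\<forall>t<length es. excursion_at \<eta> (i + int t) = es ! t)"
  unfolding exc_vec_def list_eq_iff_nth_eq by auto

text \<open>The bounds on i say that record 0 is one of the ends of the listed excursions. The
  record density from \<open>record_cyl\<close> cancels against the normalization of the Palm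
  measure, which leaves a product of weights and hence independence.\<close>

lemma prob_exc_vec:
  assumes i: "i \<le> 0" "0 \<le> i + int n" and l: "length es = n" and es: "set es \<subseteq> excursions"
  shows "{\<eta>\<in>configs_hat. exc_vec i n \<eta> = es} \<in> sets (palm \<pi>)"
    "palm.prob {\<eta>\<in>configs_hat. exc_vec i n \<eta> = es} = prod_list (map exc_wt es)"
proof -
  define z where "z = - (\<Sum>t<nat (- i). int (length (es ! t)))"
  let ?A = "{\<eta>. z \<in> records \<eta>} \<inter> cyl (z + 1) (concat (map exc_word es))"
  have A: "?A \<in> sets config_space" using sets_record sets_cyl by auto
  have iff: "0 \<in> records \<eta> \<and> exc_vec i n \<eta> = es \<longleftrightarrow> \<eta> \<in> ?A" if "drifting \<eta>" for \<eta>
    using records_excursions_iff[OF that es i(1)] i(2) l unfolding z_def exc_vec_eq by auto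
  have eq: "{\<eta>\<in>configs_hat. exc_vec i n \<eta> = es} = ?A \<inter> configs_hat"
    using iff hat_drifting by blast
  show "{\<eta>\<in>configs_hat. exc_vec i n \<eta> = es} \<in> sets (palm \<pi>)" unfolding eq by (rule palm_sets[OF A])
  have "prob (?A \<inter> {\<eta>. 0 \<in> records \<eta>}) = prob ?A"
  proof (rule finite_measure_eq_AE)
    show "AE \<eta> in \<pi>. (\<eta> \<in> ?A \<inter> {\<eta>. 0 \<in> records \<eta>}) = (\<eta> \<in> ?A)"
      using configs_AE by eventually_elim (use iff configs_drifting in blast)
  qed (use A sets_record sets_law in auto)
  then show "palm.prob {\<eta>\<in>configs_hat. exc_vec i n \<eta> = es} = prod_list (map exc_wt es)"
    unfolding eq palm_measure[OF A] record_cyl path_weight_excursions[OF es] using v_pos by simp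
qed

definition exc_pmf :: "int list pmf" where
  "exc_pmf = embed_pmf exc_wt"

lemma exc_vec_in: "\<eta> \<in> configs_hat \<Longrightarrow> set (exc_vec i n \<eta>) \<subseteq> excursions"
  using excursion_at_in hat_drifting by (auto simp: exc_vec_def)

lemma measurable_exc_vec:
  assumes i: "i \<le> 0" "0 \<le> i + int n"
  shows "exc_vec i n \<in> measurable (palm \<pi>) (count_space UNIV)"
proof (subst measurable_count_space_eq2_countable, intro conjI ballI)
  fix es :: "int list list"
  show "exc_vec i n -` {es} \<inter> space (palm \<pi>) \<in> sets (palm \<pi>)"
  proof (cases "length es = n \<and> set es \<subseteq> excursions")
    case True
    then show ?thesis using prob_exc_vec(1)[OF i, of es] by (simp add: vimage_def Int_def conj_commute)
  next
    case False
    then have "exc_vec i n \<eta> \<noteq> es" if "\<eta> \<in> configs_hat" for \<eta> using exc_vec_in[OF that, of i n] by (auto simp: exc_vec_def)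
    then have "exc_vec i n -` {es} \<inter> space (palm \<pi>) = {}" by auto
    then show ?thesis by simp
  qed
qed auto

lemma emeasure_exc_vec:
  assumes i: "i \<le> 0" "0 \<le> i + int n"
  shows "emeasure (distr (palm \<pi>) (count_space UNIV) (exc_vec i n)) {es} = (if length es = n then ennreal (prod_list (map exc_wt es)) else 0)"
proof -
  have e: "emeasure (distr (palm \<pi>) (count_space UNIV) (exc_vec i n)) {es} = ennreal (palm.prob {\<eta>\<in>configs_hat. exc_vec i n \<eta> = es})"
    using measurable_exc_vec[OF i] by (simp add: emeasure_distr vimage_def Int_def conj_commute palm.emeasure_eq_measure)
  show ?thesis
  proof (cases "length es = n \<and> set es \<subseteq> excursions")
    case True
    then show ?thesis unfolding e using prob_exc_vec(2)[OF i, of es] by simp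
  next
    case False
    then have "exc_vec i n \<eta> \<noteq> es" if "\<eta> \<in> configs_hat" for \<eta> using exc_vec_in[OF that, of i n] by (auto simp: exc_vec_def)
    then have "{\<eta>\<in>configs_hat. exc_vec i n \<eta> = es} = {}" by auto
    moreover have "prod_list (map exc_wt es) = 0" if "length es = n"
      using False that by (auto simp: prod_list_zero_iff exc_wt_def)
    ultimately show ?thesis unfolding e by (simp only: measure_empty) auto
  qed
qed

text \<open>Excursion 0 exists almost surely under the Palm measure, so its probabilities, which are
  these weights, add up to one.\<close>

lemma exc_wt_total: "(\<integral>\<^sup>+\<epsilon>. ennreal (exc_wt \<epsilon>) \<partial>count_space UNIV) = 1"
proof -
  let ?D = "distr (palm \<pi>) (count_space UNIV) (exc_vec 0 1)"
  have m: "exc_vec 0 1 \<in> measurable (palm \<pi>) (count_space UNIV)" by (rule measurable_exc_vec) auto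
  interpret D: prob_space ?D by (rule palm.prob_space_distr[OF m])
  have "emeasure ?D ((\<lambda>\<epsilon>. [\<epsilon>]) ` UNIV) = (\<integral>\<^sup>+es. emeasure ?D {es} \<partial>count_space ((\<lambda>\<epsilon>. [\<epsilon>]) ` UNIV))"
    by (rule emeasure_countable_singleton) (auto intro: countableI_type)
  also have "\<dots> = (\<integral>\<^sup>+\<epsilon>. emeasure ?D {[\<epsilon>]} \<partial>count_space UNIV)"
    by (rule nn_integral_bij_count_space[symmetric]) (auto simp: bij_betw_def inj_on_def)
  also have "\<dots> = (\<integral>\<^sup>+\<epsilon>. ennreal (exc_wt \<epsilon>) \<partial>count_space UNIV)"
    by (rule nn_integral_cong) (subst emeasure_exc_vec; simp)
  also have "emeasure ?D ((\<lambda>\<epsilon>. [\<epsilon>]) ` UNIV) = emeasure ?D (space ?D)"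
  proof (rule emeasure_eq_AE)
    have "AE \<eta> in palm \<pi>. exc_vec 0 1 \<eta> \<in> (\<lambda>\<epsilon>. [\<epsilon>]) ` UNIV" by (auto simp: exc_vec_def)
    then have "AE es in ?D. es \<in> (\<lambda>\<epsilon>. [\<epsilon>]) ` UNIV" by (subst AE_distr_iff[OF m]) auto
    then show "AE es in ?D. (es \<in> (\<lambda>\<epsilon>. [\<epsilon>]) ` UNIV) = (es \<in> space ?D)" by eventually_elim simp
  qed auto
  finally show ?thesis using D.emeasure_space_1 by simp
qed

lemma pmf_exc_pmf: "pmf exc_pmf \<epsilon> = exc_wt \<epsilon>"
  unfolding exc_pmf_def by (rule pmf_embed_pmf[OF exc_wt_nonneg exc_wt_total])

lemma set_exc_pmf: "set_pmf exc_pmf = excursions"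
proof (rule set_eqI)
  fix \<epsilon>
  show "\<epsilon> \<in> set_pmf exc_pmf \<longleftrightarrow> \<epsilon> \<in> excursions"
    using exc_wt_pos[of \<epsilon>] by (cases "\<epsilon> \<in> excursions") (simp_all add: set_pmf_iff pmf_exc_pmf, simp add: exc_wt_def)
qed

lemma exc_vec_law:
  assumes i: "i \<le> 0" "0 \<le> i + int n"
  shows "distr (palm \<pi>) (count_space UNIV) (exc_vec i n) = measure_pmf (replicate_pmf n exc_pmf)"
proof (rule measure_eqI_countable[of _ UNIV])
  fix es :: "int list list"
  show "emeasure (distr (palm \<pi>) (count_space UNIV) (exc_vec i n)) {es} = emeasure (measure_pmf (replicate_pmf n exc_pmf)) {es}"
    unfolding emeasure_exc_vec[OF i] emeasure_pmf_single pmf_replicate_pmf by (simp add: pmf_exc_pmf[abs_def])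
qed (auto intro: countableI_type)

lemma prob_exc_vec_event:
  assumes i: "i \<le> 0" "0 \<le> i + int n"
  shows "palm.prob {\<eta>\<in>configs_hat. exc_vec i n \<eta> \<in> S} = measure_pmf.prob (replicate_pmf n exc_pmf) S"
proof -
  have "measure_pmf.prob (replicate_pmf n exc_pmf) S = measure (distr (palm \<pi>) (count_space UNIV) (exc_vec i n)) S"
    by (simp only: exc_vec_law[OF i])
  also have "\<dots> = palm.prob {\<eta>\<in>configs_hat. exc_vec i n \<eta> \<in> S}"
    using measurable_exc_vec[OF i] by (simp add: measure_distr vimage_def Int_def conj_commute)
  finally show ?thesis by simp
qed

end

section \<open>Independence\<close>

lemma (in prob_space) indep_vars_finiteI:
  assumes rv: "\<And>i. i \<in> I \<Longrightarrow> random_variable (M' i) (X i)"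
    and P: "\<And>J B. finite J \<Longrightarrow> J \<subseteq> I \<Longrightarrow> (\<And>j. j \<in> J \<Longrightarrow> B j \<in> sets (M' j)) \<Longrightarrow>
      prob {x\<in>space M. \<forall>j\<in>J. X j x \<in> B j} = (\<Prod>j\<in>J. prob {x\<in>space M. X j x \<in> B j})"
  shows "indep_vars M' X I"
  unfolding indep_vars_def2
proof (intro conjI ballI indep_setsI rv)
  show "{X i -` A \<inter> space M |A. A \<in> sets (M' i)} \<subseteq> events" if "i \<in> I" for i
    using rv[OF that] by (auto simp: measurable_sets)
next
  fix A J assume J: "J \<noteq> {}" "J \<subseteq> I" "finite J" and A: "\<forall>j\<in>J. A j \<in> {X j -` A \<inter> space M |A. A \<in> sets (M' j)}"
  then have "\<forall>j\<in>J. \<exists>B. A j = X j -` B \<inter> space M \<and> B \<in> sets (M' j)" by blast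
  from bchoice[OF this] obtain B where B: "\<And>j. j \<in> J \<Longrightarrow> A j = X j -` B j \<inter> space M \<and> B j \<in> sets (M' j)" by blast
  have "(\<Inter>j\<in>J. A j) = {x\<in>space M. \<forall>j\<in>J. X j x \<in> B j}" using B J(1) by auto
  moreover have "A j = {x\<in>space M. X j x \<in> B j}" if "j \<in> J" for j using B[OF that] by auto
  ultimately show "prob (\<Inter>j\<in>J. A j) = (\<Prod>j\<in>J. prob (A j))"
    using P[OF J(3,2), of B] B by (simp cong: prod.cong)
qed

lemma prod_window:
  fixes g :: "int \<Rightarrow> 'a::comm_monoid_mult"
  assumes "J \<subseteq> {- int m..<int m}"
  shows "(\<Prod>t<2 * m. if - int m + int t \<in> J then g (- int m + int t) else 1) = prod g J"
proof -
  have "(\<Prod>t<2 * m. if - int m + int t \<in> J then g (- int m + int t) else 1) = (\<Prod>i\<in>{- int m..<int m}. if i \<in> J then g i else 1)"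
    by (rule prod.reindex_bij_witness[of _ "\<lambda>i. nat (i + int m)" "\<lambda>t. - int m + int t"]) auto
  also have "\<dots> = prod g ({- int m..<int m} \<inter> J)" by (simp add: prod.inter_restrict)
  also have "{- int m..<int m} \<inter> J = J" using assms by blast
  finally show ?thesis .
qed

lemma finite_int_window: "finite (J::int set) \<Longrightarrow> \<exists>m. J \<subseteq> {- int m..<int m}"
proof -
  assume "finite J"
  then have "x \<le> Max (abs ` J)" if "x \<in> abs ` J" for x using that by (intro Max_ge) auto
  then have "J \<subseteq> {- int (nat (Max (abs ` J)) + 1)..<int (nat (Max (abs ` J)) + 1)}" by force
  then show ?thesis by blast
qed

context chain
begin

lemma prob_excursions:
  assumes "finite J"
  shows "palm.prob {\<eta>\<in>configs_hat. \<forall>j\<in>J. excursion_at \<eta> j \<in> B j} = (\<Prod>j\<in>J. measure_pmf.prob exc_pmf (B j))"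
proof -
  obtain m where m: "J \<subseteq> {- int m..<int m}" using finite_int_window[OF assms] by blast
  let ?A = "\<lambda>t::nat. if - int m + int t \<in> J then B (- int m + int t) else UNIV"
  have iff: "(\<forall>j\<in>J. excursion_at \<eta> j \<in> B j) \<longleftrightarrow> (\<forall>t<2 * m. exc_vec (- int m) (2 * m) \<eta> ! t \<in> ?A t)" for \<eta>
  proof safe
    fix t assume "\<forall>j\<in>J. excursion_at \<eta> j \<in> B j" "t < 2 * m"
    then show "exc_vec (- int m) (2 * m) \<eta> ! t \<in> ?A t" by (simp add: exc_vec_def)
  next
    fix j assume a: "\<forall>t<2 * m. exc_vec (- int m) (2 * m) \<eta> ! t \<in> ?A t" and j: "j \<in> J"
    have "- int m \<le> j" "j < int m" using j m by auto
    then have t: "nat (j + int m) < 2 * m" "- int m + int (nat (j + int m)) = j" by linarith+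
    then show "excursion_at \<eta> j \<in> B j" using a[rule_format, OF t(1)] j by (simp add: exc_vec_def)
  qed
  have "palm.prob {\<eta>\<in>configs_hat. \<forall>j\<in>J. excursion_at \<eta> j \<in> B j}
    = palm.prob {\<eta>\<in>configs_hat. exc_vec (- int m) (2 * m) \<eta> \<in> {xs. \<forall>t<2 * m. xs ! t \<in> ?A t}}"
    by (simp only: iff mem_Collect_eq)
  also have "\<dots> = measure_pmf.prob (replicate_pmf (2 * m) exc_pmf) {xs. \<forall>t<2 * m. xs ! t \<in> ?A t}"
    by (rule prob_exc_vec_event) simp_all
  also have "\<dots> = (\<Prod>t<2 * m. measure_pmf.prob exc_pmf (?A t))" by (rule prob_replicate_pmf)
  also have "\<dots> = (\<Prod>t<2 * m. if - int m + int t \<in> J then measure_pmf.prob exc_pmf (B (- int m + int t)) else 1)"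
    by (rule prod.cong) auto
  also have "\<dots> = (\<Prod>j\<in>J. measure_pmf.prob exc_pmf (B j))"
    by (rule prod_window[OF m, where g = "\<lambda>j. measure_pmf.prob exc_pmf (B j)"])
  finally show ?thesis .
qed

lemma excursions_indep:
  "palm.indep_vars (\<lambda>_. count_space excursions) (\<lambda>i \<eta>. excursion_at \<eta> i) UNIV"
proof (rule palm.indep_vars_finiteI[OF measurable_excursion_at])
  fix J :: "int set" and B assume J: "finite J"
  show "palm.prob {\<eta>\<in>space (palm \<pi>). \<forall>j\<in>J. excursion_at \<eta> j \<in> B j} = (\<Prod>j\<in>J. palm.prob {\<eta>\<in>space (palm \<pi>). excursion_at \<eta> j \<in> B j})"
    using prob_excursions[OF J, of B] prob_excursions[of "{_}" B] by simp
qed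

text \<open>The probabilities of the excursions are Q(0,0) times the soliton weights and add up to
  one; this evaluates the partition function.\<close>

lemma exc_weight_total:
  assumes "\<And>k. \<alpha> k = qa * qb ^ k"
  shows "(\<integral>\<^sup>+\<epsilon>. ennreal (exc_weight \<alpha> \<epsilon>) \<partial>count_space excursions) = 1 / ennreal (Q False False)"
proof -
  have "1 = (\<integral>\<^sup>+\<epsilon>. ennreal (exc_wt \<epsilon>) \<partial>count_space UNIV)" by (simp only: exc_wt_total)
  also have "\<dots> = (\<integral>\<^sup>+\<epsilon>. ennreal (exc_wt \<epsilon>) \<partial>count_space excursions)"
    by (rule nn_integral_count_space_eq) (auto simp: exc_wt_def)
  also have "\<dots> = (\<integral>\<^sup>+\<epsilon>. ennreal (Q False False) * ennreal (exc_weight \<alpha> \<epsilon>) \<partial>count_space excursions)"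
    by (rule nn_integral_cong) (use Q00 in \<open>simp add: exc_wt_weight[OF _ assms] ennreal_mult'[symmetric]\<close>)
  also have "\<dots> = ennreal (Q False False) * (\<integral>\<^sup>+\<epsilon>. ennreal (exc_weight \<alpha> \<epsilon>) \<partial>count_space excursions)"
    by (rule nn_integral_cmult) simp
  finally have "1 = ennreal (Q False False) * (\<integral>\<^sup>+\<epsilon>. ennreal (exc_weight \<alpha> \<epsilon>) \<partial>count_space excursions)" .
  then have "1 / ennreal (Q False False) = (\<integral>\<^sup>+\<epsilon>. ennreal (exc_weight \<alpha> \<epsilon>) \<partial>count_space excursions) * ennreal (Q False False) / ennreal (Q False False)"
    by (simp add: mult.commute)
  then show ?thesis using Q00 by (subst (asm) ennreal_mult_divide_eq) auto
qed

lemma soliton_excursions: "soliton_pmf (map_pmf ball_config exc_pmf) qa qb (Q False False) (\<lambda>k. qa * qb ^ k)"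
proof
  show "0 < qa" "0 < qb" "0 < Q False False" using qa_qb_pos Q00 by auto
  fix \<eta> :: config
  show "pmf (map_pmf ball_config exc_pmf) \<eta>
    = (if is_dyck \<eta> then Q False False * qa ^ num_peaks \<eta> * qb ^ nat (dyck_size_of \<eta> div 2) else 0)"
  proof (cases "is_dyck \<eta>")
    case True
    then obtain \<epsilon> where e: "\<epsilon> \<in> excursions" "ball_config \<epsilon> = \<eta>" using dyck_excursion[OF is_dyckD[OF True]] by blast
    have "pmf (map_pmf ball_config exc_pmf) (ball_config \<epsilon>) = pmf exc_pmf \<epsilon>"
      by (rule pmf_map_inj) (use ball_config_inj set_exc_pmf e in auto)
    then show ?thesis using True e(2) exc_wt_eq[OF e(1)] exc_size[OF e(1)] by (simp add: pmf_exc_pmf)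
  next
    case False
    have "\<eta> \<notin> ball_config ` excursions" using False excursions_dyck(1) is_dyck_def by auto
    then have "pmf (map_pmf ball_config exc_pmf) \<eta> = 0" by (simp add: pmf_eq_0_set_pmf set_exc_pmf)
    then show ?thesis using False by simp
  qed
qed simp

section \<open>Joint law of the soliton components\<close>

definition comp_param :: "nat \<Rightarrow> real" where "comp_param k = q_param (\<lambda>k. qa * qb ^ k) k"

lemma prob_windows:
  "palm.prob {\<eta>\<in>configs_hat. \<forall>k\<in>{1..<1 + n}. map (\<lambda>t. component k \<eta> (- int m + int t)) [0..<2 * m] \<in> D k}
    = (\<Prod>k\<in>{1..<1 + n}. measure_pmf.prob (replicate_pmf (2 * m) (geometric_pmf (1 - comp_param k))) (D k))"
proof -
  interpret S: soliton_pmf "map_pmf ball_config exc_pmf" qa qb "Q False False" "\<lambda>k. qa * qb ^ k" by (rule soliton_excursions)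
  let ?W = "{us. \<forall>k\<in>{1..<1 + n}. S.window k m us \<in> D k}"
  have w: "map (\<lambda>t. component k \<eta> (- int m + int t)) [0..<2 * m] = S.window k m (map ball_config (exc_vec (- int m) (2 * m) \<eta>))"
    if "\<eta> \<in> configs_hat" for k \<eta>
    unfolding component_window[OF hat_drifting[OF that]] comp_window_def exc_vec_def exc_comp_def by (simp add: o_def take_map)
  have "{\<eta>\<in>configs_hat. \<forall>k\<in>{1..<1 + n}. map (\<lambda>t. component k \<eta> (- int m + int t)) [0..<2 * m] \<in> D k}
    = {\<eta>\<in>configs_hat. exc_vec (- int m) (2 * m) \<eta> \<in> map ball_config -` ?W}"
    by (rule Collect_cong, rule conj_cong[OF refl]) (simp only: w vimage_eq mem_Collect_eq)
  then have "palm.prob {\<eta>\<in>configs_hat. \<forall>k\<in>{1..<1 + n}. map (\<lambda>t. component k \<eta> (- int m + int t)) [0..<2 * m] \<in> D k}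
    = measure_pmf.prob (replicate_pmf (2 * m) exc_pmf) (map ball_config -` ?W)"
    by (simp only:) (rule prob_exc_vec_event, simp_all)
  also have "\<dots> = measure_pmf.prob (replicate_pmf (2 * m) (map_pmf ball_config exc_pmf)) ?W"
    unfolding S.map_replicate_pmf[symmetric] by (simp only: measure_map_pmf)
  also have "\<dots> = (\<Prod>k\<in>{1..<1 + n}. measure_pmf.prob (replicate_pmf (2 * m) (geometric_pmf (1 - comp_param k))) (D k))"
    unfolding comp_param_def by (rule S.windows_prob) simp
  finally show ?thesis .
qed

text \<open>A finite set of index pairs fits into a rectangle of sizes 1, ..., n and slots -m, ...,
  m - 1. Pairs outside J carry the trivial condition \<open>UNIV\<close>, which contributes a factor
  1.\<close>

lemma prob_components:
  assumes J: "finite J" "J \<subseteq> {1..} \<times> UNIV"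
  shows "palm.prob {\<eta>\<in>configs_hat. \<forall>x\<in>J. component (fst x) \<eta> (snd x) \<in> B x}
    = (\<Prod>x\<in>J. measure_pmf.prob (geometric_pmf (1 - comp_param (fst x))) (B x))"
proof -
  obtain m where m: "snd ` J \<subseteq> {- int m..<int m}" using finite_int_window[of "snd ` J"] J by blast
  obtain n where "\<And>k. k \<in> fst ` J \<Longrightarrow> k \<le> n" using finite_nat_set_iff_bounded_le[of "fst ` J"] J by blast
  then have n: "fst x \<in> {1..<1 + n}" if "x \<in> J" for x using that J by force
  let ?Jk = "\<lambda>k. {j. (k, j) \<in> J}"
  have Jk: "?Jk k \<subseteq> {- int m..<int m}" for k using m by force
  let ?A = "\<lambda>k (t::nat). if - int m + int t \<in> ?Jk k then B (k, - int m + int t) else UNIV"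
  let ?c = "\<lambda>k \<eta>. map (\<lambda>t. component k \<eta> (- int m + int t)) [0..<2 * m]"
  have iff: "(\<forall>x\<in>J. component (fst x) \<eta> (snd x) \<in> B x) \<longleftrightarrow> (\<forall>k\<in>{1..<1 + n}. ?c k \<eta> \<in> {xs. \<forall>t<2 * m. xs ! t \<in> ?A k t})" for \<eta>
  proof
    assume "\<forall>x\<in>J. component (fst x) \<eta> (snd x) \<in> B x"
    then show "\<forall>k\<in>{1..<1 + n}. ?c k \<eta> \<in> {xs. \<forall>t<2 * m. xs ! t \<in> ?A k t}" by auto
  next
    assume a: "\<forall>k\<in>{1..<1 + n}. ?c k \<eta> \<in> {xs. \<forall>t<2 * m. xs ! t \<in> ?A k t}"
    show "\<forall>x\<in>J. component (fst x) \<eta> (snd x) \<in> B x"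
    proof
      fix x assume x: "x \<in> J"
      obtain k j where kj: "x = (k, j)" by (cases x)
      have "- int m \<le> j" "j < int m" using x Jk[of k] kj by auto
      then have t: "nat (j + int m) < 2 * m" "- int m + int (nat (j + int m)) = j" by linarith+
      have "?c k \<eta> \<in> {xs. \<forall>t<2 * m. xs ! t \<in> ?A k t}" using a n[OF x] kj by simp
      then have "?c k \<eta> ! nat (j + int m) \<in> ?A k (nat (j + int m))" using t(1) by blast
      then show "component (fst x) \<eta> (snd x) \<in> B x" using t x kj by simp
    qed
  qed
  have "palm.prob {\<eta>\<in>configs_hat. \<forall>x\<in>J. component (fst x) \<eta> (snd x) \<in> B x}
    = palm.prob {\<eta>\<in>configs_hat. \<forall>k\<in>{1..<1 + n}. ?c k \<eta> \<in> {xs. \<forall>t<2 * m. xs ! t \<in> ?A k t}}"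
    by (simp only: iff)
  also have "\<dots> = (\<Prod>k\<in>{1..<1 + n}. \<Prod>t<2 * m. measure_pmf.prob (geometric_pmf (1 - comp_param k)) (?A k t))"
    unfolding prob_windows prob_replicate_pmf ..
  also have "\<dots> = (\<Prod>k\<in>{1..<1 + n}. \<Prod>j\<in>?Jk k. measure_pmf.prob (geometric_pmf (1 - comp_param k)) (B (k, j)))"
  proof (rule prod.cong[OF refl])
    fix k
    let ?g = "\<lambda>j. measure_pmf.prob (geometric_pmf (1 - comp_param k)) (B (k, j))"
    have "(\<Prod>t<2 * m. measure_pmf.prob (geometric_pmf (1 - comp_param k)) (?A k t))
      = (\<Prod>t<2 * m. if - int m + int t \<in> ?Jk k then ?g (- int m + int t) else 1)"
      by (rule prod.cong) auto
    also have "\<dots> = prod ?g (?Jk k)" by (rule prod_window[OF Jk])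
    finally show "(\<Prod>t<2 * m. measure_pmf.prob (geometric_pmf (1 - comp_param k)) (?A k t)) = prod ?g (?Jk k)" .
  qed
  also have "\<dots> = (\<Prod>(k, j)\<in>Sigma {1..<1 + n} ?Jk. measure_pmf.prob (geometric_pmf (1 - comp_param k)) (B (k, j)))"
    by (rule prod.Sigma) (use Jk finite_subset in blast)+
  also have "Sigma {1..<1 + n} ?Jk = J" using n by force
  finally show ?thesis by (simp add: case_prod_beta)
qed

lemma measurable_component: "(\<lambda>\<eta>. component k \<eta> j) \<in> measurable (palm \<pi>) (count_space UNIV)"
proof -
  define m where "m = nat \<bar>j\<bar> + 1"
  have t: "nat (j + int m) < 2 * m" "- int m + int (nat (j + int m)) = j" by (auto simp: m_def)
  have eq: "component k \<eta> j = comp_window (exc_comp k) m (exc_vec (- int m) (2 * m) \<eta>) ! nat (j + int m)" if "\<eta> \<in> configs_hat" for \<eta>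
  proof -
    have "component k \<eta> j = map (\<lambda>t. component k \<eta> (- int m + int t)) [0..<2 * m] ! nat (j + int m)" using t by simp
    then show ?thesis unfolding component_window[OF hat_drifting[OF that]] exc_vec_def .
  qed
  have "(\<lambda>\<eta>. comp_window (exc_comp k) m (exc_vec (- int m) (2 * m) \<eta>) ! nat (j + int m)) \<in> measurable (palm \<pi>) (count_space UNIV)"
    by (rule measurable_compose[OF measurable_exc_vec]) auto
  then show ?thesis by (subst measurable_cong[OF eq]) simp_all
qed

lemma component_pairs_indep:
  "palm.indep_vars (\<lambda>_. count_space UNIV) (\<lambda>x \<eta>. component (fst x) \<eta> (snd x)) ({1..} \<times> UNIV)"
proof (rule palm.indep_vars_finiteI[OF measurable_component])
  fix J :: "(nat \<times> int) set" and B :: "nat \<times> int \<Rightarrow> nat set" assume J: "finite J" "J \<subseteq> {1..} \<times> UNIV"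
  have "palm.prob {\<eta>\<in>configs_hat. component (fst x) \<eta> (snd x) \<in> B x} = measure_pmf.prob (geometric_pmf (1 - comp_param (fst x))) (B x)"
    if "x \<in> J" for x
    using prob_components[of "{x}" B] J that by auto
  then show "palm.prob {\<eta>\<in>space (palm \<pi>). \<forall>x\<in>J. component (fst x) \<eta> (snd x) \<in> B x}
    = (\<Prod>x\<in>J. palm.prob {\<eta>\<in>space (palm \<pi>). component (fst x) \<eta> (snd x) \<in> B x})"
    using prob_components[OF J, of B] by simp
qed

text \<open>Independence of the whole array indexed by (k, j) is grouped by rows, and each row is
  then renamed from the index set of pairs to the integers.\<close>

lemma components_indep: "palm.indep_vars (\<lambda>_. \<Pi>\<^sub>M j\<in>UNIV. count_space UNIV) component {1..}"
proof -
  let ?K = "\<lambda>k::nat. {k} \<times> (UNIV::int set)"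
  have "palm.indep_vars (\<lambda>k. PiM (?K k) (\<lambda>_. count_space UNIV)) (\<lambda>k \<eta>. restrict (\<lambda>x. component (fst x) \<eta> (snd x)) (?K k)) {1..}"
    by (rule palm.indep_vars_restrict[OF component_pairs_indep]) (auto simp: disjoint_family_on_def)
  then have "palm.indep_vars (\<lambda>_. \<Pi>\<^sub>M j\<in>UNIV. count_space UNIV)
    (\<lambda>k \<eta>. (\<lambda>f j. f (k, j)) (restrict (\<lambda>x. component (fst x) \<eta> (snd x)) (?K k))) {1..}"
  proof (rule palm.indep_vars_compose2)
    fix k :: nat
    show "(\<lambda>f j. f (k, j)) \<in> measurable (PiM (?K k) (\<lambda>_. count_space (UNIV::nat set))) (\<Pi>\<^sub>M j\<in>(UNIV::int set). count_space (UNIV::nat set))"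
      by (rule measurable_PiM_single') auto
  qed
  then show ?thesis by simp
qed

lemma component_indep:
  assumes "1 \<le> k"
  shows "palm.indep_vars (\<lambda>_. count_space UNIV) (\<lambda>j \<eta>. component k \<eta> j) UNIV"
proof (rule palm.indep_vars_finiteI[OF measurable_component])
  fix J :: "int set" and B :: "int \<Rightarrow> nat set" assume J: "finite J"
  have *: "palm.prob {\<eta>\<in>configs_hat. \<forall>j\<in>I. component k \<eta> j \<in> B j} = (\<Prod>j\<in>I. measure_pmf.prob (geometric_pmf (1 - comp_param k)) (B j))"
    if "finite I" for I
    using prob_components[of "Pair k ` I" "\<lambda>x. B (snd x)"] that assms by (auto simp: prod.reindex inj_on_def)
  show "palm.prob {\<eta>\<in>space (palm \<pi>). \<forall>j\<in>J. component k \<eta> j \<in> B j} = (\<Prod>j\<in>J. palm.prob {\<eta>\<in>space (palm \<pi>). component k \<eta> j \<in> B j})"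
    using *[OF J] *[of "{_}"] by simp
qed

lemma component_distr:
  assumes "1 \<le> k"
  shows "distr (palm \<pi>) (count_space UNIV) (\<lambda>\<eta>. component k \<eta> j) = measure_pmf (geometric_pmf (1 - comp_param k))"
proof (rule measure_eqI)
  fix B :: "nat set"
  have "emeasure (distr (palm \<pi>) (count_space UNIV) (\<lambda>\<eta>. component k \<eta> j)) B = ennreal (palm.prob {\<eta>\<in>configs_hat. component k \<eta> j \<in> B})"
    using measurable_component by (simp add: emeasure_distr vimage_def Int_def conj_commute palm.emeasure_eq_measure)
  also have "\<dots> = emeasure (measure_pmf (geometric_pmf (1 - comp_param k))) B"
    using prob_components[of "{(k, j)}" "\<lambda>_. B"] assms by (simp add: measure_pmf.emeasure_eq_measure)
  finally show "emeasure (distr (palm \<pi>) (count_space UNIV) (\<lambda>\<eta>. component k \<eta> j)) B = emeasure (measure_pmf (geometric_pmf (1 - comp_param k))) B" .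
qed simp

end

section \<open>Expected length of the excursions\<close>

text \<open>Both sides are limits of finite partial sums, taken on the right along the enumeration
  \<open>to_nat\<close>. It moves the sums over excursions to integrals, where constants and finite
  sums can be pulled out.\<close>

lemma infsum_ennreal_eq_nn_integral:
  fixes f :: "'a::countable \<Rightarrow> ennreal"
  shows "infsum f A = (\<integral>\<^sup>+x. f x \<partial>count_space A)"
proof -
  have inf: "infsum f A = (SUP F\<in>{F. finite F \<and> F \<subseteq> A}. sum f F)" by (rule nonneg_infsum_complete) simp
  have "infsum f A \<le> (\<integral>\<^sup>+x. f x \<partial>count_space A)"
    unfolding inf
  proof (rule SUP_least)
    fix F assume F: "F \<in> {F. finite F \<and> F \<subseteq> A}"
    then have "sum f F = (\<integral>\<^sup>+x. f x \<partial>count_space F)" by (simp add: nn_integral_count_space_finite)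
    also have "\<dots> \<le> (\<integral>\<^sup>+x. f x \<partial>count_space A)"
      unfolding nn_integral_count_space_indicator[of F] nn_integral_count_space_indicator[of A]
      using F by (auto intro!: nn_integral_mono split: split_indicator simp: nn_integral_count_space_indicator)
    finally show "sum f F \<le> (\<integral>\<^sup>+x. f x \<partial>count_space A)" .
  qed
  moreover have "(\<integral>\<^sup>+x. f x \<partial>count_space A) \<le> infsum f A"
  proof -
    let ?g = "\<lambda>n. if n \<in> to_nat ` A then f (from_nat n) else 0"
    have "(\<integral>\<^sup>+x. f x \<partial>count_space A) = (\<integral>\<^sup>+x. ?g (to_nat x) \<partial>count_space A)"
      by (rule nn_integral_cong) simp
    also have "\<dots> = (\<integral>\<^sup>+n. ?g n \<partial>count_space (to_nat ` A))"
      by (rule nn_integral_bij_count_space) (simp add: bij_betw_def)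
    also have "\<dots> = (\<integral>\<^sup>+n. ?g n \<partial>count_space UNIV)" by (rule nn_integral_count_space_eq) auto
    also have "\<dots> = (SUP n. \<Sum>i<n. ?g i)" by (simp only: nn_integral_count_space_nat suminf_eq_SUP)
    also have "\<dots> \<le> infsum f A"
    proof (rule SUP_least)
      fix n
      let ?F = "{x\<in>A. to_nat x < n}"
      have fin: "finite ?F" by (rule finite_imageD[of to_nat]) (auto intro: finite_subset[of _ "{..<n}"] inj_on_subset[OF inj_to_nat])
      have "(\<Sum>i<n. ?g i) = (\<Sum>i\<in>to_nat ` ?F. ?g i)"
        by (rule sum.mono_neutral_right) auto
      also have "\<dots> = sum f ?F" by (subst sum.reindex) (auto intro: inj_on_subset[OF inj_to_nat])
      also have "\<dots> \<le> infsum f A" unfolding inf using fin by (intro SUP_upper) auto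
      finally show "(\<Sum>i<n. ?g i) \<le> infsum f A" .
    qed
    finally show ?thesis .
  qed
  ultimately show ?thesis by (rule antisym)
qed

context chain
begin

text \<open>The events that the excursion containing the origin is \<open>\<epsilon>\<close> and starts at \<open>- j\<close>, for \<open>\<epsilon>\<close> and
  \<open>j < length \<epsilon>\<close>, are disjoint.\<close>

lemma sum_length_exc_wt:
  assumes F: "finite F" "F \<subseteq> excursions"
  shows "(\<Sum>\<epsilon>\<in>F. real (length \<epsilon>) * exc_wt \<epsilon>) \<le> 1 / (1 - 2 * p True)"
proof -
  let ?I = "Sigma F (\<lambda>\<epsilon>. {..<length \<epsilon>})"
  define E where "E x = {\<eta>. - int (snd x) \<in> records \<eta>} \<inter> cyl (- int (snd x) + 1) (exc_word (fst x))" for x :: "int list \<times> nat"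
  have E: "E x \<in> events" for x unfolding E_def sets_law by (intro sets.Int sets_record sets_cyl)
  have C: "configs \<in> events" using sets_configs sets_law by simp
  have fin: "finite ?I" using F by simp
  have disj: "disjoint_family_on (\<lambda>x. E x \<inter> configs) ?I"
    unfolding disjoint_family_on_def
  proof (intro ballI impI, rule ccontr)
    fix x y assume x: "x \<in> ?I" and y: "y \<in> ?I" and "x \<noteq> y" "E x \<inter> configs \<inter> (E y \<inter> configs) \<noteq> {}"
    then obtain \<eta> where \<eta>: "\<eta> \<in> E x" "\<eta> \<in> E y" "\<eta> \<in> configs" by blast
    then have d: "drifting \<eta>" using configs_drifting by blast
    have key: "\<exists>i. record_pos \<eta> i = - int (snd z) \<and> excursion_at \<eta> i = fst z \<and> record_pos \<eta> i \<le> 0 \<and> 0 < record_pos \<eta> (i + 1)"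
      if z: "z \<in> ?I" "\<eta> \<in> E z" for z
    proof -
      obtain i where i: "record_pos \<eta> i = - int (snd z)" using record_is_record_pos[OF d, of "- int (snd z)"] z(2) by (auto simp: E_def)
      have "fst z \<in> excursions" using z(1) F by auto
      then have e: "excursion_at \<eta> i = fst z" using excursion_at_iff[OF d, of "fst z" i] z(2) i by (auto simp: E_def)
      then have "0 < record_pos \<eta> (i + 1)" using record_pos_next[OF d, of i] i z(1) by auto
      then show ?thesis using i e by auto
    qed
    obtain i where i: "record_pos \<eta> i = - int (snd x)" "excursion_at \<eta> i = fst x" "record_pos \<eta> i \<le> 0" "0 < record_pos \<eta> (i + 1)"
      using key[OF x \<eta>(1)] by blast
    obtain j where j: "record_pos \<eta> j = - int (snd y)" "excursion_at \<eta> j = fst y" "record_pos \<eta> j \<le> 0" "0 < record_pos \<eta> (j + 1)"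
      using key[OF y \<eta>(2)] by blast
    have "record_pos \<eta> i < record_pos \<eta> (j + 1)" "record_pos \<eta> j < record_pos \<eta> (i + 1)" using i j by linarith+
    then have "i < j + 1" "j < i + 1" using strict_mono_less[OF record_pos_mono[OF d]] by blast+
    then have "i = j" by simp
    then have "x = y" using i(1,2) j(1,2) by (simp add: prod_eq_iff)
    then show False using \<open>x \<noteq> y\<close> by contradiction
  qed
  have pE: "prob (E x \<inter> configs) = (1 - 2 * p True) * exc_wt (fst x)" if "x \<in> ?I" for x
  proof -
    have "prob (E x \<inter> configs) = prob (E x)"
    proof (rule finite_measure_eq_AE)
      show "AE \<eta> in \<pi>. (\<eta> \<in> E x \<inter> configs) = (\<eta> \<in> E x)" using configs_AE by eventually_elim blast
    qed (use E C in auto)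
    also have "\<dots> = (1 - 2 * p True) * path_weight Q False (exc_word (fst x))" unfolding E_def by (rule record_cyl)
    finally show ?thesis using that F by (auto simp: exc_wt_def)
  qed
  have "(1 - 2 * p True) * (\<Sum>\<epsilon>\<in>F. real (length \<epsilon>) * exc_wt \<epsilon>) = (\<Sum>\<epsilon>\<in>F. \<Sum>j<length \<epsilon>. (1 - 2 * p True) * exc_wt \<epsilon>)"
    by (simp add: sum_distrib_left mult_ac)
  also have "\<dots> = (\<Sum>x\<in>?I. (1 - 2 * p True) * exc_wt (fst x))"
    using F by (subst sum.Sigma) (auto simp: case_prod_beta)
  also have "\<dots> = (\<Sum>x\<in>?I. prob (E x \<inter> configs))" using pE by simp
  also have "\<dots> = prob (\<Union>x\<in>?I. E x \<inter> configs)"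
    by (rule finite_measure_finite_Union[symmetric, OF fin _ disj]) (use E C in auto)
  also have "\<dots> \<le> 1" by (rule prob_le_1)
  finally show ?thesis using v_pos by (simp add: field_simps)
qed

lemma nn_integral_length_exc_wt:
  "(\<integral>\<^sup>+\<epsilon>. ennreal (real (length \<epsilon>) * exc_wt \<epsilon>) \<partial>count_space excursions) \<le> ennreal (1 / (1 - 2 * p True))"
  unfolding infsum_ennreal_eq_nn_integral[symmetric]
  by (subst nonneg_infsum_complete, simp, rule SUP_least)
    (use sum_length_exc_wt exc_wt_nonneg in \<open>auto simp: sum_ennreal intro!: ennreal_leI\<close>)

section \<open>The parameters\<close>

abbreviation "weight_param k \<equiv> qa * qb ^ k"

lemma partition_fun: "partition_fun weight_param = 1 / ennreal (Q False False)"
  unfolding partition_fun_def infsum_ennreal_eq_nn_integral by (rule exc_weight_total) simp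

lemma exc_prob: "\<epsilon> \<in> excursions \<Longrightarrow> exc_prob weight_param \<epsilon> = ennreal (exc_wt \<epsilon>)"
proof -
  assume e: "\<epsilon> \<in> excursions"
  have w: "exc_wt \<epsilon> = Q False False * exc_weight weight_param \<epsilon>" by (rule exc_wt_weight[OF e refl])
  have "0 \<le> exc_weight weight_param \<epsilon>" using exc_wt_pos[OF e] Q00 unfolding w by (simp add: zero_less_mult_iff)
  moreover have "partition_fun weight_param = ennreal (1 / Q False False)"
    unfolding partition_fun using Q00 by (simp add: divide_ennreal[symmetric])
  ultimately show ?thesis
    unfolding exc_prob_def w using Q00 by (simp add: divide_ennreal mult.commute)
qed

text \<open>Summed over sizes, the boxes covered by solitons of one excursion never exceed its
  length, so the series is bounded by the expected length of an excursion, which is at most the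
  inverse of the record density.\<close>

lemma param_A_plus: "weight_param \<in> param_A_plus"
proof -
  \<comment> \<open>Rewritten as Q(0,1) Q(1,0) b^(k-1), the parameter is below 1 because both
    transition probabilities are; with a in front this is not visible, since a itself may be
    large.\<close>
  have "0 \<le> weight_param k \<and> weight_param k < 1" if "1 \<le> k" for k
  proof -
    have "0 < Q False True * Q True False" "Q False True < 1" "Q True False < 1" "Q False False \<le> 1" "Q True True \<le> 1"
      using Q01 Q10 Q00 Q11 Q_row[of False] Q_row[of True] by auto
    moreover have "weight_param k = Q False True * Q True False * qb ^ (k - 1)"
      using block_weight[of k False] that by (simp add: qb_def mult.commute)
    moreover have "qb ^ (k - 1) \<le> 1"
      using calculation Q00 Q11 by (intro power_le_one) (auto simp: qb_def mult_le_one)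
    moreover have "Q False True * Q True False < 1"
      using calculation Q10 Q01 by (metis mult.right_neutral mult_strict_mono' less_eq_real_def zero_less_one)
    ultimately show ?thesis using qa_qb_pos
      by (metis less_eq_real_def mult_left_le order_le_less_trans mult_nonneg_nonneg zero_le_power)
  qed
  moreover have "partition_fun weight_param < \<infinity>"
    unfolding partition_fun using Q00 by (simp add: ennreal_divide_eq_top_iff less_top[symmetric])
  ultimately have A: "weight_param \<in> param_A" by (simp add: param_A_def)
  have dens: "2 * of_nat k * soliton_density k weight_param
    = (\<integral>\<^sup>+\<epsilon>. ennreal (2 * real k * real (num_solitons k \<epsilon>) * exc_wt \<epsilon>) \<partial>count_space excursions)" for k
  proof -
    have "2 * of_nat k * soliton_density k weight_param = 2 * of_nat k * (\<integral>\<^sup>+\<epsilon>. of_nat (num_solitons k \<epsilon>) * exc_prob weight_param \<epsilon> \<partial>count_space excursions)"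
      unfolding soliton_density_def infsum_ennreal_eq_nn_integral ..
    also have "\<dots> = (\<integral>\<^sup>+\<epsilon>. 2 * of_nat k * (of_nat (num_solitons k \<epsilon>) * exc_prob weight_param \<epsilon>) \<partial>count_space excursions)"
      by (rule nn_integral_cmult[symmetric]) simp
    also have "\<dots> = (\<integral>\<^sup>+\<epsilon>. ennreal (2 * real k * real (num_solitons k \<epsilon>) * exc_wt \<epsilon>) \<partial>count_space excursions)"
    proof (rule nn_integral_cong)
      fix \<epsilon> assume "\<epsilon> \<in> space (count_space excursions)"
      then show "2 * of_nat k * (of_nat (num_solitons k \<epsilon>) * exc_prob weight_param \<epsilon>) = ennreal (2 * real k * real (num_solitons k \<epsilon>) * exc_wt \<epsilon>)"
        by (simp add: exc_prob ennreal_mult' exc_wt_nonneg ennreal_of_nat_eq_real_of_nat mult.assoc)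
    qed
    finally show ?thesis .
  qed
  have "(\<Sum>\<^sub>\<infinity>k\<in>{1..}. 2 * of_nat k * soliton_density k weight_param) \<le> ennreal (1 / (1 - 2 * p True))"
  proof (subst nonneg_infsum_complete, simp, rule SUP_least)
    fix K assume "K \<in> {K. finite K \<and> K \<subseteq> {1::nat..}}"
    then have K: "finite K" by simp
    have "(\<Sum>k\<in>K. 2 * of_nat k * soliton_density k weight_param)
      = (\<integral>\<^sup>+\<epsilon>. (\<Sum>k\<in>K. ennreal (2 * real k * real (num_solitons k \<epsilon>) * exc_wt \<epsilon>)) \<partial>count_space excursions)"
      unfolding dens by (rule nn_integral_sum[symmetric]) simp
    also have "\<dots> \<le> (\<integral>\<^sup>+\<epsilon>. ennreal (real (length \<epsilon>) * exc_wt \<epsilon>) \<partial>count_space excursions)"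
    proof (rule nn_integral_mono)
      fix \<epsilon> assume "\<epsilon> \<in> space (count_space excursions)"
      then have e: "\<epsilon> \<in> excursions" by simp
      have "(\<Sum>k\<in>K. 2 * int k * int (num_solitons k \<epsilon>)) \<le> int (length \<epsilon>)"
        using sum_num_solitons[OF excursions_dyck(1)[OF e], of K] by linarith
      then have "real_of_int (\<Sum>k\<in>K. 2 * int k * int (num_solitons k \<epsilon>)) \<le> real_of_int (int (length \<epsilon>))" by (simp only: of_int_le_iff)
      then have "(\<Sum>k\<in>K. 2 * real k * real (num_solitons k \<epsilon>)) \<le> real (length \<epsilon>)" by simp
      then have "(\<Sum>k\<in>K. 2 * real k * real (num_solitons k \<epsilon>)) * exc_wt \<epsilon> \<le> real (length \<epsilon>) * exc_wt \<epsilon>"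
        by (rule mult_right_mono[OF _ exc_wt_nonneg])
      then show "(\<Sum>k\<in>K. ennreal (2 * real k * real (num_solitons k \<epsilon>) * exc_wt \<epsilon>)) \<le> ennreal (real (length \<epsilon>) * exc_wt \<epsilon>)"
        by (subst sum_ennreal) (auto simp: exc_wt_nonneg sum_distrib_right intro!: ennreal_leI)
    qed
    also have "\<dots> \<le> ennreal (1 / (1 - 2 * p True))" by (rule nn_integral_length_exc_wt)
    finally show "(\<Sum>k\<in>K. 2 * of_nat k * soliton_density k weight_param) \<le> ennreal (1 / (1 - 2 * p True))" .
  qed
  also have "\<dots> < \<infinity>" by simp
  finally show ?thesis using A by (simp add: param_A_plus_def)
qed

lemma excursion_distr: "distr (palm \<pi>) (count_space excursions) (\<lambda>\<eta>. excursion_at \<eta> i) = exc_measure weight_param"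
proof (rule measure_eqI_countable[of _ excursions])
  fix \<epsilon> assume e: "\<epsilon> \<in> excursions"
  have "emeasure (distr (palm \<pi>) (count_space excursions) (\<lambda>\<eta>. excursion_at \<eta> i)) {\<epsilon>}
    = ennreal (palm.prob {\<eta>\<in>configs_hat. \<forall>j\<in>{i}. excursion_at \<eta> j \<in> {\<epsilon>}})"
    using measurable_excursion_at e by (simp add: emeasure_distr vimage_def Int_def conj_commute palm.emeasure_eq_measure)
  also have "\<dots> = ennreal (exc_wt \<epsilon>)"
    by (subst prob_excursions) (simp_all add: measure_pmf_single pmf_exc_pmf)
  also have "\<dots> = emeasure (exc_measure weight_param) {\<epsilon>}"
  proof -
    have "{\<epsilon>' \<in> {\<epsilon>}. 0 < exc_prob weight_param \<epsilon>'} = {\<epsilon>}" using exc_wt_pos[OF e] by (auto simp: exc_prob[OF e])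
    then show ?thesis unfolding exc_measure_def using e by (subst emeasure_point_measure) (auto simp: exc_prob[OF e])
  qed
  finally show "emeasure (distr (palm \<pi>) (count_space excursions) (\<lambda>\<eta>. excursion_at \<eta> i)) {\<epsilon>} = emeasure (exc_measure weight_param) {\<epsilon>}" .
qed (auto simp: exc_measure_def sets_point_measure intro: countableI_type)

end

theorem corollary15:
  fixes Q :: "bool \<Rightarrow> bool \<Rightarrow> real" and p :: "bool \<Rightarrow> real" and \<pi> :: "config measure"
    and a b :: real and \<alpha> :: "nat \<Rightarrow> real"
  assumes "transition_matrix Q" and "Q True True > 0"
    and "stationary_prob Q p" and "\<And>p'. stationary_prob Q p' \<Longrightarrow> p' = p"
    and "0 < p True" and "p True < 1/2"
    and "stationary_chain_law Q p \<pi>"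
    and "a = Q False True * Q True False / (Q True True * Q False False)"
    and "b = Q True True * Q False False"
    and "\<And>k. \<alpha> k = a * b ^ k"
  shows "\<alpha> \<in> param_A_plus
    \<and> (AE \<eta> in \<pi>. \<eta> \<in> configs)
    \<and> prob_space (palm \<pi>)
    \<and> prob_space.indep_vars (palm \<pi>) (\<lambda>_. count_space excursions) (\<lambda>i \<eta>. excursion_at \<eta> i) UNIV
    \<and> (\<forall>i. distr (palm \<pi>) (count_space excursions) (\<lambda>\<eta>. excursion_at \<eta> i) = exc_measure \<alpha>)
    \<and> prob_space.indep_vars (palm \<pi>) (\<lambda>_. \<Pi>\<^sub>M j\<in>UNIV. count_space UNIV) component {1..}
    \<and> (\<forall>k\<ge>1. prob_space.indep_vars (palm \<pi>) (\<lambda>_. count_space UNIV) (\<lambda>j \<eta>. component k \<eta> j) UNIV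
        \<and> (\<forall>j. distr (palm \<pi>) (count_space UNIV) (\<lambda>\<eta>. component k \<eta> j)
              = measure_pmf (geometric_pmf (1 - q_param \<alpha> k))))
    \<and> distr \<pi> \<pi> bbs = \<pi>"
proof -
  have Q10: "Q True False > 0"
  proof (rule ccontr)
    assume n: "\<not> Q True False > 0"
    have "0 \<le> Q True False" "Q True True + Q True False = 1"
      using assms(1) by (auto simp: transition_matrix_def UNIV_bool add.commute)
    then have "Q True False = 0" "Q True True = 1" using n by auto
    \<comment> \<open>With 1 absorbing, the point mass at 1 is stationary, so uniqueness would give
      p_1 = 1.\<close>
    then have "stationary_prob Q (\<lambda>x. of_bool x)"
      unfolding stationary_prob_def by (auto simp: UNIV_bool split: bool.splits)
    then have "p = (\<lambda>x. of_bool x)" using assms(4) by blast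
    then have "p True = 1" by simp
    then show False using \<open>p True < 1/2\<close> by simp
  qed
  interpret chain Q p \<pi>
    by unfold_locales (use assms(1-3,5-7) Q10 in auto)
  have \<alpha>: "\<alpha> = (\<lambda>k. qa * qb ^ k)" using assms(8-10) by (auto simp: qa_def qb_def)
  show ?thesis
    unfolding \<alpha>
    by (intro conjI allI impI param_A_plus configs_AE palm_prob_space excursions_indep excursion_distr
      components_indep component_indep component_distr[unfolded comp_param_def] bbs_invariant)
qed

end
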